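(* Let $I$ be a linearly ordered set. 1. If $I$ is finite, or countable and well-ordered, then every completion of $\mathrm{ACF}^I$ is $\omega$-stable. 2. If $I$ is uncountable and well-ordered, then every completion of $\mathrm{ACF}^I$ is totally transcendental, and in particular superstable, but not $\omega$-stable. 3. If $I$ is not well-ordered, then no completion of $\mathrm{ACF}^I$ is superstable.
   Context: $\mathrm{ACF}$ is the theory of algebraically closed fields in the language of rings $L_{\mathrm{rings}}$. For a linearly ordered set $I$, let $L^I=L_{\mathrm{rings}}\cup\{P_i\}_{i\in I}$ with $P_i$ unary predicates. $\mathrm{ACF}^I$ is the $L^I$-theory expanding $\mathrm{ACF}$ by the axioms: (1) each $P_i$ is an algebraically closed (sub)field that is strictly contained in the model; (2) for $i<j$ in $I$, $P_i\subsetneq P_j$. A theory is totally transcendental if in no model is there a binary tree of consistent formulas, i.e. a family of consistent formulas with parameters $(\phi_s(x;c_s))_{s\in 2^{<\omega}}$ such that each $\phi_{s\frown\langle 0\rangle}$ and $\phi_{s\frown\langle 1\rangle}$ implies $\phi_s$ and $\phi_{s\frown\langle 0\rangle}\wedge\phi_{s\frown\langle 1\rangle}$ is inconsistent. A complete theory is $\omega$-stable if over every countable set of parameters there are at most countably many complete types in one variable. *)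

theory Defs
  imports Main "HOL-Library.Countable_Set" "HOL-Library.Equipollence"
begin

text \<open>
  First-order logic for the language \<open>L\<^sup>I\<close>, the language of rings \<open>0, 1, +, -, *\<close> (with unary minus)
  expanded by unary predicates \<open>P\<^sub>i\<close>, with constants for parameters from \<open>'a\<close>. A formula without
  constants is a pure \<open>L\<^sup>I\<close>-formula. Variables are named by natural numbers.
\<close>

datatype (tparams: 'a) tm =
    Var nat
  | Cst 'a
  | TZero
  | TOne
  | TAdd "'a tm" "'a tm"
  | TMinus "'a tm"
  | TMul "'a tm" "'a tm"

datatype (preds: 'i, params: 'a) fm =
    FEq "'a tm" "'a tm"
  | FPred 'i "'a tm"
  | FNot "('i, 'a) fm"
  | FAnd "('i, 'a) fm" "('i, 'a) fm"
  | FEx nat "('i, 'a) fm"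

abbreviation FOr :: "('i, 'a) fm \<Rightarrow> ('i, 'a) fm \<Rightarrow> ('i, 'a) fm" where
  "FOr p q \<equiv> FNot (FAnd (FNot p) (FNot q))"

abbreviation FImp :: "('i, 'a) fm \<Rightarrow> ('i, 'a) fm \<Rightarrow> ('i, 'a) fm" where
  "FImp p q \<equiv> FNot (FAnd p (FNot q))"

abbreviation FAll :: "nat \<Rightarrow> ('i, 'a) fm \<Rightarrow> ('i, 'a) fm" where
  "FAll v p \<equiv> FNot (FEx v (FNot p))"

primrec tvars :: "'a tm \<Rightarrow> nat set" where
  "tvars (Var v) = {v}"
| "tvars (Cst a) = {}"
| "tvars TZero = {}"
| "tvars TOne = {}"
| "tvars (TAdd s t) = tvars s \<union> tvars t"
| "tvars (TMinus t) = tvars t"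
| "tvars (TMul s t) = tvars s \<union> tvars t"

primrec fvars :: "('i, 'a) fm \<Rightarrow> nat set" where
  "fvars (FEq s t) = tvars s \<union> tvars t"
| "fvars (FPred i t) = tvars t"
| "fvars (FNot p) = fvars p"
| "fvars (FAnd p q) = fvars p \<union> fvars q"
| "fvars (FEx v p) = fvars p - {v}"

text \<open>The \<open>L\<^sup>I(A)\<close>-formulas in the variables \<open>x\<^sub>0, ..., x\<^bsub>n-1\<^esub>\<close>.\<close>

definition formulas :: "'i set \<Rightarrow> 'a set \<Rightarrow> nat \<Rightarrow> ('i, 'a) fm set" where
  "formulas I A n = {\<phi>. preds \<phi> \<subseteq> I \<and> params \<phi> \<subseteq> A \<and> fvars \<phi> \<subseteq> {..<n}}"

abbreviation sentences :: "'i set \<Rightarrow> ('i, 'a) fm set" where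
  "sentences I \<equiv> formulas I {} 0"

record ('i, 'a) struct =
  Dom :: "'a set"
  zero_of :: 'a
  one_of :: 'a
  add_of :: "'a \<Rightarrow> 'a \<Rightarrow> 'a"
  minus_of :: "'a \<Rightarrow> 'a"
  mul_of :: "'a \<Rightarrow> 'a \<Rightarrow> 'a"
  pred_of :: "'i \<Rightarrow> 'a set"

definition is_struct :: "'i set \<Rightarrow> ('i, 'a) struct \<Rightarrow> bool" where
  "is_struct I M \<longleftrightarrow>
     zero_of M \<in> Dom M \<and> one_of M \<in> Dom M \<and>
     (\<forall>a\<in>Dom M. \<forall>b\<in>Dom M. add_of M a b \<in> Dom M) \<and>
     (\<forall>a\<in>Dom M. minus_of M a \<in> Dom M) \<and>
     (\<forall>a\<in>Dom M. \<forall>b\<in>Dom M. mul_of M a b \<in> Dom M) \<and>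
     (\<forall>i\<in>I. pred_of M i \<subseteq> Dom M)"

primrec val :: "('i, 'a) struct \<Rightarrow> (nat \<Rightarrow> 'a) \<Rightarrow> 'a tm \<Rightarrow> 'a" where
  "val M e (Var v) = e v"
| "val M e (Cst a) = a"
| "val M e TZero = zero_of M"
| "val M e TOne = one_of M"
| "val M e (TAdd s t) = add_of M (val M e s) (val M e t)"
| "val M e (TMinus t) = minus_of M (val M e t)"
| "val M e (TMul s t) = mul_of M (val M e s) (val M e t)"

primrec sat :: "('i, 'a) struct \<Rightarrow> (nat \<Rightarrow> 'a) \<Rightarrow> ('i, 'a) fm \<Rightarrow> bool" where
  "sat M e (FEq s t) \<longleftrightarrow> val M e s = val M e t"
| "sat M e (FPred i t) \<longleftrightarrow> val M e t \<in> pred_of M i"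
| "sat M e (FNot p) \<longleftrightarrow> \<not> sat M e p"
| "sat M e (FAnd p q) \<longleftrightarrow> sat M e p \<and> sat M e q"
| "sat M e (FEx v p) \<longleftrightarrow> (\<exists>a\<in>Dom M. sat M (e(v := a)) p)"

text \<open>An \<open>n\<close>-tuple of elements of \<open>M\<close> is given by an assignment, of which only the values at
  \<open>0, ..., n-1\<close> matter for formulas in \<open>x\<^sub>0, ..., x\<^bsub>n-1\<^esub>\<close>.\<close>

definition assignments :: "('i, 'a) struct \<Rightarrow> (nat \<Rightarrow> 'a) set" where
  "assignments M = {e. range e \<subseteq> Dom M}"

definition holds :: "('i, 'a) struct \<Rightarrow> ('i, 'a) fm \<Rightarrow> bool" where
  "holds M \<phi> \<longleftrightarrow> (\<forall>e\<in>assignments M. sat M e \<phi>)"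

definition models :: "'i set \<Rightarrow> ('i, 'a) fm set \<Rightarrow> ('i, 'a) struct set" where
  "models I T = {M. is_struct I M \<and> (\<forall>\<phi>\<in>T. holds M \<phi>)}"

text \<open>
  Here and below, models range over the structures whose domain is a set of elements of the type \<open>'a\<close>
  occurring in \<open>T :: ('i, 'a) fm set\<close>. If \<open>'a\<close> is infinite and at least as large as \<open>I\<close>, then by
  the downward Loewenheim-Skolem theorem satisfiability, consequence and each of the properties of a
  complete theory defined below do not depend on \<open>'a\<close>: a failure in a structure of any cardinality
  already occurs with countably many parameters, hence in structures of cardinality at most
  \<open>max(|I|, \<aleph>\<^sub>0)\<close>.
\<close>

definition complete_theory :: "'i set \<Rightarrow> ('i, 'a) fm set \<Rightarrow> bool" where
  "complete_theory I T \<longleftrightarrow> T \<subseteq> sentences I \<and> models I T \<noteq> {} \<and>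
     (\<forall>\<phi>\<in>sentences I. (\<forall>M\<in>models I T. holds M \<phi>) \<or> (\<forall>M\<in>models I T. holds M (FNot \<phi>)))"

definition completion :: "'i set \<Rightarrow> ('i, 'a) fm set \<Rightarrow> ('i, 'a) fm set \<Rightarrow> bool" where
  "completion I T0 T \<longleftrightarrow> complete_theory I T \<and> T0 \<subseteq> T"


subsection \<open>The theory \<open>ACF\<^sup>I\<close>\<close>

definition field_axioms :: "('i, 'a) fm set" where
  "field_axioms =
    (let x = Var 0; y = Var 1; z = Var 2 in
     { FAll 0 (FAll 1 (FAll 2 (FEq (TAdd (TAdd x y) z) (TAdd x (TAdd y z))))),
       FAll 0 (FAll 1 (FEq (TAdd x y) (TAdd y x))),
       FAll 0 (FEq (TAdd x TZero) x),
       FAll 0 (FEq (TAdd x (TMinus x)) TZero),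
       FAll 0 (FAll 1 (FAll 2 (FEq (TMul (TMul x y) z) (TMul x (TMul y z))))),
       FAll 0 (FAll 1 (FEq (TMul x y) (TMul y x))),
       FAll 0 (FEq (TMul x TOne) x),
       FAll 0 (FAll 1 (FAll 2 (FEq (TMul x (TAdd y z)) (TAdd (TMul x y) (TMul x z))))),
       FNot (FEq TZero TOne),
       FAll 0 (FImp (FNot (FEq x TZero)) (FEx 1 (FEq (TMul x y) TOne))) })"

text \<open>\<open>monic_tm n\<close> is the generic monic polynomial \<open>x\<^sup>n + a\<^sub>1 x\<^bsup>n-1\<^esup> + ... + a\<^sub>n\<close>, in Horner form, with
  \<open>x\<close> the variable \<open>0\<close> and \<open>a\<^sub>k\<close> the variable \<open>k\<close>.\<close>

primrec monic_tm :: "nat \<Rightarrow> 'a tm" where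
  "monic_tm 0 = TOne"
| "monic_tm (Suc n) = TAdd (TMul (monic_tm n) (Var 0)) (Var (Suc n))"

text \<open>\<open>\<forall>a\<^sub>1, ..., a\<^sub>n. \<phi>\<close>, and the same with the quantifiers relativised to \<open>P\<^sub>i\<close>.\<close>

primrec FAlls :: "nat \<Rightarrow> ('i, 'a) fm \<Rightarrow> ('i, 'a) fm" where
  "FAlls 0 \<phi> = \<phi>"
| "FAlls (Suc n) \<phi> = FAlls n (FAll (Suc n) \<phi>)"

primrec FAlls_in :: "'i \<Rightarrow> nat \<Rightarrow> ('i, 'a) fm \<Rightarrow> ('i, 'a) fm" where
  "FAlls_in i 0 \<phi> = \<phi>"
| "FAlls_in i (Suc n) \<phi> = FAlls_in i n (FAll (Suc n) (FImp (FPred i (Var (Suc n))) \<phi>))"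

definition ACF :: "('i, 'a) fm set" where
  "ACF = field_axioms \<union> {FAlls n (FEx 0 (FEq (monic_tm n) TZero)) | n. n \<ge> 1}"

definition subfield_axioms :: "'i \<Rightarrow> ('i, 'a) fm set" where
  "subfield_axioms i =
    (let x = Var 0; y = Var 1 in
     { FPred i TZero,
       FPred i TOne,
       FAll 0 (FAll 1 (FImp (FAnd (FPred i x) (FPred i y)) (FPred i (TAdd x y)))),
       FAll 0 (FImp (FPred i x) (FPred i (TMinus x))),
       FAll 0 (FAll 1 (FImp (FAnd (FPred i x) (FPred i y)) (FPred i (TMul x y)))),
       FAll 0 (FImp (FAnd (FPred i x) (FNot (FEq x TZero)))
                    (FEx 1 (FAnd (FPred i y) (FEq (TMul x y) TOne)))) })"

definition acl_subfield_axioms :: "'i \<Rightarrow> ('i, 'a) fm set" where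
  "acl_subfield_axioms i = subfield_axioms i \<union>
     {FAlls_in i n (FEx 0 (FAnd (FPred i (Var 0)) (FEq (monic_tm n) TZero))) | n. n \<ge> 1}"

text \<open>The linear order \<open>i \<le> j\<close> on the index set \<open>I\<close> is \<open>(i, j) \<in> r\<close>.\<close>

definition ACF_chain :: "'i set \<Rightarrow> 'i rel \<Rightarrow> ('i, 'a) fm set" where
  "ACF_chain I r =
     ACF \<union>
     (\<Union>i\<in>I. acl_subfield_axioms i \<union> {FEx 0 (FNot (FPred i (Var 0)))}) \<union>
     (\<Union>i\<in>I. \<Union>j\<in>{j \<in> I. (i, j) \<in> r \<and> i \<noteq> j}.
        { FAll 0 (FImp (FPred i (Var 0)) (FPred j (Var 0))),
          FEx 0 (FAnd (FPred j (Var 0)) (FNot (FPred i (Var 0)))) })"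


subsection \<open>Types and \<open>\<omega>\<close>-stability\<close>

text \<open>A set of formulas with parameters in \<open>M\<close> is consistent with the elementary diagram of \<open>M\<close> iff it is
  finitely satisfiable in \<open>M\<close>.\<close>

definition fin_sat :: "('i, 'a) struct \<Rightarrow> ('i, 'a) fm set \<Rightarrow> bool" where
  "fin_sat M p \<longleftrightarrow> (\<forall>q. finite q \<and> q \<subseteq> p \<longrightarrow> (\<exists>e\<in>assignments M. \<forall>\<phi>\<in>q. sat M e \<phi>))"

definition complete_types :: "'i set \<Rightarrow> ('i, 'a) struct \<Rightarrow> 'a set \<Rightarrow> nat \<Rightarrow> ('i, 'a) fm set set" where
  "complete_types I M A n =
     {p. p \<subseteq> formulas I A n \<and> fin_sat M p \<and> (\<forall>\<phi>\<in>formulas I A n. \<phi> \<in> p \<or> FNot \<phi> \<in> p)}"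

definition omega_stable :: "'i set \<Rightarrow> ('i, 'a) fm set \<Rightarrow> bool" where
  "omega_stable I T \<longleftrightarrow>
     (\<forall>M\<in>models I T. \<forall>A. A \<subseteq> Dom M \<and> countable A \<longrightarrow> countable (complete_types I M A 1))"


subsection \<open>Total transcendence\<close>

definition binary_tree ::
    "'i set \<Rightarrow> ('i, 'a) struct \<Rightarrow> nat \<Rightarrow> (bool list \<Rightarrow> ('i, 'a) fm) \<Rightarrow> bool" where
  "binary_tree I M n \<phi> \<longleftrightarrow>
     (\<forall>s. \<phi> s \<in> formulas I (Dom M) n \<and>
          (\<exists>e\<in>assignments M. sat M e (\<phi> s)) \<and>
          (\<forall>b. \<forall>e\<in>assignments M. sat M e (\<phi> (s @ [b])) \<longrightarrow> sat M e (\<phi> s)) \<and>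
          \<not> (\<exists>e\<in>assignments M. sat M e (\<phi> (s @ [False])) \<and> sat M e (\<phi> (s @ [True]))))"

definition totally_transcendental :: "'i set \<Rightarrow> ('i, 'a) fm set \<Rightarrow> bool" where
  "totally_transcendental I T \<longleftrightarrow> \<not> (\<exists>M\<in>models I T. \<exists>n \<phi>. binary_tree I M n \<phi>)"


subsection \<open>Superstability\<close>

text \<open>Instead of working in a monster model, elementary extensions are taken where needed. They are given
  by elementary embeddings, so that a structure may have extensions within the type even if its domain
  is the whole type.\<close>

definition elementary_on ::
    "'i set \<Rightarrow> ('i, 'a) struct \<Rightarrow> ('i, 'a) struct \<Rightarrow> 'a set \<Rightarrow> ('a \<Rightarrow> 'a) \<Rightarrow> bool" where
  "elementary_on I M N A f \<longleftrightarrow> f ` A \<subseteq> Dom N \<and>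
     (\<forall>\<phi>\<in>formulas I A 0. holds M \<phi> \<longleftrightarrow> holds N (map_fm id f \<phi>))"

abbreviation elementary_embedding ::
    "'i set \<Rightarrow> ('i, 'a) struct \<Rightarrow> ('i, 'a) struct \<Rightarrow> ('a \<Rightarrow> 'a) \<Rightarrow> bool" where
  "elementary_embedding I M N f \<equiv> elementary_on I M N (Dom M) f"

text \<open>
  A formula \<open>\<phi>\<close> with parameters in \<open>M\<close>, viewed as \<open>\<psi>(x, b)\<close> with \<open>b\<close> enumerating its constants, divides
  over \<open>B\<close> if in some elementary extension there are \<open>b\<^sub>0, b\<^sub>1, ...\<close> realising the type of \<open>b\<close> over \<open>B\<close>
  such that \<open>(\<psi>(x, b\<^sub>j))\<^sub>j\<close> is \<open>k\<close>-inconsistent for some \<open>k\<close>. The tuple \<open>b\<^sub>j\<close> is given by a map \<open>h j\<close> with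
  \<open>h j b = b\<^sub>j\<close>; realising the type of \<open>b\<close> over \<open>B\<close> means that \<open>h j\<close>, which agrees with the embedding on
  \<open>B\<close>, is elementary on \<open>B\<close> and \<open>b\<close>.
\<close>

definition divides ::
    "'i set \<Rightarrow> ('i, 'a) struct \<Rightarrow> 'a set \<Rightarrow> ('i, 'a) fm \<Rightarrow> bool" where
  "divides I M B \<phi> \<longleftrightarrow>
     (\<exists>N f (h :: nat \<Rightarrow> 'a \<Rightarrow> 'a) k.
        is_struct I N \<and> elementary_embedding I M N f \<and>
        (\<forall>j. elementary_on I M N (B \<union> params \<phi>) (h j) \<and> (\<forall>b\<in>B. h j b = f b)) \<and>
        (\<forall>J. finite J \<and> card J = k \<longrightarrow>
           \<not> (\<exists>e\<in>assignments N. \<forall>j\<in>J. sat N e (map_fm id (h j) \<phi>))))"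

text \<open>A partial type \<open>p\<close> forks over \<open>B\<close> if, possibly with parameters from an elementary extension, it implies
  a finite disjunction of formulas each of which divides over \<open>B\<close>.\<close>

definition forks ::
    "'i set \<Rightarrow> ('i, 'a) struct \<Rightarrow> 'a set \<Rightarrow> nat \<Rightarrow> ('i, 'a) fm set \<Rightarrow> bool" where
  "forks I M B n p \<longleftrightarrow>
     (\<exists>N f \<Phi>. is_struct I N \<and> elementary_embedding I M N f \<and>
        finite \<Phi> \<and> \<Phi> \<subseteq> formulas I (Dom N) n \<and> (\<forall>\<phi>\<in>\<Phi>. divides I N (f ` B) \<phi>) \<and>
        \<not> fin_sat N (map_fm id f ` p \<union> FNot ` \<Phi>))"

text \<open>The order property for \<open>\<phi>(x; y)\<close>, with \<open>x\<close> the first \<open>n\<close> variables and \<open>y\<close> the next \<open>m\<close> ones.\<close>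

definition order_property ::
    "('i, 'a) struct \<Rightarrow> nat \<Rightarrow> ('i, 'a) fm \<Rightarrow> bool" where
  "order_property M n \<phi> \<longleftrightarrow>
     (\<exists>a b :: nat \<Rightarrow> nat \<Rightarrow> 'a. range a \<subseteq> assignments M \<and> range b \<subseteq> assignments M \<and>
        (\<forall>i j. sat M (\<lambda>v. if v < n then a i v else b j (v - n)) \<phi> \<longleftrightarrow> i < j))"

definition stable :: "'i set \<Rightarrow> ('i, 'a) fm set \<Rightarrow> bool" where
  "stable I T \<longleftrightarrow>
     \<not> (\<exists>M\<in>models I T. \<exists>n m. \<exists>\<phi>\<in>formulas I {} (n + m). order_property M n \<phi>)"

text \<open>Superstable: stable, and no complete type forks over every finite subset of its domain. (The
  equivalent definition, stability in all large enough cardinals, quantifies over all cardinals.)\<close>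

definition superstable :: "'i set \<Rightarrow> ('i, 'a) fm set \<Rightarrow> bool" where
  "superstable I T \<longleftrightarrow> stable I T \<and>
     (\<forall>M\<in>models I T. \<forall>A n. \<forall>p\<in>complete_types I M A n. A \<subseteq> Dom M \<longrightarrow>
        (\<exists>B. finite B \<and> B \<subseteq> A \<and> \<not> forks I M B n p))"

end

theory Submission
  imports Defs "HOL-Algebra.Finite_Extensions" "HOL-Algebra.Generated_Fields"
begin

text \<open>
  If \<open>I\<close> is well-ordered, a model has a transcendence basis containing a transcendence basis of each \<open>P\<^sub>i\<close>.
  Permutations of the basis which preserve the least \<open>i\<close> with \<open>x \<in> P\<^sub>i\<close> extend to automorphisms, so over
  a countable set and in a countable sublanguage only countably many types are realised. This excludes
  binary trees and the order property, each of which would give uncountably many types in an ultrapower.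
  As binary trees are also excluded in an ultrapower that is saturated for a countable sublanguage, types
  have finite multiplicity modulo suitable invariant ideals of formulas; these ideals contain the dividing
  formulas, so a type does not fork over some finite subset of its domain. If \<open>I\<close> is uncountable, the types of elements outside
  \<open>P\<^sub>i\<close> but inside all larger \<open>P\<^sub>j\<close> are different.

  If \<open>i\<^sub>0 > i\<^sub>1 > ...\<close> in \<open>I\<close>, choose \<open>c\<^sub>k \<in> P\<^bsub>i\<^sub>k\<^esub>\<close> in the basis of a finite part of the chain, outside
  the next field. Multiplying \<open>c\<^sub>k\<close> by elements \<open>q\<close> of the next field gives conjugates of \<open>c\<^sub>k\<close> over
  \<open>c\<^sub>0, ..., c\<^bsub>k-1\<^esub>\<close> in different cosets of the next field. Hence the type of an infinite sum
  \<open>c\<^sub>0 + c\<^sub>1 + ...\<close>, which contains the coset of each partial sum, forks over every finite set of the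
  \<open>c\<^sub>k\<close>. The elements \<open>c\<^sub>k\<close> themselves come from an ultrapower, which is cut down to the type \<open>'a\<close> by the
  downward Loewenheim-Skolem theorem.
\<close>

subsection \<open>Syntax and semantics\<close>

text \<open>Automorphisms only control types that are realised in a given model, while stability
  speaks of all types. An ultrapower over \<open>nat\<close> realises all types given by countably
  many formulas over the model at once, so it is enough to count realised types there, without
  describing the definable sets. This saturation reaches countable sets of formulas only; for
  uncountable I every argument is first cut down to the countably many predicates and parameters
  that it mentions. Forking is harder to confine: it refers to an extension N of M, and dividing to
  a further extension of N. Elementary maps with countable domain extend into a saturated structure,
  and this brings all these witnesses into one ultrapower of M. Finite subchains have one, and there
  conjugates come from automorphisms; as a sentence mentions finitely many predicates, an ultrapower
  indexed by the finite subsets of I turns these automorphisms into an elementary map.\<close>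

definition fms :: "'i set \<Rightarrow> 'a set \<Rightarrow> ('i, 'a) fm set" where
  "fms I A = {\<phi>. preds \<phi> \<subseteq> I \<and> params \<phi> \<subseteq> A}"

text \<open>The bound on free variables in \<open>formulas\<close> is lost below a quantifier, so
  inductions on formulas are carried out in \<open>fms\<close>, which has no such bound.\<close>

lemma formulas_fms: "\<phi> \<in> formulas I A n \<longleftrightarrow> \<phi> \<in> fms I A \<and> fvars \<phi> \<subseteq> {..<n}"
  by (auto simp: formulas_def fms_def)

lemma fms_simps [simp]:
  "FEq s t \<in> fms I A \<longleftrightarrow> tparams s \<subseteq> A \<and> tparams t \<subseteq> A"
  "FPred i t \<in> fms I A \<longleftrightarrow> i \<in> I \<and> tparams t \<subseteq> A"
  "FNot p \<in> fms I A \<longleftrightarrow> p \<in> fms I A"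
  "FAnd p q \<in> fms I A \<longleftrightarrow> p \<in> fms I A \<and> q \<in> fms I A"
  "FEx v p \<in> fms I A \<longleftrightarrow> p \<in> fms I A"
  by (auto simp: fms_def)

lemma formulas_simps [simp]:
  "FEq s t \<in> formulas I A n \<longleftrightarrow> tparams s \<subseteq> A \<and> tparams t \<subseteq> A \<and> tvars s \<union> tvars t \<subseteq> {..<n}"
  "FPred i t \<in> formulas I A n \<longleftrightarrow> i \<in> I \<and> tparams t \<subseteq> A \<and> tvars t \<subseteq> {..<n}"
  "FNot p \<in> formulas I A n \<longleftrightarrow> p \<in> formulas I A n"
  "FAnd p q \<in> formulas I A n \<longleftrightarrow> p \<in> formulas I A n \<and> q \<in> formulas I A n"
  by (auto simp: formulas_def)

lemma fms_mono: "\<phi> \<in> fms I A \<Longrightarrow> I \<subseteq> J \<Longrightarrow> A \<subseteq> B \<Longrightarrow> \<phi> \<in> fms J B"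
  by (auto simp: fms_def)

lemma formulas_mono: "\<phi> \<in> formulas I A n \<Longrightarrow> I \<subseteq> J \<Longrightarrow> A \<subseteq> B \<Longrightarrow> n \<le> m \<Longrightarrow> \<phi> \<in> formulas J B m"
  by (fastforce simp: formulas_def)

lemma finite_tvars [simp]: "finite (tvars t)"
  by (induction t) auto

lemma finite_fvars [simp]: "finite (fvars \<phi>)"
  by (induction \<phi>) auto

lemma tvars_map_tm [simp]: "tvars (map_tm f t) = tvars t"
  by (induction t) auto

lemma fvars_map_fm [simp]: "fvars (map_fm g f \<phi>) = fvars \<phi>"
  by (induction \<phi>) auto

lemma preds_map_fm [simp]: "preds (map_fm id f \<phi>) = preds \<phi>"
  by (simp add: fm.set_map)

lemma params_map_fm [simp]: "params (map_fm g f \<phi>) = f ` params \<phi>"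
  by (simp add: fm.set_map)

lemma map_fm_comp [simp]: "map_fm id f (map_fm id g \<phi>) = map_fm id (\<lambda>x. f (g x)) \<phi>"
  by (simp add: fm.map_comp comp_def id_def)

lemma map_tm_comp [simp]: "map_tm f (map_tm g t) = map_tm (\<lambda>x. f (g x)) t"
  by (simp add: tm.map_comp comp_def)

lemma map_fm_cong_params: "(\<And>c. c \<in> params \<phi> \<Longrightarrow> f c = g c) \<Longrightarrow> map_fm id f \<phi> = map_fm id g \<phi>"
  by (simp cong: fm.map_cong)

lemma map_fm_ident: "(\<And>c. c \<in> params \<phi> \<Longrightarrow> f c = c) \<Longrightarrow> map_fm id f \<phi> = \<phi>"
  using map_fm_cong_params[of \<phi> f id] by (simp add: fm.map_id)

lemma map_fm_fms: "\<phi> \<in> fms I A \<Longrightarrow> f ` A \<subseteq> B \<Longrightarrow> map_fm id f \<phi> \<in> fms I B"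
  by (auto simp: fms_def)

lemma map_fm_formulas: "\<phi> \<in> formulas I A n \<Longrightarrow> f ` A \<subseteq> B \<Longrightarrow> map_fm id f \<phi> \<in> formulas I B n"
  by (auto simp: formulas_def)

lemma val_cong: "(\<And>v. v \<in> tvars t \<Longrightarrow> e v = e' v) \<Longrightarrow> val M e t = val M e' t"
  by (induction t) auto

lemma sat_cong: "(\<And>v. v \<in> fvars \<phi> \<Longrightarrow> e v = e' v) \<Longrightarrow> sat M e \<phi> = sat M e' \<phi>"
proof (induction \<phi> arbitrary: e e')
  case (FEq s t)
  then show ?case using val_cong[of s e e' M] val_cong[of t e e' M] by auto
next
  case (FPred i t)
  then show ?case using val_cong[of t e e' M] by auto
next
  case (FEx v p)
  have "sat M (e(v := a)) p = sat M (e'(v := a)) p" for a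
    using FEx.prems by (intro FEx.IH) auto
  then show ?case by simp
next
  case (FAnd p q)
  have "sat M e p = sat M e' p" "sat M e q = sat M e' q"
    using FAnd.prems by (auto intro!: FAnd.IH)
  then show ?case by simp
next
  case (FNot p)
  have "sat M e p = sat M e' p" using FNot.prems by (auto intro!: FNot.IH)
  then show ?case by simp
qed

lemma val_in_Dom:
  "is_struct I M \<Longrightarrow> (\<And>v. v \<in> tvars t \<Longrightarrow> e v \<in> Dom M) \<Longrightarrow> tparams t \<subseteq> Dom M \<Longrightarrow> val M e t \<in> Dom M"
  by (induction t) (auto simp: is_struct_def)

lemma assignmentsD [simp]: "e \<in> assignments M \<Longrightarrow> e v \<in> Dom M"
  by (auto simp: assignments_def)

lemma assignments_upd [simp]: "e \<in> assignments M \<Longrightarrow> a \<in> Dom M \<Longrightarrow> e(v := a) \<in> assignments M"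
  by (auto simp: assignments_def)

lemma assignmentsI: "(\<And>v. e v \<in> Dom M) \<Longrightarrow> e \<in> assignments M"
  by (auto simp: assignments_def)

lemma zero_in_Dom: "is_struct I M \<Longrightarrow> zero_of M \<in> Dom M"
  by (simp add: is_struct_def)

lemma assignments_nonempty: "is_struct I M \<Longrightarrow> assignments M \<noteq> {}"
  using assignmentsI[of "\<lambda>_. zero_of M" M] by (auto simp: zero_in_Dom)

lemma holds_sentence:
  assumes "is_struct I M" "fvars \<phi> = {}"
  shows "holds M \<phi> \<longleftrightarrow> sat M e \<phi>"
proof -
  have "sat M e' \<phi> = sat M e \<phi>" for e' by (rule sat_cong) (simp add: assms)
  then show ?thesis using assignments_nonempty[OF assms(1)] by (auto simp: holds_def)
qed

lemma sentence_fvars: "\<phi> \<in> formulas I A 0 \<Longrightarrow> fvars \<phi> = {}"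
  by (auto simp: formulas_def)

lemma is_struct_mono: "is_struct I M \<Longrightarrow> J \<subseteq> I \<Longrightarrow> is_struct J M"
  by (auto simp: is_struct_def)

section \<open>Finite conjunctions, disjunctions and existential closures\<close>

definition FConj :: "('i, 'a) fm list \<Rightarrow> ('i, 'a) fm" where
  "FConj \<phi>s = foldr FAnd \<phi>s (FEq TZero TZero)"

definition FDisj :: "('i, 'a) fm list \<Rightarrow> ('i, 'a) fm" where
  "FDisj \<phi>s = FNot (FConj (map FNot \<phi>s))"

definition FExs :: "nat list \<Rightarrow> ('i, 'a) fm \<Rightarrow> ('i, 'a) fm" where
  "FExs vs \<phi> = foldr FEx vs \<phi>"

lemma sat_FConj [simp]: "sat M e (FConj \<phi>s) \<longleftrightarrow> (\<forall>\<phi>\<in>set \<phi>s. sat M e \<phi>)"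
  by (induction \<phi>s) (auto simp: FConj_def)

lemma FConj_fms [simp]: "FConj \<phi>s \<in> fms I A \<longleftrightarrow> set \<phi>s \<subseteq> fms I A"
  by (induction \<phi>s) (auto simp: FConj_def)

lemma fvars_FConj [simp]: "fvars (FConj \<phi>s) = (\<Union>\<phi>\<in>set \<phi>s. fvars \<phi>)"
  by (induction \<phi>s) (auto simp: FConj_def)

lemma params_FConj [simp]: "params (FConj \<phi>s) = (\<Union>\<phi>\<in>set \<phi>s. params \<phi>)"
  by (induction \<phi>s) (auto simp: FConj_def)

lemma FConj_formulas [simp]: "FConj \<phi>s \<in> formulas I A n \<longleftrightarrow> set \<phi>s \<subseteq> formulas I A n"
  by (auto simp: formulas_fms subset_iff)

lemma map_FConj [simp]: "map_fm id f (FConj \<phi>s) = FConj (map (map_fm id f) \<phi>s)"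
  by (induction \<phi>s) (auto simp: FConj_def)

lemma sat_FDisj [simp]: "sat M e (FDisj \<phi>s) \<longleftrightarrow> (\<exists>\<phi>\<in>set \<phi>s. sat M e \<phi>)"
  by (auto simp: FDisj_def)

lemma FDisj_formulas [simp]: "FDisj \<phi>s \<in> formulas I A n \<longleftrightarrow> set \<phi>s \<subseteq> formulas I A n"
  by (auto simp: FDisj_def)

lemma map_FDisj [simp]: "map_fm id f (FDisj \<phi>s) = FDisj (map (map_fm id f) \<phi>s)"
  by (simp add: FDisj_def comp_def)

lemma params_FDisj [simp]: "params (FDisj \<phi>s) = (\<Union>\<phi>\<in>set \<phi>s. params \<phi>)"
  by (simp add: FDisj_def)

lemma sat_FExs:
  "sat M e (FExs vs \<phi>) \<longleftrightarrow>
     (\<exists>e'. (\<forall>v\<in>set vs. e' v \<in> Dom M) \<and> (\<forall>v. v \<notin> set vs \<longrightarrow> e' v = e v) \<and> sat M e' \<phi>)"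
proof (induction vs arbitrary: e)
  case Nil
  have "(\<forall>v. e' v = e v) \<longleftrightarrow> e' = e" for e' by auto
  then show ?case by (simp add: FExs_def)
next
  case (Cons w vs)
  have "sat M e (FExs (w # vs) \<phi>) \<longleftrightarrow> (\<exists>a\<in>Dom M. sat M (e(w := a)) (FExs vs \<phi>))"
    by (simp add: FExs_def)
  also have "\<dots> \<longleftrightarrow> (\<exists>a\<in>Dom M. \<exists>e'. (\<forall>v\<in>set vs. e' v \<in> Dom M) \<and>
      (\<forall>v. v \<notin> set vs \<longrightarrow> e' v = (e(w := a)) v) \<and> sat M e' \<phi>)"
    by (simp only: Cons.IH)
  also have "\<dots> \<longleftrightarrow> (\<exists>e'. (\<forall>v\<in>set (w # vs). e' v \<in> Dom M) \<and>
      (\<forall>v. v \<notin> set (w # vs) \<longrightarrow> e' v = e v) \<and> sat M e' \<phi>)" (is "?L = ?R")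
  proof
    assume ?L
    then obtain a e' where *: "a \<in> Dom M" "\<forall>v\<in>set vs. e' v \<in> Dom M"
      "\<forall>v. v \<notin> set vs \<longrightarrow> e' v = (e(w := a)) v" "sat M e' \<phi>" by blast
    have "e' w \<in> Dom M" using * by (cases "w \<in> set vs") auto
    then show ?R using * by (intro exI[of _ e']) auto
  next
    assume ?R
    then obtain e' where "\<forall>v\<in>set (w # vs). e' v \<in> Dom M"
      "\<forall>v. v \<notin> set (w # vs) \<longrightarrow> e' v = e v" "sat M e' \<phi>" by blast
    then show ?L by (intro bexI[of _ "e' w"] exI[of _ e']) auto
  qed
  finally show ?case .
qed

lemma fvars_FExs [simp]: "fvars (FExs vs \<phi>) = fvars \<phi> - set vs"
  by (induction vs) (auto simp: FExs_def)

lemma FExs_fms [simp]: "FExs vs \<phi> \<in> fms I A \<longleftrightarrow> \<phi> \<in> fms I A"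
  by (induction vs) (auto simp: FExs_def)

lemma map_FExs [simp]: "map_fm id f (FExs vs \<phi>) = FExs vs (map_fm id f \<phi>)"
  by (induction vs) (auto simp: FExs_def)

text \<open>Elementary maps compare sentences only; the existential closure lets them compare the
  satisfiability of formulas as well.\<close>

definition FEcl :: "('i, 'a) fm \<Rightarrow> ('i, 'a) fm" where
  "FEcl \<phi> = FExs (sorted_list_of_set (fvars \<phi>)) \<phi>"

lemma fvars_FEcl [simp]: "fvars (FEcl \<phi>) = {}"
  by (simp add: FEcl_def)

lemma FEcl_fms [simp]: "FEcl \<phi> \<in> fms I A \<longleftrightarrow> \<phi> \<in> fms I A"
  by (simp add: FEcl_def)

lemma map_FEcl [simp]: "map_fm id f (FEcl \<phi>) = FEcl (map_fm id f \<phi>)"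
  by (simp add: FEcl_def)

lemma FEcl_sentence: "\<phi> \<in> fms I A \<Longrightarrow> FEcl \<phi> \<in> formulas I A 0"
  by (simp add: formulas_fms)

lemma holds_FEcl:
  assumes "is_struct I M"
  shows "holds M (FEcl \<phi>) \<longleftrightarrow> (\<exists>e\<in>assignments M. sat M e \<phi>)"
proof -
  obtain e0 where e0: "e0 \<in> assignments M" using assignments_nonempty[OF assms] by auto
  have "holds M (FEcl \<phi>) \<longleftrightarrow> sat M e0 (FEcl \<phi>)" by (rule holds_sentence[OF assms]) simp
  also have "\<dots> \<longleftrightarrow> (\<exists>e\<in>assignments M. sat M e \<phi>)"
  proof
    assume "sat M e0 (FEcl \<phi>)"
    then obtain e' where e': "\<forall>v\<in>fvars \<phi>. e' v \<in> Dom M" "\<forall>v. v \<notin> fvars \<phi> \<longrightarrow> e' v = e0 v" "sat M e' \<phi>"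
      by (auto simp: FEcl_def sat_FExs)
    have "e' \<in> assignments M" using e' e0 by (intro assignmentsI) (metis assignmentsD)
    then show "\<exists>e\<in>assignments M. sat M e \<phi>" using e' by auto
  next
    assume "\<exists>e\<in>assignments M. sat M e \<phi>"
    then obtain e where e: "e \<in> assignments M" "sat M e \<phi>" by auto
    have "sat M (\<lambda>v. if v \<in> fvars \<phi> then e v else e0 v) \<phi>"
      using e(2) by (subst sat_cong[where e' = e]) auto
    then show "sat M e0 (FEcl \<phi>)"
      using e(1) unfolding FEcl_def sat_FExs
      by (intro exI[of _ "\<lambda>v. if v \<in> fvars \<phi> then e v else e0 v"]) auto
  qed
  finally show ?thesis .
qed

section \<open>Isomorphisms of structures\<close>

definition struct_iso :: "'i set \<Rightarrow> ('i, 'a) struct \<Rightarrow> ('i, 'b) struct \<Rightarrow> ('a \<Rightarrow> 'b) \<Rightarrow> bool" where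
  "struct_iso I M N \<tau> \<longleftrightarrow> bij_betw \<tau> (Dom M) (Dom N) \<and>
     \<tau> (zero_of M) = zero_of N \<and> \<tau> (one_of M) = one_of N \<and>
     (\<forall>a\<in>Dom M. \<forall>b\<in>Dom M. \<tau> (add_of M a b) = add_of N (\<tau> a) (\<tau> b)) \<and>
     (\<forall>a\<in>Dom M. \<tau> (minus_of M a) = minus_of N (\<tau> a)) \<and>
     (\<forall>a\<in>Dom M. \<forall>b\<in>Dom M. \<tau> (mul_of M a b) = mul_of N (\<tau> a) (\<tau> b)) \<and>
     (\<forall>i\<in>I. \<forall>a\<in>Dom M. \<tau> a \<in> pred_of N i \<longleftrightarrow> a \<in> pred_of M i)"

lemma val_iso:
  assumes "is_struct I M" "struct_iso I M N \<tau>" "e \<in> assignments M" "tparams t \<subseteq> Dom M"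
  shows "val N (\<lambda>v. \<tau> (e v)) (map_tm \<tau> t) = \<tau> (val M e t)"
  using assms(4)
proof (induction t)
  case (TAdd s t)
  have "val M e s \<in> Dom M" "val M e t \<in> Dom M"
    using TAdd.prems assms by (auto intro!: val_in_Dom[OF assms(1)])
  then show ?case using TAdd assms by (simp add: struct_iso_def)
next
  case (TMul s t)
  have "val M e s \<in> Dom M" "val M e t \<in> Dom M"
    using TMul.prems assms by (auto intro!: val_in_Dom[OF assms(1)])
  then show ?case using TMul assms by (simp add: struct_iso_def)
next
  case (TMinus t)
  have "val M e t \<in> Dom M"
    using TMinus.prems assms by (auto intro!: val_in_Dom[OF assms(1)])
  then show ?case using TMinus assms by (simp add: struct_iso_def)
qed (use assms in \<open>auto simp: struct_iso_def\<close>)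

lemma sat_iso:
  assumes "is_struct I M" "struct_iso I M N \<tau>" "e \<in> assignments M" "\<phi> \<in> fms I (Dom M)"
  shows "sat N (\<lambda>v. \<tau> (e v)) (map_fm id \<tau> \<phi>) \<longleftrightarrow> sat M e \<phi>"
  using assms(3,4)
proof (induction \<phi> arbitrary: e)
  case (FEq s t)
  have "val M e s \<in> Dom M" "val M e t \<in> Dom M"
    using FEq.prems by (auto intro!: val_in_Dom[OF assms(1)])
  moreover have "inj_on \<tau> (Dom M)" using assms(2) by (auto simp: struct_iso_def bij_betw_def)
  ultimately show ?case using FEq.prems by (simp add: val_iso[OF assms(1,2)] inj_on_eq_iff)
next
  case (FPred i t)
  have "val M e t \<in> Dom M"
    using FPred.prems by (auto intro!: val_in_Dom[OF assms(1)])
  then show ?case using FPred.prems assms(2) by (simp add: val_iso[OF assms(1,2)] struct_iso_def)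
next
  case (FEx v p)
  have img: "Dom N = \<tau> ` Dom M" using assms(2) by (auto simp: struct_iso_def bij_betw_def)
  have "sat N ((\<lambda>w. \<tau> (e w))(v := \<tau> a)) (map_fm id \<tau> p) \<longleftrightarrow> sat M (e(v := a)) p" if "a \<in> Dom M" for a
  proof -
    have eq: "(\<lambda>w. \<tau> (e w))(v := \<tau> a) = (\<lambda>w. \<tau> ((e(v := a)) w))" by auto
    have 1: "e(v := a) \<in> assignments M" using FEx.prems(1) that by (rule assignments_upd)
    have 2: "p \<in> fms I (Dom M)" using FEx.prems by simp
    show ?thesis unfolding eq by (rule FEx.IH[OF 1 2])
  qed
  then show ?case unfolding fm.map sat.simps img bex_simps by (intro bex_cong) auto
qed auto

subsection \<open>Elementary maps\<close>

text \<open>The relation \<open>elementary_on\<close> between structures over possibly different types.\<close>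

definition elem :: "'i set \<Rightarrow> ('i, 'a) struct \<Rightarrow> ('i, 'b) struct \<Rightarrow> 'a set \<Rightarrow> ('a \<Rightarrow> 'b) \<Rightarrow> bool" where
  "elem I M N A f \<longleftrightarrow> f ` A \<subseteq> Dom N \<and>
     (\<forall>\<phi>\<in>formulas I A 0. holds M \<phi> \<longleftrightarrow> holds N (map_fm id f \<phi>))"

lemma elementary_on_elem: "elementary_on I M N A f \<longleftrightarrow> elem I M N A f"
  by (simp add: elem_def elementary_on_def)

lemma elem_mono: "elem I M N A f \<Longrightarrow> B \<subseteq> A \<Longrightarrow> J \<subseteq> I \<Longrightarrow> elem J M N B f"
  unfolding elem_def by (meson formulas_mono image_mono order_refl order_trans)

lemma elem_comp:
  assumes "elem I M N A f" "elem I N K B g" "f ` A \<subseteq> B"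
  shows "elem I M K A (\<lambda>x. g (f x))"
proof -
  have "holds M \<phi> \<longleftrightarrow> holds K (map_fm id (\<lambda>x. g (f x)) \<phi>)" if "\<phi> \<in> formulas I A 0" for \<phi>
  proof -
    have "map_fm id f \<phi> \<in> formulas I B 0" using that assms(3) by (rule map_fm_formulas)
    then show ?thesis using assms(1,2) that by (auto simp: elem_def)
  qed
  then show ?thesis using assms by (fastforce simp: elem_def)
qed

lemma elem_ex:
  assumes "elem I M N A f" "is_struct I M" "is_struct I N" "\<phi> \<in> fms I A"
  shows "(\<exists>e\<in>assignments M. sat M e \<phi>) \<longleftrightarrow> (\<exists>e\<in>assignments N. sat N e (map_fm id f \<phi>))"
proof -
  have "holds M (FEcl \<phi>) \<longleftrightarrow> holds N (map_fm id f (FEcl \<phi>))"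
    using assms(1) FEcl_sentence[OF assms(4)] by (auto simp: elem_def)
  then show ?thesis by (simp add: holds_FEcl[OF assms(2)] holds_FEcl[OF assms(3)])
qed

lemma elem_all:
  assumes "elem I M N A f" "is_struct I M" "is_struct I N" "\<phi> \<in> fms I A"
  shows "(\<forall>e\<in>assignments M. sat M e \<phi>) \<longleftrightarrow> (\<forall>e\<in>assignments N. sat N e (map_fm id f \<phi>))"
  using elem_ex[OF assms(1-3), of "FNot \<phi>"] assms(4) by simp blast

lemma elem_inj:
  assumes "elem I M N A f" "is_struct I M" "is_struct I N"
  shows "inj_on f A"
proof (rule inj_onI)
  fix a b assume ab: "a \<in> A" "b \<in> A" "f a = f b"
  show "a = b"
    using elem_ex[OF assms, of "FEq (Cst a) (Cst b)"] ab assignments_nonempty[OF assms(2)]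
      assignments_nonempty[OF assms(3)] by auto
qed

text \<open>Elementary maps are injective, so every sentence over the image of A is the image of a
  sentence over A.\<close>

lemma elem_inv:
  assumes "elem I M N A f" "is_struct I M" "is_struct I N" "A \<subseteq> Dom M"
  shows "elem I N M (f ` A) (inv_into A f)"
proof -
  have inj: "inj_on f A" by (rule elem_inj[OF assms(1-3)])
  have "holds N \<phi> \<longleftrightarrow> holds M (map_fm id (inv_into A f) \<phi>)" if "\<phi> \<in> formulas I (f ` A) 0" for \<phi>
  proof -
    have "map_fm id (inv_into A f) \<phi> \<in> formulas I A 0"
      using that by (rule map_fm_formulas) (auto simp: inj)
    moreover have "map_fm id f (map_fm id (inv_into A f) \<phi>) = \<phi>"
      unfolding map_fm_comp using that by (intro map_fm_ident) (auto simp: formulas_def f_inv_into_f)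
    ultimately show ?thesis using assms(1) unfolding elem_def by metis
  qed
  then show ?thesis using inj assms(4) by (auto simp: elem_def)
qed

text \<open>Renaming the variable \<open>v\<close> to \<open>2 v\<close> frees the odd variables, which can then replace constants
  without being captured by a quantifier.\<close>

primrec tsub :: "('a \<Rightarrow> 'b tm) \<Rightarrow> 'a tm \<Rightarrow> 'b tm" where
  "tsub \<kappa> (Var v) = Var (2 * v)"
| "tsub \<kappa> (Cst a) = \<kappa> a"
| "tsub \<kappa> TZero = TZero"
| "tsub \<kappa> TOne = TOne"
| "tsub \<kappa> (TAdd s t) = TAdd (tsub \<kappa> s) (tsub \<kappa> t)"
| "tsub \<kappa> (TMinus t) = TMinus (tsub \<kappa> t)"
| "tsub \<kappa> (TMul s t) = TMul (tsub \<kappa> s) (tsub \<kappa> t)"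

primrec fsub :: "('a \<Rightarrow> 'b tm) \<Rightarrow> ('i, 'a) fm \<Rightarrow> ('i, 'b) fm" where
  "fsub \<kappa> (FEq s t) = FEq (tsub \<kappa> s) (tsub \<kappa> t)"
| "fsub \<kappa> (FPred i t) = FPred i (tsub \<kappa> t)"
| "fsub \<kappa> (FNot p) = FNot (fsub \<kappa> p)"
| "fsub \<kappa> (FAnd p q) = FAnd (fsub \<kappa> p) (fsub \<kappa> q)"
| "fsub \<kappa> (FEx v p) = FEx (2 * v) (fsub \<kappa> p)"

lemma val_tsub: "val M e (tsub \<kappa> t) = val M (\<lambda>v. e (2 * v)) (map_tm (\<lambda>a. val M e (\<kappa> a)) t)"
  by (induction t) auto

text \<open>The quantifiers of \<open>fsub\<close> bind even variables only, so the value of an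
  inserted term with odd variables does not change below them.\<close>

lemma sat_fsub:
  assumes "\<And>a. \<forall>v\<in>tvars (\<kappa> a). odd v"
  shows "sat M e (fsub \<kappa> \<phi>) \<longleftrightarrow> sat M (\<lambda>v. e (2 * v)) (map_fm id (\<lambda>a. val M e (\<kappa> a)) \<phi>)"
proof (induction \<phi> arbitrary: e)
  case (FEx v p)
  have "val M (e(2 * v := b)) (\<kappa> a) = val M e (\<kappa> a)" for a b
    using assms[of a] by (intro val_cong) auto
  moreover have "(\<lambda>w. (e(2 * v := b)) (2 * w)) = (\<lambda>w. e (2 * w))(v := b)" for b
    by (auto simp: fun_eq_iff)
  ultimately show ?case by (simp only: fsub.simps sat.simps fm.map FEx.IH)
qed (auto simp: val_tsub)

lemma tparams_tsub: "tparams (tsub \<kappa> t) = (\<Union>a\<in>tparams t. tparams (\<kappa> a))"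
  by (induction t) auto

lemma params_fsub: "params (fsub \<kappa> \<phi>) = (\<Union>a\<in>params \<phi>. tparams (\<kappa> a))"
  by (induction \<phi>) (auto simp: tparams_tsub)

lemma preds_fsub [simp]: "preds (fsub \<kappa> \<phi>) = preds \<phi>"
  by (induction \<phi>) auto

lemma map_tsub: "map_tm f (tsub \<kappa> t) = tsub (\<lambda>a. map_tm f (\<kappa> a)) t"
  by (induction t) auto

lemma map_fsub: "map_fm id f (fsub \<kappa> \<phi>) = fsub (\<lambda>a. map_tm f (\<kappa> a)) \<phi>"
  by (induction \<phi>) (auto simp: map_tsub)

lemma tsub_cong: "(\<And>a. a \<in> tparams t \<Longrightarrow> \<kappa> a = \<kappa>' a) \<Longrightarrow> tsub \<kappa> t = tsub \<kappa>' t"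
  by (induction t) auto

lemma fsub_cong: "(\<And>a. a \<in> params \<phi> \<Longrightarrow> \<kappa> a = \<kappa>' a) \<Longrightarrow> fsub \<kappa> \<phi> = fsub \<kappa>' \<phi>"
  by (induction \<phi>) (auto intro: tsub_cong)

subsection \<open>Ultrapowers\<close>

definition ultrafilter :: "'x filter \<Rightarrow> bool" where
  "ultrafilter U \<longleftrightarrow> U \<noteq> bot \<and> (\<forall>P. eventually P U \<or> eventually (\<lambda>x. \<not> P x) U)"

lemma ultrafilter_not: "ultrafilter U \<Longrightarrow> eventually (\<lambda>x. \<not> P x) U \<longleftrightarrow> \<not> eventually P U"
  unfolding ultrafilter_def using eventually_conj_iff[of P "\<lambda>x. \<not> P x" U] by (auto simp: trivial_limit_def)

lemma ultrafilter_ex: "ultrafilter U \<Longrightarrow> eventually P U \<Longrightarrow> \<exists>x. P x"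
  unfolding ultrafilter_def using eventually_happens by blast

text \<open>Zorn's lemma is applied to the systems of eventually true predicates, because passing to
  a finer filter enlarges them; the union of a chain of such systems belongs to the infimum of the
  filters.\<close>

lemma ultrafilter_exists:
  assumes "F \<noteq> bot"
  shows "\<exists>U. ultrafilter U \<and> U \<le> F"
proof -
  define A where "A = {{P. eventually P G} | G. G \<noteq> bot \<and> G \<le> F}"
  have "\<exists>m\<in>A. \<forall>Z\<in>A. m \<subseteq> Z \<longrightarrow> Z = m"
  proof (rule subset_Zorn_nonempty)
    show "A \<noteq> {}" using assms by (auto simp: A_def)
    fix C assume C: "C \<noteq> {}" "subset.chain A C"
    define Gs where "Gs = {G. G \<noteq> bot \<and> G \<le> F \<and> {P. eventually P G} \<in> C}"
    have C_eq: "C = (\<lambda>G. {P. eventually P G}) ` Gs"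
    proof
      show "C \<subseteq> (\<lambda>G. {P. eventually P G}) ` Gs"
      proof
        fix c assume c: "c \<in> C"
        then have "c \<in> A" using C(2) by (auto simp: subset.chain_def)
        then obtain G where "c = {P. eventually P G}" "G \<noteq> bot" "G \<le> F" by (auto simp: A_def)
        then show "c \<in> (\<lambda>G. {P. eventually P G}) ` Gs" using c by (auto simp: Gs_def)
      qed
    qed (auto simp: Gs_def)
    have ne: "Gs \<noteq> {}" using C(1) C_eq by auto
    have dir: "\<exists>x\<in>Gs. x \<le> inf G H" if "G \<in> Gs" "H \<in> Gs" for G H
    proof -
      have "{P. eventually P G} \<in> C" "{P. eventually P H} \<in> C" using that by (auto simp: Gs_def)
      then have "{P. eventually P G} \<subseteq> {P. eventually P H} \<or> {P. eventually P H} \<subseteq> {P. eventually P G}"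
        using C(2) by (auto simp: subset_chain_def)
      then have "H \<le> G \<or> G \<le> H" by (auto simp: le_filter_def)
      then show ?thesis using that by (metis inf.absorb1 inf.absorb2 order_refl)
    qed
    have ev: "eventually P (Inf Gs) \<longleftrightarrow> (\<exists>G\<in>Gs. eventually P G)" for P
      by (rule eventually_Inf_base[OF ne dir])
    have "\<Union>C = {P. eventually P (Inf Gs)}" by (auto simp: ev C_eq)
    moreover have "Inf Gs \<noteq> bot" unfolding trivial_limit_def ev by (auto simp: Gs_def trivial_limit_def)
    moreover have "Inf Gs \<le> F"
    proof -
      obtain G where "G \<in> Gs" using ne by auto
      then show ?thesis using Inf_lower[of G Gs] by (auto simp: Gs_def)
    qed
    ultimately show "\<Union>C \<in> A" by (auto simp: A_def)
  qed
  then obtain U where U: "U \<noteq> bot" "U \<le> F"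
    and max: "\<And>Z. Z \<in> A \<Longrightarrow> {P. eventually P U} \<subseteq> Z \<Longrightarrow> Z = {P. eventually P U}"
    by (auto simp: A_def)
  have "eventually P U \<or> eventually (\<lambda>x. \<not> P x) U" for P
  proof (rule disjCI)
    assume *: "\<not> eventually (\<lambda>x. \<not> P x) U"
    \<comment> \<open>Adjoining P keeps the filter proper because the complement of P is not in U;
      by maximality P was already there.\<close>
    let ?G = "inf U (principal {x. P x})"
    have "?G \<noteq> bot" using * by (simp add: trivial_limit_def eventually_inf_principal)
    moreover have "?G \<le> F" using U(2) by (simp add: le_infI1)
    ultimately have "{Q. eventually Q ?G} \<in> A" by (auto simp: A_def)
    moreover have "{Q. eventually Q U} \<subseteq> {Q. eventually Q ?G}"
      by (auto simp: eventually_inf_principal elim: eventually_mono)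
    ultimately have "{Q. eventually Q ?G} = {Q. eventually Q U}" by (rule max)
    moreover have "eventually P ?G" by (simp add: eventually_inf_principal)
    ultimately show "eventually P U" by blast
  qed
  then show ?thesis using U by (auto simp: ultrafilter_def)
qed

text \<open>The elements of an ultrapower are canonical representatives of the classes of functions modulo \<open>U\<close>.\<close>

definition urep :: "'x filter \<Rightarrow> 'a set \<Rightarrow> ('x \<Rightarrow> 'a) \<Rightarrow> 'x \<Rightarrow> 'a" where
  "urep U D f = (SOME g. (\<forall>x. g x \<in> D) \<and> eventually (\<lambda>x. f x = g x) U)"

definition ultrapower :: "'x filter \<Rightarrow> ('i, 'a) struct \<Rightarrow> ('i, 'x \<Rightarrow> 'a) struct" where
  "ultrapower U M =
    \<lparr> Dom = urep U (Dom M) ` {f. \<forall>x. f x \<in> Dom M},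
      zero_of = urep U (Dom M) (\<lambda>_. zero_of M),
      one_of = urep U (Dom M) (\<lambda>_. one_of M),
      add_of = (\<lambda>f g. urep U (Dom M) (\<lambda>x. add_of M (f x) (g x))),
      minus_of = (\<lambda>f. urep U (Dom M) (\<lambda>x. minus_of M (f x))),
      mul_of = (\<lambda>f g. urep U (Dom M) (\<lambda>x. mul_of M (f x) (g x))),
      pred_of = (\<lambda>i. {f \<in> urep U (Dom M) ` {f. \<forall>x. f x \<in> Dom M}. eventually (\<lambda>x. f x \<in> pred_of M i) U}) \<rparr>"

definition diag :: "'x filter \<Rightarrow> ('i, 'a) struct \<Rightarrow> 'a \<Rightarrow> 'x \<Rightarrow> 'a" where
  "diag U M a = urep U (Dom M) (\<lambda>_. a)"

lemma urep_works:
  assumes "\<And>x. f x \<in> D"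
  shows "urep U D f x \<in> D" "eventually (\<lambda>x. f x = urep U D f x) U"
proof -
  have "(\<forall>x. urep U D f x \<in> D) \<and> eventually (\<lambda>x. f x = urep U D f x) U"
    unfolding urep_def by (rule someI[of _ f]) (simp add: assms)
  then show "urep U D f x \<in> D" "eventually (\<lambda>x. f x = urep U D f x) U" by auto
qed

lemma urep_eqI:
  assumes "eventually (\<lambda>x. f x = g x) U"
  shows "urep U D f = urep U D g"
proof -
  have "eventually (\<lambda>x. f x = h x) U \<longleftrightarrow> eventually (\<lambda>x. g x = h x) U" for h
    using assms by (auto elim: eventually_elim2)
  then show ?thesis by (simp add: urep_def)
qed

context
  fixes U :: "'x filter" and M :: "('i, 'a) struct" and I :: "'i set"
  assumes U: "ultrafilter U" and M: "is_struct I M"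
begin

lemma Dom_ultrapower: "a \<in> Dom (ultrapower U M) \<Longrightarrow> a x \<in> Dom M"
  by (auto simp: ultrapower_def urep_works)

lemma urep_Dom: "(\<And>x. f x \<in> Dom M) \<Longrightarrow> urep U (Dom M) f \<in> Dom (ultrapower U M)"
  by (auto simp: ultrapower_def)

lemma urep_fix: "a \<in> Dom (ultrapower U M) \<Longrightarrow> urep U (Dom M) a = a"
proof -
  assume "a \<in> Dom (ultrapower U M)"
  then obtain f where f: "\<forall>x. f x \<in> Dom M" "a = urep U (Dom M) f" by (auto simp: ultrapower_def)
  have "eventually (\<lambda>x. a x = f x) U"
    using urep_works(2)[of f "Dom M" U] f by (auto elim: eventually_mono)
  then show ?thesis using urep_eqI[of a f U "Dom M"] f by simp
qed

lemma ultrapower_eq_iff: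
  "a \<in> Dom (ultrapower U M) \<Longrightarrow> b \<in> Dom (ultrapower U M) \<Longrightarrow> a = b \<longleftrightarrow> eventually (\<lambda>x. a x = b x) U"
  using urep_eqI[of a b U "Dom M"] by (auto simp: urep_fix)

lemma is_struct_ultrapower: "is_struct I (ultrapower U M)"
  unfolding is_struct_def
proof (intro conjI ballI)
  fix a b assume ab: "a \<in> Dom (ultrapower U M)" "b \<in> Dom (ultrapower U M)"
  have *: "add_of M (a x) (b x) \<in> Dom M" "mul_of M (a x) (b x) \<in> Dom M" for x
    using M Dom_ultrapower[OF ab(1)] Dom_ultrapower[OF ab(2)] by (auto simp: is_struct_def)
  show "add_of (ultrapower U M) a b \<in> Dom (ultrapower U M)"
    using urep_Dom[OF *(1)] by (simp add: ultrapower_def)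
  show "mul_of (ultrapower U M) a b \<in> Dom (ultrapower U M)"
    using urep_Dom[OF *(2)] by (simp add: ultrapower_def)
next
  fix a assume a: "a \<in> Dom (ultrapower U M)"
  have *: "minus_of M (a x) \<in> Dom M" for x
    using M Dom_ultrapower[OF a] by (auto simp: is_struct_def)
  show "minus_of (ultrapower U M) a \<in> Dom (ultrapower U M)"
    using urep_Dom[OF *] by (simp add: ultrapower_def)
next
  show "zero_of (ultrapower U M) \<in> Dom (ultrapower U M)" "one_of (ultrapower U M) \<in> Dom (ultrapower U M)"
    using M by (auto simp: ultrapower_def is_struct_def)
qed (auto simp: ultrapower_def)

lemma val_ultrapower:
  assumes e: "e \<in> assignments (ultrapower U M)"
  shows "tparams t \<subseteq> Dom (ultrapower U M) \<Longrightarrow>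
    eventually (\<lambda>x. val (ultrapower U M) e t x = val M (\<lambda>v. e v x) (map_tm (\<lambda>a. a x) t)) U"
proof (induction t)
  case TZero
  show ?case using urep_works(2)[of "\<lambda>_. zero_of M" "Dom M" U] M
    by (auto simp: ultrapower_def is_struct_def elim: eventually_mono)
next
  case TOne
  show ?case using urep_works(2)[of "\<lambda>_. one_of M" "Dom M" U] M
    by (auto simp: ultrapower_def is_struct_def elim: eventually_mono)
next
  case (TAdd s t)
  let ?s = "val (ultrapower U M) e s" and ?t = "val (ultrapower U M) e t"
  have st: "?s \<in> Dom (ultrapower U M)" "?t \<in> Dom (ultrapower U M)"
    using TAdd.prems e by (auto intro!: val_in_Dom[OF is_struct_ultrapower])
  have "add_of M (?s x) (?t x) \<in> Dom M" for x
    using M Dom_ultrapower[OF st(1)] Dom_ultrapower[OF st(2)] by (auto simp: is_struct_def)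
  then have "eventually (\<lambda>x. add_of M (?s x) (?t x) = urep U (Dom M) (\<lambda>x. add_of M (?s x) (?t x)) x) U"
    by (rule urep_works(2))
  moreover have "eventually (\<lambda>x. ?s x = val M (\<lambda>v. e v x) (map_tm (\<lambda>a. a x) s)) U"
    "eventually (\<lambda>x. ?t x = val M (\<lambda>v. e v x) (map_tm (\<lambda>a. a x) t)) U"
    using TAdd by auto
  ultimately show ?case by eventually_elim (simp add: ultrapower_def)
next
  case (TMul s t)
  let ?s = "val (ultrapower U M) e s" and ?t = "val (ultrapower U M) e t"
  have st: "?s \<in> Dom (ultrapower U M)" "?t \<in> Dom (ultrapower U M)"
    using TMul.prems e by (auto intro!: val_in_Dom[OF is_struct_ultrapower])
  have "mul_of M (?s x) (?t x) \<in> Dom M" for x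
    using M Dom_ultrapower[OF st(1)] Dom_ultrapower[OF st(2)] by (auto simp: is_struct_def)
  then have "eventually (\<lambda>x. mul_of M (?s x) (?t x) = urep U (Dom M) (\<lambda>x. mul_of M (?s x) (?t x)) x) U"
    by (rule urep_works(2))
  moreover have "eventually (\<lambda>x. ?s x = val M (\<lambda>v. e v x) (map_tm (\<lambda>a. a x) s)) U"
    "eventually (\<lambda>x. ?t x = val M (\<lambda>v. e v x) (map_tm (\<lambda>a. a x) t)) U"
    using TMul by auto
  ultimately show ?case by eventually_elim (simp add: ultrapower_def)
next
  case (TMinus t)
  let ?t = "val (ultrapower U M) e t"
  have t: "?t \<in> Dom (ultrapower U M)"
    using TMinus.prems e by (auto intro!: val_in_Dom[OF is_struct_ultrapower])
  have "minus_of M (?t x) \<in> Dom M" for x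
    using M Dom_ultrapower[OF t] by (auto simp: is_struct_def)
  then have "eventually (\<lambda>x. minus_of M (?t x) = urep U (Dom M) (\<lambda>x. minus_of M (?t x)) x) U"
    by (rule urep_works(2))
  moreover have "eventually (\<lambda>x. ?t x = val M (\<lambda>v. e v x) (map_tm (\<lambda>a. a x) t)) U"
    using TMinus by auto
  ultimately show ?case by eventually_elim (simp add: ultrapower_def)
qed auto

theorem los:
  assumes "e \<in> assignments (ultrapower U M)" "\<phi> \<in> fms I (Dom (ultrapower U M))"
  shows "sat (ultrapower U M) e \<phi> \<longleftrightarrow> eventually (\<lambda>x. sat M (\<lambda>v. e v x) (map_fm id (\<lambda>a. a x) \<phi>)) U"
  using assms
proof (induction \<phi> arbitrary: e)
  case (FEq s t)
  let ?s = "val (ultrapower U M) e s" and ?t = "val (ultrapower U M) e t"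
  have st: "?s \<in> Dom (ultrapower U M)" "?t \<in> Dom (ultrapower U M)"
    using FEq.prems by (auto intro!: val_in_Dom[OF is_struct_ultrapower])
  have "eventually (\<lambda>x. ?s x = val M (\<lambda>v. e v x) (map_tm (\<lambda>a. a x) s)) U"
    "eventually (\<lambda>x. ?t x = val M (\<lambda>v. e v x) (map_tm (\<lambda>a. a x) t)) U"
    using FEq.prems by (auto intro!: val_ultrapower)
  then have "eventually (\<lambda>x. ?s x = ?t x \<longleftrightarrow>
      val M (\<lambda>v. e v x) (map_tm (\<lambda>a. a x) s) = val M (\<lambda>v. e v x) (map_tm (\<lambda>a. a x) t)) U"
    by eventually_elim simp
  then show ?case unfolding sat.simps fm.map ultrapower_eq_iff[OF st]
    by (rule eventually_cong)
next
  case (FPred i t)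
  let ?t = "val (ultrapower U M) e t"
  have t: "?t \<in> Dom (ultrapower U M)"
    using FPred.prems by (auto intro!: val_in_Dom[OF is_struct_ultrapower])
  have "eventually (\<lambda>x. ?t x = val M (\<lambda>v. e v x) (map_tm (\<lambda>a. a x) t)) U"
    using FPred.prems by (auto intro!: val_ultrapower)
  then have "eventually (\<lambda>x. ?t x \<in> pred_of M i \<longleftrightarrow>
      val M (\<lambda>v. e v x) (map_tm (\<lambda>a. a x) t) \<in> pred_of M i) U"
    by eventually_elim simp
  then have "eventually (\<lambda>x. ?t x \<in> pred_of M i) U \<longleftrightarrow>
      eventually (\<lambda>x. val M (\<lambda>v. e v x) (map_tm (\<lambda>a. a x) t) \<in> pred_of M i) U"
    by (rule eventually_cong)
  moreover have "?t \<in> pred_of (ultrapower U M) i \<longleftrightarrow> eventually (\<lambda>x. ?t x \<in> pred_of M i) U"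
    using t unfolding ultrapower_def by simp
  ultimately show ?case by simp
next
  case (FNot p)
  then show ?case using ultrafilter_not[OF U] by simp
next
  case (FAnd p q)
  then show ?case by (simp add: eventually_conj_iff)
next
  case (FEx v p)
  let ?V = "ultrapower U M"
  let ?S = "\<lambda>x b. sat M ((\<lambda>w. e w x)(v := b)) (map_fm id (\<lambda>a. a x) p)"
  have IH: "sat ?V (e(v := a)) p \<longleftrightarrow> eventually (\<lambda>x. ?S x (a x)) U" if "a \<in> Dom ?V" for a
  proof -
    have "(\<lambda>w. (e(v := a)) w x) = (\<lambda>w. e w x)(v := a x)" for x by auto
    moreover have "sat ?V (e(v := a)) p \<longleftrightarrow>
        eventually (\<lambda>x. sat M (\<lambda>w. (e(v := a)) w x) (map_fm id (\<lambda>a. a x) p)) U"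
      using FEx.prems that by (intro FEx.IH[of "e(v := a)"] assignments_upd) auto
    ultimately show ?thesis by presburger
  qed
  have "(\<exists>a\<in>Dom ?V. eventually (\<lambda>x. ?S x (a x)) U) \<longleftrightarrow> eventually (\<lambda>x. \<exists>b\<in>Dom M. ?S x b) U"
  proof
    assume "\<exists>a\<in>Dom ?V. eventually (\<lambda>x. ?S x (a x)) U"
    then obtain a where a: "a \<in> Dom ?V" "eventually (\<lambda>x. ?S x (a x)) U" by blast
    from a(2) show "eventually (\<lambda>x. \<exists>b\<in>Dom M. ?S x b) U"
      by (rule eventually_mono) (use Dom_ultrapower[OF a(1)] in blast)
  next
    assume ev: "eventually (\<lambda>x. \<exists>b\<in>Dom M. ?S x b) U"
    obtain z where z: "z \<in> Dom M" using zero_in_Dom[OF M] by auto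
    define f where "f x = (if \<exists>b\<in>Dom M. ?S x b then SOME b. b \<in> Dom M \<and> ?S x b else z)" for x
    have f: "f x \<in> Dom M \<and> ((\<exists>b\<in>Dom M. ?S x b) \<longrightarrow> ?S x (f x))" for x
    proof (cases "\<exists>b\<in>Dom M. ?S x b")
      case True
      then have "\<exists>b. b \<in> Dom M \<and> ?S x b" by blast
      from someI_ex[OF this] True show ?thesis unfolding f_def by presburger
    next
      case False
      then show ?thesis using z unfolding f_def by presburger
    qed
    have "eventually (\<lambda>x. ?S x (f x)) U" using ev by (rule eventually_mono) (use f in blast)
    moreover have "eventually (\<lambda>x. f x = urep U (Dom M) f x) U" by (rule urep_works(2)) (use f in blast)
    ultimately have "eventually (\<lambda>x. ?S x (urep U (Dom M) f x)) U"
      by (rule eventually_elim2) (erule subst)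
    moreover have "urep U (Dom M) f \<in> Dom ?V" using f by (intro urep_Dom) blast
    ultimately show "\<exists>a\<in>Dom ?V. eventually (\<lambda>x. ?S x (a x)) U" by blast
  qed
  then show ?case unfolding fm.map sat.simps using IH by blast
qed

lemma diag_Dom: "a \<in> Dom M \<Longrightarrow> diag U M a \<in> Dom (ultrapower U M)"
  unfolding diag_def by (rule urep_Dom)

lemma diag_ev: "a \<in> Dom M \<Longrightarrow> eventually (\<lambda>x. diag U M a x = a) U"
  using urep_works(2)[of "\<lambda>_. a" "Dom M" U] by (auto simp: diag_def elim: eventually_mono)

lemma eventually_map_fm_cong:
  assumes "\<And>a. a \<in> params \<phi> \<Longrightarrow> eventually (\<lambda>x. f a x = g a x) U"
  shows "eventually (\<lambda>x. map_fm id (\<lambda>a. f a x) \<phi> = map_fm id (\<lambda>a. g a x) \<phi>) U"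
proof -
  have "eventually (\<lambda>x. \<forall>a\<in>params \<phi>. f a x = g a x) U"
    using assms by (simp add: eventually_ball_finite)
  then show ?thesis by eventually_elim (rule map_fm_cong_params, blast)
qed

lemma diag_sat:
  assumes "e \<in> assignments M" "\<phi> \<in> fms I (Dom M)"
  shows "sat (ultrapower U M) (\<lambda>v. diag U M (e v)) (map_fm id (diag U M) \<phi>) \<longleftrightarrow> sat M e \<phi>"
proof -
  have 1: "(\<lambda>v. diag U M (e v)) \<in> assignments (ultrapower U M)"
    using assms by (intro assignmentsI diag_Dom) auto
  have 2: "map_fm id (diag U M) \<phi> \<in> fms I (Dom (ultrapower U M))"
    using assms(2) by (rule map_fm_fms) (auto intro: diag_Dom)
  have "eventually (\<lambda>x. map_fm id (\<lambda>a. diag U M a x) \<phi> = map_fm id (\<lambda>a. a) \<phi>) U"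
    using assms(2) by (intro eventually_map_fm_cong diag_ev) (auto simp: fms_def)
  moreover have "eventually (\<lambda>x. \<forall>v\<in>fvars \<phi>. diag U M (e v) x = e v) U"
    using assms(1) by (intro eventually_ball_finite) (auto intro: diag_ev)
  ultimately have "eventually (\<lambda>x. sat M (\<lambda>v. diag U M (e v) x) (map_fm id (\<lambda>a. diag U M a x) \<phi>) \<longleftrightarrow> sat M e \<phi>) U"
  proof eventually_elim
    case (elim x)
    have "map_fm id (\<lambda>a. a) \<phi> = \<phi>" by (rule map_fm_ident) simp
    then show ?case using elim sat_cong[of \<phi> "\<lambda>v. diag U M (e v) x" e M] by simp
  qed
  then have "eventually (\<lambda>x. sat M (\<lambda>v. diag U M (e v) x) (map_fm id (\<lambda>a. diag U M a x) \<phi>)) U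
      \<longleftrightarrow> eventually (\<lambda>x. sat M e \<phi>) U" by (rule eventually_cong)
  also have "\<dots> \<longleftrightarrow> sat M e \<phi>" using U by (auto simp: ultrafilter_def eventually_const_iff)
  finally show ?thesis unfolding los[OF 1 2] map_fm_comp .
qed

lemma diag_elem: "elem I M (ultrapower U M) (Dom M) (diag U M)"
  unfolding elem_def
proof (intro conjI ballI)
  show "diag U M ` Dom M \<subseteq> Dom (ultrapower U M)" by (auto intro: diag_Dom)
  fix \<phi> assume \<phi>: "\<phi> \<in> formulas I (Dom M) 0"
  obtain e where e: "e \<in> assignments M" using assignments_nonempty[OF M] by auto
  show "holds M \<phi> \<longleftrightarrow> holds (ultrapower U M) (map_fm id (diag U M) \<phi>)"
    using diag_sat[OF e, of \<phi>] \<phi> holds_sentence[OF M, of \<phi> e]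
      holds_sentence[OF is_struct_ultrapower, of "map_fm id (diag U M) \<phi>" "\<lambda>v. diag U M (e v)"]
    by (simp add: formulas_fms)
qed

end

text \<open>\<open>\<aleph>\<^sub>1\<close>-saturation, for types in all variables at once.\<close>

definition saturated :: "'i set \<Rightarrow> ('i, 'a) struct \<Rightarrow> bool" where
  "saturated I M \<longleftrightarrow> (\<forall>\<Sigma>. countable \<Sigma> \<and> \<Sigma> \<subseteq> fms I (Dom M) \<and> fin_sat M \<Sigma> \<longrightarrow>
     (\<exists>e\<in>assignments M. \<forall>\<phi>\<in>\<Sigma>. sat M e \<phi>))"

text \<open>Diagonalisation: coordinate x follows the partial realisation \<open>ek k\<close> for
  the largest k that works there, so each single formula is respected in almost all
  coordinates.\<close>

lemma saturated_ultrapower: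
  fixes U :: "nat filter"
  assumes U: "ultrafilter U" "U \<le> sequentially" and M: "is_struct I M"
  shows "saturated I (ultrapower U M)"
  unfolding saturated_def
proof (intro allI impI)
  let ?V = "ultrapower U M"
  fix \<Sigma> assume \<Sigma>: "countable \<Sigma> \<and> \<Sigma> \<subseteq> fms I (Dom ?V) \<and> fin_sat ?V \<Sigma>"
  obtain e0 where e0: "e0 \<in> assignments ?V"
    using assignments_nonempty[OF is_struct_ultrapower[OF U(1) M]] by auto
  show "\<exists>e\<in>assignments ?V. \<forall>\<phi>\<in>\<Sigma>. sat ?V e \<phi>"
  proof (cases "\<Sigma> = {}")
    case True
    then show ?thesis using e0 by auto
  next
    case False
    define \<sigma> where "\<sigma> = from_nat_into \<Sigma>"
    have \<sigma>: "\<Sigma> = range \<sigma>" using False \<Sigma> by (simp add: \<sigma>_def)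
    have \<sigma>_fms: "\<sigma> l \<in> fms I (Dom ?V)" for l using \<Sigma> \<sigma> by blast
    have "\<exists>e\<in>assignments ?V. \<forall>l\<le>k. sat ?V e (\<sigma> l)" for k
    proof -
      have "finite (\<sigma> ` {..k})" "\<sigma> ` {..k} \<subseteq> \<Sigma>" using \<sigma> by auto
      then show ?thesis using \<Sigma> unfolding fin_sat_def by (metis atMost_iff imageI)
    qed
    then obtain ek where ek: "\<And>k. ek k \<in> assignments ?V" "\<And>k l. l \<le> k \<Longrightarrow> sat ?V (ek k) (\<sigma> l)"
      by metis
    let ?S = "\<lambda>x e l. sat M e (map_fm id (\<lambda>a. a x) (\<sigma> l))"
    \<comment> \<open>The bound k <= x leaves finitely many admissible k at each x, so that a
      largest one exists; the bound holds almost everywhere because U refines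
      \<open>sequentially\<close>.\<close>
    define Z where "Z k x \<longleftrightarrow> k \<le> x \<and> (\<forall>l\<le>k. ?S x (\<lambda>v. ek k v x) l)" for k x
    have Z: "eventually (Z k) U" for k
    proof -
      have "eventually (\<lambda>x. k \<le> x) U" using U(2) eventually_ge_at_top[of k] by (auto simp: le_filter_def)
      moreover have "eventually (\<lambda>x. \<forall>l\<in>{..k}. ?S x (\<lambda>v. ek k v x) l) U"
        using ek \<sigma>_fms los[OF U(1) M] by (intro eventually_ball_finite) auto
      ultimately show ?thesis unfolding Z_def by eventually_elim auto
    qed
    define K where "K x = (if \<exists>k. Z k x then Max {k. Z k x} else 0)" for x
    have fin: "finite {k. Z k x}" for x
      by (rule finite_subset[of _ "{..x}"]) (auto simp: Z_def)
    have K: "Z (K x) x \<and> k \<le> K x" if "Z k x" for k x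
      using Max_in[OF fin[of x]] Max_ge[OF fin[of x], of k] that by (auto simp: K_def)
    define e where "e v = urep U (Dom M) (\<lambda>x. ek (K x) v x)" for v
    have dom: "ek k v x \<in> Dom M" for k v x using ek(1) Dom_ultrapower[OF U(1) M] by (metis assignmentsD)
    have e: "e \<in> assignments ?V" unfolding e_def by (intro assignmentsI urep_Dom[OF U(1) M] dom)
    have "sat ?V e (\<sigma> l)" for l
    proof -
      have "eventually (\<lambda>x. \<forall>v\<in>fvars (\<sigma> l). ek (K x) v x = e v x) U"
        unfolding e_def using dom by (intro eventually_ball_finite ballI urep_works(2)) auto
      with Z[of l] have "eventually (\<lambda>x. ?S x (\<lambda>v. e v x) l) U"
      proof eventually_elim
        case (elim x)
        have "?S x (\<lambda>v. ek (K x) v x) l" using K[OF elim(1)] by (auto simp: Z_def)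
        then show ?case using elim(2) by (subst sat_cong[where e' = "\<lambda>v. ek (K x) v x"]) auto
      qed
      then show ?thesis using los[OF U(1) M e \<sigma>_fms] by blast
    qed
    then show ?thesis using e \<sigma> by auto
  qed
qed

section \<open>Countable languages and extension of elementary maps\<close>

instance tm :: (countable) countable
  by countable_datatype

instance fm :: (countable, countable) countable
  by countable_datatype

lemma countable_fms:
  assumes "countable I" "countable A"
  shows "countable (fms I A :: ('i, 'a) fm set)"
proof -
  let ?f = "map_fm (from_nat_into I) (from_nat_into A)" and ?g = "map_fm (to_nat_on I) (to_nat_on A)"
  have "\<phi> = ?f (?g \<phi>)" if "\<phi> \<in> fms I A" for \<phi>
  proof -
    have "?f (?g \<phi>) = map_fm id id \<phi>"
      unfolding fm.map_comp using that assms by (intro fm.map_cong) (auto simp: fms_def)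
    then show ?thesis by (simp add: fm.map_id0)
  qed
  then have "fms I A \<subseteq> range ?f" by blast
  then show ?thesis by (rule countable_subset) simp
qed

text \<open>The elements of \<open>C\<close> outside \<open>C0\<close> become variables. The
  sentences true of them, with \<open>C0\<close> replaced by its image under \<open>h\<close>, form
  a countable finitely satisfiable set, and a realisation of this set provides the missing
  values.\<close>

lemma countable_extend_elem:
  fixes N :: "('i, 'b) struct" and M :: "('i, 'a) struct"
  assumes sat: "saturated I M" and I: "countable I" and M: "is_struct I M" and N: "is_struct I N"
    and C: "countable C" "C \<subseteq> Dom N" "C0 \<subseteq> C" and h: "elem I N M C0 h"
  shows "\<exists>h'. elem I N M C h' \<and> (\<forall>c\<in>C0. h' c = h c)"
proof -
  define ix where "ix = to_nat_on C"
  have ix: "from_nat_into C (ix c) = c" if "c \<in> C" for c using that C(1) by (simp add: ix_def)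
  define \<kappa> where "\<kappa> c = (if c \<in> C0 then Cst (h c) else Var (2 * ix c + 1))" for c
  \<comment> \<open>The counterpart of \<open>\<kappa>\<close> inside N: it abstracts the new
    elements but keeps the old ones, so that applying \<open>h\<close> to it yields
    \<open>\<kappa>\<close>.\<close>
  define \<kappa>0 where "\<kappa>0 c = (if c \<in> C0 then Cst c else Var (2 * ix c + 1))" for c
  have odd: "\<forall>v\<in>tvars (\<kappa> a). odd v" "\<forall>v\<in>tvars (\<kappa>0 a). odd v" for a
    by (auto simp: \<kappa>_def \<kappa>0_def)
  define \<Theta> where "\<Theta> = {\<theta> \<in> formulas I C 0. holds N \<theta>}"
  define \<Sigma> where "\<Sigma> = fsub \<kappa> ` \<Theta>"
  have h_Dom: "h c \<in> Dom M" if "c \<in> C0" for c using h that by (auto simp: elem_def)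
  have "countable \<Theta>"
    by (rule countable_subset[OF _ countable_fms[OF I C(1)]]) (auto simp: \<Theta>_def formulas_fms)
  then have "countable \<Sigma>" by (simp add: \<Sigma>_def)
  moreover have "\<Sigma> \<subseteq> fms I (Dom M)"
  proof
    fix \<sigma> assume "\<sigma> \<in> \<Sigma>"
    then obtain \<theta> where "\<theta> \<in> formulas I C 0" "\<sigma> = fsub \<kappa> \<theta>" by (auto simp: \<Sigma>_def \<Theta>_def)
    then show "\<sigma> \<in> fms I (Dom M)"
      using h_Dom by (auto simp: fms_def formulas_def params_fsub \<kappa>_def split: if_splits)
  qed
  moreover have "fin_sat M \<Sigma>"
    unfolding fin_sat_def
  proof (intro allI impI)
    fix q assume "finite q \<and> q \<subseteq> \<Sigma>"
    then obtain \<Theta>' where \<Theta>': "finite \<Theta>'" "\<Theta>' \<subseteq> \<Theta>" "q = fsub \<kappa> ` \<Theta>'"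
      using finite_subset_image unfolding \<Sigma>_def by metis
    obtain \<theta>s where \<theta>s: "set \<theta>s = \<Theta>'" using finite_list[OF \<Theta>'(1)] by auto
    let ?\<theta> = "FConj \<theta>s"
    have fms: "?\<theta> \<in> fms I C" using \<Theta>'(2) \<theta>s by (auto simp: \<Theta>_def formulas_fms)
    obtain z where z: "z \<in> Dom N" using zero_in_Dom[OF N] by auto
    \<comment> \<open>The variable \<open>2 * ix c + 1\<close> has to receive \<open>c\<close>;
      halving recovers the index.\<close>
    define e0 where "e0 n = (if n div 2 \<in> ix ` C then from_nat_into C (n div 2) else z)" for n
    have e0: "e0 \<in> assignments N" using C(2) z ix by (intro assignmentsI) (auto simp: e0_def)
    have val_e0: "val N e0 (\<kappa>0 c) = c" if "c \<in> C" for c using ix that by (simp add: \<kappa>0_def e0_def)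
    have "(\<lambda>v. e0 (2 * v)) \<in> assignments N" using e0 by (intro assignmentsI) simp
    then have "sat N (\<lambda>v. e0 (2 * v)) ?\<theta>"
      using \<Theta>'(2) \<theta>s unfolding sat_FConj \<Theta>_def holds_def by blast
    moreover have "map_fm id (\<lambda>a. val N e0 (\<kappa>0 a)) ?\<theta> = ?\<theta>"
      using fms by (intro map_fm_ident val_e0) (auto simp: fms_def)
    ultimately have sat0: "sat N e0 (fsub \<kappa>0 ?\<theta>)" by (simp only: sat_fsub[OF odd(2)])
    have "fsub \<kappa>0 ?\<theta> \<in> fms I C0"
      using fms by (auto simp: fms_def params_fsub \<kappa>0_def split: if_splits)
    then have "\<exists>e\<in>assignments M. sat M e (map_fm id h (fsub \<kappa>0 ?\<theta>))"
      using elem_ex[OF h N M] e0 sat0 by blast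
    moreover have "map_fm id h (fsub \<kappa>0 ?\<theta>) = fsub \<kappa> ?\<theta>"
      unfolding map_fsub by (intro fsub_cong) (simp add: \<kappa>_def \<kappa>0_def)
    ultimately obtain e where e: "e \<in> assignments M" "sat M e (fsub \<kappa> ?\<theta>)" by auto
    have "sat M e (fsub \<kappa> \<theta>)" if "\<theta> \<in> set \<theta>s" for \<theta>
      using e(2) that unfolding sat_fsub[OF odd(1)] map_FConj sat_FConj by simp
    then show "\<exists>e\<in>assignments M. \<forall>\<phi>\<in>q. sat M e \<phi>" using e(1) \<Theta>'(3) \<theta>s by auto
  qed
  ultimately have "\<exists>e\<in>assignments M. \<forall>\<phi>\<in>\<Sigma>. sat M e \<phi>"
    using sat unfolding saturated_def by (elim allE[of _ \<Sigma>]) simp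
  then obtain e where e: "e \<in> assignments M" "\<And>\<theta>. \<theta> \<in> \<Theta> \<Longrightarrow> sat M e (fsub \<kappa> \<theta>)"
    unfolding \<Sigma>_def by auto
  define h' where "h' c = val M e (\<kappa> c)" for c
  have 1: "holds M (map_fm id h' \<theta>)" if "\<theta> \<in> \<Theta>" for \<theta>
  proof -
    have "sat M (\<lambda>v. e (2 * v)) (map_fm id h' \<theta>)"
      using e(2)[OF that] unfolding sat_fsub[OF odd(1)] h'_def .
    then show ?thesis using holds_sentence[OF M, of "map_fm id h' \<theta>"] that
      by (auto simp: \<Theta>_def dest: sentence_fvars)
  qed
  have "holds N \<theta> \<longleftrightarrow> holds M (map_fm id h' \<theta>)" if \<theta>: "\<theta> \<in> formulas I C 0" for \<theta>
  proof
    assume "holds N \<theta>"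
    then show "holds M (map_fm id h' \<theta>)" using 1[of \<theta>] \<theta> by (auto simp: \<Theta>_def)
  next
    assume *: "holds M (map_fm id h' \<theta>)"
    show "holds N \<theta>"
    proof (rule ccontr)
      assume "\<not> holds N \<theta>"
      then have "holds N (FNot \<theta>)"
        using holds_sentence[OF N, of \<theta>] holds_sentence[OF N, of "FNot \<theta>"] \<theta> by (auto dest: sentence_fvars)
      then have "holds M (FNot (map_fm id h' \<theta>))" using 1[of "FNot \<theta>"] \<theta> by (auto simp: \<Theta>_def)
      then show False using * assignments_nonempty[OF M] by (auto simp: holds_def)
    qed
  qed
  moreover have "h' ` C \<subseteq> Dom M" using e(1) h_Dom by (auto simp: h'_def \<kappa>_def)
  moreover have "\<forall>c\<in>C0. h' c = h c" by (simp add: h'_def \<kappa>_def)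
  ultimately show ?thesis by (auto simp: elem_def)
qed

subsection \<open>Terms as polynomials\<close>

text \<open>Polynomials are lists of terms, not of field elements, so that a map of the constants
  carries a whole polynomial computation along. The lists are not normalised and may end in terms
  that denote zero.\<close>

primrec tpadd :: "'a tm list \<Rightarrow> 'a tm list \<Rightarrow> 'a tm list" where
  "tpadd [] q = q"
| "tpadd (a # p) q = (case q of [] \<Rightarrow> a # p | b # q' \<Rightarrow> TAdd a b # tpadd p q')"

primrec tpmul :: "'a tm list \<Rightarrow> 'a tm list \<Rightarrow> 'a tm list" where
  "tpmul [] q = []"
| "tpmul (a # p) q = tpadd (map (TMul a) q) (TZero # tpmul p q)"

text \<open>The coefficients of a term, read as a polynomial in the variables identified with each other.\<close>

primrec tpoly :: "'a tm \<Rightarrow> 'a tm list" where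
  "tpoly (Var v) = [TZero, TOne]"
| "tpoly (Cst a) = [Cst a]"
| "tpoly TZero = []"
| "tpoly TOne = [TOne]"
| "tpoly (TAdd s t) = tpadd (tpoly s) (tpoly t)"
| "tpoly (TMinus t) = map TMinus (tpoly t)"
| "tpoly (TMul s t) = tpmul (tpoly s) (tpoly t)"

definition cterms :: "'a set \<Rightarrow> 'a tm set" where
  "cterms S = {t. tparams t \<subseteq> S \<and> tvars t = {}}"

lemma cterms_simps [simp]:
  "Cst a \<in> cterms S \<longleftrightarrow> a \<in> S" "TZero \<in> cterms S" "TOne \<in> cterms S"
  "TAdd s t \<in> cterms S \<longleftrightarrow> s \<in> cterms S \<and> t \<in> cterms S"
  "TMul s t \<in> cterms S \<longleftrightarrow> s \<in> cterms S \<and> t \<in> cterms S"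
  "TMinus t \<in> cterms S \<longleftrightarrow> t \<in> cterms S"
  "Var v \<notin> cterms S"
  by (auto simp: cterms_def)

lemma cterms_mono: "S \<subseteq> T \<Longrightarrow> cterms S \<subseteq> cterms T"
  by (auto simp: cterms_def)

lemma tpadd_cterms: "set p \<subseteq> cterms S \<Longrightarrow> set q \<subseteq> cterms S \<Longrightarrow> set (tpadd p q) \<subseteq> cterms S"
proof (induction p arbitrary: q)
  case (Cons a p)
  show ?case
  proof (cases q)
    case (Cons b q')
    then have "set (tpadd p q') \<subseteq> cterms S" using Cons.prems \<open>set (a # p) \<subseteq> _\<close> by (intro Cons.IH) auto
    then show ?thesis using Cons.prems Cons by auto
  qed (use Cons.prems in simp)
qed simp

lemma tpmul_cterms: "set p \<subseteq> cterms S \<Longrightarrow> set q \<subseteq> cterms S \<Longrightarrow> set (tpmul p q) \<subseteq> cterms S"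
proof (induction p)
  case (Cons a p)
  have "set (tpadd (map (TMul a) q) (TZero # tpmul p q)) \<subseteq> cterms S"
    using Cons by (intro tpadd_cterms) auto
  then show ?case by simp
qed simp

lemma tpoly_cterms: "tparams t \<subseteq> S \<Longrightarrow> set (tpoly t) \<subseteq> cterms S"
proof (induction t)
  case (TAdd s t)
  then show ?case unfolding tpoly.simps by (intro tpadd_cterms) auto
next
  case (TMul s t)
  then show ?case unfolding tpoly.simps by (intro tpmul_cterms) auto
qed auto

lemma map_tpadd: "map (map_tm f) (tpadd p q) = tpadd (map (map_tm f) p) (map (map_tm f) q)"
  by (induction p arbitrary: q) (auto split: list.splits)

lemma map_tpmul: "map (map_tm f) (tpmul p q) = tpmul (map (map_tm f) p) (map (map_tm f) q)"
  by (induction p) (auto simp: map_tpadd comp_def)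

lemma map_tpoly: "map (map_tm f) (tpoly t) = tpoly (map_tm f t)"
proof (induction t)
  case (TMinus t)
  have "map (map_tm f) (map TMinus (tpoly t)) = map TMinus (map (map_tm f) (tpoly t))" by simp
  then show ?case unfolding tm.map tpoly.simps TMinus .
qed (auto simp: map_tpadd map_tpmul)

primrec ptm :: "'a tm list \<Rightarrow> 'a tm" where
  "ptm [] = TZero"
| "ptm (c # cs) = TAdd c (TMul (Var 0) (ptm cs))"

lemma tparams_ptm: "tparams (ptm cs) = (\<Union>c\<in>set cs. tparams c)"
  by (induction cs) auto

subsection \<open>Algebraic closure inside an algebraically closed field\<close>

definition ring_of :: "('i, 'a) struct \<Rightarrow> 'a ring" where
  "ring_of M = \<lparr> carrier = Dom M, monoid.mult = mul_of M, one = one_of M,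
     zero = zero_of M, add = add_of M \<rparr>"

text \<open>A ring record derives negation from addition, so \<open>ring_of\<close> says nothing
  about \<open>minus_of\<close>; hence the two separate conditions on it. In
  \<open>root_exists\<close>, \<open>cs\<close> lists the lower coefficients of a monic polynomial
  of positive degree.\<close>

locale acf = field R for R :: "'a ring" (structure) +
  fixes M :: "('i, 'a) struct"
  assumes R_eq: "R = ring_of M"
    and minus_closed: "a \<in> carrier R \<Longrightarrow> minus_of M a \<in> carrier R"
    and add_minus: "a \<in> carrier R \<Longrightarrow> a \<oplus> minus_of M a = \<zero>"
    and root_exists: "set cs \<subseteq> carrier R \<Longrightarrow> cs \<noteq> [] \<Longrightarrow> \<exists>x\<in>carrier R. eval (\<one> # cs) x = \<zero>"
begin

lemma Dom_R [simp]: "Dom M = carrier R"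
  and zero_R [simp]: "zero_of M = \<zero>"
  and one_R [simp]: "one_of M = \<one>"
  and add_R [simp]: "add_of M a b = a \<oplus> b"
  and mul_R [simp]: "mul_of M a b = a \<otimes> b"
  by (simp_all add: R_eq ring_of_def)

lemma minus_R [simp]: "a \<in> carrier R \<Longrightarrow> minus_of M a = \<ominus> a"
  using add_minus[of a] minus_closed[of a] by (metis add.m_comm minus_equality)

lemma val_closed:
  "tparams t \<subseteq> carrier R \<Longrightarrow> (\<And>v. v \<in> tvars t \<Longrightarrow> e v \<in> carrier R) \<Longrightarrow> val M e t \<in> carrier R"
  by (induction t) auto

definition root_closed :: "'a set \<Rightarrow> bool" where
  "root_closed K \<longleftrightarrow> (\<forall>cs. set cs \<subseteq> K \<longrightarrow> cs \<noteq> [] \<longrightarrow> (\<exists>x\<in>K. eval (\<one> # cs) x = \<zero>))"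

text \<open>Evaluation of the polynomial with coefficient list \<open>cs\<close>, constant coefficient first.\<close>

primrec heval :: "'a list \<Rightarrow> 'a \<Rightarrow> 'a" where
  "heval [] x = \<zero>"
| "heval (c # cs) x = c \<oplus> x \<otimes> heval cs x"

lemma heval_closed [simp]: "set cs \<subseteq> carrier R \<Longrightarrow> x \<in> carrier R \<Longrightarrow> heval cs x \<in> carrier R"
  by (induction cs) auto

lemma heval_eval: "set cs \<subseteq> carrier R \<Longrightarrow> x \<in> carrier R \<Longrightarrow> heval cs x = eval (rev cs) x"
proof (induction cs)
  case (Cons c cs)
  then have "eval (rev cs @ [c]) x = eval (rev cs) x \<otimes> x \<oplus> c"
    by (intro eval_append_aux) auto
  then show ?case using Cons eval_in_carrier[of "rev cs" x] by (simp add: m_comm add.m_comm)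
qed simp

lemma normalize_eq_Nil: "normalize p = [] \<longleftrightarrow> set p \<subseteq> {\<zero>}"
  by (induction p) auto

lemma infinite_zeros:
  assumes "set cs \<subseteq> carrier R" "infinite {x \<in> carrier R. heval cs x = \<zero>}"
  shows "set cs \<subseteq> {\<zero>}"
proof (rule ccontr)
  assume *: "\<not> set cs \<subseteq> {\<zero>}"
  let ?p = "normalize (rev cs)"
  have p: "?p \<in> carrier (poly_ring R)"
    using normalize_gives_polynomial[of "rev cs" "carrier R"] assms(1) by (simp add: univ_poly_carrier)
  have "?p \<noteq> []" using * by (simp add: normalize_eq_Nil)
  then have "{x \<in> carrier R. heval cs x = \<zero>} \<subseteq> {x. is_root ?p x}"
    using assms(1) by (auto simp: is_root_def eval_normalize heval_eval)
  then show False using finite_number_of_roots[OF p] assms(2) finite_subset by blast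
qed

text \<open>In a finite field with N units, x^(N+1) - x + 1 takes only the value 1 and so has no
  root.\<close>

lemma infinite_root_closed:
  assumes K: "subfield K R" and rc: "root_closed K"
  shows "infinite K"
proof
  assume fin: "finite K"
  note Kr = subfieldE(1)[OF K]
  let ?R = "R \<lparr> carrier := K \<rparr>"
  interpret K: field ?R by (rule subfield_iff(2)[OF K])
  define N where "N = card (Units ?R)"
  have pow: "a [^] N = \<one>" if a: "a \<in> K" "a \<noteq> \<zero>" for a
  proof -
    have "a \<in> Units ?R" using a K.field_Units by simp
    then have "a [^]\<^bsub>?R\<^esub> N = \<one>" using K.units_power_order_eq_one[of a] fin
      by (simp add: N_def K.field_Units)
    then show ?thesis by (simp add: nat_pow_def)
  qed
  have "\<one> \<in> Units ?R" using K.Units_one_closed by simp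
  moreover have "finite (Units ?R)" using fin K.field_Units by simp
  ultimately have "N > 0" by (auto simp: N_def card_gt_0_iff)
  \<comment> \<open>The coefficients of x^(N+1) - x + 1 below the leading one. There are N - 1
    zeros, which makes sense as N is positive.\<close>
  let ?cs = "replicate (N - 1) \<zero> @ [\<ominus> \<one>, \<one>]"
  have "set ?cs \<subseteq> K" using subringE(2,3,5)[OF Kr] by auto
  then obtain x where x: "x \<in> K" "eval (\<one> # ?cs) x = \<zero>"
    using rc unfolding root_closed_def by blast
  have xR: "x \<in> carrier R" using x(1) subringE(1)[OF Kr] by auto
  have rep: "eval (replicate n \<zero> @ [\<ominus> \<one>, \<one>]) x = \<ominus> x \<oplus> \<one>" for n
    by (induction n) (use xR in \<open>simp_all add: l_minus\<close>)
  have "eval (\<one> # ?cs) x = x [^] Suc N \<oplus> (\<ominus> x \<oplus> \<one>)"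
    using \<open>N > 0\<close> xR rep by simp
  moreover have "x [^] Suc N = x" using pow[OF x(1)] xR by (cases "x = \<zero>") auto
  ultimately have "\<one> = \<zero>" using x(2) xR by (simp add: r_neg2)
  then show False by simp
qed

lemma root_closed_carrier: "root_closed (carrier R)"
  using root_exists by (auto simp: root_closed_def)

lemma infinite_carrier: "infinite (carrier R)"
  using infinite_root_closed[OF carrier_is_subfield root_closed_carrier] .

abbreviation cval :: "'a tm \<Rightarrow> 'a" where
  "cval t \<equiv> val M (\<lambda>_. \<zero>) t"

lemma cval_closed [simp]: "S \<subseteq> carrier R \<Longrightarrow> t \<in> cterms S \<Longrightarrow> cval t \<in> carrier R"
  by (rule val_closed) (auto simp: cterms_def)

lemma val_cterm: "t \<in> cterms S \<Longrightarrow> val M e t = cval t"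
  by (rule val_cong) (auto simp: cterms_def)

lemma cvals_closed: "set p \<subseteq> cterms S \<Longrightarrow> S \<subseteq> carrier R \<Longrightarrow> set (map cval p) \<subseteq> carrier R"
  by auto

lemma heval_tpadd:
  assumes "S \<subseteq> carrier R" "x \<in> carrier R"
  shows "set p \<subseteq> cterms S \<Longrightarrow> set q \<subseteq> cterms S \<Longrightarrow>
    heval (map cval (tpadd p q)) x = heval (map cval p) x \<oplus> heval (map cval q) x"
proof (induction p arbitrary: q)
  case (Cons a p)
  show ?case
  proof (cases q)
    case Nil
    then show ?thesis using Cons.prems assms cvals_closed[of p S] by simp
  next
    case [simp]: (Cons b q')
    have [simp]: "cval a \<in> carrier R" "cval b \<in> carrier R" "heval (map cval p) x \<in> carrier R"
      "heval (map cval q') x \<in> carrier R"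
      using Cons.prems assms cvals_closed[of p S] cvals_closed[of q' S] by auto
    have "heval (map cval (tpadd p q')) x = heval (map cval p) x \<oplus> heval (map cval q') x"
      using Cons.prems by (intro Cons.IH) auto
    then show ?thesis using assms by (simp add: r_distr a_ac)
  qed
qed (use assms cvals_closed in auto)

lemma heval_tpmul:
  assumes "S \<subseteq> carrier R" "x \<in> carrier R"
  shows "set p \<subseteq> cterms S \<Longrightarrow> set q \<subseteq> cterms S \<Longrightarrow>
    heval (map cval (tpmul p q)) x = heval (map cval p) x \<otimes> heval (map cval q) x"
proof (induction p)
  case Nil
  then show ?case using assms cvals_closed[of q S] by simp
next
  case (Cons a p)
  have cl [simp]: "cval a \<in> carrier R" "heval (map cval p) x \<in> carrier R" "heval (map cval q) x \<in> carrier R"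
    using Cons.prems assms cvals_closed[of p S] cvals_closed[of q S] by auto
  have sc: "heval (map cval (map (TMul a) q)) x = cval a \<otimes> heval (map cval q) x" if "set q \<subseteq> cterms S" for q
    using that
  proof (induction q)
    case (Cons b q)
    have "cval b \<in> carrier R" "heval (map cval q) x \<in> carrier R"
      using Cons.prems assms cvals_closed[of q S] by auto
    then show ?case using Cons assms by (simp add: r_distr m_ac)
  qed simp
  have "heval (map cval (tpmul (a # p) q)) x =
      heval (map cval (map (TMul a) q)) x \<oplus> heval (map cval (TZero # tpmul p q)) x"
    unfolding tpmul.simps using Cons.prems assms tpmul_cterms[of p S q]
    by (intro heval_tpadd[OF assms]) auto
  also have "\<dots> = cval a \<otimes> heval (map cval q) x \<oplus> x \<otimes> (heval (map cval p) x \<otimes> heval (map cval q) x)"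
    using Cons sc[of q] assms by simp
  also have "\<dots> = heval (map cval (a # p)) x \<otimes> heval (map cval q) x"
    using assms by (simp add: l_distr m_assoc)
  finally show ?case .
qed

lemma heval_tpoly:
  assumes "S \<subseteq> carrier R" "x \<in> carrier R"
  shows "tparams t \<subseteq> S \<Longrightarrow> heval (map cval (tpoly t)) x = val M (\<lambda>_. x) t"
proof (induction t)
  case (TAdd s t)
  then show ?case using tpoly_cterms[of s S] tpoly_cterms[of t S] by (simp add: heval_tpadd[OF assms])
next
  case (TMul s t)
  then show ?case using tpoly_cterms[of s S] tpoly_cterms[of t S] by (simp add: heval_tpmul[OF assms])
next
  case (TMinus t)
  have *: "heval (map cval (map TMinus p)) x = \<ominus> heval (map cval p) x" if "set p \<subseteq> cterms S" for p
    using that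
  proof (induction p)
    case (Cons b p)
    have "cval b \<in> carrier R" "heval (map cval p) x \<in> carrier R"
      using Cons.prems assms cvals_closed[of p S] by auto
    then show ?case using Cons assms by (simp add: r_minus minus_add)
  qed simp
  have "val M (\<lambda>_. x) t \<in> carrier R" using TMinus.prems assms by (intro val_closed) auto
  then show ?case using TMinus *[OF tpoly_cterms[of t S]] by simp
qed (use assms in auto)

lemma val_ptm: "set cs \<subseteq> cterms S \<Longrightarrow> val M (\<lambda>_. x) (ptm cs) = heval (map cval cs) x"
proof (induction cs)
  case (Cons c cs)
  have "val M (\<lambda>_. x) c = cval c" by (rule val_cterm[of _ S]) (use Cons.prems in auto)
  then show ?case using Cons by simp
qed simp

subsubsection \<open>The closure operator\<close>

definition acl :: "'a set \<Rightarrow> 'a set" where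
  "acl S = {x \<in> carrier R. (algebraic over (generate_field R S)) x}"

lemma acl_carrier: "acl S \<subseteq> carrier R"
  by (auto simp: acl_def)

lemma subfield_acl: "S \<subseteq> carrier R \<Longrightarrow> subfield (acl S) R"
  unfolding acl_def by (rule subfield_of_algebraics) (rule generate_field_is_subfield)

lemma acl_incl: "S \<subseteq> carrier R \<Longrightarrow> S \<subseteq> acl S"
  using algebraic_self[OF subfieldE(1)[OF generate_field_is_subfield]]
  by (auto simp: acl_def intro: generate_field.incl)

lemma generate_field_subfield: "subfield K R \<Longrightarrow> generate_field R K = K"
  using generate_fieldE(2,3)[of K "generate_field R K"] subfieldE(3)[of K R] by (intro equalityI) auto

text \<open>A polynomial for x has finitely many coefficients, all algebraic over the base field;
  they generate a finite extension, over which x is again finite, and finite dimension is transitive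
  in towers.\<close>

lemma acl_idem:
  assumes S: "S \<subseteq> carrier R"
  shows "acl (acl S) = acl S"
proof
  show "acl S \<subseteq> acl (acl S)" by (rule acl_incl) (rule acl_carrier)
  show "acl (acl S) \<subseteq> acl S"
  proof
    fix x assume "x \<in> acl (acl S)"
    then have x: "x \<in> carrier R" "(algebraic over (acl S)) x"
      by (auto simp: acl_def[of "acl S"] generate_field_subfield[OF subfield_acl[OF S]])
    let ?K = "generate_field R S"
    have K: "subfield ?K R" by (rule generate_field_is_subfield[OF S])
    obtain p where p: "p \<in> carrier ((acl S)[X])" "p \<noteq> []" "eval p x = \<zero>"
      using algebraicE[OF subfieldE(1)[OF subfield_acl[OF S]] x] by auto
    have set_p: "set p \<subseteq> acl S" using p(1) by (auto simp: univ_poly_carrier[symmetric] polynomial_def)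
    then have pR: "set p \<subseteq> carrier R" and alg: "\<And>c. c \<in> set p \<Longrightarrow> (algebraic over ?K) c"
      by (auto simp: acl_def)
    let ?F = "finite_extension ?K p"
    have F: "subfield ?F R" by (rule finite_extension_is_subfield[OF K pR alg])
    have "finite_dimension ?K ?F" by (rule finite_extension_finite_dimension(1)[OF K pR alg])
    moreover have "p \<in> carrier (?F[X])"
      using p(1,2) finite_extension_mem[OF subfieldE(1)[OF K] pR]
      by (auto simp: univ_poly_carrier[symmetric] polynomial_def)
    then have "(algebraic over ?F) x" using algebraicI p(2,3) by auto
    then have "finite_dimension ?F (simple_extension ?F x)"
      using finite_dimension_simple_extension[OF F x(1)] by simp
    ultimately have "finite_dimension ?K (simple_extension ?F x)"
      by (rule telescopic_base_dim(1)[OF K F])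
    then have "(algebraic over ?K) x"
      using finite_extension_finite_dimension(2)[OF K, of "x # p"] x(1) pR by simp
    then show "x \<in> acl S" using x(1) by (simp add: acl_def)
  qed
qed

lemma fracI:
  "a \<in> cterms S \<Longrightarrow> b \<in> cterms S \<Longrightarrow> cval b \<noteq> \<zero> \<Longrightarrow> cval b \<otimes> h = cval a \<Longrightarrow>
    \<exists>a b. a \<in> cterms S \<and> b \<in> cterms S \<and> cval b \<noteq> \<zero> \<and> cval b \<otimes> h = cval a"
  by blast

text \<open>Terms have no division, so an element h of the generated field is described by an
  equation b * h = a between values of closed terms.\<close>

lemma generate_field_frac:
  assumes S: "S \<subseteq> carrier R" and "h \<in> generate_field R S"
  shows "\<exists>a b. a \<in> cterms S \<and> b \<in> cterms S \<and> cval b \<noteq> \<zero> \<and> cval b \<otimes> h = cval a"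
  using assms(2)
proof induction
  case one
  show ?case by (intro fracI[of TOne _ TOne]) auto
next
  case (incl h)
  then show ?case using S by (intro fracI[of "Cst h" _ TOne]) auto
next
  case (a_inv h)
  then obtain a b where ab: "a \<in> cterms S" "b \<in> cterms S" "cval b \<noteq> \<zero>" "cval b \<otimes> h = cval a" by blast
  have "h \<in> carrier R" using a_inv generate_field_in_carrier[OF S] by blast
  then show ?case using ab S
    by (intro fracI[of "TMinus a" _ b]) (auto simp: r_minus)
next
  case (m_inv h)
  then obtain a b where ab: "a \<in> cterms S" "b \<in> cterms S" "cval b \<noteq> \<zero>" "cval b \<otimes> h = cval a" by blast
  have h: "h \<in> carrier R" "h \<noteq> \<zero>" using m_inv generate_field_in_carrier[OF S] by auto
  have hu: "h \<in> Units R" using h field_Units by auto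
  have cl: "cval a \<in> carrier R" "cval b \<in> carrier R" using ab S by auto
  have "cval a \<noteq> \<zero>" using ab(3,4) h cl integral by metis
  moreover have "cval a \<otimes> inv h = cval b" using ab(4) cl h(1) hu by (metis Units_inv_closed Units_r_inv m_assoc r_one)
  ultimately show ?case using ab by blast
next
  case (eng_add h1 h2)
  then obtain a b c d where ab: "a \<in> cterms S" "b \<in> cterms S" "cval b \<noteq> \<zero>" "cval b \<otimes> h1 = cval a"
    and cd: "c \<in> cterms S" "d \<in> cterms S" "cval d \<noteq> \<zero>" "cval d \<otimes> h2 = cval c" by blast
  have h: "h1 \<in> carrier R" "h2 \<in> carrier R" using eng_add generate_field_in_carrier[OF S] by auto
  have cl: "cval b \<in> carrier R" "cval d \<in> carrier R" using ab cd S by auto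
  have "cval b \<otimes> cval d \<otimes> (h1 \<oplus> h2) = cval d \<otimes> (cval b \<otimes> h1) \<oplus> cval b \<otimes> (cval d \<otimes> h2)"
    using cl h by (simp add: l_distr r_distr m_ac)
  then show ?case using ab cd cl S
    by (intro fracI[of "TAdd (TMul d a) (TMul b c)" _ "TMul b d"]) (auto simp: integral_iff)
next
  case (eng_mult h1 h2)
  then obtain a b c d where ab: "a \<in> cterms S" "b \<in> cterms S" "cval b \<noteq> \<zero>" "cval b \<otimes> h1 = cval a"
    and cd: "c \<in> cterms S" "d \<in> cterms S" "cval d \<noteq> \<zero>" "cval d \<otimes> h2 = cval c" by blast
  have h: "h1 \<in> carrier R" "h2 \<in> carrier R" using eng_mult generate_field_in_carrier[OF S] by auto
  have cl: "cval b \<in> carrier R" "cval d \<in> carrier R" using ab cd S by auto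
  have "cval b \<otimes> cval d \<otimes> (h1 \<otimes> h2) = (cval b \<otimes> h1) \<otimes> (cval d \<otimes> h2)"
    using cl h by (simp add: m_ac)
  then show ?case using ab cd cl S
    by (intro fracI[of "TMul a c" _ "TMul b d"]) (auto simp: integral_iff)
qed

lemma common_denominator:
  assumes S: "S \<subseteq> carrier R"
  shows "set p \<subseteq> generate_field R S \<Longrightarrow>
    \<exists>d q. d \<in> cterms S \<and> cval d \<noteq> \<zero> \<and> set q \<subseteq> cterms S \<and> map cval q = map (\<lambda>c. cval d \<otimes> c) p"
proof (induction p)
  case Nil
  show ?case by (intro exI[of _ TOne] exI[of _ "[]"]) simp
next
  case (Cons c p)
  then obtain d q where d: "d \<in> cterms S" "cval d \<noteq> \<zero>" "set q \<subseteq> cterms S"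
    "map cval q = map (\<lambda>c. cval d \<otimes> c) p" by auto
  obtain a b where ab: "a \<in> cterms S" "b \<in> cterms S" "cval b \<noteq> \<zero>" "cval b \<otimes> c = cval a"
    using generate_field_frac[OF S, of c] Cons.prems by auto
  have c: "c \<in> carrier R" and p: "set p \<subseteq> carrier R"
    using Cons.prems generate_field_incl[OF S] by auto
  have cl: "cval b \<in> carrier R" "cval d \<in> carrier R" using ab d S by auto
  have "cval d \<otimes> cval a = cval b \<otimes> cval d \<otimes> c"
    unfolding ab(4)[symmetric] using cl c by (simp add: m_ac)
  moreover have "map cval (map (TMul b) q) = map (\<lambda>c. cval b \<otimes> cval d \<otimes> c) p"
  proof -
    have "map cval (map (TMul b) q) = map (\<lambda>u. cval b \<otimes> u) (map cval q)" by simp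
    also have "\<dots> = map (\<lambda>c. cval b \<otimes> cval d \<otimes> c) p"
      using p cl by (auto simp: d(4) m_assoc)
    finally show ?thesis .
  qed
  ultimately show ?case using ab d cl
    by (rule_tac exI[of _ "TMul b d"], rule_tac exI[of _ "TMul d a # map (TMul b) q"]) (auto simp: integral_iff)
qed

lemma acl_iff:
  assumes S: "S \<subseteq> carrier R"
  shows "x \<in> acl S \<longleftrightarrow> x \<in> carrier R \<and>
    (\<exists>cs. set cs \<subseteq> cterms S \<and> heval (map cval cs) x = \<zero> \<and> \<not> cval ` set cs \<subseteq> {\<zero>})"
  (is "_ \<longleftrightarrow> _ \<and> ?Q")
proof -
  let ?K = "generate_field R S"
  have K: "subfield ?K R" by (rule generate_field_is_subfield[OF S])
  have ?Q if x: "x \<in> acl S"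
  proof -
    have xR: "x \<in> carrier R" using x by (simp add: acl_def)
    obtain p where p: "p \<in> carrier (?K[X])" "p \<noteq> []" "eval p x = \<zero>"
      using algebraicE[OF subfieldE(1)[OF K], of x] x by (auto simp: acl_def)
    then have set_p: "set p \<subseteq> ?K" "hd p \<noteq> \<zero>"
      by (auto simp: univ_poly_carrier[symmetric] polynomial_def)
    obtain d q where d: "d \<in> cterms S" "cval d \<noteq> \<zero>" "set q \<subseteq> cterms S"
      "map cval q = map (\<lambda>c. cval d \<otimes> c) p"
      using common_denominator[OF S set_p(1)] by blast
    have pR: "set p \<subseteq> carrier R" using set_p(1) generate_field_incl[OF S] by auto
    have dR: "cval d \<in> carrier R" using d(1) S by simp
    have "heval (map cval (rev q)) x = eval (map (\<lambda>c. cval d \<otimes> c) p) x"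
      using xR d(3) S by (subst heval_eval) (auto simp: rev_map d(4))
    also have "\<dots> = cval d \<otimes> eval p x"
      using pR
    proof (induction p)
      case (Cons a p)
      then show ?case using dR xR eval_in_carrier[of p x] by (simp add: r_distr m_assoc)
    qed (use dR in simp)
    finally have "heval (map cval (rev q)) x = \<zero>" using p(3) dR by simp
    moreover have "\<not> cval ` set (rev q) \<subseteq> {\<zero>}"
    proof -
      have "cval d \<otimes> hd p \<in> set (map cval q)" using p(2) d(4) by auto
      moreover have "cval d \<otimes> hd p \<noteq> \<zero>" using integral dR set_p(2) d(2) pR p(2) by (metis hd_in_set subsetD)
      ultimately show ?thesis by auto
    qed
    ultimately show ?thesis
      using d(3) by (intro exI[of _ "rev q"]) simp
  qed
  moreover have "x \<in> acl S" if x: "x \<in> carrier R" and ?Q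
  proof -
    from \<open>?Q\<close> obtain cs y where cs: "set cs \<subseteq> cterms S" "heval (map cval cs) x = \<zero>"
      and y: "y \<in> set cs" "cval y \<noteq> \<zero>" by blast
    have cval_K: "cval t \<in> ?K" if "t \<in> cterms S" for t
      using that
    proof (induction t)
      case (TMinus t)
      then show ?case using S by (auto intro: generate_field.a_inv)
    qed (use zero_in_generate in \<open>auto intro: generate_field.intros\<close>)
    let ?p = "normalize (rev (map cval cs))"
    have "?p \<in> carrier (?K[X])"
      using normalize_gives_polynomial[of "rev (map cval cs)" ?K] cs cval_K
      by (auto simp: univ_poly_carrier)
    moreover have "?p \<noteq> []" using y by (auto simp: normalize_eq_Nil)
    moreover have "eval ?p x = \<zero>"
      using cs S x heval_eval[of "map cval cs" x] cvals_closed[of cs S] by (subst eval_normalize) auto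
    ultimately show "x \<in> acl S" using algebraicI x by (auto simp: acl_def)
  qed
  ultimately show ?thesis using acl_carrier by blast
qed

text \<open>The field is infinite, so a polynomial is nonzero iff it is nonzero at some point. In
  this form only values of one term occur, which makes monotonicity in S and invariance under
  automorphisms immediate.\<close>

lemma acl_iff_tm:
  assumes S: "S \<subseteq> carrier R"
  shows "x \<in> acl S \<longleftrightarrow> x \<in> carrier R \<and>
    (\<exists>t. tparams t \<subseteq> S \<and> val M (\<lambda>_. x) t = \<zero> \<and> (\<exists>y\<in>carrier R. val M (\<lambda>_. y) t \<noteq> \<zero>))"
proof (intro iffI conjI; (elim conjE exE)?)
  assume x: "x \<in> acl S"
  then show "x \<in> carrier R" by (simp add: acl_def)
  obtain cs where cs: "set cs \<subseteq> cterms S" "heval (map cval cs) x = \<zero>" "\<not> cval ` set cs \<subseteq> {\<zero>}"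
    using x acl_iff[OF S] by blast
  have "\<exists>y\<in>carrier R. heval (map cval cs) y \<noteq> \<zero>"
  proof (rule ccontr)
    assume "\<not> ?thesis"
    then have "{y \<in> carrier R. heval (map cval cs) y = \<zero>} = carrier R" by auto
    then have "set (map cval cs) \<subseteq> {\<zero>}"
      using infinite_carrier cs(1) S by (intro infinite_zeros) auto
    then show False using cs(3) by simp
  qed
  moreover have "tparams (ptm cs) \<subseteq> S" using cs(1) by (auto simp: tparams_ptm cterms_def)
  ultimately show "\<exists>t. tparams t \<subseteq> S \<and> val M (\<lambda>_. x) t = \<zero> \<and> (\<exists>y\<in>carrier R. val M (\<lambda>_. y) t \<noteq> \<zero>)"
    using cs(2) by (intro exI[of _ "ptm cs"]) (simp add: val_ptm[OF cs(1)])
next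
  fix t assume x: "x \<in> carrier R" and t: "tparams t \<subseteq> S" "val M (\<lambda>_. x) t = \<zero>"
    "\<exists>y\<in>carrier R. val M (\<lambda>_. y) t \<noteq> \<zero>"
  then obtain y where y: "y \<in> carrier R" "val M (\<lambda>_. y) t \<noteq> \<zero>" by blast
  have "\<not> cval ` set (tpoly t) \<subseteq> {\<zero>}"
  proof
    assume *: "cval ` set (tpoly t) \<subseteq> {\<zero>}"
    have "heval cs y = \<zero>" if "set cs \<subseteq> {\<zero>}" for cs
      using that y(1) by (induction cs) auto
    then have "heval (map cval (tpoly t)) y = \<zero>" using * by simp
    then show False using y heval_tpoly[OF S _ t(1)] by simp
  qed
  then show "x \<in> acl S"
    unfolding acl_iff[OF S] using tpoly_cterms[OF t(1)] heval_tpoly[OF S x t(1)] t(2) x by metis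
qed

lemma acl_mono: "S \<subseteq> T \<Longrightarrow> T \<subseteq> carrier R \<Longrightarrow> acl S \<subseteq> acl T"
  using acl_iff_tm[of S] acl_iff_tm[of T] by blast

lemma acl_subset: "S \<subseteq> acl T \<Longrightarrow> T \<subseteq> carrier R \<Longrightarrow> acl S \<subseteq> acl T"
  using acl_mono[of S "acl T"] acl_idem[of T] acl_carrier by blast

lemma acl_finite: "x \<in> acl S \<Longrightarrow> S \<subseteq> carrier R \<Longrightarrow> \<exists>F. finite F \<and> F \<subseteq> S \<and> x \<in> acl F"
proof -
  assume x: "x \<in> acl S" and S: "S \<subseteq> carrier R"
  then obtain t where t: "x \<in> carrier R" "tparams t \<subseteq> S" "val M (\<lambda>_. x) t = \<zero>" "\<exists>y\<in>carrier R. val M (\<lambda>_. y) t \<noteq> \<zero>"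
    using acl_iff_tm by blast
  then have "x \<in> acl (tparams t)" using acl_iff_tm[of "tparams t"] S by blast
  then show ?thesis using t(2) by (intro exI[of _ "tparams t"]) auto
qed

lemma root_closed_acl:
  assumes S: "S \<subseteq> carrier R"
  shows "root_closed (acl S)"
  unfolding root_closed_def
proof (intro allI impI)
  fix cs assume cs: "set cs \<subseteq> acl S" "cs \<noteq> []"
  note sub = subfieldE(1)[OF subfield_acl[OF S]]
  obtain x where x: "x \<in> carrier R" "eval (\<one> # cs) x = \<zero>"
    using root_exists cs acl_carrier by blast
  have "\<one> # cs \<in> carrier ((acl S)[X])"
    using cs(1) subringE(3)[OF sub] by (auto simp: univ_poly_carrier[symmetric] polynomial_def)
  then have "(algebraic over (acl S)) x" using x(2) algebraicI by auto
  then have "x \<in> acl (acl S)"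
    using x(1) by (simp add: acl_def[of "acl S"] generate_field_subfield[OF subfield_acl[OF S]])
  then show "\<exists>x\<in>acl S. eval (\<one> # cs) x = \<zero>" using x(2) unfolding acl_idem[OF S] by (rule bexI[rotated])
qed

text \<open>The minimal polynomial of x over K has a root a in K. It is then also the minimal
  polynomial of a, which is X - a; hence x = a.\<close>

lemma acl_root_closed:
  assumes K: "subfield K R" and rc: "root_closed K"
  shows "acl K = K"
proof
  show "K \<subseteq> acl K" by (rule acl_incl) (rule subfieldE(3)[OF K])
  show "acl K \<subseteq> K"
  proof
    fix x assume "x \<in> acl K"
    then have x: "x \<in> carrier R" "(algebraic over K) x"
      by (auto simp: acl_def generate_field_subfield[OF K])
    note I = IrrE[OF K x]
    have set_p: "set (Irr K x) \<subseteq> K" "Irr K x \<noteq> []"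
      using I(1) pirreducible_degree[OF K I(1,2)] by (auto simp: univ_poly_carrier[symmetric] polynomial_def)
    then obtain cs where cs: "Irr K x = \<one> # cs" using I(3) by (cases "Irr K x") auto
    have "cs \<noteq> []" using pirreducible_degree[OF K I(1,2)] cs by auto
    then obtain a where a: "a \<in> K" "eval (Irr K x) a = \<zero>"
      using rc cs set_p(1) unfolding root_closed_def by auto
    have aR: "a \<in> carrier R" using a(1) subfieldE(3)[OF K] by auto
    have alg: "(algebraic over K) a" by (rule algebraic_self[OF subfieldE(1)[OF K] a(1)])
    have 1: "[\<one>, \<ominus> a] \<in> carrier (K[X])"
      using subringE(3,5)[OF subfieldE(1)[OF K]] a(1) by (auto simp: univ_poly_carrier[symmetric] polynomial_def)
    have 2: "pirreducible K [\<one>, \<ominus> a]" by (rule degree_one_imp_pirreducible[OF K 1]) simp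
    have "[\<one>, \<ominus> a] = Irr K x"
      using minimal_polynomial_is_unique[OF K aR alg] 1 2 I(1,2,3) a(2) aR by (auto simp: r_neg)
    then have "x \<oplus> \<ominus> a = \<zero>" using I(4) x(1) aR by (metis eval.simps list.sel(1,3) One_nat_def diff_Suc_1 l_one length_Cons list.size(3) nat_pow_0 nat_pow_Suc a_inv_closed r_one r_zero)
    then have "x = a" using x(1) aR by (metis a_inv_closed local.minus_minus minus_equality)
    then show "x \<in> K" using a(1) by simp
  qed
qed

lemma infinite_acl: "S \<subseteq> carrier R \<Longrightarrow> infinite (acl S)"
  using infinite_root_closed[OF subfield_acl root_closed_acl] .

end

context acf
begin

lemma val_subring:
  "subring K R \<Longrightarrow> tparams t \<subseteq> K \<Longrightarrow> (\<And>v. v \<in> tvars t \<Longrightarrow> e v \<in> K) \<Longrightarrow> val M e t \<in> K"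
proof (induction t)
  case (TMinus t)
  then have "val M e t \<in> K" by simp
  then show ?case using subringE(1,5)[OF TMinus.prems(1)] by auto
qed (auto dest: subringE)

text \<open>Steinitz exchange. A relation for x whose coefficients involve y is also a polynomial in
  y over S and x. If y were transcendental over these, it would vanish at every value z in place of
  y. For z in the infinite field \<open>acl S\<close> the coefficients then vanish at z, since x is
  not algebraic over S; so they vanish identically, in particular at y.\<close>

lemma acl_exchange:
  assumes S: "S \<subseteq> carrier R" and y: "y \<in> carrier R"
    and x: "x \<in> acl (insert y S)" "x \<notin> acl S"
  shows "y \<in> acl (insert x S)"
proof (rule ccontr)
  assume ny: "y \<notin> acl (insert x S)"
  have xR: "x \<in> carrier R" using x(1) acl_carrier by auto
  have yS: "insert y S \<subseteq> carrier R" and xS: "insert x S \<subseteq> carrier R" using S y xR by auto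
  obtain cs where cs: "set cs \<subseteq> cterms (insert y S)" "heval (map cval cs) x = \<zero>" "\<not> cval ` set cs \<subseteq> {\<zero>}"
    using x(1) acl_iff[OF yS] by blast
  \<comment> \<open>\<open>\<kappa>\<close> opens the constant y as a variable; \<open>T\<close>
    below is the relation read as a polynomial in this variable, with x among its constants.\<close>
  define \<kappa> where "\<kappa> a = (if a = y then Var 0 else Cst a)" for a
  define T where "T cs = foldr (\<lambda>c t. TAdd (tsub \<kappa> c) (TMul (Cst x) t)) cs TZero" for cs
  have par: "tparams (tsub \<kappa> c) \<subseteq> S" if "c \<in> cterms (insert y S)" for c
    using that by (auto simp: tparams_tsub cterms_def \<kappa>_def split: if_splits)
  have val_T: "val M (\<lambda>_. z) (T cs) = heval (map (\<lambda>c. val M (\<lambda>_. z) (tsub \<kappa> c)) cs) x" for z cs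
    by (induction cs) (auto simp: T_def)
  have val_y: "val M (\<lambda>_. y) (tsub \<kappa> c) = cval c" if "c \<in> cterms (insert y S)" for c
  proof -
    have "(\<lambda>a. val M (\<lambda>_. y) (\<kappa> a)) = (\<lambda>a. a)" by (auto simp: \<kappa>_def)
    then have "val M (\<lambda>_. y) (tsub \<kappa> c) = val M (\<lambda>_. y) c" unfolding val_tsub by (simp add: tm.map_ident)
    also have "\<dots> = cval c" by (rule val_cterm[OF that])
    finally show ?thesis .
  qed
  have eq: "map (\<lambda>c. val M (\<lambda>_. y) (tsub \<kappa> c)) cs = map cval cs" using cs(1) val_y by auto
  have "val M (\<lambda>_. y) (T cs) = \<zero>" using cs(2) unfolding val_T eq .
  moreover have "tparams (T cs) \<subseteq> insert x S"
    using cs(1)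
  proof (induction cs)
    case (Cons c cs)
    then show ?case using par[of c] by (auto simp: T_def)
  qed (simp add: T_def)
  ultimately have T0: "val M (\<lambda>_. z) (T cs) = \<zero>" if "z \<in> carrier R" for z
    using ny acl_iff_tm[OF xS] y that by blast
  have "val M (\<lambda>_. z) (tsub \<kappa> c) = \<zero>" if z: "z \<in> acl S" and c: "c \<in> set cs" for z c
  proof -
    have "val M (\<lambda>_. z) (tsub \<kappa> c) \<in> acl S" if "c \<in> set cs" for c
      using z that cs(1) par[of c] acl_incl[OF S]
      by (intro val_subring[OF subfieldE(1)[OF subfield_acl[OF S]]]) auto
    then have "set (map (\<lambda>c. Cst (val M (\<lambda>_. z) (tsub \<kappa> c))) cs) \<subseteq> cterms (acl S)" by auto
    moreover have "heval (map cval (map (\<lambda>c. Cst (val M (\<lambda>_. z) (tsub \<kappa> c))) cs)) x = \<zero>"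
      using T0[of z] z acl_carrier by (auto simp: val_T comp_def)
    ultimately have "cval ` set (map (\<lambda>c. Cst (val M (\<lambda>_. z) (tsub \<kappa> c))) cs) \<subseteq> {\<zero>}"
      using x(2) xR acl_iff[OF acl_carrier[of S], of x] unfolding acl_idem[OF S] by blast
    moreover have "Cst (val M (\<lambda>_. z) (tsub \<kappa> c)) \<in> set (map (\<lambda>c. Cst (val M (\<lambda>_. z) (tsub \<kappa> c))) cs)"
      using c by simp
    ultimately have "cval (Cst (val M (\<lambda>_. z) (tsub \<kappa> c))) \<in> {\<zero>}" by blast
    then show ?thesis by simp
  qed
  then have zero: "heval (map cval (tpoly (tsub \<kappa> c))) z = \<zero>" if "z \<in> acl S" "c \<in> set cs" for z c
    using that cs(1) par[of c] acl_carrier[of S] S by (subst heval_tpoly[of S]) auto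
  have "cval c = \<zero>" if c: "c \<in> set cs" for c
  proof -
    have c': "c \<in> cterms (insert y S)" using c cs(1) by auto
    have sub: "set (map cval (tpoly (tsub \<kappa> c))) \<subseteq> carrier R"
      using cvals_closed[OF tpoly_cterms[OF par[OF c']] S] .
    have "acl S \<subseteq> {z \<in> carrier R. heval (map cval (tpoly (tsub \<kappa> c))) z = \<zero>}"
      using zero c acl_carrier by blast
    then have "infinite {z \<in> carrier R. heval (map cval (tpoly (tsub \<kappa> c))) z = \<zero>}"
      using infinite_acl[OF S] finite_subset by blast
    then have z0: "set (map cval (tpoly (tsub \<kappa> c))) \<subseteq> {\<zero>}" by (rule infinite_zeros[OF sub])
    have "heval ds y = \<zero>" if "set ds \<subseteq> {\<zero>}" for ds
      using that y by (induction ds) auto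
    then have "heval (map cval (tpoly (tsub \<kappa> c))) y = \<zero>" using z0 by blast
    then show ?thesis using heval_tpoly[OF S y par[OF c']] val_y[OF c'] by simp
  qed
  then show False using cs(3) by blast
qed

section \<open>Independent sets and greedy bases\<close>

definition indep :: "'a set \<Rightarrow> 'a set \<Rightarrow> bool" where
  "indep C B \<longleftrightarrow> B \<subseteq> carrier R \<and> (\<forall>b\<in>B. b \<notin> acl (C \<union> (B - {b})))"

text \<open>All predecessors count here, not just those already chosen, so the definition needs no
  recursion. For a well-order W the result restricts to a basis of every initial segment that is an
  algebraically closed field.\<close>

definition greedy_basis :: "'a rel \<Rightarrow> 'a set" where
  "greedy_basis W = {x \<in> carrier R. x \<notin> acl {y \<in> carrier R. (y, x) \<in> W}}"

lemma greedy_basis_span: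
  assumes W: "wf W" and P: "P \<subseteq> carrier R"
    and initial: "\<And>x y. x \<in> P \<Longrightarrow> y \<in> carrier R \<Longrightarrow> (y, x) \<in> W \<Longrightarrow> y \<in> P"
  shows "P \<subseteq> acl (greedy_basis W \<inter> P)"
proof
  fix x assume "x \<in> P"
  with W show "x \<in> acl (greedy_basis W \<inter> P)"
  proof (induction x rule: wf_induct_rule)
    case (less x)
    have BP: "greedy_basis W \<inter> P \<subseteq> carrier R" using P by auto
    show ?case
    proof (cases "x \<in> greedy_basis W")
      case True
      then show ?thesis using acl_incl[OF BP] less.prems by auto
    next
      case False
      then have "x \<in> acl {y \<in> carrier R. (y, x) \<in> W}"
        using less.prems P by (auto simp: greedy_basis_def)
      moreover have "{y \<in> carrier R. (y, x) \<in> W} \<subseteq> acl (greedy_basis W \<inter> P)"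
        using less initial by blast
      ultimately show ?thesis using acl_subset[OF _ BP] by blast
    qed
  qed
qed

lemma finite_total_max:
  assumes "trans W" "total_on D W"
  shows "finite G \<Longrightarrow> G \<noteq> {} \<Longrightarrow> G \<subseteq> D \<Longrightarrow> \<exists>m\<in>G. \<forall>g\<in>G - {m}. (g, m) \<in> W"
proof (induction G rule: finite_ne_induct)
  case (insert a G)
  then obtain m where m: "m \<in> G" "\<forall>g\<in>G - {m}. (g, m) \<in> W" by auto
  then have "(a, m) \<in> W \<or> (m, a) \<in> W"
    using insert assms(2) by (auto simp: total_on_def)
  then show ?case
  proof
    assume "(a, m) \<in> W"
    then show ?thesis using m by (intro bexI[of _ m]) auto
  next
    assume "(m, a) \<in> W"
    then show ?thesis using m assms(1) by (intro bexI[of _ a]) (auto dest: transD)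
  qed
qed simp

text \<open>In a finite subset the W-largest element m does not depend on the others by
  construction. Any other b does not depend on the rest without m, by induction; if b depended on
  the rest with m, exchange would make m dependent.\<close>

lemma greedy_basis_indep:
  assumes W: "wf W" "trans W" "total_on (carrier R) W"
  shows "indep {} (greedy_basis W)"
proof -
  let ?B = "greedy_basis W"
  have B: "?B \<subseteq> carrier R" by (auto simp: greedy_basis_def)
  have fin: "b \<notin> acl (G - {b})" if "finite G" "G \<subseteq> ?B" "b \<in> G" for G b
    using that
  proof (induction "card G" arbitrary: G b rule: less_induct)
    case less
    obtain m where m: "m \<in> G" "\<forall>g\<in>G - {m}. (g, m) \<in> W"
      using finite_total_max[OF W(2,3), of G] less.prems B by blast
    have GR: "G \<subseteq> carrier R" using less.prems B by auto
    have "G - {m} \<subseteq> {y \<in> carrier R. (y, m) \<in> W}" using m GR by auto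
    then have "acl (G - {m}) \<subseteq> acl {y \<in> carrier R. (y, m) \<in> W}" by (rule acl_mono) auto
    then have nm: "m \<notin> acl (G - {m})" using m(1) less.prems by (auto simp: greedy_basis_def)
    show ?case
    proof (cases "b = m")
      case False
      have "b \<notin> acl (G - {m} - {b})"
        using less.prems False m by (intro less.hyps psubset_card_mono) auto
      moreover have "G - {b} = insert m (G - {m} - {b})" "insert b (G - {m} - {b}) = G - {m}"
        using less.prems m False by auto
      ultimately show ?thesis
        using acl_exchange[of "G - {m} - {b}" m b] nm GR m by auto
    qed (use nm in simp)
  qed
  show ?thesis
    unfolding indep_def
  proof (intro conjI ballI notI B)
    fix b assume b: "b \<in> ?B" "b \<in> acl ({} \<union> (?B - {b}))"
    then obtain F where F: "finite F" "F \<subseteq> ?B - {b}" "b \<in> acl F"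
      using acl_finite[of b "?B - {b}"] B by auto
    then have "insert b F - {b} = F" by auto
    then show False using fin[of "insert b F" b] F b(1) by auto
  qed
qed

lemma indep_over_acl:
  assumes B: "indep {} B" and B0: "B0 \<subseteq> B"
  shows "indep (acl B0) (B - B0)"
  unfolding indep_def
proof (intro conjI ballI notI)
  have BR: "B \<subseteq> carrier R" using B by (simp add: indep_def)
  then show "B - B0 \<subseteq> carrier R" by auto
  fix b assume b: "b \<in> B - B0" "b \<in> acl (acl B0 \<union> (B - B0 - {b}))"
  have "B - {b} \<subseteq> carrier R" using BR by auto
  then have "acl B0 \<union> (B - B0 - {b}) \<subseteq> acl (B - {b})"
    using acl_mono[of B0 "B - {b}"] acl_incl[of "B - {b}"] b(1) B0 by auto
  then have "b \<in> acl (B - {b})" using b(2) acl_subset \<open>B - {b} \<subseteq> carrier R\<close> by blast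
  then show False using B b(1) by (auto simp: indep_def)
qed

subsection \<open>Extending partial isomorphisms\<close>

text \<open>A partial isomorphism is a relation preserving the vanishing of closed terms; a closed term in pairs
  stands for the two terms obtained by projecting its constants.\<close>

definition pisom :: "('a \<times> 'a) set \<Rightarrow> bool" where
  "pisom G \<longleftrightarrow> G \<subseteq> carrier R \<times> carrier R \<and>
     (\<forall>t\<in>cterms G. cval (map_tm fst t) = \<zero> \<longleftrightarrow> cval (map_tm snd t) = \<zero>)"

abbreviation val1 :: "('a \<times> 'a) tm \<Rightarrow> 'a" where "val1 t \<equiv> cval (map_tm fst t)"
abbreviation val2 :: "('a \<times> 'a) tm \<Rightarrow> 'a" where "val2 t \<equiv> cval (map_tm snd t)"

lemma map_cterms: "t \<in> cterms G \<Longrightarrow> map_tm f t \<in> cterms (f ` G)"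
  by (auto simp: cterms_def tm.set_map)

lemma val12_closed: "G \<subseteq> carrier R \<times> carrier R \<Longrightarrow> t \<in> cterms G \<Longrightarrow> val1 t \<in> carrier R \<and> val2 t \<in> carrier R"
proof
  assume *: "G \<subseteq> carrier R \<times> carrier R" "t \<in> cterms G"
  show "val1 t \<in> carrier R" using * by (intro cval_closed[OF _ map_cterms[OF *(2)]]) auto
  show "val2 t \<in> carrier R" using * by (intro cval_closed[OF _ map_cterms[OF *(2)]]) auto
qed

lemma pisom_converse: "pisom G \<Longrightarrow> pisom (G\<inverse>)"
proof -
  assume G: "pisom G"
  have "val1 t = \<zero> \<longleftrightarrow> val2 t = \<zero>" if t: "t \<in> cterms (G\<inverse>)" for t
  proof -
    have "map_tm prod.swap t \<in> cterms G" using map_cterms[OF t, of prod.swap]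
      by (rule set_mp[OF cterms_mono, rotated]) auto
    then have "cval (map_tm fst (map_tm prod.swap t)) = \<zero> \<longleftrightarrow> cval (map_tm snd (map_tm prod.swap t)) = \<zero>"
      using G unfolding pisom_def by blast
    then show ?thesis by simp
  qed
  then show ?thesis using G by (auto simp: pisom_def)
qed

lemma cval_tsub: "t \<in> cterms S \<Longrightarrow> val M e (tsub \<kappa> t) = cval (map_tm (\<lambda>a. val M e (\<kappa> a)) t)"
  unfolding val_tsub by (rule val_cterm[of _ UNIV]) (auto simp: cterms_def)

text \<open>A closed term containing the new pair is a polynomial in it whose coefficients are
  closed terms over \<open>G\<close>, and both projections of the term are computed from the same
  list of coefficients.\<close>

lemma pisom_insert:
  assumes G: "pisom G" and xy: "x \<in> carrier R" "y \<in> carrier R"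
    and coeffs: "\<And>cs. set cs \<subseteq> cterms G \<Longrightarrow> heval (map val1 cs) x = \<zero> \<longleftrightarrow> heval (map val2 cs) y = \<zero>"
  shows "pisom (insert (x, y) G)"
  unfolding pisom_def
proof (intro conjI ballI)
  have GR: "G \<subseteq> carrier R \<times> carrier R" using G by (simp add: pisom_def)
  show "insert (x, y) G \<subseteq> carrier R \<times> carrier R" using G xy by (auto simp: pisom_def)
  fix t assume t: "t \<in> cterms (insert (x, y) G)"
  define \<kappa> where "\<kappa> a = (if a = (x, y) then Var 0 else Cst a)" for a
  let ?v = "tsub \<kappa> t"
  have par: "tparams ?v \<subseteq> G"
    using t by (auto simp: tparams_tsub cterms_def \<kappa>_def split: if_splits)
  have *: "heval (map (\<lambda>c. cval (map_tm f c)) (tpoly ?v)) (f (x, y)) = cval (map_tm f t)"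
    if f: "f ` G \<subseteq> carrier R" "f (x, y) \<in> carrier R" for f
  proof -
    have "map (\<lambda>c. cval (map_tm f c)) (tpoly ?v) = map cval (tpoly (map_tm f ?v))"
      by (simp add: map_tpoly[symmetric])
    then have "heval (map (\<lambda>c. cval (map_tm f c)) (tpoly ?v)) (f (x, y)) = val M (\<lambda>_. f (x, y)) (map_tm f ?v)"
      using heval_tpoly[of "f ` G" "f (x, y)" "map_tm f ?v"] f par by (auto simp: tm.set_map)
    also have "\<dots> = val M (\<lambda>_. f (x, y)) (tsub (\<lambda>a. map_tm f (\<kappa> a)) t)" by (simp add: map_tsub)
    also have "\<dots> = cval (map_tm (\<lambda>a. val M (\<lambda>_. f (x, y)) (map_tm f (\<kappa> a))) t)"
      by (rule cval_tsub[OF t])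
    also have "(\<lambda>a. val M (\<lambda>_. f (x, y)) (map_tm f (\<kappa> a))) = f" by (auto simp: \<kappa>_def)
    finally show ?thesis .
  qed
  have "fst ` G \<subseteq> carrier R" "snd ` G \<subseteq> carrier R" using GR by auto
  then show "val1 t = \<zero> \<longleftrightarrow> val2 t = \<zero>"
    using *[of fst] *[of snd] coeffs[OF tpoly_cterms[OF par]] xy by simp
qed

text \<open>A term is a polynomial in one of its basis elements b. As b is independent of the
  remaining constants, all coefficients vanish; they contain fewer basis pairs, so their images
  vanish by induction. Only one direction is shown, for an arbitrary map \<open>\<sigma>\<close>
  into the field; for an injective \<open>\<sigma>\<close> with independent image the other
  direction is this one for the inverse map.\<close>

lemma pisom_independent_aux:
  assumes C: "C \<subseteq> carrier R" and B: "indep C B" and \<sigma>: "\<sigma> ` B \<subseteq> carrier R"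
  shows "t \<in> cterms ((\<lambda>c. (c, c)) ` C \<union> (\<lambda>b. (b, \<sigma> b)) ` B) \<Longrightarrow> val1 t = \<zero> \<Longrightarrow> val2 t = \<zero>"
proof (induction "card (tparams t \<inter> (\<lambda>b. (b, \<sigma> b)) ` B)" arbitrary: t rule: less_induct)
  case less
  let ?G = "(\<lambda>c. (c, c)) ` C \<union> (\<lambda>b. (b, \<sigma> b)) ` B"
  have BR: "B \<subseteq> carrier R" using B by (simp add: indep_def)
  show ?case
  proof (cases "tparams t \<inter> (\<lambda>b. (b, \<sigma> b)) ` B = {}")
    case True
    then have "tparams t \<subseteq> (\<lambda>c. (c, c)) ` C" using less.prems by (auto simp: cterms_def)
    then have "map_tm fst t = map_tm snd t" by (intro tm.map_cong) auto
    then show ?thesis using less.prems by simp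
  next
    case False
    then obtain b where b: "b \<in> B" "(b, \<sigma> b) \<in> tparams t" by auto
    define \<kappa> where "\<kappa> a = (if a = (b, \<sigma> b) then Var 0 else Cst a)" for a
    let ?v = "tsub \<kappa> t"
    have par: "tparams ?v \<subseteq> tparams t - {(b, \<sigma> b)}"
      by (auto simp: tparams_tsub \<kappa>_def split: if_splits)
    have parG: "tparams t \<subseteq> ?G" using less.prems by (simp add: cterms_def)
    have *: "heval (map (\<lambda>c. cval (map_tm f c)) (tpoly ?v)) (f (b, \<sigma> b)) = cval (map_tm f t)"
      if f: "f ` ?G \<subseteq> carrier R" for f
    proof -
      have fb: "f (b, \<sigma> b) \<in> carrier R" using f b(1) by auto
      have fv: "tparams (map_tm f ?v) \<subseteq> f ` ?G" using par parG by (auto simp: tm.set_map)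
      have "map (\<lambda>c. cval (map_tm f c)) (tpoly ?v) = map cval (tpoly (map_tm f ?v))"
        by (simp add: map_tpoly[symmetric])
      then have "heval (map (\<lambda>c. cval (map_tm f c)) (tpoly ?v)) (f (b, \<sigma> b)) = val M (\<lambda>_. f (b, \<sigma> b)) (map_tm f ?v)"
        using heval_tpoly[OF f fb fv] by simp
      also have "\<dots> = val M (\<lambda>_. f (b, \<sigma> b)) (tsub (\<lambda>a. map_tm f (\<kappa> a)) t)" by (simp add: map_tsub)
      also have "\<dots> = cval (map_tm (\<lambda>a. val M (\<lambda>_. f (b, \<sigma> b)) (map_tm f (\<kappa> a))) t)"
        by (rule cval_tsub[OF less.prems(1)])
      also have "(\<lambda>a. val M (\<lambda>_. f (b, \<sigma> b)) (map_tm f (\<kappa> a))) = f" by (auto simp: \<kappa>_def)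
      finally show ?thesis .
    qed
    have fG: "fst ` ?G \<subseteq> carrier R" "snd ` ?G \<subseteq> carrier R" using C BR \<sigma> by auto
    let ?S = "C \<union> (B - {b})"
    have S: "?S \<subseteq> carrier R" using C BR by auto
    have "fst ` tparams ?v \<subseteq> ?S"
    proof
      fix a assume "a \<in> fst ` tparams ?v"
      then obtain p where p: "p \<in> tparams ?v" "a = fst p" by auto
      then have "p \<in> ?G" "p \<noteq> (b, \<sigma> b)" using par parG by auto
      then show "a \<in> ?S" using p(2) by auto
    qed
    then have "set (tpoly (map_tm fst ?v)) \<subseteq> cterms ?S" by (intro tpoly_cterms) (simp add: tm.set_map)
    moreover have "heval (map cval (tpoly (map_tm fst ?v))) b = \<zero>"
      using *[OF fG(1)] less.prems(2) by (simp add: map_tpoly[symmetric] comp_def)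
    ultimately have "cval ` set (tpoly (map_tm fst ?v)) \<subseteq> {\<zero>}"
      using B b(1) BR acl_iff[OF S, of b] unfolding indep_def by blast
    then have z1: "val1 c = \<zero>" if "c \<in> set (tpoly ?v)" for c
      using that by (auto simp: map_tpoly[symmetric])
    have z2: "val2 c = \<zero>" if c: "c \<in> set (tpoly ?v)" for c
    proof (rule less.hyps)
      have "tparams c \<subseteq> tparams ?v" using c tpoly_cterms[of ?v "tparams ?v"] by (auto simp: cterms_def)
      then have sub: "tparams c \<subseteq> tparams t - {(b, \<sigma> b)}" using par by auto
      then show "card (tparams c \<inter> (\<lambda>b. (b, \<sigma> b)) ` B) < card (tparams t \<inter> (\<lambda>b. (b, \<sigma> b)) ` B)"
        using b by (intro psubset_card_mono) auto
      show "c \<in> cterms ?G" using sub parG c tpoly_cterms[of ?v "tparams ?v"] by (auto simp: cterms_def)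
      show "val1 c = \<zero>" by (rule z1[OF c])
    qed
    have "\<sigma> b \<in> carrier R" using \<sigma> b(1) by auto
    then have "heval (map val2 cs) (\<sigma> b) = \<zero>" if "\<And>c. c \<in> set cs \<Longrightarrow> val2 c = \<zero>" for cs
      using that by (induction cs) auto
    then have "heval (map val2 (tpoly ?v)) (\<sigma> b) = \<zero>" using z2 by blast
    then show ?thesis using *[OF fG(2)] by simp
  qed
qed

lemma pisom_independent:
  assumes C: "C \<subseteq> carrier R" and B: "indep C B" and \<sigma>: "inj_on \<sigma> B" "indep C (\<sigma> ` B)"
  shows "pisom ((\<lambda>c. (c, c)) ` C \<union> (\<lambda>b. (b, \<sigma> b)) ` B)" (is "pisom ?G")
  unfolding pisom_def
proof (intro conjI ballI iffI)
  have R: "B \<subseteq> carrier R" "\<sigma> ` B \<subseteq> carrier R" using B \<sigma>(2) by (auto simp: indep_def)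
  then show "?G \<subseteq> carrier R \<times> carrier R" using C by auto
  fix t assume t: "t \<in> cterms ?G"
  show "val2 t = \<zero>" if "val1 t = \<zero>" by (rule pisom_independent_aux[OF C B R(2) t that])
  assume v2: "val2 t = \<zero>"
  let ?\<rho> = "inv_into B \<sigma>"
  have \<rho>: "?\<rho> (\<sigma> b) = b" if "b \<in> B" for b using that \<sigma>(1) by simp
  have "prod.swap ` ?G \<subseteq> (\<lambda>c. (c, c)) ` C \<union> (\<lambda>b. (b, ?\<rho> b)) ` \<sigma> ` B" using \<rho> by force
  then have "map_tm prod.swap t \<in> cterms ((\<lambda>c. (c, c)) ` C \<union> (\<lambda>b. (b, ?\<rho> b)) ` \<sigma> ` B)"
    using map_cterms[OF t, of prod.swap] cterms_mono by blast
  moreover have "?\<rho> ` \<sigma> ` B \<subseteq> carrier R" using \<rho> R(1) by auto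
  ultimately have "val1 (map_tm prod.swap t) = \<zero> \<Longrightarrow> val2 (map_tm prod.swap t) = \<zero>"
    using pisom_independent_aux[OF C \<sigma>(2)] by blast
  then show "val1 t = \<zero>" using v2 by simp
qed

end

section \<open>Maximal partial isomorphisms and automorphisms\<close>

primrec tpow :: "'a tm \<Rightarrow> nat \<Rightarrow> 'a tm" where
  "tpow s 0 = TOne"
| "tpow s (Suc n) = TMul s (tpow s n)"

text \<open>The value at \<open>1 / s\<close> of the polynomial with coefficients \<open>cs\<close>, up to a power of \<open>s\<close>.\<close>

primrec thom :: "'a tm \<Rightarrow> 'a tm list \<Rightarrow> 'a tm" where
  "thom s [] = TZero"
| "thom s (c # cs) = TAdd (TMul c (tpow s (length cs))) (thom s cs)"

lemma map_tpow: "map_tm f (tpow s n) = tpow (map_tm f s) n"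
  by (induction n) auto

lemma map_thom: "map_tm f (thom s cs) = thom (map_tm f s) (map (map_tm f) cs)"
  by (induction cs) (auto simp: map_tpow)

lemma tpow_cterms: "s \<in> cterms S \<Longrightarrow> tpow s n \<in> cterms S"
  by (induction n) auto

lemma thom_cterms: "s \<in> cterms S \<Longrightarrow> set cs \<subseteq> cterms S \<Longrightarrow> thom s cs \<in> cterms S"
  by (induction cs) (auto intro: tpow_cterms)

context acf
begin

lemma cval_tpow: "S \<subseteq> carrier R \<Longrightarrow> s \<in> cterms S \<Longrightarrow> cval (tpow s n) = cval s [^] n"
  by (induction n) (auto simp: m_comm)

lemma heval_thom:
  assumes S: "S \<subseteq> carrier R" and s: "s \<in> cterms S" "cval s \<noteq> \<zero>" and cs: "set cs \<subseteq> cterms S"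
  shows "heval (map cval cs) (inv (cval s)) = \<zero> \<longleftrightarrow> cval (thom s cs) = \<zero>"
proof -
  have sR: "cval s \<in> carrier R" using S s by simp
  then have su: "cval s \<in> Units R" using s(2) field_Units by simp
  then have iR: "inv (cval s) \<in> carrier R" by simp
  \<comment> \<open>The extra factor \<open>cval s\<close> on the right avoids the exponent
    \<open>length cs - 1\<close> and so covers the empty list.\<close>
  have "cval s [^] length cs \<otimes> heval (map cval cs) (inv (cval s)) = cval s \<otimes> cval (thom s cs)"
    using cs
  proof (induction cs)
    case Nil
    then show ?case using sR by simp
  next
    case (Cons c cs)
    let ?h = "heval (map cval cs) (inv (cval s))" and ?p = "cval s [^] length cs"
    have cl: "cval c \<in> carrier R" "?h \<in> carrier R" "?p \<in> carrier R" "cval (thom s cs) \<in> carrier R"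
      using Cons.prems S sR iR cvals_closed[of cs S] thom_cterms[OF s(1), of cs] by auto
    have "cval s [^] length (c # cs) \<otimes> heval (map cval (c # cs)) (inv (cval s)) =
        (?p \<otimes> cval s) \<otimes> (cval c \<oplus> inv (cval s) \<otimes> ?h)" by simp
    also have "\<dots> = cval s \<otimes> (cval c \<otimes> ?p) \<oplus> ?p \<otimes> (cval s \<otimes> inv (cval s)) \<otimes> ?h"
      using cl sR iR by (simp add: r_distr m_ac)
    also have "\<dots> = cval s \<otimes> (cval c \<otimes> ?p) \<oplus> ?p \<otimes> ?h" using su cl by simp
    also have "\<dots> = cval s \<otimes> (cval c \<otimes> ?p) \<oplus> cval s \<otimes> cval (thom s cs)" using Cons by simp
    also have "\<dots> = cval s \<otimes> cval (thom s (c # cs))"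
      using cl sR by (simp add: r_distr cval_tpow[OF S s(1)])
    finally show ?case .
  qed
  moreover have "cval (thom s cs) \<in> carrier R" "heval (map cval cs) (inv (cval s)) \<in> carrier R"
    using thom_cterms[OF s(1) cs] S cvals_closed[OF cs S] iR by auto
  moreover have "cval s [^] length cs \<noteq> \<zero>" using su sR Units_pow_closed[OF su] field_Units by simp
  ultimately show ?thesis using sR s(2) integral_iff[of "cval s" "cval (thom s cs)"]
      integral_iff[of "cval s [^] length cs"] by auto
qed

text \<open>A polynomial over \<open>G\<close> evaluated at the value of \<open>t\<close> is itself
  a closed term over \<open>G\<close>, so adding the pair of values imposes no new
  condition.\<close>

lemma pisom_cval_closed:
  assumes G: "pisom G" and max: "\<And>x y. pisom (insert (x, y) G) \<Longrightarrow> (x, y) \<in> G"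
    and t: "t \<in> cterms G"
  shows "(val1 t, val2 t) \<in> G"
proof -
  have GR: "G \<subseteq> carrier R \<times> carrier R" using G by (simp add: pisom_def)
  define H where "H cs = foldr (\<lambda>c u. TAdd c (TMul t u)) cs TZero" for cs
  have H: "set cs \<subseteq> cterms G \<Longrightarrow> H cs \<in> cterms G" for cs
    using t by (induction cs) (auto simp: H_def)
  have v: "val1 (H cs) = heval (map val1 cs) (val1 t)" "val2 (H cs) = heval (map val2 cs) (val2 t)" for cs
    by (induction cs) (auto simp: H_def)
  show ?thesis
  proof (rule max, rule pisom_insert[OF G])
    show "val1 t \<in> carrier R" "val2 t \<in> carrier R" using val12_closed[OF GR t] by auto
    fix cs assume "set cs \<subseteq> cterms G"
    then show "heval (map val1 cs) (val1 t) = \<zero> \<longleftrightarrow> heval (map val2 cs) (val2 t) = \<zero>"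
      unfolding v[symmetric] using H G by (auto simp: pisom_def)
  qed
qed

lemma pisom_single_valued: "pisom G \<Longrightarrow> (a, b) \<in> G \<Longrightarrow> (a, c) \<in> G \<Longrightarrow> b = c"
proof -
  assume G: "pisom G" "(a, b) \<in> G" "(a, c) \<in> G"
  then have R: "a \<in> carrier R" "b \<in> carrier R" "c \<in> carrier R" by (auto simp: pisom_def)
  let ?t = "TAdd (Cst (a, b)) (TMinus (Cst (a, c)))"
  have "val1 ?t = \<zero> \<longleftrightarrow> val2 ?t = \<zero>" using G unfolding pisom_def by (metis cterms_simps(1,4,6))
  then have "b \<oplus> \<ominus> c = \<zero>" using R by (simp add: r_neg)
  then show "b = c" using R by (metis add.inv_closed local.minus_minus minus_equality)
qed

text \<open>The domain K of a maximal partial isomorphism is a field. An element x algebraic over K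
  can be sent to any root y of the transported minimal polynomial: a polynomial vanishing at x is a
  multiple of the minimal polynomial, which is an identity between coefficients and is transported;
  a value that is nonzero at x has an inverse that is again a polynomial in x, and this relation is
  transported too.\<close>

lemma pisom_algebraic:
  assumes G: "pisom G" and max: "\<And>x y. pisom (insert (x, y) G) \<Longrightarrow> (x, y) \<in> G"
  shows "acl (Domain G) \<subseteq> Domain G"
proof
  fix x assume x: "x \<in> acl (Domain G)"
  let ?K = "Domain G"
  have GR: "G \<subseteq> carrier R \<times> carrier R" using G by (simp add: pisom_def)
  then have KR: "?K \<subseteq> carrier R" by auto
  have closed: "(val1 t, val2 t) \<in> G" if "t \<in> cterms G" for t
    by (rule pisom_cval_closed[OF G max that])
  have inv_K: "inv s \<in> ?K" if s: "s \<in> ?K" "s \<noteq> \<zero>" for s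
  proof -
    obtain s' where s': "(s, s') \<in> G" using s(1) by auto
    have t: "Cst (s, s') \<in> cterms G" using s' by simp
    have "val1 (Cst (s, s')) = \<zero> \<longleftrightarrow> val2 (Cst (s, s')) = \<zero>" using G t unfolding pisom_def by blast
    then have "s' \<noteq> \<zero>" using s(2) by simp
    have R: "s \<in> carrier R" "s' \<in> carrier R" using s' GR by auto
    \<comment> \<open>A polynomial in the inverse of s is cleared of denominators by
      \<open>thom\<close> and becomes a closed term over \<open>G\<close>.\<close>
    have "pisom (insert (inv s, inv s') G)"
    proof (rule pisom_insert[OF G])
      show "inv s \<in> carrier R" "inv s' \<in> carrier R"
        using R s(2) \<open>s' \<noteq> \<zero>\<close> field_Units by auto
      fix cs assume cs: "set cs \<subseteq> cterms G"
      have *: "heval (map (\<lambda>c. cval (map_tm f c)) cs) (inv (f (s, s'))) = \<zero> \<longleftrightarrow>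
          cval (map_tm f (thom (Cst (s, s')) cs)) = \<zero>"
        if f: "f ` G \<subseteq> carrier R" "f (s, s') \<noteq> \<zero>" for f
      proof -
        have "Cst (f (s, s')) \<in> cterms (f ` G)" using s' by simp
        moreover have "set (map (map_tm f) cs) \<subseteq> cterms (f ` G)" using cs map_cterms by auto
        ultimately show ?thesis
          using heval_thom[OF f(1), of "Cst (f (s, s'))" "map (map_tm f) cs"] f(2)
          by (simp add: map_thom comp_def)
      qed
      have "thom (Cst (s, s')) cs \<in> cterms G" using thom_cterms[OF t cs] .
      then have "val1 (thom (Cst (s, s')) cs) = \<zero> \<longleftrightarrow> val2 (thom (Cst (s, s')) cs) = \<zero>"
        using G by (auto simp: pisom_def)
      moreover have "fst ` G \<subseteq> carrier R" "snd ` G \<subseteq> carrier R" using GR by auto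
      ultimately show "heval (map val1 cs) (inv s) = \<zero> \<longleftrightarrow> heval (map val2 cs) (inv s') = \<zero>"
        using *[of fst] *[of snd] s(2) \<open>s' \<noteq> \<zero>\<close> by simp
    qed
    then show ?thesis using max by blast
  qed
  have K: "subfield ?K R"
  proof (rule subfieldI')
    show "subring ?K R"
    proof (rule subringI)
      show "\<one> \<in> ?K" using closed[of TOne] by auto
      show "\<ominus> h \<in> ?K" if h: "h \<in> ?K" for h
      proof -
        obtain h' where "(h, h') \<in> G" using h by auto
        then have "(minus_of M h, minus_of M h') \<in> G" "h \<in> carrier R"
          using closed[of "TMinus (Cst (h, h'))"] GR by auto
        then show ?thesis by auto
      qed
      fix h1 h2 assume "h1 \<in> ?K" "h2 \<in> ?K"
      then obtain h1' h2' where "(h1, h1') \<in> G" "(h2, h2') \<in> G" by auto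
      then show "h1 \<oplus> h2 \<in> ?K" "h1 \<otimes> h2 \<in> ?K"
        using closed[of "TAdd (Cst (h1, h1')) (Cst (h2, h2'))"]
          closed[of "TMul (Cst (h1, h1')) (Cst (h2, h2'))"] by auto
    qed (use KR in auto)
  qed (use inv_K in auto)
  note Kr = subfieldE(1)[OF K]
  have xR: "x \<in> carrier R" and alg: "(algebraic over ?K) x"
    using x by (auto simp: acl_def generate_field_subfield[OF K])
  \<comment> \<open>The partial isomorphism as a function; \<open>L\<close> below writes a list of
    elements of K as constants that are pairs in \<open>G\<close>.\<close>
  define g where "g k = (SOME k'. (k, k') \<in> G)" for k
  have g: "(k, g k) \<in> G" if "k \<in> ?K" for k
    using that unfolding g_def by (metis DomainE someI_ex)
  have g_eq: "(k, k') \<in> G \<Longrightarrow> k' = g k" for k k'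
    using pisom_single_valued[OF G] g by blast
  define L where "L ks = map (\<lambda>k. Cst (k, g k)) ks" for ks
  have L: "set ks \<subseteq> ?K \<Longrightarrow> set (L ks) \<subseteq> cterms G" for ks by (auto simp: L_def intro!: g)
  have L1: "map val1 (L ks) = ks" for ks by (induction ks) (auto simp: L_def)
  have L2: "map val2 (L ks) = map g ks" for ks by (induction ks) (auto simp: L_def)
  note I = IrrE[OF K xR alg]
  have set_p: "set (Irr ?K x) \<subseteq> ?K"
    using I(1) by (auto simp: univ_poly_carrier[symmetric] polynomial_def)
  have deg: "degree (Irr ?K x) \<ge> 1" by (rule pirreducible_degree[OF K I(1,2)])
  then obtain ps where ps: "Irr ?K x = \<one> # ps" "ps \<noteq> []"
    using I(3) by (cases "Irr ?K x") fastforce+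
  have gR: "set (map g ks) \<subseteq> carrier R" if "set ks \<subseteq> ?K" for ks
  proof
    fix z assume "z \<in> set (map g ks)"
    then obtain k where "k \<in> set ks" "z = g k" by auto
    then have "(k, z) \<in> G" using g that by blast
    then show "z \<in> carrier R" using GR by blast
  qed
  obtain y where y: "y \<in> carrier R" "eval (\<one> # map g ps) y = \<zero>"
    using root_exists[of "map g ps"] gR[of ps] set_p ps by auto
  have "g \<one> = \<one>" using closed[of TOne] g_eq[of \<one> \<one>] by simp
  then have y0: "heval (map g (rev (Irr ?K x))) y = \<zero>"
    using y gR[OF set_p] by (subst heval_eval) (auto simp: rev_map ps(1))
  let ?h1 = "\<lambda>cs. heval (map cval (map (map_tm fst) cs))" and ?h2 = "\<lambda>cs. heval (map cval (map (map_tm snd) cs))"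
  have h: "?h1 cs = heval (map val1 cs)" "?h2 cs = heval (map val2 cs)" for cs by (simp_all add: comp_def)
  have c1: "set cs \<subseteq> cterms G \<Longrightarrow> set (map (map_tm fst) cs) \<subseteq> cterms ?K" for cs
    using map_cterms[of _ G fst] by (auto simp: fst_eq_Domain)
  have c2: "set cs \<subseteq> cterms G \<Longrightarrow> set (map (map_tm snd) cs) \<subseteq> cterms (Range G)" for cs
    using map_cterms[of _ G snd] by (auto simp: snd_eq_Range)
  have RR: "Range G \<subseteq> carrier R" using GR by auto
  have add: "?h1 (tpadd cs ds) z = ?h1 cs z \<oplus> ?h1 ds z" "?h2 (tpadd cs ds) z = ?h2 cs z \<oplus> ?h2 ds z"
    if "set cs \<subseteq> cterms G" "set ds \<subseteq> cterms G" "z \<in> carrier R" for cs ds z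
    unfolding map_tpadd
    by (rule heval_tpadd[OF KR that(3) c1[OF that(1)] c1[OF that(2)]],
        rule heval_tpadd[OF RR that(3) c2[OF that(1)] c2[OF that(2)]])
  have mul: "?h1 (tpmul cs ds) z = ?h1 cs z \<otimes> ?h1 ds z" "?h2 (tpmul cs ds) z = ?h2 cs z \<otimes> ?h2 ds z"
    if "set cs \<subseteq> cterms G" "set ds \<subseteq> cterms G" "z \<in> carrier R" for cs ds z
    unfolding map_tpmul
    by (rule heval_tpmul[OF KR that(3) c1[OF that(1)] c1[OF that(2)]],
        rule heval_tpmul[OF RR that(3) c2[OF that(1)] c2[OF that(2)]])
  have hR: "?h1 cs z \<in> carrier R" "?h2 cs z \<in> carrier R" if "set cs \<subseteq> cterms G" "z \<in> carrier R" for cs z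
    using cvals_closed[OF c1[OF that(1)] KR] cvals_closed[OF c2[OF that(1)] RR] that(2) by auto
  have poly: "\<exists>q. q \<in> carrier (?K[X]) \<and> (\<forall>z\<in>carrier R. eval q z = ?h1 cs z)" if cs: "set cs \<subseteq> cterms G" for cs
  proof -
    have sub: "set (map val1 cs) \<subseteq> ?K" using cs closed by force
    let ?q = "normalize (rev (map val1 cs))"
    have "?q \<in> carrier (?K[X])"
      using normalize_gives_polynomial[of "rev (map val1 cs)" ?K] sub by (simp add: univ_poly_carrier)
    moreover have "eval ?q z = ?h1 cs z" if "z \<in> carrier R" for z
      using that sub KR unfolding h by (subst eval_normalize) (auto simp: heval_eval)
    ultimately show ?thesis by blast
  qed
  have list: "\<exists>w. set w \<subseteq> cterms G \<and> (\<forall>z\<in>carrier R. ?h1 w z = eval q z) \<and> map val2 w = map g (rev q)"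
    if q: "q \<in> carrier (?K[X])" for q
  proof -
    have sub: "set q \<subseteq> ?K" using q by (auto simp: univ_poly_carrier[symmetric] polynomial_def)
    have "?h1 (L (rev q)) z = eval q z" if "z \<in> carrier R" for z
      unfolding h L1 using that sub KR by (subst heval_eval) auto
    then show ?thesis using L[of "rev q"] sub L2 by (intro exI[of _ "L (rev q)"]) auto
  qed
  have fwd: "?h2 cs y = \<zero>" if cs: "set cs \<subseteq> cterms G" and x0: "?h1 cs x = \<zero>" for cs
  proof -
    obtain q where q: "q \<in> carrier (?K[X])" "\<And>z. z \<in> carrier R \<Longrightarrow> eval q z = ?h1 cs z"
      using poly[OF cs] by auto
    have "eval q x = \<zero>" using q(2) xR x0 by simp
    then have "(Irr ?K x) pdivides q" by (rule Irr_minimal[OF K xR alg q(1)])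
    then obtain w where w: "w \<in> carrier (?K[X])" "q = Irr ?K x \<otimes>\<^bsub>?K[X]\<^esub> w"
      using q(1) I(1) pdivides_iff_shell[OF K I(1) q(1)] by (auto elim: dividesE)
    have ev: "eval q z = eval (Irr ?K x) z \<otimes> eval w z" if "z \<in> carrier R" for z
      unfolding w(2) using ring_hom_mult[OF ring_hom_ring.homh[OF eval_ring_hom[OF Kr that]] I(1) w(1)] .
    obtain P where P: "set P \<subseteq> cterms G" "\<And>z. z \<in> carrier R \<Longrightarrow> ?h1 P z = eval (Irr ?K x) z"
      "map val2 P = map g (rev (Irr ?K x))" using list[OF I(1)] by auto
    obtain W where W: "set W \<subseteq> cterms G" "\<And>z. z \<in> carrier R \<Longrightarrow> ?h1 W z = eval w z"
      using list[OF w(1)] by auto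
    \<comment> \<open>Minus the product of the minimal polynomial and the cofactor, so
      \<open>tpadd cs ?N\<close> vanishes at every point. Its coefficients are therefore zero; they
      are closed terms, and \<open>G\<close> preserves their vanishing.\<close>
    let ?N = "tpmul [TMinus TOne] (tpmul P W)"
    have PW: "set (tpmul P W) \<subseteq> cterms G" by (rule tpmul_cterms[OF P(1) W(1)])
    then have N: "set ?N \<subseteq> cterms G" by (rule tpmul_cterms[rotated]) simp
    have hN: "?h1 ?N z = \<ominus> (?h1 P z \<otimes> ?h1 W z)" "?h2 ?N z = \<ominus> (?h2 P z \<otimes> ?h2 W z)" if z: "z \<in> carrier R" for z
    proof -
      have "?h1 [TMinus TOne] z = \<ominus> \<one>" "?h2 [TMinus TOne] z = \<ominus> \<one>" using z by simp_all
      moreover have "set [TMinus TOne] \<subseteq> cterms G" by simp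
      ultimately show "?h1 ?N z = \<ominus> (?h1 P z \<otimes> ?h1 W z)" "?h2 ?N z = \<ominus> (?h2 P z \<otimes> ?h2 W z)"
        using mul[OF _ PW z, of "[TMinus TOne]"] mul[OF P(1) W(1) z] hR[OF P(1) z] hR[OF W(1) z]
        by (auto simp: l_minus)
    qed
    let ?Z = "tpadd cs ?N"
    have Z: "set ?Z \<subseteq> cterms G" by (rule tpadd_cterms[OF cs N])
    have "?h1 ?Z z = \<zero>" if z: "z \<in> carrier R" for z
      using add(1)[OF cs N z] hN(1)[OF z] q(2)[OF z] ev[OF z] P(2)[OF z] W(2)[OF z] hR[OF cs z]
      by (simp add: r_neg)
    then have "{z \<in> carrier R. ?h1 ?Z z = \<zero>} = carrier R" by auto
    then have "set (map cval (map (map_tm fst) ?Z)) \<subseteq> {\<zero>}"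
      using infinite_carrier by (intro infinite_zeros cvals_closed[OF c1[OF Z] KR]) simp
    then have "val1 c = \<zero>" if "c \<in> set ?Z" for c using that by auto
    then have "val2 c = \<zero>" if "c \<in> set ?Z" for c using that Z G unfolding pisom_def by blast
    moreover have "heval (map val2 ds) y = \<zero>" if "\<And>c. c \<in> set ds \<Longrightarrow> val2 c = \<zero>" for ds
      using that y(1) by (induction ds) auto
    ultimately have "?h2 ?Z y = \<zero>" unfolding h by blast
    moreover have "?h2 P y = \<zero>" unfolding h P(3) by (rule y0)
    ultimately show ?thesis
      using add(2)[OF cs N y(1)] hN(2)[OF y(1)] hR(2)[OF cs y(1)] hR(2)[OF W(1) y(1)] by simp
  qed
  have "pisom (insert (x, y) G)"
  proof (rule pisom_insert[OF G xR y(1)])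
    fix cs assume cs: "set cs \<subseteq> cterms G"
    show "heval (map val1 cs) x = \<zero> \<longleftrightarrow> heval (map val2 cs) y = \<zero>"
    proof
      assume "heval (map val1 cs) x = \<zero>"
      then show "heval (map val2 cs) y = \<zero>" using fwd[OF cs] unfolding h by blast
    next
      assume y2: "heval (map val2 cs) y = \<zero>"
      show "heval (map val1 cs) x = \<zero>"
      proof (rule ccontr)
        assume nz: "heval (map val1 cs) x \<noteq> \<zero>"
        let ?E = "simple_extension ?K x" and ?a = "?h1 cs x"
        have E: "subfield ?E R" using simple_extension_is_subfield[OF K xR] alg by simp
        obtain q where q: "q \<in> carrier (?K[X])" "eval q x = ?a" using poly[OF cs] xR by auto
        then have "?a \<in> ?E" unfolding simple_extension_as_eval_img[OF KR xR] by force
        then have a: "?a \<in> ?E - {\<zero>}" using nz unfolding h by simp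
        have "inv ?a \<in> ?E" "inv ?a \<otimes> ?a = \<one>" using subfield_m_inv[OF E a] by auto
        then obtain w where w: "w \<in> carrier (?K[X])" "inv ?a = eval w x"
          unfolding simple_extension_as_eval_img[OF KR xR] by auto
        obtain W where W: "set W \<subseteq> cterms G" "?h1 W x = eval w x" using list[OF w(1)] xR by auto
        \<comment> \<open>At x, \<open>W\<close> is inverse to the value of \<open>cs\<close>, so
          this polynomial vanishes there; if \<open>cs\<close> vanished at y, its transport would
          have the value -1.\<close>
        let ?Z = "tpadd (tpmul W cs) [TMinus TOne]"
        have Wc: "set (tpmul W cs) \<subseteq> cterms G" by (rule tpmul_cterms[OF W(1) cs])
        have 1: "set [TMinus TOne] \<subseteq> cterms G" by simp
        have "?h1 ?Z x = \<zero>"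
          using add(1)[OF Wc 1 xR] mul(1)[OF W(1) cs xR] W(2) w(2) \<open>inv ?a \<otimes> ?a = \<one>\<close> xR
          by (simp add: r_neg)
        then have "?h2 ?Z y = \<zero>" by (rule fwd[OF tpadd_cterms[OF Wc 1]])
        then have "\<ominus> \<one> = \<zero>"
          using add(2)[OF Wc 1 y(1)] mul(2)[OF W(1) cs y(1)] y2 hR(2)[OF W(1) y(1)] y(1) unfolding h by simp
        then show False by simp
      qed
    qed
  qed
  then show "x \<in> ?K" using max by blast
qed

text \<open>A maximal partial isomorphism above \<open>G0\<close> has an algebraically closed domain
  containing a spanning set. The converse relation is maximal as well, which settles the
  range.\<close>

theorem automorphism_exists:
  assumes G0: "pisom G0" and dom: "acl (Domain G0) = carrier R" and ran: "acl (Range G0) = carrier R"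
  shows "\<exists>\<tau>. struct_iso {} M M \<tau> \<and> (\<forall>a b. (a, b) \<in> G0 \<longrightarrow> \<tau> a = b)"
proof -
  define A where "A = {G. pisom G \<and> G0 \<subseteq> G}"
  have "\<exists>G\<in>A. \<forall>G'\<in>A. G \<subseteq> G' \<longrightarrow> G' = G"
  proof (rule subset_Zorn_nonempty)
    show "A \<noteq> {}" using G0 by (auto simp: A_def)
    fix C assume C: "C \<noteq> {}" "subset.chain A C"
    then have CA: "\<And>G. G \<in> C \<Longrightarrow> pisom G \<and> G0 \<subseteq> G" by (auto simp: subset.chain_def A_def)
    have "pisom (\<Union>C)"
      unfolding pisom_def
    proof (intro conjI ballI)
      show "\<Union>C \<subseteq> carrier R \<times> carrier R" using CA by (fastforce simp: pisom_def)
      fix t assume t: "t \<in> cterms (\<Union>C)"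
      have "\<exists>G\<in>C. tparams t \<subseteq> G"
        using t finite_subset_Union_chain[of "tparams t" C] C by (auto simp: cterms_def subset.chain_def)
      then obtain G where "G \<in> C" "t \<in> cterms G" using t by (auto simp: cterms_def)
      then show "val1 t = \<zero> \<longleftrightarrow> val2 t = \<zero>" using CA by (auto simp: pisom_def)
    qed
    then show "\<Union>C \<in> A" using CA C(1) by (auto simp: A_def)
  qed
  then obtain G where G: "pisom G" "G0 \<subseteq> G" and max: "\<And>G'. pisom G' \<Longrightarrow> G \<subseteq> G' \<Longrightarrow> G' = G"
    unfolding A_def by (auto dest: order_trans)
  have max1: "pisom (insert (x, y) G) \<Longrightarrow> (x, y) \<in> G" for x y using max[of "insert (x, y) G"] by blast
  have GR: "G \<subseteq> carrier R \<times> carrier R" using G by (simp add: pisom_def)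
  have "acl (Domain G0) \<subseteq> acl (Domain G)" using G GR by (intro acl_mono) auto
  then have D: "Domain G = carrier R" using dom pisom_algebraic[OF G(1) max1] GR by auto
  have max2: "pisom (insert (x, y) (G\<inverse>)) \<Longrightarrow> (x, y) \<in> G\<inverse>" for x y
  proof -
    assume "pisom (insert (x, y) (G\<inverse>))"
    moreover have "(insert (x, y) (G\<inverse>))\<inverse> = insert (y, x) G" by auto
    ultimately have "pisom (insert (y, x) G)" using pisom_converse by metis
    then show ?thesis using max1 by auto
  qed
  have "acl (Range G0) \<subseteq> acl (Range G)" using G GR by (intro acl_mono) auto
  then have Ra: "Range G = carrier R" using ran pisom_algebraic[OF pisom_converse[OF G(1)] max2] GR by auto
  have "\<exists>b. (a, b) \<in> G" if "a \<in> carrier R" for a using that unfolding D[symmetric] by (rule DomainE) blast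
  then obtain \<tau> where \<tau>: "\<And>a. a \<in> carrier R \<Longrightarrow> (a, \<tau> a) \<in> G" by metis
  have \<tau>_eq: "\<tau> a = b" if "(a, b) \<in> G" for a b
  proof -
    have "a \<in> carrier R" using that GR by auto
    from pisom_single_valued[OF G(1) \<tau>[OF this] that] show ?thesis .
  qed
  have inj: "inj_on \<tau> (carrier R)"
  proof (rule inj_onI)
    fix a b assume "a \<in> carrier R" "b \<in> carrier R" "\<tau> a = \<tau> b"
    then have "(\<tau> a, a) \<in> G\<inverse>" "(\<tau> a, b) \<in> G\<inverse>" using \<tau>[of a] \<tau>[of b] by auto
    then show "a = b" by (rule pisom_single_valued[OF pisom_converse[OF G(1)]])
  qed
  have "carrier R \<subseteq> \<tau> ` carrier R"
  proof
    fix b assume "b \<in> carrier R"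
    then obtain a where a: "(a, b) \<in> G" using Ra by blast
    then show "b \<in> \<tau> ` carrier R" using \<tau>_eq[OF a] GR by auto
  qed
  moreover have "\<tau> ` carrier R \<subseteq> carrier R" using \<tau> GR by blast
  ultimately have "\<tau> ` carrier R = carrier R" by auto
  with inj have bij: "bij_betw \<tau> (carrier R) (carrier R)" by (simp add: bij_betw_def)
  have hom: "\<tau> (val1 t) = val2 t" if "t \<in> cterms G" for t
    by (rule \<tau>_eq[OF pisom_cval_closed[OF G(1) max1 that]])
  have \<tau>R: "\<tau> a \<in> carrier R" if "a \<in> carrier R" for a using \<tau>[OF that] GR by auto
  have "struct_iso {} M M \<tau>"
    unfolding struct_iso_def
  proof (intro conjI ballI)
    show "bij_betw \<tau> (Dom M) (Dom M)" using bij by simp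
    show "\<tau> (zero_of M) = zero_of M" using hom[of TZero] by simp
    show "\<tau> (one_of M) = one_of M" using hom[of TOne] by simp
    fix a assume a: "a \<in> Dom M"
    show "\<tau> (minus_of M a) = minus_of M (\<tau> a)"
      using hom[of "TMinus (Cst (a, \<tau> a))"] a \<tau> by simp
    fix b assume b: "b \<in> Dom M"
    show "\<tau> (add_of M a b) = add_of M (\<tau> a) (\<tau> b)"
      using hom[of "TAdd (Cst (a, \<tau> a)) (Cst (b, \<tau> b))"] a b \<tau> by simp
    show "\<tau> (mul_of M a b) = mul_of M (\<tau> a) (\<tau> b)"
      using hom[of "TMul (Cst (a, \<tau> a)) (Cst (b, \<tau> b))"] a b \<tau> by simp
  qed auto
  then show ?thesis using \<tau>_eq G(2) by (intro exI[of _ \<tau>]) auto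
qed

lemma is_struct_empty: "is_struct {} M"
  by (simp add: is_struct_def)

lemma automorphism_inv:
  assumes "struct_iso {} M M \<tau>"
  shows "struct_iso {} M M (inv_into (carrier R) \<tau>)"
proof -
  let ?\<rho> = "inv_into (carrier R) \<tau>"
  have bij: "bij_betw \<tau> (carrier R) (carrier R)" using assms by (simp add: struct_iso_def)
  have \<rho>: "?\<rho> a \<in> carrier R" "\<tau> (?\<rho> a) = a" if "a \<in> carrier R" for a
    using bij_betw_apply[OF bij_betw_inv_into[OF bij] that] bij_betw_inv_into_right[OF bij that] by auto
  have inj: "a = b" if "\<tau> a = \<tau> b" "a \<in> carrier R" "b \<in> carrier R" for a b
    using bij that by (auto simp: bij_betw_def inj_on_def)
  have c: "\<tau> \<zero> = \<zero>" "\<tau> \<one> = \<one>" using assms by (auto simp: struct_iso_def)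
  have h: "\<tau> (a \<oplus> b) = \<tau> a \<oplus> \<tau> b" "\<tau> (a \<otimes> b) = \<tau> a \<otimes> \<tau> b" "\<tau> (\<ominus> a) = minus_of M (\<tau> a)"
    if "a \<in> carrier R" "b \<in> carrier R" for a b using assms that by (auto simp: struct_iso_def)
  show ?thesis
    unfolding struct_iso_def Dom_R zero_R one_R add_R mul_R
  proof (intro conjI ballI)
    show "bij_betw ?\<rho> (carrier R) (carrier R)" by (rule bij_betw_inv_into[OF bij])
    show "?\<rho> \<zero> = \<zero>" using \<rho>[of \<zero>] c by - (rule inj, simp_all)
    show "?\<rho> \<one> = \<one>" using \<rho>[of \<one>] c by - (rule inj, simp_all)
    fix a assume a: "a \<in> carrier R"
    show "?\<rho> (minus_of M a) = minus_of M (?\<rho> a)"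
      using \<rho>[OF a] \<rho>[of "\<ominus> a"] a h(3)[of "?\<rho> a" \<zero>] by - (rule inj, simp_all)
    fix b assume b: "b \<in> carrier R"
    show "?\<rho> (a \<oplus> b) = ?\<rho> a \<oplus> ?\<rho> b"
      using \<rho>[OF a] \<rho>[OF b] \<rho>[of "a \<oplus> b"] a b h(1)[of "?\<rho> a" "?\<rho> b"] by - (rule inj, simp_all)
    show "?\<rho> (a \<otimes> b) = ?\<rho> a \<otimes> ?\<rho> b"
      using \<rho>[OF a] \<rho>[OF b] \<rho>[of "a \<otimes> b"] a b h(2)[of "?\<rho> a" "?\<rho> b"] by - (rule inj, simp_all)
  qed auto
qed

text \<open>One inclusion moves the term and the point of nonvanishing from
  \<open>acl_iff_tm\<close> along the automorphism; the other is the same inclusion for its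
  inverse.\<close>

lemma automorphism_acl:
  assumes "struct_iso {} M M \<tau>" and S: "S \<subseteq> carrier R"
  shows "\<tau> ` acl S = acl (\<tau> ` S)"
proof -
  have sub: "\<tau> ` acl S \<subseteq> acl (\<tau> ` S)" if iso: "struct_iso {} M M \<tau>" and S: "S \<subseteq> carrier R" for \<tau> S
  proof
    fix z assume "z \<in> \<tau> ` acl S"
    then obtain x where x: "x \<in> acl S" "z = \<tau> x" by auto
    have \<tau>R: "\<tau> a \<in> carrier R" if "a \<in> carrier R" for a
      using iso that by (auto simp: struct_iso_def dest: bij_betw_apply)
    have inj: "a = b" if "\<tau> a = \<tau> b" "a \<in> carrier R" "b \<in> carrier R" for a b
      using iso that by (auto simp: bij_betw_def inj_on_def struct_iso_def)
    have \<tau>0: "\<tau> \<zero> = \<zero>" using iso by (auto simp: struct_iso_def)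
    obtain t y where t: "x \<in> carrier R" "tparams t \<subseteq> S" "val M (\<lambda>_. x) t = \<zero>" "y \<in> carrier R" "val M (\<lambda>_. y) t \<noteq> \<zero>"
      using x(1) acl_iff_tm[OF S] by blast
    have v: "val M (\<lambda>_. \<tau> u) (map_tm \<tau> t) = \<tau> (val M (\<lambda>_. u) t)" if "u \<in> carrier R" for u
      using val_iso[OF is_struct_empty iso, of "\<lambda>_. u" t] that t(2) S by (simp add: assignments_def image_subset_iff subset_trans)
    have "val M (\<lambda>_. y) t \<in> carrier R" using t S by (intro val_closed) auto
    then have "val M (\<lambda>_. \<tau> y) (map_tm \<tau> t) \<noteq> \<zero>"
      using v[OF t(4)] inj[of "val M (\<lambda>_. y) t" \<zero>] t(5) \<tau>0 by auto
    moreover have "val M (\<lambda>_. \<tau> x) (map_tm \<tau> t) = \<zero>" using v[OF t(1)] t(3) \<tau>0 by simp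
    moreover have "tparams (map_tm \<tau> t) \<subseteq> \<tau> ` S" using t(2) by (auto simp: tm.set_map)
    moreover have "\<tau> ` S \<subseteq> carrier R" using S \<tau>R by auto
    ultimately show "z \<in> acl (\<tau> ` S)" using acl_iff_tm[of "\<tau> ` S" z] x(2) \<tau>R t(1,4) by blast
  qed
  let ?\<rho> = "inv_into (carrier R) \<tau>"
  have bij: "bij_betw \<tau> (carrier R) (carrier R)" using assms by (simp add: struct_iso_def)
  have \<tau>S: "\<tau> ` S \<subseteq> carrier R" using S bij by (auto simp: bij_betw_def)
  have "?\<rho> ` \<tau> ` S = S" using S bij by (intro inv_into_image_cancel) (auto simp: bij_betw_def)
  then have "?\<rho> ` acl (\<tau> ` S) \<subseteq> acl S" using sub[OF automorphism_inv[OF assms(1)] \<tau>S] by simp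
  then have "\<tau> ` ?\<rho> ` acl (\<tau> ` S) \<subseteq> \<tau> ` acl S" by blast
  moreover have "\<tau> ` ?\<rho> ` acl (\<tau> ` S) = acl (\<tau> ` S)"
    using bij acl_carrier[of "\<tau> ` S"] by (intro image_inv_into_cancel) (auto simp: bij_betw_def)
  ultimately show ?thesis using sub[OF assms] by auto
qed

end

subsection \<open>Models of \<open>ACF\<^sup>I\<close>\<close>

definition acf_chain :: "'i set \<Rightarrow> 'i rel \<Rightarrow> ('i, 'a) struct \<Rightarrow> bool" where
  "acf_chain I r M \<longleftrightarrow> is_struct I M \<and> acf (ring_of M) M \<and>
     (\<forall>i\<in>I. subfield (pred_of M i) (ring_of M) \<and> acf.root_closed (ring_of M) (pred_of M i) \<and>
        pred_of M i \<noteq> Dom M) \<and>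
     (\<forall>i\<in>I. \<forall>j\<in>I. (i, j) \<in> r \<and> i \<noteq> j \<longrightarrow> pred_of M i \<subset> pred_of M j)"

lemma acf_chain_mono: "acf_chain I r M \<Longrightarrow> J \<subseteq> I \<Longrightarrow> acf_chain J r M"
  unfolding acf_chain_def using is_struct_mono by blast

lemma sat_FAlls:
  "sat M e (FAlls n \<phi>) \<Longrightarrow> (\<And>v. v \<in> {1..n} \<Longrightarrow> e' v \<in> Dom M) \<Longrightarrow> (\<And>v. v \<notin> {1..n} \<Longrightarrow> e' v = e v) \<Longrightarrow>
    sat M e' \<phi>"
proof (induction n arbitrary: \<phi> e')
  case 0
  then have "e' = e" by auto
  then show ?case using 0 by simp
next
  case (Suc n)
  \<comment> \<open>The induction hypothesis lets only the variables 1 to n differ from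
    \<open>e\<close>, so variable \<open>Suc n\<close> is first reset and then changed by the
    innermost quantifier.\<close>
  have "sat M (e'(Suc n := e (Suc n))) (FAll (Suc n) \<phi>)"
  proof (rule Suc.IH)
    show "sat M e (FAlls n (FAll (Suc n) \<phi>))" using Suc.prems(1) by simp
    show "(e'(Suc n := e (Suc n))) v \<in> Dom M" if "v \<in> {1..n}" for v
      using Suc.prems(2)[of v] that by simp
    show "(e'(Suc n := e (Suc n))) v = e v" if "v \<notin> {1..n}" for v
    proof (cases "v = Suc n")
      case False
      then have "v \<notin> {1..Suc n}" using that by auto
      then show ?thesis using Suc.prems(3)[of v] False by simp
    qed simp
  qed
  then have "\<forall>a\<in>Dom M. sat M (e'(Suc n := e (Suc n), Suc n := a)) \<phi>" by simp
  moreover have "e' (Suc n) \<in> Dom M" using Suc.prems(2) by simp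
  ultimately have "sat M (e'(Suc n := e (Suc n), Suc n := e' (Suc n))) \<phi>" by blast
  then show ?case by simp
qed

lemma sat_FAlls_in:
  "sat M e (FAlls_in i n \<phi>) \<Longrightarrow> pred_of M i \<subseteq> Dom M \<Longrightarrow> (\<And>v. v \<in> {1..n} \<Longrightarrow> e' v \<in> pred_of M i) \<Longrightarrow>
    (\<And>v. v \<notin> {1..n} \<Longrightarrow> e' v = e v) \<Longrightarrow> sat M e' \<phi>"
proof (induction n arbitrary: \<phi> e')
  case 0
  then have "e' = e" by auto
  then show ?case using 0 by simp
next
  case (Suc n)
  have "sat M (e'(Suc n := e (Suc n))) (FAll (Suc n) (FImp (FPred i (Var (Suc n))) \<phi>))"
  proof (rule Suc.IH)
    show "sat M e (FAlls_in i n (FAll (Suc n) (FImp (FPred i (Var (Suc n))) \<phi>)))" using Suc.prems(1) by simp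
    show "pred_of M i \<subseteq> Dom M" by (rule Suc.prems(2))
    show "(e'(Suc n := e (Suc n))) v \<in> pred_of M i" if "v \<in> {1..n}" for v
      using Suc.prems(3)[of v] that by simp
    show "(e'(Suc n := e (Suc n))) v = e v" if "v \<notin> {1..n}" for v
    proof (cases "v = Suc n")
      case False
      then have "v \<notin> {1..Suc n}" using that by auto
      then show ?thesis using Suc.prems(4)[of v] False by simp
    qed simp
  qed
  then have "\<forall>a\<in>Dom M. a \<in> pred_of M i \<longrightarrow> sat M (e'(Suc n := e (Suc n), Suc n := a)) \<phi>" by simp
  moreover have "e' (Suc n) \<in> pred_of M i" using Suc.prems(3) by simp
  ultimately have "sat M (e'(Suc n := e (Suc n), Suc n := e' (Suc n))) \<phi>"
    using Suc.prems(2) by blast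
  then show ?case by simp
qed

lemma val_monic_tm:
  fixes M :: "('i, 'a) struct" and R (structure)
  assumes "ring R" "R = ring_of M" "\<And>v. e v \<in> carrier R" "x \<in> carrier R" "e 0 = x"
  shows "val M e (monic_tm n) = ring.eval R (\<one> # map e [1..<Suc n]) x"
proof -
  interpret ring R by (rule assms(1))
  have ops: "one_of M = \<one>" "add_of M a b = a \<oplus> b" "mul_of M a b = a \<otimes> b" for a b
    by (simp_all add: assms(2) ring_of_def)
  show ?thesis
  proof (induction n)
  case 0
  show ?case using assms(4) by (simp add: ops)
next
  case (Suc n)
  have "eval (\<one> # map e [1..<Suc (Suc n)]) x = eval ((\<one> # map e [1..<Suc n]) @ [e (Suc n)]) x" by simp
  also have "\<dots> = eval (\<one> # map e [1..<Suc n]) x \<otimes> x \<oplus> e (Suc n)"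
    using assms(3,4) by (intro eval_append_aux) auto
  finally show ?case using Suc assms(5) by (simp add: ops)
  qed
qed

lemma acf_chainI:
  assumes M: "is_struct I M" and ax: "\<And>\<phi>. \<phi> \<in> ACF_chain I r \<Longrightarrow> holds M \<phi>"
  shows "acf_chain I r M"
proof -
  let ?R = "ring_of M"
  obtain e where e: "e \<in> assignments M" using assignments_nonempty[OF M] by auto
  have sat: "sat M e \<phi>" if "\<phi> \<in> ACF_chain I r" for \<phi> using ax[OF that] e by (auto simp: holds_def)
  have cl: "zero_of M \<in> Dom M" "one_of M \<in> Dom M" "a \<in> Dom M \<Longrightarrow> minus_of M a \<in> Dom M"
    "a \<in> Dom M \<Longrightarrow> b \<in> Dom M \<Longrightarrow> add_of M a b \<in> Dom M"
    "a \<in> Dom M \<Longrightarrow> b \<in> Dom M \<Longrightarrow> mul_of M a b \<in> Dom M"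
    "i \<in> I \<Longrightarrow> pred_of M i \<subseteq> Dom M" for a b i
    using M by (auto simp: is_struct_def)
  have field: "\<forall>\<phi>\<in>Defs.field_axioms. sat M e \<phi>" using sat by (auto simp: ACF_chain_def ACF_def)
  have f: "add_of M (add_of M a b) c = add_of M a (add_of M b c)" "add_of M a b = add_of M b a"
    "add_of M a (zero_of M) = a" "add_of M a (minus_of M a) = zero_of M"
    "mul_of M (mul_of M a b) c = mul_of M a (mul_of M b c)" "mul_of M a b = mul_of M b a"
    "mul_of M a (one_of M) = a" "mul_of M a (add_of M b c) = add_of M (mul_of M a b) (mul_of M a c)"
    "zero_of M \<noteq> one_of M" "a \<noteq> zero_of M \<Longrightarrow> \<exists>b\<in>Dom M. mul_of M a b = one_of M"
    if "a \<in> Dom M" "b \<in> Dom M" "c \<in> Dom M" for a b c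
  proof -
    have "sat M e (FAll 0 (FImp (FNot (FEq (Var 0) TZero)) (FEx 1 (FEq (TMul (Var 0) (Var 1)) TOne))))"
      by (rule field[THEN bspec]) (simp add: Defs.field_axioms_def Let_def)
    then show "a \<noteq> zero_of M \<Longrightarrow> \<exists>b\<in>Dom M. mul_of M a b = one_of M" using that by auto
  qed (use field that in \<open>simp_all add: Defs.field_axioms_def Let_def\<close>)
  note z = cl(1)
  have "cring ?R"
  proof (rule cringI)
    show "abelian_group ?R"
    proof (rule abelian_groupI)
      fix x assume x: "x \<in> carrier ?R"
      show "\<exists>y\<in>carrier ?R. y \<oplus>\<^bsub>?R\<^esub> x = \<zero>\<^bsub>?R\<^esub>"
        using x f(2)[of x "minus_of M x" x] f(4)[of x x x] cl
        by (intro bexI[of _ "minus_of M x"]) (auto simp: ring_of_def)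
      show "\<zero>\<^bsub>?R\<^esub> \<oplus>\<^bsub>?R\<^esub> x = x" using x f(2)[of x "zero_of M" x] f(3)[of x x x] cl by (auto simp: ring_of_def)
    qed (use cl f in \<open>auto simp: ring_of_def\<close>)
    show "comm_monoid ?R"
    proof (rule comm_monoidI)
      fix x assume x: "x \<in> carrier ?R"
      show "\<one>\<^bsub>?R\<^esub> \<otimes>\<^bsub>?R\<^esub> x = x" using x f(6)[of x "one_of M" x] f(7)[of x x x] cl by (auto simp: ring_of_def)
    qed (use cl f in \<open>auto simp: ring_of_def\<close>)
    fix x y z assume "x \<in> carrier ?R" "y \<in> carrier ?R" "z \<in> carrier ?R"
    then show "(x \<oplus>\<^bsub>?R\<^esub> y) \<otimes>\<^bsub>?R\<^esub> z = x \<otimes>\<^bsub>?R\<^esub> z \<oplus>\<^bsub>?R\<^esub> y \<otimes>\<^bsub>?R\<^esub> z"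
      using f(6)[of "add_of M x y" z z] f(6)[of x z z] f(6)[of y z z] f(8)[of z x y] cl by (auto simp: ring_of_def)
  qed
  then have "field ?R"
    using f(9,10) z by (intro cring.cring_fieldI2) (auto simp: ring_of_def)
  then interpret R: field ?R .
  have minus: "minus_of M a = \<ominus>\<^bsub>?R\<^esub> a" if "a \<in> carrier ?R" for a
  proof (rule sym, rule R.minus_equality)
    show "minus_of M a \<oplus>\<^bsub>?R\<^esub> a = \<zero>\<^bsub>?R\<^esub>"
      using f(2)[of a "minus_of M a" a] f(4)[of a a a] cl that by (auto simp: ring_of_def)
  qed (use that cl in \<open>auto simp: ring_of_def\<close>)
  have root: "\<exists>x\<in>K. R.eval (\<one>\<^bsub>?R\<^esub> # cs) x = \<zero>\<^bsub>?R\<^esub>"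
    if K: "K \<subseteq> Dom M" "K \<noteq> {}" and cs: "set cs \<subseteq> K" "cs \<noteq> []"
      and ax: "\<And>e'. (\<And>v. v \<in> {1..length cs} \<Longrightarrow> e' v \<in> K) \<Longrightarrow> (\<And>v. v \<notin> {1..length cs} \<Longrightarrow> e' v = e v) \<Longrightarrow>
        \<exists>x\<in>K. val M (e'(0 := x)) (monic_tm (length cs)) = zero_of M"
    for K cs
  proof -
    \<comment> \<open>\<open>monic_tm\<close> reads its coefficients from the variables 1, 2, ...;
      variable 0 is left for the root.\<close>
    let ?e = "\<lambda>v. if v \<in> {1..length cs} then cs ! (v - 1) else e v"
    have in_K: "cs ! (v - 1) \<in> K" if "v \<in> {1..length cs}" for v
    proof -
      have "v - 1 < length cs" using that by auto
      then show ?thesis using cs(1) nth_mem by blast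
    qed
    have "\<exists>x\<in>K. val M (?e(0 := x)) (monic_tm (length cs)) = zero_of M"
    proof (rule ax)
      show "?e v \<in> K" if "v \<in> {1..length cs}" for v using in_K[OF that] that by simp
      show "?e v = e v" if "v \<notin> {1..length cs}" for v using that by (rule if_not_P)
    qed
    then obtain x where x: "x \<in> K" "val M (?e(0 := x)) (monic_tm (length cs)) = zero_of M" by blast
    define e1 where "e1 = ?e(0 := x)"
    have dom: "e1 v \<in> carrier ?R" for v
      using in_K[of v] x(1) K(1) e by (auto simp: ring_of_def e1_def)
    have e10: "e1 0 = x" "x \<in> carrier ?R" using x(1) K(1) by (auto simp: e1_def ring_of_def)
    have "map e1 [1..<Suc (length cs)] = cs"
      by (rule nth_equalityI) (auto simp: e1_def simp del: upt_Suc)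
    then have "val M e1 (monic_tm (length cs)) = R.eval (\<one>\<^bsub>?R\<^esub> # cs) x"
      using val_monic_tm[of ?R M e1 x "length cs", OF R.is_ring refl dom e10(2,1)] by (simp only:)
    then have "R.eval (\<one>\<^bsub>?R\<^esub> # cs) x = zero_of M" using x(2) unfolding e1_def by simp
    then show ?thesis using x by (auto simp: ring_of_def)
  qed
  have "acf_axioms ?R M"
  proof
    show "?R = ring_of M" ..
    fix a assume a: "a \<in> carrier ?R"
    show "minus_of M a \<in> carrier ?R" "a \<oplus>\<^bsub>?R\<^esub> minus_of M a = \<zero>\<^bsub>?R\<^esub>"
      using a cl f(4)[of a a a] by (auto simp: ring_of_def)
  next
    fix cs assume cs: "set cs \<subseteq> carrier ?R" "cs \<noteq> []"
    have "FAlls (length cs) (FEx 0 (FEq (monic_tm (length cs)) TZero)) \<in> ACF_chain I r"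
      using cs(2) by (auto simp: ACF_chain_def ACF_def Suc_le_eq)
    note * = sat_FAlls[OF sat[OF this], unfolded sat.simps val.simps]
    have "\<exists>x\<in>Dom M. val M (e'(0 := x)) (monic_tm (length cs)) = zero_of M"
      if "\<And>v. v \<in> {1..length cs} \<Longrightarrow> e' v \<in> Dom M" "\<And>v. v \<notin> {1..length cs} \<Longrightarrow> e' v = e v" for e'
      using *[of e', OF that] .
    then show "\<exists>x\<in>carrier ?R. R.eval (\<one>\<^bsub>?R\<^esub> # cs) x = \<zero>\<^bsub>?R\<^esub>"
      using root[of "Dom M" cs] cs z by (auto simp: ring_of_def)
  qed
  then interpret A: acf ?R M by (rule acf.intro[OF \<open>field ?R\<close>])
  show ?thesis
    unfolding acf_chain_def
  proof (intro conjI ballI impI)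
    show "is_struct I M" by (rule M)
    show "acf ?R M" by unfold_locales
  next
    fix i assume i: "i \<in> I"
    have P: "pred_of M i \<subseteq> Dom M" using cl i by auto
    have "\<forall>\<phi>\<in>Defs.subfield_axioms i. sat M e \<phi>"
      using sat i by (auto simp: ACF_chain_def acl_subfield_axioms_def)
    then have s': "zero_of M \<in> pred_of M i" "one_of M \<in> pred_of M i"
      "\<forall>a\<in>Dom M. \<forall>b\<in>Dom M. a \<in> pred_of M i \<and> b \<in> pred_of M i \<longrightarrow> add_of M a b \<in> pred_of M i"
      "\<forall>a\<in>Dom M. a \<in> pred_of M i \<longrightarrow> minus_of M a \<in> pred_of M i"
      "\<forall>a\<in>Dom M. \<forall>b\<in>Dom M. a \<in> pred_of M i \<and> b \<in> pred_of M i \<longrightarrow> mul_of M a b \<in> pred_of M i"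
      "\<forall>a\<in>Dom M. a \<in> pred_of M i \<longrightarrow> a = zero_of M \<or> (\<exists>b\<in>Dom M. b \<in> pred_of M i \<and> mul_of M a b = one_of M)"
      by (simp_all add: Defs.subfield_axioms_def Let_def)
    note D = subsetD[OF P]
    have s: "zero_of M \<in> pred_of M i" "one_of M \<in> pred_of M i"
      "a \<in> pred_of M i \<Longrightarrow> b \<in> pred_of M i \<Longrightarrow> add_of M a b \<in> pred_of M i"
      "a \<in> pred_of M i \<Longrightarrow> minus_of M a \<in> pred_of M i"
      "a \<in> pred_of M i \<Longrightarrow> b \<in> pred_of M i \<Longrightarrow> mul_of M a b \<in> pred_of M i"
      "a \<in> pred_of M i \<Longrightarrow> a \<noteq> zero_of M \<Longrightarrow> \<exists>b\<in>Dom M. b \<in> pred_of M i \<and> mul_of M a b = one_of M" for a b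
      subgoal by (rule s'(1))
      subgoal by (rule s'(2))
      subgoal using s'(3)[THEN bspec[of _ _ a], THEN bspec[of _ _ b], OF D D] by blast
      subgoal using s'(4)[THEN bspec[of _ _ a], OF D] by blast
      subgoal using s'(5)[THEN bspec[of _ _ a], THEN bspec[of _ _ b], OF D D] by blast
      subgoal using s'(6)[THEN bspec[of _ _ a], OF D] by blast
      done
    show "subfield (pred_of M i) ?R"
    proof (rule R.subfieldI')
      show "subring (pred_of M i) ?R"
      proof (rule R.subringI)
        show P': "pred_of M i \<subseteq> carrier ?R" using P by simp
        show "\<one>\<^bsub>?R\<^esub> \<in> pred_of M i" using s(2) by simp
        fix h assume h: "h \<in> pred_of M i"
        then show "\<ominus>\<^bsub>?R\<^esub> h \<in> pred_of M i" using s(4)[OF h] minus[of h] P' by auto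
        fix h' assume h': "h' \<in> pred_of M i"
        show "h \<oplus>\<^bsub>?R\<^esub> h' \<in> pred_of M i" "h \<otimes>\<^bsub>?R\<^esub> h' \<in> pred_of M i"
          using s(3)[OF h h'] s(5)[OF h h'] by simp_all
      qed
      fix k assume k: "k \<in> pred_of M i - {\<zero>\<^bsub>?R\<^esub>}"
      then obtain b where b: "b \<in> pred_of M i" "k \<otimes>\<^bsub>?R\<^esub> b = \<one>\<^bsub>?R\<^esub>"
        using s(6)[of k] by auto
      have R: "k \<in> carrier ?R" "b \<in> carrier ?R" using k b P by auto
      have "inv\<^bsub>?R\<^esub> k = b" using R.comm_inv_char[OF R b(2)] by simp
      then show "inv\<^bsub>?R\<^esub> k \<in> pred_of M i" using b by simp
    qed
    show "A.root_closed (pred_of M i)"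
      unfolding A.root_closed_def
    proof (intro allI impI)
      fix cs assume cs: "set cs \<subseteq> pred_of M i" "cs \<noteq> []"
      have "FAlls_in i (length cs) (FEx 0 (FAnd (FPred i (Var 0)) (FEq (monic_tm (length cs)) TZero))) \<in> ACF_chain I r"
        using cs(2) i by (auto simp: ACF_chain_def acl_subfield_axioms_def Suc_le_eq)
      note * = sat_FAlls_in[OF sat[OF this] P, unfolded sat.simps val.simps fun_upd_same]
      have "\<exists>x\<in>Dom M. x \<in> pred_of M i \<and> val M (e'(0 := x)) (monic_tm (length cs)) = zero_of M"
        if "\<And>v. v \<in> {1..length cs} \<Longrightarrow> e' v \<in> pred_of M i" "\<And>v. v \<notin> {1..length cs} \<Longrightarrow> e' v = e v" for e'
        using *[of e', OF that] .
      then have "\<exists>x\<in>pred_of M i. val M (e'(0 := x)) (monic_tm (length cs)) = zero_of M"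
        if "\<And>v. v \<in> {1..length cs} \<Longrightarrow> e' v \<in> pred_of M i" "\<And>v. v \<notin> {1..length cs} \<Longrightarrow> e' v = e v" for e'
        using that by blast
      then show "\<exists>x\<in>pred_of M i. R.eval (\<one>\<^bsub>?R\<^esub> # cs) x = \<zero>\<^bsub>?R\<^esub>"
        using root[of "pred_of M i" cs] cs P s(1) by blast
    qed
    have "FEx 0 (FNot (FPred i (Var 0))) \<in> ACF_chain I r" using i by (auto simp: ACF_chain_def)
    from sat[OF this] show "pred_of M i \<noteq> Dom M" by auto
    fix j assume j: "j \<in> I" "(i, j) \<in> r \<and> i \<noteq> j"
    then have "FAll 0 (FImp (FPred i (Var 0)) (FPred j (Var 0))) \<in> ACF_chain I r"
      "FEx 0 (FAnd (FPred j (Var 0)) (FNot (FPred i (Var 0)))) \<in> ACF_chain I r"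
      using i by (auto simp: ACF_chain_def)
    from this[THEN sat] show "pred_of M i \<subset> pred_of M j" using P by auto
  qed
qed

lemma acf_chain_models:
  "M \<in> models I T \<Longrightarrow> ACF_chain I r \<subseteq> T \<Longrightarrow> acf_chain I r M"
  by (rule acf_chainI) (auto simp: models_def)

subsection \<open>A basis adapted to the chain\<close>

text \<open>The level of an element is the least \<open>i\<close> with \<open>x \<in> P\<^sub>i\<close>, where \<open>None\<close> stands for the whole model.\<close>

definition level :: "'i set \<Rightarrow> 'i rel \<Rightarrow> ('i, 'a) struct \<Rightarrow> 'a \<Rightarrow> 'i option" where
  "level I r M x = (if \<exists>i\<in>I. x \<in> pred_of M i
     then Some (SOME i. i \<in> I \<and> x \<in> pred_of M i \<and> (\<forall>j\<in>I. x \<in> pred_of M j \<longrightarrow> (i, j) \<in> r)) else None)"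

lemma well_order_onD:
  assumes "well_order_on I r"
  shows "wf (r - Id)" "trans r" "antisym r" "total_on I r" "refl_on I r" "r \<subseteq> I \<times> I"
  using assms by (auto simp: well_order_on_def linear_order_on_def partial_order_on_def preorder_on_def)

context
  fixes I :: "'i set" and r :: "'i rel" and M :: "('i, 'a) struct"
  assumes chain: "acf_chain I r M" and wo: "well_order_on I r"
begin

interpretation acf "ring_of M" M
  using chain by (simp add: acf_chain_def)

abbreviation (input) "Rg \<equiv> ring_of M"

lemmas order_facts = well_order_onD[OF wo]

lemma pred_carrier: "i \<in> I \<Longrightarrow> pred_of M i \<subseteq> carrier Rg"
  using chain by (auto simp: acf_chain_def is_struct_def)

lemma pred_mono: "(i, j) \<in> r \<Longrightarrow> pred_of M i \<subseteq> pred_of M j"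
proof -
  assume "(i, j) \<in> r"
  then have "i = j \<or> pred_of M i \<subset> pred_of M j"
    using chain order_facts(6) unfolding acf_chain_def by blast
  then show ?thesis by auto
qed

lemma acl_pred: "i \<in> I \<Longrightarrow> acl (pred_of M i) = pred_of M i"
  using chain by (auto simp: acf_chain_def intro!: acl_root_closed)

lemma level_Some:
  assumes "i \<in> I" "x \<in> pred_of M i"
  shows "\<exists>j\<in>I. level I r M x = Some j \<and> x \<in> pred_of M j \<and> (j, i) \<in> r"
proof -
  obtain j where j: "j \<in> {i \<in> I. x \<in> pred_of M i}" "\<And>k. (k, j) \<in> r - Id \<Longrightarrow> k \<notin> {i \<in> I. x \<in> pred_of M i}"
    using wfE_min[OF order_facts(1), of i "{i \<in> I. x \<in> pred_of M i}"] assms by blast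
  have "(j, k) \<in> r" if "k \<in> I" "x \<in> pred_of M k" for k
    using j that order_facts(4,5) by (cases "j = k") (auto simp: total_on_def refl_on_def)
  then have "\<exists>i. i \<in> I \<and> x \<in> pred_of M i \<and> (\<forall>j\<in>I. x \<in> pred_of M j \<longrightarrow> (i, j) \<in> r)" using j by blast
  from someI_ex[OF this] show ?thesis using assms by (auto simp: level_def)
qed

text \<open>The fields increase with i, so the least index determines membership in all of them. A
  permutation of an adapted basis that preserves levels therefore preserves the part of the basis in
  each field.\<close>

lemma level_eq: "level I r M x = level I r M y \<Longrightarrow> i \<in> I \<Longrightarrow> x \<in> pred_of M i \<Longrightarrow> y \<in> pred_of M i"
proof -
  assume eq: "level I r M x = level I r M y" and i: "i \<in> I" "x \<in> pred_of M i"
  obtain j where j: "j \<in> I" "level I r M x = Some j" "(j, i) \<in> r" using level_Some[OF i] by auto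
  then obtain k where "k \<in> I" "y \<in> pred_of M k" using eq by (auto simp: level_def split: if_splits)
  from level_Some[OF this] have "y \<in> pred_of M j" using j(2) eq by auto
  then show ?thesis using pred_mono[OF j(3)] by auto
qed

lemma level_range: "level I r M x \<in> insert None (Some ` I)"
proof (cases "\<exists>i\<in>I. x \<in> pred_of M i")
  case True
  then show ?thesis using level_Some by blast
qed (simp add: level_def)

text \<open>The elements are well-ordered by level first, and within a level by an arbitrary
  well-order of the type. Every P_i is then an initial segment, so the greedy basis restricts to
  it.\<close>

theorem adapted_basis_exists:
  "\<exists>B. indep {} B \<and> acl B = carrier Rg \<and> (\<forall>i\<in>I. acl (B \<inter> pred_of M i) = pred_of M i)"
proof -
  \<comment> \<open>The strict order of the levels, with \<open>None\<close> above all
    indices.\<close>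
  define L where "L = {(Some i, Some j) | i j. (i, j) \<in> r - Id} \<union> {(Some i, None) | i. i \<in> I}"
  have "wf L"
  proof (rule wfUNIVI)
    fix P :: "'i option \<Rightarrow> bool" and x
    assume step: "\<forall>x. (\<forall>y. (y, x) \<in> L \<longrightarrow> P y) \<longrightarrow> P x"
    have S: "P (Some i)" for i
      using order_facts(1)
    proof (induction i rule: wf_induct_rule)
      case (less i)
      show ?case using less by - (rule step[rule_format], auto simp: L_def)
    qed
    have "P None" using S by - (rule step[rule_format], auto simp: L_def)
    then show "P x" using S by (cases x) auto
  qed
  have "trans (r - Id)" using order_facts(2,3) by (rule trans_diff_Id)
  then have "trans L" using order_facts(6) unfolding L_def trans_def by blast
  have total_L: "(a, b) \<in> L \<or> (b, a) \<in> L"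
    if "a \<in> insert None (Some ` I)" "b \<in> insert None (Some ` I)" "a \<noteq> b" for a b
    using that order_facts(4) by (auto simp: L_def total_on_def)
  obtain w :: "'a rel" where w: "well_order_on UNIV w" using well_order_on by blast
  then have w': "wf (w - Id)" "trans w" "antisym w" "total w"
    by (auto simp: well_order_on_def linear_order_on_def partial_order_on_def preorder_on_def)
  define W where "W = inv_image (L <*lex*> (w - Id)) (\<lambda>x. (level I r M x, x))"
  have W: "wf W" unfolding W_def using \<open>wf L\<close> w'(1) by auto
  have tW: "trans W" unfolding W_def
    using \<open>trans L\<close> trans_diff_Id[OF w'(2,3)] by (intro trans_inv_image trans_lex_prod)
  have totW: "total_on (carrier Rg) W"
  proof (rule total_onI)
    fix x y :: 'a assume "x \<noteq> y"
    then have "(x, y) \<in> w - Id \<or> (y, x) \<in> w - Id" using w'(4) by (auto simp: total_on_def)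
    moreover have "level I r M x \<noteq> level I r M y \<Longrightarrow>
        (level I r M x, level I r M y) \<in> L \<or> (level I r M y, level I r M x) \<in> L"
      by (intro total_L level_range)
    ultimately show "(x, y) \<in> W \<or> (y, x) \<in> W"
      by (cases "level I r M x = level I r M y") (auto simp: W_def)
  qed
  let ?B = "greedy_basis W"
  have init: "y \<in> pred_of M i" if "i \<in> I" "x \<in> pred_of M i" "(y, x) \<in> W" for i x y
  proof -
    obtain j where j: "j \<in> I" "level I r M x = Some j" "(j, i) \<in> r"
      using level_Some[OF \<open>i \<in> I\<close> \<open>x \<in> pred_of M i\<close>] by blast
    have "\<exists>k\<in>I. level I r M y = Some k \<and> (k, j) \<in> r"
    proof (cases "level I r M y = level I r M x")
      case True
      then show ?thesis using j order_facts(5) by (auto simp: refl_on_def)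
    next
      case False
      then have "(level I r M y, Some j) \<in> L" using that(3) j(2) by (auto simp: W_def)
      then show ?thesis using order_facts(6) by (auto simp: L_def)
    qed
    then obtain k where k: "k \<in> I" "level I r M y = Some k" "(k, j) \<in> r" by auto
    then obtain l where "l \<in> I" "y \<in> pred_of M l" by (auto simp: level_def split: if_splits)
    from level_Some[OF this] k have "y \<in> pred_of M k" by auto
    then show ?thesis using pred_mono[OF k(3)] pred_mono[OF j(3)] by auto
  qed
  have "carrier Rg \<subseteq> acl (?B \<inter> carrier Rg)" by (rule greedy_basis_span[OF W]) auto
  moreover have "?B \<inter> carrier Rg = ?B" by (auto simp: greedy_basis_def)
  ultimately have 1: "acl ?B = carrier Rg" using acl_carrier by auto
  have 2: "acl (?B \<inter> pred_of M i) = pred_of M i" if i: "i \<in> I" for i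
  proof
    show "pred_of M i \<subseteq> acl (?B \<inter> pred_of M i)"
      using greedy_basis_span[OF W pred_carrier[OF i]] init[OF i] by blast
    show "acl (?B \<inter> pred_of M i) \<subseteq> pred_of M i"
      using acl_mono[of "?B \<inter> pred_of M i" "pred_of M i"] pred_carrier[OF i] acl_pred[OF i] by auto
  qed
  show ?thesis using greedy_basis_indep[OF W tW totW] 1 2 by blast
qed

end

subsection \<open>Counting types\<close>

lemma countable_cterms: "countable S \<Longrightarrow> countable (cterms S)"
proof -
  assume S: "countable S"
  have "countable (fms ({} :: nat set) S)" by (rule countable_fms[OF _ S]) simp
  then have "countable ((\<lambda>t. FEq t t) ` cterms S :: (nat, 'a) fm set)"
    by (rule countable_subset[rotated]) (auto simp: cterms_def)
  then show ?thesis by (rule countable_image_inj_on) (auto simp: inj_on_def)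
qed

text \<open>There are countably many nonzero polynomials, with finitely many roots each.\<close>

lemma (in acf) countable_acl:
  assumes S: "S \<subseteq> carrier R" "countable S"
  shows "countable (acl S)"
proof -
  let ?Z = "\<lambda>cs. {x \<in> carrier R. heval (map cval cs) x = \<zero>}"
  let ?C = "{cs \<in> lists (cterms S). \<not> cval ` set cs \<subseteq> {\<zero>}}"
  have "finite (?Z cs)" if "cs \<in> ?C" for cs
  proof (rule ccontr)
    assume "infinite (?Z cs)"
    then have "set (map cval cs) \<subseteq> {\<zero>}"
      using that cvals_closed[OF _ S(1), of cs] by (intro infinite_zeros) (auto simp: in_lists_conv_set)
    then show False using that by auto
  qed
  then have "countable (\<Union>cs\<in>?C. ?Z cs)"
    using countable_cterms[OF S(2)]
    by (intro countable_UN) (auto intro: countable_finite countable_subset[OF _ countable_lists])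
  moreover have "acl S \<subseteq> (\<Union>cs\<in>?C. ?Z cs)"
  proof
    fix x assume "x \<in> acl S"
    then obtain cs where "x \<in> carrier R" "set cs \<subseteq> cterms S" "heval (map cval cs) x = \<zero>" "\<not> cval ` set cs \<subseteq> {\<zero>}"
      using acl_iff[OF S(1)] by blast
    then show "x \<in> (\<Union>cs\<in>?C. ?Z cs)" by (intro UN_I[of cs]) auto
  qed
  ultimately show ?thesis by (rule countable_subset[rotated])
qed

text \<open>An infinite set always has a member outside the finitely many values chosen
  before.\<close>

lemma distinct_representatives:
  "finite G \<Longrightarrow> (\<And>g. g \<in> G \<Longrightarrow> infinite (T g)) \<Longrightarrow> \<exists>\<pi>. inj_on \<pi> G \<and> (\<forall>g\<in>G. \<pi> g \<in> T g)"
proof (induction G rule: finite_induct)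
  case (insert a G)
  then obtain \<pi> where \<pi>: "inj_on \<pi> G" "\<forall>g\<in>G. \<pi> g \<in> T g" by auto
  have "infinite (T a - \<pi> ` G)" using insert by simp
  then obtain b where b: "b \<in> T a" "b \<notin> \<pi> ` G" using infinite_imp_nonempty by blast
  have "inj_on (\<pi>(a := b)) (insert a G)" using \<pi> b insert by (auto simp: inj_on_def)
  moreover have "\<forall>g\<in>insert a G. (\<pi>(a := b)) g \<in> T g" using \<pi> b by auto
  ultimately show ?case by blast
qed auto

text \<open>The finitely many elements of F outside E are exchanged with distinct elements of E of
  the same colour, taken outside \<open>B0\<close> and F; everything else stays. The exchange is an
  involution, hence bijective.\<close>

lemma colour_swap:
  assumes F: "finite F" "F \<subseteq> B" and E: "E \<subseteq> B"
    and room: "\<And>f. f \<in> F - E \<Longrightarrow> infinite {b \<in> E. c b = c f \<and> b \<notin> B0}" and B0: "B0 \<subseteq> E"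
  shows "\<exists>\<sigma>. bij_betw \<sigma> B B \<and> (\<forall>b\<in>B. c (\<sigma> b) = c b) \<and> (\<forall>b\<in>B0. \<sigma> b = b) \<and> \<sigma> ` F \<subseteq> E"
proof -
  let ?G = "F - E"
  let ?T = "\<lambda>g. {b \<in> E. c b = c g \<and> b \<notin> B0} - F"
  have "\<exists>\<pi>. inj_on \<pi> ?G \<and> (\<forall>g\<in>?G. \<pi> g \<in> ?T g)"
    using F room by (intro distinct_representatives) auto
  then obtain \<pi> where \<pi>: "inj_on \<pi> ?G" "\<And>g. g \<in> ?G \<Longrightarrow> \<pi> g \<in> ?T g" by blast
  define \<sigma> where "\<sigma> x = (if x \<in> ?G then \<pi> x else if x \<in> \<pi> ` ?G then inv_into ?G \<pi> x else x)" for x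
  have a: "\<sigma> x = \<pi> x" "\<sigma> (\<pi> x) = x" if "x \<in> ?G" for x
    using that \<pi>(2)[OF that] \<pi>(1) by (auto simp: \<sigma>_def)
  have b: "\<sigma> x = x" if "x \<notin> ?G" "x \<notin> \<pi> ` ?G" for x using that by (auto simp: \<sigma>_def)
  have inv: "\<sigma> (\<sigma> x) = x" for x
  proof -
    consider "x \<in> ?G" | y where "y \<in> ?G" "x = \<pi> y" | "x \<notin> ?G" "x \<notin> \<pi> ` ?G" by blast
    then show ?thesis
    proof cases
      case 1
      then show ?thesis using a[OF 1] by simp
    next
      case 2
      then show ?thesis using a[OF 2(1)] by simp
    next
      case 3
      then show ?thesis using b[OF 3] by simp
    qed
  qed
  have \<sigma>B: "\<sigma> x \<in> B \<and> c (\<sigma> x) = c x" if "x \<in> B" for x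
  proof -
    consider "x \<in> ?G" | y where "y \<in> ?G" "x = \<pi> y" | "x \<notin> ?G" "x \<notin> \<pi> ` ?G" by blast
    then show ?thesis
    proof cases
      case 1
      then show ?thesis using a[OF 1] \<pi>(2)[OF 1] E by auto
    next
      case 2
      then show ?thesis using a[OF 2(1)] \<pi>(2)[OF 2(1)] F by auto
    next
      case 3
      then show ?thesis using b[OF 3] that by simp
    qed
  qed
  have "\<sigma> ` B = B"
  proof
    show "\<sigma> ` B \<subseteq> B" using \<sigma>B by auto
    show "B \<subseteq> \<sigma> ` B"
    proof
      fix x assume "x \<in> B"
      then show "x \<in> \<sigma> ` B" using \<sigma>B[of x] inv[of x] by (intro image_eqI[of _ _ "\<sigma> x"]) auto
    qed
  qed
  moreover have "inj_on \<sigma> B" using inv by (metis inj_onI)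
  moreover have "\<sigma> b = b" if "b \<in> B0" for b using that B0 \<pi>(2) by (intro b) auto
  moreover have "\<sigma> f \<in> E" if "f \<in> F" for f
  proof (cases "f \<in> E")
    case True
    then show ?thesis using b[of f] that \<pi>(2) by fastforce
  next
    case False
    then show ?thesis using a[of f] \<pi>(2)[of f] that by auto
  qed
  ultimately show ?thesis using \<sigma>B by (intro exI[of _ \<sigma>]) (auto simp: bij_betw_def)
qed

lemma struct_iso_preds:
  "struct_iso {} M N \<tau> \<Longrightarrow> (\<And>i a. i \<in> I \<Longrightarrow> a \<in> Dom M \<Longrightarrow> \<tau> a \<in> pred_of N i \<longleftrightarrow> a \<in> pred_of M i) \<Longrightarrow>
    struct_iso I M N \<tau>"
  by (auto simp: struct_iso_def)

text \<open>Each field is spanned by its part of B, so it is preserved as soon as the image of this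
  part spans it again.\<close>

lemma (in acf) automorphism_preds:
  assumes \<tau>: "struct_iso {} M M \<tau>" and B: "B \<subseteq> carrier R"
    and P: "\<And>i. i \<in> I \<Longrightarrow> acl (B \<inter> pred_of M i) = pred_of M i"
    and \<tau>P: "\<And>i. i \<in> I \<Longrightarrow> acl (\<tau> ` (B \<inter> pred_of M i)) = pred_of M i"
  shows "struct_iso I M M \<tau>"
proof (rule struct_iso_preds[OF \<tau>])
  fix i a assume i: "i \<in> I" and a: "a \<in> Dom M"
  have bij: "bij_betw \<tau> (carrier R) (carrier R)" using \<tau> by (simp add: struct_iso_def)
  have "\<tau> ` pred_of M i = pred_of M i"
    using automorphism_acl[OF \<tau>, of "B \<inter> pred_of M i"] B P[OF i] \<tau>P[OF i] by auto
  moreover have "pred_of M i \<subseteq> carrier R" using P[OF i] acl_carrier by blast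
  ultimately show "\<tau> a \<in> pred_of M i \<longleftrightarrow> a \<in> pred_of M i"
    using bij a by (auto simp: bij_betw_def inj_on_def)
qed

text \<open>The parameters are algebraic over a countable part \<open>B0\<close> of an adapted
  basis. The set E contains \<open>B0\<close> and, from each of the countably many levels, either
  all the other basis elements or infinitely many of them. A tuple depends on a finite part F of the
  basis; a level-preserving permutation that fixes \<open>B0\<close> moves F into E. It extends to
  an automorphism, which moves the tuple into the countable set \<open>acl E\<close> without
  changing its type over A.\<close>

theorem countable_realised_types:
  assumes chain: "acf_chain I r M" and wo: "well_order_on I r" and I: "countable I"
    and A: "A \<subseteq> Dom M" "countable A"
  shows "\<exists>W. countable W \<and> W \<subseteq> assignments M \<and>
    (\<forall>e\<in>assignments M. \<exists>w\<in>W. \<forall>\<phi>\<in>formulas I A n. sat M w \<phi> \<longleftrightarrow> sat M e \<phi>)"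
proof -
  interpret acf "ring_of M" M using chain by (simp add: acf_chain_def)
  let ?D = "carrier (ring_of M)"
  have M: "is_struct I M" using chain by (simp add: acf_chain_def)
  obtain B where B: "indep {} B" "acl B = ?D" "\<And>i. i \<in> I \<Longrightarrow> acl (B \<inter> pred_of M i) = pred_of M i"
    using adapted_basis_exists[OF chain wo] by blast
  have BD: "B \<subseteq> ?D" using B(1) by (simp add: indep_def)
  have "\<exists>F. finite F \<and> F \<subseteq> B \<and> x \<in> acl F" if "x \<in> ?D" for x using that acl_finite[OF _ BD] B(2) by blast
  then obtain S where S: "\<And>x. x \<in> ?D \<Longrightarrow> finite (S x) \<and> S x \<subseteq> B \<and> x \<in> acl (S x)" by metis
  define B0 where "B0 = \<Union>(S ` A)"
  have AD: "A \<subseteq> ?D" using A(1) by simp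
  have "countable (S a)" if "a \<in> A" for a using S AD that countable_finite by blast
  then have B0: "B0 \<subseteq> B" "countable B0"
    using S AD A(2) unfolding B0_def by (blast, intro countable_UN)
  have B0D: "B0 \<subseteq> ?D" using B0 BD by auto
  have A_acl: "A \<subseteq> acl B0"
  proof
    fix a assume a: "a \<in> A"
    then have "a \<in> acl (S a)" "S a \<subseteq> B0" using S AD by (auto simp: B0_def)
    then show "a \<in> acl B0" using acl_mono B0D by blast
  qed
  let ?c = "level I r M"
  let ?K = "insert None (Some ` I)"
  have "\<exists>T. T \<subseteq> {b \<in> B - B0. ?c b = k} \<and> countable T \<and>
      (infinite T \<or> T = {b \<in> B - B0. ?c b = k})" for k
  proof (cases "finite {b \<in> B - B0. ?c b = k}")
    case True
    then show ?thesis by (intro exI[of _ "{b \<in> B - B0. ?c b = k}"]) (simp add: countable_finite)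
  next
    case False
    then obtain T where "T \<subseteq> {b \<in> B - B0. ?c b = k}" "infinite T" "countable T"
      using infinite_countable_subset'[OF False] by blast
    then show ?thesis by blast
  qed
  then have "\<exists>T. \<forall>k. T k \<subseteq> {b \<in> B - B0. ?c b = k} \<and> countable (T k) \<and>
      (infinite (T k) \<or> T k = {b \<in> B - B0. ?c b = k})" by (intro choice allI)
  then obtain T where T': "\<forall>k. T k \<subseteq> {b \<in> B - B0. ?c b = k} \<and> countable (T k) \<and>
      (infinite (T k) \<or> T k = {b \<in> B - B0. ?c b = k})" by (rule exE)
  note T = T'[THEN spec, THEN conjunct1] T'[THEN spec, THEN conjunct2, THEN conjunct1]
    T'[THEN spec, THEN conjunct2, THEN conjunct2]
  define E where "E = B0 \<union> (\<Union>k\<in>?K. T k)"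
  have E: "E \<subseteq> B" "countable E" using B0 T I by (auto simp: E_def)
  have ED: "E \<subseteq> ?D" using E BD by auto
  \<comment> \<open>Tuples from \<open>acl E\<close>, continued by zero; formulas in n variables
    only see the first n values.\<close>
  define W where "W = (\<lambda>xs v. if v < length xs then xs ! v else zero_of M) ` lists (acl E)"
  have "countable W" unfolding W_def using countable_acl[OF ED E(2)] by auto
  moreover have "W \<subseteq> assignments M"
  proof
    fix w assume "w \<in> W"
    then obtain xs where xs: "xs \<in> lists (acl E)" "w = (\<lambda>v. if v < length xs then xs ! v else zero_of M)"
      unfolding W_def by (rule imageE)
    have *: "xs ! v \<in> ?D" if "v < length xs" for v using xs(1) nth_mem[OF that] acl_carrier by blast
    show "w \<in> assignments M"
    proof (rule assignmentsI)
      fix v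
      show "w v \<in> Dom M" using *[of v] zero_in_Dom[OF M] unfolding xs(2) by simp
    qed
  qed
  moreover have "\<exists>w\<in>W. \<forall>\<phi>\<in>formulas I A n. sat M w \<phi> \<longleftrightarrow> sat M e \<phi>" if e: "e \<in> assignments M" for e
  proof -
    have eD: "e v \<in> ?D" for v using assignmentsD[OF e] by simp
    define F where "F = (\<Union>v<n. S (e v))"
    have F: "finite F" "F \<subseteq> B" using S eD by (auto simp: F_def)
    have eF: "e v \<in> acl F" if "v < n" for v
    proof -
      have "S (e v) \<subseteq> F" using that by (auto simp: F_def)
      then show ?thesis using S[OF eD] acl_mono[of "S (e v)" F] F BD by blast
    qed
    have "\<exists>\<sigma>. bij_betw \<sigma> B B \<and> (\<forall>b\<in>B. ?c (\<sigma> b) = ?c b) \<and> (\<forall>b\<in>B0. \<sigma> b = b) \<and> \<sigma> ` F \<subseteq> E"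
    proof (rule colour_swap[OF F E(1)])
      show "B0 \<subseteq> E" by (auto simp: E_def)
      fix f assume f: "f \<in> F - E"
      let ?k = "?c f"
      have k: "?k \<in> ?K" by (rule level_range[OF chain wo])
      have "f \<in> B - B0" using f F by (auto simp: E_def)
      moreover have "f \<notin> T ?k" using f k by (auto simp: E_def)
      ultimately have "infinite (T ?k)" using T(3)[of ?k] by auto
      moreover have "T ?k \<subseteq> {b \<in> E. ?c b = ?k \<and> b \<notin> B0}" using T(1)[of ?k] k by (auto simp: E_def)
      ultimately show "infinite {b \<in> E. ?c b = ?k \<and> b \<notin> B0}" using infinite_super by blast
    qed
    then obtain \<sigma> where \<sigma>: "bij_betw \<sigma> B B" "\<And>b. b \<in> B \<Longrightarrow> ?c (\<sigma> b) = ?c b"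
      "\<And>b. b \<in> B0 \<Longrightarrow> \<sigma> b = b" "\<sigma> ` F \<subseteq> E" by blast
    have img: "\<sigma> ` (B - B0) = B - B0"
    proof -
      have "\<sigma> ` B0 = B0" using \<sigma>(3) by auto
      moreover have "\<sigma> ` (B - B0) = \<sigma> ` B - \<sigma> ` B0"
        using \<sigma>(1) B0(1) by (intro inj_on_image_set_diff[of _ B]) (auto simp: bij_betw_def)
      ultimately show ?thesis using \<sigma>(1) by (simp add: bij_betw_def)
    qed
    \<comment> \<open>Not just \<open>B0\<close> but all of \<open>acl B0\<close> is fixed
      pointwise, because the parameters lie there; the rest of the basis is still independent over
      it.\<close>
    let ?G0 = "(\<lambda>c. (c, c)) ` acl B0 \<union> (\<lambda>b. (b, \<sigma> b)) ` (B - B0)"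
    have ind: "indep (acl B0) (B - B0)" by (rule indep_over_acl[OF B(1) B0(1)])
    have G0: "pisom ?G0"
      using \<sigma>(1) by (intro pisom_independent acl_carrier ind) (auto simp: img ind bij_betw_def inj_on_def)
    have dom: "Domain ?G0 = acl B0 \<union> (B - B0)" "Range ?G0 = acl B0 \<union> (B - B0)"
    proof -
      show "Domain ?G0 = acl B0 \<union> (B - B0)" by (auto simp: Domain_fst image_Un image_image)
      have "Range ?G0 = acl B0 \<union> \<sigma> ` (B - B0)" by (auto simp: Range_snd image_Un image_image)
      then show "Range ?G0 = acl B0 \<union> (B - B0)" unfolding img .
    qed
    have "B \<subseteq> acl B0 \<union> (B - B0)" using acl_incl[OF B0D] by auto
    moreover have "acl B0 \<union> (B - B0) \<subseteq> ?D" using acl_carrier BD by auto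
    ultimately have span: "acl (acl B0 \<union> (B - B0)) = ?D"
      using acl_mono[of B "acl B0 \<union> (B - B0)"] B(2) acl_carrier by blast
    obtain \<tau> where \<tau>: "struct_iso {} M M \<tau>" "\<forall>a b. (a, b) \<in> ?G0 \<longrightarrow> \<tau> a = b"
      using automorphism_exists[OF G0] unfolding dom span by blast
    have \<tau>2: "(a, b) \<in> ?G0 \<Longrightarrow> \<tau> a = b" for a b using \<tau>(2) by blast
    have \<tau>C: "\<tau> a = a" if "a \<in> acl B0" for a
      using \<tau>2[of a a] that by blast
    have \<tau>B: "\<tau> b = \<sigma> b" if "b \<in> B" for b
    proof (cases "b \<in> B0")
      case True
      then have "b \<in> acl B0" using acl_incl[OF B0D] by blast
      then show ?thesis using \<tau>C \<sigma>(3)[OF True] by simp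
    next
      case False
      then show ?thesis using \<tau>2[of b "\<sigma> b"] that by blast
    qed
    have "struct_iso I M M \<tau>"
    proof (rule automorphism_preds[OF \<tau>(1) BD B(3)])
      fix i assume i: "i \<in> I"
      have "\<tau> ` (B \<inter> pred_of M i) = B \<inter> pred_of M i"
      proof
        show "\<tau> ` (B \<inter> pred_of M i) \<subseteq> B \<inter> pred_of M i"
        proof
          fix z assume "z \<in> \<tau> ` (B \<inter> pred_of M i)"
          then obtain b where b: "b \<in> B" "b \<in> pred_of M i" "z = \<sigma> b" using \<tau>B by auto
          then show "z \<in> B \<inter> pred_of M i"
            using \<sigma>(1,2) level_eq[OF chain wo, of b "\<sigma> b" i] i by (auto simp: bij_betw_def)
        qed
        show "B \<inter> pred_of M i \<subseteq> \<tau> ` (B \<inter> pred_of M i)"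
        proof
          fix z assume z: "z \<in> B \<inter> pred_of M i"
          then obtain b where b: "b \<in> B" "z = \<sigma> b" using \<sigma>(1) by (auto simp: bij_betw_def)
          then have "b \<in> pred_of M i"
            using \<sigma>(2)[OF b(1)] level_eq[OF chain wo, of z b i] i z by auto
          then show "z \<in> \<tau> ` (B \<inter> pred_of M i)" using b \<tau>B by auto
        qed
      qed
      then show "acl (\<tau> ` (B \<inter> pred_of M i)) = pred_of M i" using B(3)[OF i] by simp
    qed
    have \<tau>e: "\<tau> (e v) \<in> acl E" if "v < n" for v
    proof -
      have FD: "F \<subseteq> ?D" using F(2) BD by auto
      have "\<tau> (e v) \<in> acl (\<tau> ` F)" using automorphism_acl[OF \<tau>(1) FD] eF[OF that] by auto
      moreover have "\<tau> ` F \<subseteq> E" using \<tau>B F(2) \<sigma>(4) by auto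
      ultimately show ?thesis using acl_mono[of "\<tau> ` F" E] ED by blast
    qed
    define xs where "xs = map (\<lambda>v. \<tau> (e v)) [0..<n]"
    define w where "w = (\<lambda>v. if v < length xs then xs ! v else zero_of M)"
    have "w \<in> W" unfolding W_def w_def using \<tau>e by (intro imageI) (auto simp: xs_def)
    moreover have "sat M w \<phi> \<longleftrightarrow> sat M e \<phi>" if \<phi>: "\<phi> \<in> formulas I A n" for \<phi>
    proof -
      have eq: "map_fm id \<tau> \<phi> = \<phi>"
        using \<phi> A_acl \<tau>C by (intro map_fm_ident) (auto simp: formulas_def)
      have "sat M w \<phi> \<longleftrightarrow> sat M (\<lambda>v. \<tau> (e v)) (map_fm id \<tau> \<phi>)"
        unfolding eq using \<phi> by (intro sat_cong) (auto simp: w_def xs_def formulas_def)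
      also have "sat M (\<lambda>v. \<tau> (e v)) (map_fm id \<tau> \<phi>) \<longleftrightarrow> sat M e \<phi>"
        using \<phi> A(1) by (intro sat_iso[OF M \<open>struct_iso I M M \<tau>\<close> e]) (auto simp: formulas_def fms_def)
      finally show ?thesis .
    qed
    ultimately show ?thesis by blast
  qed
  ultimately show ?thesis by blast
qed

subsection \<open>Models of \<open>ACF\<^sup>I\<close> in different types\<close>

lemma map_monic_tm [simp]: "map_tm f (monic_tm n) = monic_tm n"
  by (induction n) auto

lemma map_FAlls [simp]: "map_fm id f (FAlls n \<phi>) = FAlls n (map_fm id f \<phi>)"
  by (induction n arbitrary: \<phi>) auto

lemma map_FAlls_in [simp]: "map_fm id f (FAlls_in i n \<phi>) = FAlls_in i n (map_fm id f \<phi>)"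
  by (induction n arbitrary: \<phi>) auto

text \<open>The axioms contain no constants, so renaming turns the axioms over one type of
  parameters into those over another. This makes an ultrapower, whose elements are functions, a
  model again.\<close>

lemma map_ACF_chain: "map_fm id f ` ACF_chain I r = ACF_chain I r"
proof -
  have set_image: "{F n |n. n \<ge> 1} = F ` {1::nat..}" for F :: "nat \<Rightarrow> ('d, 'e) fm" by auto
  have field: "map_fm id f ` Defs.field_axioms = Defs.field_axioms"
    by (simp add: Defs.field_axioms_def Let_def)
  have sub: "map_fm id f ` Defs.subfield_axioms i = Defs.subfield_axioms i" for i
    by (simp add: Defs.subfield_axioms_def Let_def)
  show ?thesis
    unfolding ACF_chain_def ACF_def acl_subfield_axioms_def set_image image_Un image_UN field sub image_image
    by simp
qed

lemma tvars_monic_tm: "tvars (monic_tm n) \<subseteq> {0..n}"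
  by (induction n) auto

lemma fvars_FAlls: "fvars (FAlls n \<phi>) = fvars \<phi> - {1..n}"
  by (induction n arbitrary: \<phi>) (auto simp: atLeastAtMostSuc_conv)

lemma fvars_FAlls_in: "fvars (FAlls_in i n \<phi>) = fvars \<phi> - {1..n}"
  by (induction n arbitrary: \<phi>) (auto simp: atLeastAtMostSuc_conv)

lemma ACF_chain_fvars: "\<phi> \<in> ACF_chain I r \<Longrightarrow> fvars \<phi> = {}"
  using tvars_monic_tm
  by (fastforce simp: ACF_chain_def ACF_def acl_subfield_axioms_def Defs.field_axioms_def
      Defs.subfield_axioms_def Let_def fvars_FAlls fvars_FAlls_in)

lemma tparams_monic_tm [simp]: "tparams (monic_tm n) = {}"
  by (induction n) auto

lemma preds_FAlls [simp]: "preds (FAlls n \<phi>) = preds \<phi>" and params_FAlls [simp]: "params (FAlls n \<phi>) = params \<phi>"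
  by (induction n arbitrary: \<phi>) auto

lemma preds_FAlls_in: "preds (FAlls_in i n \<phi>) \<subseteq> insert i (preds \<phi>)"
  and params_FAlls_in [simp]: "params (FAlls_in i n \<phi>) = params \<phi>"
  by (induction n arbitrary: \<phi>) fastforce+

lemma ACF_chain_fms: "\<phi> \<in> ACF_chain I r \<Longrightarrow> \<phi> \<in> fms I {}"
  using preds_FAlls_in
  by (fastforce simp: ACF_chain_def ACF_def acl_subfield_axioms_def Defs.field_axioms_def
      Defs.subfield_axioms_def Let_def fms_def)

lemma elem_models:
  assumes el: "elem I M N A f" and N: "is_struct I N" and M: "M \<in> models I (ACF_chain I r)"
  shows "N \<in> models I (ACF_chain I r)"
proof -
  have "holds N \<phi>" if \<phi>: "\<phi> \<in> ACF_chain I r" for \<phi>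
  proof -
    obtain \<psi> where \<psi>: "\<psi> \<in> ACF_chain I r" "\<phi> = map_fm id f \<psi>"
      using \<phi> map_ACF_chain[of f I r] by blast
    have "\<psi> \<in> formulas I A 0"
      using ACF_chain_fms[OF \<psi>(1)] ACF_chain_fvars[OF \<psi>(1)] by (auto simp: formulas_fms fms_def)
    then show ?thesis using el M \<psi> by (auto simp: elem_def models_def)
  qed
  then show ?thesis using N by (auto simp: models_def)
qed

lemma models_acf_chain: "M \<in> models I (ACF_chain I r) \<Longrightarrow> acf_chain I r M"
  by (rule acf_chain_models) auto

lemma models_is_struct: "M \<in> models I T \<Longrightarrow> is_struct I M"
  by (simp add: models_def)

lemma ultrapower_models:
  "ultrafilter U \<Longrightarrow> M \<in> models I (ACF_chain I r) \<Longrightarrow> ultrapower U M \<in> models I (ACF_chain I r)"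
  by (rule elem_models[OF diag_elem is_struct_ultrapower]) (auto dest: models_is_struct)

lemma linear_order_on_subset:
  assumes lin: "linear_order_on I r" and J: "J \<subseteq> I"
  shows "linear_order_on J (r \<inter> J \<times> J)"
proof -
  have r: "trans r" "antisym r" "total_on I r" "refl_on I r"
    using lin by (auto simp: linear_order_on_def partial_order_on_def preorder_on_def)
  have "trans (r \<inter> J \<times> J)"
  proof (rule transI)
    fix x y z assume "(x, y) \<in> r \<inter> J \<times> J" "(y, z) \<in> r \<inter> J \<times> J"
    then show "(x, z) \<in> r \<inter> J \<times> J" using transD[OF r(1)] by blast
  qed
  moreover have "antisym (r \<inter> J \<times> J)" using r(2) unfolding antisym_def by blast
  moreover have "total_on J (r \<inter> J \<times> J)" using r(3) J unfolding total_on_def by blast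
  moreover have "refl_on J (r \<inter> J \<times> J)" using r(4) J unfolding refl_on_def by blast
  ultimately show ?thesis by (auto simp: linear_order_on_def partial_order_on_def preorder_on_def)
qed

lemma well_order_on_subset:
  assumes wo: "well_order_on I r" and J: "J \<subseteq> I"
  shows "well_order_on J (r \<inter> J \<times> J)"
proof -
  have "wf (r \<inter> J \<times> J - Id)" by (rule wf_subset[OF well_order_onD(1)[OF wo]]) auto
  then show ?thesis using linear_order_on_subset[of I r J] assms by (simp add: well_order_on_def)
qed

lemma finite_linear_order_well_order:
  assumes lin: "linear_order_on J r" and J: "finite J"
  shows "well_order_on J r"
proof -
  have r: "trans r" "antisym r" "r \<subseteq> J \<times> J"
    using lin by (auto simp: linear_order_on_def partial_order_on_def preorder_on_def)
  have "acyclic (r - Id)" using trancl_id[OF trans_diff_Id[OF r(1,2)]] by (simp add: acyclic_def)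
  moreover have "finite (r - Id)" using finite_subset[OF r(3)] J by simp
  ultimately show ?thesis using lin finite_acyclic_wf by (auto simp: well_order_on_def)
qed

lemma acf_chain_subset: "acf_chain I r M \<Longrightarrow> J \<subseteq> I \<Longrightarrow> acf_chain J (r \<inter> J \<times> J) M"
  by (drule (1) acf_chain_mono) (unfold acf_chain_def, blast)

text \<open>The form in which counting is applied: complete types, branches of a tree and cuts in an
  order are all represented by assignments which differ on formulas in a countable sublanguage J
  over a countable set A.\<close>

lemma countable_separated:
  assumes M: "M \<in> models I (ACF_chain I r)" and wo: "well_order_on I r"
    and J: "J \<subseteq> I" "countable J" and A: "A \<subseteq> Dom M" "countable A"
    and e: "\<And>x. x \<in> S \<Longrightarrow> e x \<in> assignments M"
    and sep: "\<And>x y. x \<in> S \<Longrightarrow> y \<in> S \<Longrightarrow> x \<noteq> y \<Longrightarrow>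
      \<exists>\<phi>\<in>formulas J A n. sat M (e x) \<phi> \<noteq> sat M (e y) \<phi>"
  shows "countable S"
proof -
  obtain W where W: "countable W"
    "\<And>e. e \<in> assignments M \<Longrightarrow> \<exists>w\<in>W. \<forall>\<phi>\<in>formulas J A n. sat M w \<phi> \<longleftrightarrow> sat M e \<phi>"
    using countable_realised_types[OF acf_chain_subset[OF models_acf_chain[OF M] J(1)]
        well_order_on_subset[OF wo J(1)] J(2) A, of n] by blast
  have "\<forall>x\<in>S. \<exists>w. w \<in> W \<and> (\<forall>\<phi>\<in>formulas J A n. sat M w \<phi> \<longleftrightarrow> sat M (e x) \<phi>)" using W(2) e by blast
  from bchoice[OF this] obtain w where
    w': "\<forall>x\<in>S. w x \<in> W \<and> (\<forall>\<phi>\<in>formulas J A n. sat M (w x) \<phi> \<longleftrightarrow> sat M (e x) \<phi>)" by (rule exE)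
  have w: "x \<in> S \<Longrightarrow> w x \<in> W" "x \<in> S \<Longrightarrow> \<phi> \<in> formulas J A n \<Longrightarrow> sat M (w x) \<phi> \<longleftrightarrow> sat M (e x) \<phi>" for x \<phi>
    using bspec[OF w', of x] by blast+
  have "inj_on w S"
  proof (rule inj_onI, rule ccontr)
    fix x y assume xy: "x \<in> S" "y \<in> S" "w x = w y" "x \<noteq> y"
    then obtain \<phi> where "\<phi> \<in> formulas J A n" "sat M (e x) \<phi> \<noteq> sat M (e y) \<phi>" using sep by blast
    then show False using w(2)[of x \<phi>] w(2)[of y \<phi>] xy by simp
  qed
  moreover have "countable (w ` S)" by (rule countable_subset[OF _ W(1)]) (use w(1) in auto)
  ultimately show ?thesis by (simp add: countable_image_inj_eq)
qed

lemma nonprincipal_ultrafilter: "\<exists>U :: nat filter. ultrafilter U \<and> U \<le> sequentially"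
  by (rule ultrafilter_exists) simp

lemma diag_fin_sat:
  assumes U: "ultrafilter U" and M: "is_struct I M" and p: "p \<subseteq> fms I (Dom M)" "fin_sat M p"
  shows "fin_sat (ultrapower U M) (map_fm id (diag U M) ` p)"
  unfolding fin_sat_def
proof (intro allI impI)
  fix q assume "finite q \<and> q \<subseteq> map_fm id (diag U M) ` p"
  then obtain q' where q': "finite q'" "q' \<subseteq> p" "q = map_fm id (diag U M) ` q'"
    using finite_subset_image by metis
  then obtain e where e: "e \<in> assignments M" "\<forall>\<phi>\<in>q'. sat M e \<phi>" using p(2) by (auto simp: fin_sat_def)
  have "(\<lambda>v. diag U M (e v)) \<in> assignments (ultrapower U M)"
    using e(1) by (intro assignmentsI diag_Dom[OF U M]) simp
  moreover have "sat (ultrapower U M) (\<lambda>v. diag U M (e v)) (map_fm id (diag U M) \<phi>)" if "\<phi> \<in> q'" for \<phi>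
    using diag_sat[OF U M e(1), of \<phi>] that e(2) p(1) q'(2) by blast
  ultimately show "\<exists>e\<in>assignments (ultrapower U M). \<forall>\<phi>\<in>q. sat (ultrapower U M) e \<phi>" using q'(3) by auto
qed

lemma realise_in_ultrapower:
  fixes U :: "nat filter"
  assumes U: "ultrafilter U" "U \<le> sequentially" and M: "is_struct I M"
    and p: "p \<subseteq> fms I (Dom M)" "fin_sat M p" "countable p"
  shows "\<exists>e\<in>assignments (ultrapower U M). \<forall>\<phi>\<in>p. sat (ultrapower U M) e (map_fm id (diag U M) \<phi>)"
proof -
  have "map_fm id (diag U M) ` p \<subseteq> fms I (Dom (ultrapower U M))"
    using p(1) diag_Dom[OF U(1) M] by (auto intro!: map_fm_fms)
  then have "\<exists>e\<in>assignments (ultrapower U M). \<forall>\<phi>\<in>map_fm id (diag U M) ` p. sat (ultrapower U M) e \<phi>"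
    using saturated_ultrapower[OF U M] diag_fin_sat[OF U(1) M p(1,2)] p(3)
    unfolding saturated_def by (elim allE[of _ "map_fm id (diag U M) ` p"]) simp
  then show ?thesis by auto
qed

subsection \<open>\<open>\<omega>\<close>-stability\<close>

text \<open>All complete types over A are realised in one ultrapower, where different types are
  separated by a formula and its negation.\<close>

theorem countable_complete_types:
  assumes M: "M \<in> models I (ACF_chain I r)" and wo: "well_order_on I r" and I: "countable I"
    and A: "A \<subseteq> Dom M" "countable A"
  shows "countable (complete_types I M A n)"
proof -
  obtain U :: "nat filter" where U: "ultrafilter U" "U \<le> sequentially" using nonprincipal_ultrafilter by auto
  have Ms: "is_struct I M" by (rule models_is_struct[OF M])
  let ?S = "complete_types I M A n" and ?d = "map_fm id (diag U M)" and ?V = "ultrapower U M"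
  have sub: "formulas I A n \<subseteq> fms I (Dom M)" using A(1) fms_mono[OF _ subset_refl A(1)] by (auto simp: formulas_fms)
  have cnt: "countable (formulas I A n)"
    by (rule countable_subset[OF _ countable_fms[OF I A(2)]]) (auto simp: formulas_fms)
  have "\<exists>e\<in>assignments ?V. \<forall>\<phi>\<in>p. sat ?V e (?d \<phi>)" if p: "p \<in> ?S" for p
  proof (rule realise_in_ultrapower[OF U Ms])
    show "p \<subseteq> fms I (Dom M)" "fin_sat M p" "countable p"
      using p sub countable_subset[OF _ cnt] by (auto simp: complete_types_def)
  qed
  then have "\<forall>p\<in>?S. \<exists>e. e \<in> assignments ?V \<and> (\<forall>\<phi>\<in>p. sat ?V e (?d \<phi>))" by blast
  from bchoice[OF this] obtain e where
    e': "\<forall>p\<in>?S. e p \<in> assignments ?V \<and> (\<forall>\<phi>\<in>p. sat ?V (e p) (?d \<phi>))" by (rule exE)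
  have e: "p \<in> ?S \<Longrightarrow> e p \<in> assignments ?V" "p \<in> ?S \<Longrightarrow> \<phi> \<in> p \<Longrightarrow> sat ?V (e p) (?d \<phi>)" for p \<phi>
    using bspec[OF e', of p] by blast+
  show ?thesis
  proof (rule countable_separated[OF ultrapower_models[OF U(1) M] wo subset_refl I, of "diag U M ` A" ?S e n])
    show "diag U M ` A \<subseteq> Dom ?V" using A(1) diag_Dom[OF U(1) Ms] by auto
    fix p q assume pq: "p \<in> ?S" "q \<in> ?S" "p \<noteq> q"
    have "\<exists>\<phi>\<in>formulas I A n. \<phi> \<in> p \<and> FNot \<phi> \<in> q \<or> \<phi> \<in> q \<and> FNot \<phi> \<in> p"
      using pq unfolding complete_types_def by blast
    then obtain \<phi> where \<phi>: "\<phi> \<in> formulas I A n" "\<phi> \<in> p \<and> FNot \<phi> \<in> q \<or> \<phi> \<in> q \<and> FNot \<phi> \<in> p" by blast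
    then have "sat ?V (e p) (?d \<phi>) \<noteq> sat ?V (e q) (?d \<phi>)"
      using e(2)[OF pq(1), of \<phi>] e(2)[OF pq(2), of \<phi>] e(2)[OF pq(1), of "FNot \<phi>"] e(2)[OF pq(2), of "FNot \<phi>"]
      by auto
    moreover have "?d \<phi> \<in> formulas I (diag U M ` A) n" using \<phi>(1) by (rule map_fm_formulas) simp
    ultimately show "\<exists>\<phi>\<in>formulas I (diag U M ` A) n. sat ?V (e p) \<phi> \<noteq> sat ?V (e q) \<phi>" by blast
  qed (use e(1) A(2) in auto)
qed

lemma uncountable_nat_bool: "uncountable (UNIV :: (nat \<Rightarrow> bool) set)"
proof
  assume "countable (UNIV :: (nat \<Rightarrow> bool) set)"
  then have "range (from_nat_into (UNIV :: (nat \<Rightarrow> bool) set)) = UNIV"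
    by (intro range_from_nat_into) auto
  then obtain k where "from_nat_into UNIV k = (\<lambda>n. \<not> from_nat_into (UNIV :: (nat \<Rightarrow> bool) set) n n)"
    by (metis surjD)
  then have "from_nat_into UNIV k k = (\<not> from_nat_into (UNIV :: (nat \<Rightarrow> bool) set) k k)" by (rule fun_cong)
  then show False by simp
qed

text \<open>The nodes are countably many and mention countably many predicates and parameters,
  whereas there are uncountably many branches; realisations of two branches are separated by a
  formula just above the node at which they part.\<close>

theorem no_binary_tree:
  assumes M: "M \<in> models I (ACF_chain I r)" and wo: "well_order_on I r"
  shows "\<not> binary_tree I M n \<phi>"
proof
  assume tree: "binary_tree I M n \<phi>"
  obtain U :: "nat filter" where U: "ultrafilter U" "U \<le> sequentially" using nonprincipal_ultrafilter by auto
  have Ms: "is_struct I M" by (rule models_is_struct[OF M])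
  let ?d = "map_fm id (diag U M)" and ?V = "ultrapower U M"
  define J where "J = (\<Union>s. preds (\<phi> s))"
  define A where "A = (\<Union>s. params (\<phi> s))"
  have t: "\<phi> s \<in> formulas I (Dom M) n" "\<exists>e\<in>assignments M. sat M e (\<phi> s)"
    "e \<in> assignments M \<Longrightarrow> sat M e (\<phi> (s @ [b])) \<Longrightarrow> sat M e (\<phi> s)"
    "\<not> (\<exists>e\<in>assignments M. sat M e (\<phi> (s @ [False])) \<and> sat M e (\<phi> (s @ [True])))" for s e b
    using tree unfolding binary_tree_def by blast+
  have J: "J \<subseteq> I" "countable J" and A: "A \<subseteq> Dom M" "countable A"
    using t(1) by (auto simp: J_def A_def formulas_def countable_finite)
  have \<phi>: "\<phi> s \<in> formulas J A n" for s using t(1)[of s] by (auto simp: J_def A_def formulas_def)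
  define br where "br x k = \<phi> (map x [0..<k])" for x :: "nat \<Rightarrow> bool" and k
  have br_mono: "sat M e (br x k) \<Longrightarrow> e \<in> assignments M \<Longrightarrow> j \<le> k \<Longrightarrow> sat M e (br x j)" for e x j k
  proof (induction k)
    case (Suc k)
    have "sat M e (br x k)" using Suc.prems(1,2) t(3)[of e "map x [0..<k]" "x k"] by (simp add: br_def)
    then show ?case using Suc by (cases "j = Suc k") auto
  qed (simp add: br_def)
  have "\<exists>e\<in>assignments ?V. \<forall>\<psi>\<in>range (br x). sat ?V e (?d \<psi>)" for x
  proof (rule realise_in_ultrapower[OF U is_struct_mono[OF Ms J(1)]])
    show "range (br x) \<subseteq> fms J (Dom M)" using \<phi> fms_mono[OF _ subset_refl A(1)] by (auto simp: br_def formulas_fms)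
    show "fin_sat M (range (br x))"
      unfolding fin_sat_def
    proof (intro allI impI)
      fix q assume "finite q \<and> q \<subseteq> range (br x)"
      then obtain K where K: "finite K" "q = br x ` K" using finite_subset_image by metis
      obtain e where e: "e \<in> assignments M" "sat M e (br x (Max (insert 0 K)))"
        using t(2) by (auto simp: br_def)
      have "sat M e (br x k)" if "k \<in> K" for k
        using K(1) that by (intro br_mono[OF e(2,1)]) simp
      then show "\<exists>e\<in>assignments M. \<forall>\<psi>\<in>q. sat M e \<psi>" using e(1) K(2) by auto
    qed
  qed simp
  then have "\<forall>x. \<exists>e. e \<in> assignments ?V \<and> (\<forall>\<psi>\<in>range (br x). sat ?V e (?d \<psi>))" by blast
  from choice[OF this] obtain e where
    e': "\<forall>x. e x \<in> assignments ?V \<and> (\<forall>\<psi>\<in>range (br x). sat ?V (e x) (?d \<psi>))" by (rule exE)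
  have e: "e x \<in> assignments ?V" "sat ?V (e x) (?d (br x k))" for x k
    using spec[OF e', of x] by blast+
  have "countable (UNIV :: (nat \<Rightarrow> bool) set)"
  proof (rule countable_separated[OF ultrapower_models[OF U(1) M] wo J, of "diag U M ` A" UNIV e n])
    show "diag U M ` A \<subseteq> Dom ?V" using A(1) diag_Dom[OF U(1) Ms] by auto
    fix x y :: "nat \<Rightarrow> bool" assume "x \<noteq> y"
    then have ex: "\<exists>k. x k \<noteq> y k" by auto
    define k where "k = (LEAST k. x k \<noteq> y k)"
    have k: "x k \<noteq> y k" unfolding k_def using ex by (rule LeastI_ex)
    have eq: "map x [0..<k] = map y [0..<k]" using not_less_Least unfolding k_def by fastforce
    let ?s = "map x [0..<k]"
    have sx: "sat ?V (e x) (?d (\<phi> (?s @ [x k])))" using e(2)[of x "Suc k"] by (simp add: br_def)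
    have sy: "sat ?V (e y) (?d (\<phi> (?s @ [y k])))" unfolding eq using e(2)[of y "Suc k"] by (simp add: br_def)
    have "FAnd (\<phi> (?s @ [x k])) (\<phi> (?s @ [y k])) \<in> fms I (Dom M)" using t(1) by (simp add: formulas_fms)
    moreover have "\<not> (\<exists>e\<in>assignments M. sat M e (FAnd (\<phi> (?s @ [x k])) (\<phi> (?s @ [y k]))))"
      using t(4)[of ?s] k by (cases "x k"; cases "y k") auto
    ultimately have "\<not> (\<exists>e\<in>assignments ?V. sat ?V e (?d (FAnd (\<phi> (?s @ [x k])) (\<phi> (?s @ [y k])))))"
      using elem_ex[OF diag_elem[OF U(1) Ms] Ms is_struct_ultrapower[OF U(1) Ms]] by blast
    then have "\<not> sat ?V (e y) (?d (\<phi> (?s @ [x k])))"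
      using sy e(1)[of y] unfolding fm.map sat.simps by blast
    moreover have "?d (\<phi> (?s @ [x k])) \<in> formulas J (diag U M ` A) n"
      using \<phi> by (rule map_fm_formulas) simp
    ultimately show "\<exists>\<psi>\<in>formulas J (diag U M ` A) n. sat ?V (e x) \<psi> \<noteq> sat ?V (e y) \<psi>" using sx by blast
  qed (use e(1) A(2) in auto)
  then show False using uncountable_nat_bool by blast
qed

text \<open>By the well-order, either i has an immediate successor j, and an element of P_j outside
  P_i is in all later fields, or i is the last index and any element outside P_i will do.\<close>

lemma successor_elements:
  assumes M: "M \<in> models I (ACF_chain I r)" and wo: "well_order_on I r" and i: "i \<in> I"
  shows "\<exists>x\<in>Dom M. x \<notin> pred_of M i \<and> (\<forall>j\<in>I. (i, j) \<in> r \<and> i \<noteq> j \<longrightarrow> x \<in> pred_of M j)"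
proof -
  have chain: "acf_chain I r M" by (rule models_acf_chain[OF M])
  then have P: "pred_of M i \<subseteq> Dom M" "pred_of M i \<noteq> Dom M"
    "\<And>j. j \<in> I \<Longrightarrow> (i, j) \<in> r \<Longrightarrow> i \<noteq> j \<Longrightarrow> pred_of M i \<subset> pred_of M j"
    "\<And>j. j \<in> I \<Longrightarrow> pred_of M j \<subseteq> Dom M"
    using i by (auto simp: acf_chain_def is_struct_def)
  show ?thesis
  proof (cases "\<exists>j\<in>I. (i, j) \<in> r \<and> i \<noteq> j")
    case True
    then obtain j0 where j0: "j0 \<in> {j \<in> I. (i, j) \<in> r \<and> i \<noteq> j}" by auto
    obtain j where j: "j \<in> {j \<in> I. (i, j) \<in> r \<and> i \<noteq> j}"
      "\<And>k. (k, j) \<in> r - Id \<Longrightarrow> k \<notin> {j \<in> I. (i, j) \<in> r \<and> i \<noteq> j}"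
      using wfE_min[OF well_order_onD(1)[OF wo] j0] by blast
    obtain x where x: "x \<in> pred_of M j" "x \<notin> pred_of M i" using P(3)[of j] j(1) by auto
    have "x \<in> pred_of M k" if k: "k \<in> I" "(i, k) \<in> r" "i \<noteq> k" for k
    proof -
      have "(j, k) \<in> r"
        using j k well_order_onD(4,5)[OF wo] by (cases "j = k") (auto simp: total_on_def refl_on_def)
      then show ?thesis using pred_mono[OF chain wo] x(1) by blast
    qed
    then show ?thesis using x P(4)[of j] j(1) by blast
  next
    case False
    then show ?thesis using P(1,2) by blast
  qed
qed

theorem not_omega_stable:
  assumes T: "completion I (ACF_chain I r) T" and wo: "well_order_on I r" and I: "uncountable I"
  shows "\<not> omega_stable I T"
proof
  assume "omega_stable I T"
  obtain M where MT: "M \<in> models I T" using T by (auto simp: completion_def complete_theory_def)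
  then have M: "M \<in> models I (ACF_chain I r)" using T by (auto simp: completion_def models_def)
  then have Ms: "is_struct I M" by (rule models_is_struct)
  have cnt: "countable (complete_types I M {} 1)"
    using \<open>omega_stable I T\<close> MT unfolding omega_stable_def by blast
  have "\<forall>i\<in>I. \<exists>x. x \<in> Dom M \<and> x \<notin> pred_of M i \<and> (\<forall>j\<in>I. (i, j) \<in> r \<and> i \<noteq> j \<longrightarrow> x \<in> pred_of M j)"
    using successor_elements[OF M wo] by blast
  from bchoice[OF this] obtain x where
    x': "\<forall>i\<in>I. x i \<in> Dom M \<and> x i \<notin> pred_of M i \<and> (\<forall>j\<in>I. (i, j) \<in> r \<and> i \<noteq> j \<longrightarrow> x i \<in> pred_of M j)" by (rule exE)
  have x: "i \<in> I \<Longrightarrow> x i \<in> Dom M" "i \<in> I \<Longrightarrow> x i \<notin> pred_of M i"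
    "i \<in> I \<Longrightarrow> j \<in> I \<Longrightarrow> (i, j) \<in> r \<Longrightarrow> i \<noteq> j \<Longrightarrow> x i \<in> pred_of M j" for i j
    using bspec[OF x', of i] by blast+
  define tp where "tp i = {\<phi> \<in> formulas I {} 1. sat M (\<lambda>_. x i) \<phi>}" for i
  have "tp i \<in> complete_types I M {} 1" if i: "i \<in> I" for i
  proof -
    have "(\<lambda>_. x i) \<in> assignments M" using x(1)[OF i] by (intro assignmentsI)
    then have "fin_sat M (tp i)" unfolding fin_sat_def tp_def by blast
    then show ?thesis by (auto simp: tp_def complete_types_def)
  qed
  then have "tp ` I \<subseteq> complete_types I M {} 1" by auto
  moreover have "inj_on tp I"
  proof (rule inj_onI, rule ccontr)
    fix i j assume ij: "i \<in> I" "j \<in> I" "tp i = tp j" "i \<noteq> j"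
    have *: False if "i \<in> I" "j \<in> I" "tp i = tp j" "i \<noteq> j" "(i, j) \<in> r" for i j
    proof -
      have "FPred j (Var 0) \<in> tp i" using x(3)[OF that(1,2,5,4)] that(2) by (simp add: tp_def)
      moreover have "FPred j (Var 0) \<notin> tp j" using x(2)[OF that(2)] by (simp add: tp_def)
      ultimately show False using that(3) by blast
    qed
    have "(i, j) \<in> r \<or> (j, i) \<in> r" using well_order_onD(4)[OF wo] ij by (auto simp: total_on_def)
    then show False using *[of i j] *[of j i] ij by auto
  qed
  ultimately have "countable I" using cnt countable_subset[of "tp ` I"] countable_image_inj_eq[of tp I] by blast
  then show False using I by simp
qed

subsection \<open>Stability\<close>

primrec vsub :: "(nat \<Rightarrow> 'a option) \<Rightarrow> 'a tm \<Rightarrow> 'a tm" where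
  "vsub \<sigma> (Var v) = (case \<sigma> v of None \<Rightarrow> Var v | Some c \<Rightarrow> Cst c)"
| "vsub \<sigma> (Cst a) = Cst a"
| "vsub \<sigma> TZero = TZero"
| "vsub \<sigma> TOne = TOne"
| "vsub \<sigma> (TAdd s t) = TAdd (vsub \<sigma> s) (vsub \<sigma> t)"
| "vsub \<sigma> (TMinus t) = TMinus (vsub \<sigma> t)"
| "vsub \<sigma> (TMul s t) = TMul (vsub \<sigma> s) (vsub \<sigma> t)"

text \<open>The substitution is a later argument because it changes under a quantifier, where the
  bound variable is removed from it. Only constants are inserted, so nothing can be
  captured.\<close>

primrec fvsub :: "('i, 'a) fm \<Rightarrow> (nat \<Rightarrow> 'a option) \<Rightarrow> ('i, 'a) fm" where
  "fvsub (FEq s t) = (\<lambda>\<sigma>. FEq (vsub \<sigma> s) (vsub \<sigma> t))"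
| "fvsub (FPred i t) = (\<lambda>\<sigma>. FPred i (vsub \<sigma> t))"
| "fvsub (FNot p) = (\<lambda>\<sigma>. FNot (fvsub p \<sigma>))"
| "fvsub (FAnd p q) = (\<lambda>\<sigma>. FAnd (fvsub p \<sigma>) (fvsub q \<sigma>))"
| "fvsub (FEx v p) = (\<lambda>\<sigma>. FEx v (fvsub p (\<sigma>(v := None))))"

abbreviation upds :: "(nat \<Rightarrow> 'a) \<Rightarrow> (nat \<Rightarrow> 'a option) \<Rightarrow> nat \<Rightarrow> 'a" where
  "upds e \<sigma> \<equiv> (\<lambda>v. case \<sigma> v of None \<Rightarrow> e v | Some c \<Rightarrow> c)"

lemma val_vsub: "val M e (vsub \<sigma> t) = val M (upds e \<sigma>) t"
  by (induction t) (auto split: option.splits)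

lemma sat_fvsub: "sat M e (fvsub p \<sigma>) \<longleftrightarrow> sat M (upds e \<sigma>) p"
proof (induction p arbitrary: e \<sigma>)
  case (FEx v p)
  have "upds (e(v := a)) (\<sigma>(v := None)) = (upds e \<sigma>)(v := a)" for a
    by (auto simp: fun_eq_iff split: option.split)
  then show ?case unfolding fvsub.simps sat.simps FEx.IH by presburger
qed (auto simp: val_vsub)

lemma tvars_vsub: "tvars (vsub \<sigma> t) = tvars t - dom \<sigma>"
  by (induction t) (auto split: option.splits)

lemma fvars_fvsub: "fvars (fvsub p \<sigma>) = fvars p - dom \<sigma>"
  by (induction p arbitrary: \<sigma>) (auto simp: tvars_vsub)

lemma tparams_vsub: "tparams (vsub \<sigma> t) \<subseteq> tparams t \<union> ran \<sigma>"
  by (induction t) (auto split: option.splits intro: ranI)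

lemma params_fvsub: "params (fvsub p \<sigma>) \<subseteq> params p \<union> ran \<sigma>"
proof (induction p arbitrary: \<sigma>)
  case (FEx v p)
  have "ran (\<sigma>(v := None)) \<subseteq> ran \<sigma>" by (auto simp: ran_def)
  then show ?case using FEx.IH[of "\<sigma>(v := None)"] by (auto simp del: fun_upd_apply)
next
  case (FEq s t)
  then show ?case using tparams_vsub[of \<sigma> s] tparams_vsub[of \<sigma> t] by auto
next
  case (FPred i t)
  then show ?case using tparams_vsub[of \<sigma> t] by auto
next
  case (FAnd p q)
  then show ?case using FAnd.IH[of \<sigma>] by auto
qed auto

lemma preds_fvsub [simp]: "preds (fvsub p \<sigma>) = preds p"
  by (induction p arbitrary: \<sigma>) auto

text \<open>The integer with binary digits x 0, ..., x (k - 1), the first being the most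
  significant. Divided by 2^k these integers increase to a real number in the unit interval.\<close>

primrec bits :: "(nat \<Rightarrow> bool) \<Rightarrow> nat \<Rightarrow> nat" where
  "bits x 0 = 0"
| "bits x (Suc k) = 2 * bits x k + of_bool (x k)"

lemma bits_ge: "bits x m * 2 ^ k \<le> bits x (m + k)"
  by (induction k) auto

lemma bits_less: "bits x (m + k) < (bits x m + 1) * 2 ^ k"
  by (induction k) auto

lemma bits_inj: "(\<And>k. bits x k = bits y k) \<Longrightarrow> x = y"
proof
  fix k assume eq: "\<And>k. bits x k = bits y k"
  have "of_bool (x k) = (of_bool (y k) :: nat)" using eq[of "Suc k"] unfolding bits.simps eq[of k] by simp
  then show "x k = y k" by (simp only: of_bool_eq_iff)
qed

text \<open>In an ultrapower over \<open>\<nat>\<close>, an order of type \<open>\<omega>\<close> becomes an order containing uncountably many cuts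
  of a countable set.\<close>

theorem no_order_property:
  fixes M :: "('i, 'a) struct"
  assumes M: "M \<in> models I (ACF_chain I r)" and wo: "well_order_on I r" and \<phi>: "\<phi> \<in> formulas I {} (n + m)"
  shows "\<not> order_property M n \<phi>"
proof
  assume "order_property M n \<phi>"
  then obtain a b :: "nat \<Rightarrow> nat \<Rightarrow> 'a" where ab: "\<And>i. a i \<in> assignments M" "\<And>i. b i \<in> assignments M"
    "\<And>i j. sat M (\<lambda>v. if v < n then a i v else b j (v - n)) \<phi> \<longleftrightarrow> i < j"
    by (auto simp: order_property_def image_subset_iff)
  obtain U :: "nat filter" where U: "ultrafilter U" "U \<le> sequentially" using nonprincipal_ultrafilter by auto
  have Ms: "is_struct I M" by (rule models_is_struct[OF M])
  let ?V = "ultrapower U M"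
  define a' where "a' f v = urep U (Dom M) (\<lambda>k. a (f k) v)" for f :: "nat \<Rightarrow> nat" and v
  define b' where "b' f v = urep U (Dom M) (\<lambda>k. b (f k) v)" for f :: "nat \<Rightarrow> nat" and v
  have ab': "a' f v \<in> Dom ?V" "b' f v \<in> Dom ?V" for f v
    unfolding a'_def b'_def using ab(1,2) by (auto intro!: urep_Dom[OF U(1) Ms])
  \<comment> \<open>For the variables y of \<open>\<phi>\<close>, which start at n, the elements of
    the ultrapower coded by a function are inserted; the order property becomes the order of
    functions modulo U.\<close>
  define \<sigma> where "\<sigma> f v = (if v < n then None else Some (b' f (v - n)))" for f v
  let ?\<phi> = "map_fm id (diag U M) \<phi>"
  have key: "sat ?V (a' f) (fvsub ?\<phi> (\<sigma> g)) \<longleftrightarrow> eventually (\<lambda>k. f k < g k) U" for f g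
  proof -
    have par: "params \<phi> = {}" using \<phi> by (simp add: formulas_def)
    have "?\<phi> \<in> fms I (Dom ?V)" using \<phi> par by (auto simp: formulas_fms fms_def)
    moreover have "upds (a' f) (\<sigma> g) \<in> assignments ?V"
      using ab' by (intro assignmentsI) (auto simp: \<sigma>_def)
    ultimately have "sat ?V (a' f) (fvsub ?\<phi> (\<sigma> g)) \<longleftrightarrow>
        eventually (\<lambda>k. sat M (\<lambda>v. upds (a' f) (\<sigma> g) v k) (map_fm id (\<lambda>c. c k) ?\<phi>)) U"
      unfolding sat_fvsub by (intro los[OF U(1) Ms]) auto
    also have "\<dots> \<longleftrightarrow> eventually (\<lambda>k. f k < g k) U"
    proof (rule eventually_cong)
      have "eventually (\<lambda>k. \<forall>v\<in>fvars \<phi>. a (f k) v = a' f v k) U"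
        unfolding a'_def using ab(1) by (intro eventually_ball_finite ballI urep_works(2)) auto
      moreover have "eventually (\<lambda>k. \<forall>v\<in>fvars \<phi>. b (g k) (v - n) = b' g (v - n) k) U"
        unfolding b'_def using ab(2) by (intro eventually_ball_finite ballI urep_works(2)) auto
      ultimately show "eventually (\<lambda>k. sat M (\<lambda>v. upds (a' f) (\<sigma> g) v k) (map_fm id (\<lambda>c. c k) ?\<phi>) \<longleftrightarrow> f k < g k) U"
      proof eventually_elim
        case (elim k)
        have "map_fm id (\<lambda>c. c k) ?\<phi> = \<phi>"
          unfolding map_fm_comp by (rule map_fm_ident) (simp add: par)
        moreover have "sat M (\<lambda>v. upds (a' f) (\<sigma> g) v k) \<phi> \<longleftrightarrow> sat M (\<lambda>v. if v < n then a (f k) v else b (g k) (v - n)) \<phi>"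
          using elim by (intro sat_cong) (auto simp: \<sigma>_def)
        ultimately show ?case using ab(3) by simp
      qed
    qed
    finally show ?thesis .
  qed
  \<comment> \<open>At scale 2^k this is the dyadic rational c / 2^l. These thresholds are the
    countably many parameters; if \<open>bits x l < bits y l\<close>, the one with
    \<open>c = bits y l\<close> separates x from y.\<close>
  define h where "h c l k = (c :: nat) * 2 ^ (k - l)" for c l k :: nat
  define A where "A = (\<Union>c. \<Union>l. range (b' (h c l)))"
  have A: "A \<subseteq> Dom ?V" "countable A" using ab' by (auto simp: A_def)
  have "countable (UNIV :: (nat \<Rightarrow> bool) set)"
  proof (rule countable_separated[OF ultrapower_models[OF U(1) M] wo _ _ A, of "preds \<phi>" UNIV "\<lambda>x. a' (bits x)" n])
    show "preds \<phi> \<subseteq> I" using \<phi> by (simp add: formulas_def)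
    show "a' (bits x) \<in> assignments ?V" for x using ab' by (intro assignmentsI)
    fix x y :: "nat \<Rightarrow> bool" assume "x \<noteq> y"
    have *: "\<exists>\<psi>\<in>formulas (preds \<phi>) A n. sat ?V (a' (bits x)) \<psi> \<noteq> sat ?V (a' (bits y)) \<psi>"
      if less: "bits x l < bits y l" for x y l
    proof -
      let ?h = "h (bits y l) l"
      have "eventually (\<lambda>k. bits x k < ?h k) sequentially"
        unfolding eventually_sequentially
      proof (intro exI allI impI)
        fix k assume "l \<le> k"
        then have "bits x k < (bits x l + 1) * 2 ^ (k - l)" using bits_less[of x l "k - l"] by simp
        also have "\<dots> \<le> ?h k" unfolding h_def using less by (intro mult_right_mono) auto
        finally show "bits x k < ?h k" .
      qed
      then have 1: "eventually (\<lambda>k. bits x k < ?h k) U" using U(2) by (auto simp: le_filter_def)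
      have "eventually (\<lambda>k. \<not> bits y k < ?h k) sequentially"
        unfolding eventually_sequentially h_def
        by (intro exI[of _ l] allI impI) (use bits_ge[of y l] le_add_diff_inverse in \<open>metis not_less\<close>)
      then have "eventually (\<lambda>k. \<not> bits y k < ?h k) U" using U(2) by (auto simp: le_filter_def)
      then have 2: "\<not> eventually (\<lambda>k. bits y k < ?h k) U" using ultrafilter_not[OF U(1)] by blast
      have "fvsub ?\<phi> (\<sigma> ?h) \<in> formulas (preds \<phi>) A n"
      proof -
        have "ran (\<sigma> ?h) \<subseteq> A" by (auto simp: \<sigma>_def ran_def A_def split: if_splits)
        then have "params (fvsub ?\<phi> (\<sigma> ?h)) \<subseteq> A"
          using params_fvsub[of ?\<phi> "\<sigma> ?h"] \<phi> by (auto simp: formulas_def)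
        moreover have "fvars (fvsub ?\<phi> (\<sigma> ?h)) \<subseteq> {..<n}"
          by (auto simp: fvars_fvsub \<sigma>_def dom_def split: if_splits)
        ultimately show ?thesis by (simp add: formulas_def)
      qed
      then show ?thesis using key[of "bits x" ?h] key[of "bits y" ?h] 1 2 by blast
    qed
    obtain l where "bits x l \<noteq> bits y l" using \<open>x \<noteq> y\<close> bits_inj by blast
    then show "\<exists>\<psi>\<in>formulas (preds \<phi>) A n. sat ?V (a' (bits x)) \<psi> \<noteq> sat ?V (a' (bits y)) \<psi>"
      using *[of x l y] *[of y l x] by (metis linorder_neqE_nat)
  qed (simp add: countable_finite)
  then show False using uncountable_nat_bool by blast
qed

subsection \<open>Invariant ideals of formulas\<close>

text \<open>These ideals replace Morley rank: modulo an invariant ideal that is maximal among those disjoint from a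
  type, some formula of the type is a finite union of atoms, so it has finite multiplicity.\<close>

definition inv_ideal :: "'i set \<Rightarrow> ('i, 'a) struct \<Rightarrow> nat \<Rightarrow> ('i, 'a) fm set \<Rightarrow> bool" where
  "inv_ideal I V n J \<longleftrightarrow> J \<subseteq> formulas I (Dom V) n \<and>
     (\<forall>\<psi>\<in>formulas I (Dom V) n. (\<forall>e\<in>assignments V. \<not> sat V e \<psi>) \<longrightarrow> \<psi> \<in> J) \<and>
     (\<forall>\<psi>\<in>J. \<forall>\<psi>'\<in>J. \<forall>\<chi>\<in>formulas I (Dom V) n.
        (\<forall>e\<in>assignments V. sat V e \<chi> \<longrightarrow> sat V e \<psi> \<or> sat V e \<psi>') \<longrightarrow> \<chi> \<in> J) \<and>
     (\<forall>\<psi>\<in>J. \<forall>h. elem I V V (params \<psi>) h \<longrightarrow> map_fm id h \<psi> \<in> J)"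

definition atom :: "'i set \<Rightarrow> ('i, 'a) struct \<Rightarrow> nat \<Rightarrow> ('i, 'a) fm set \<Rightarrow> ('i, 'a) fm \<Rightarrow> bool" where
  "atom I V n J \<alpha> \<longleftrightarrow> \<alpha> \<in> formulas I (Dom V) n \<and> \<alpha> \<notin> J \<and>
     (\<forall>\<beta>\<in>formulas I (Dom V) n. FAnd \<alpha> \<beta> \<in> J \<or> FAnd \<alpha> (FNot \<beta>) \<in> J)"

text \<open>One step of the Cantor-Bendixson analysis behind Morley rank: finite unions of atoms
  modulo J are declared small.\<close>

definition atom_ideal :: "'i set \<Rightarrow> ('i, 'a) struct \<Rightarrow> nat \<Rightarrow> ('i, 'a) fm set \<Rightarrow> ('i, 'a) fm set" where
  "atom_ideal I V n J = {\<psi> \<in> formulas I (Dom V) n.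
     \<exists>\<alpha>s. (\<forall>\<alpha>\<in>set \<alpha>s. atom I V n J \<alpha>) \<and> FAnd \<psi> (FNot (FDisj \<alpha>s)) \<in> J}"

context
  fixes I :: "'i set" and V :: "('i, 'a) struct" and n :: nat
  assumes I: "countable I" and V: "is_struct I V" and sat: "saturated I V"
begin

abbreviation (input) "Fm \<equiv> formulas I (Dom V) n"

lemma idealD:
  assumes "inv_ideal I V n J"
  shows "\<psi> \<in> J \<Longrightarrow> \<psi> \<in> Fm"
    and "\<psi> \<in> Fm \<Longrightarrow> (\<And>e. e \<in> assignments V \<Longrightarrow> \<not> sat V e \<psi>) \<Longrightarrow> \<psi> \<in> J"
    and "\<psi> \<in> J \<Longrightarrow> \<psi>' \<in> J \<Longrightarrow> \<chi> \<in> Fm \<Longrightarrow>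
      (\<And>e. e \<in> assignments V \<Longrightarrow> sat V e \<chi> \<Longrightarrow> sat V e \<psi> \<or> sat V e \<psi>') \<Longrightarrow> \<chi> \<in> J"
    and "\<psi> \<in> J \<Longrightarrow> elem I V V (params \<psi>) h \<Longrightarrow> map_fm id h \<psi> \<in> J"
  using assms unfolding inv_ideal_def by blast+

lemma ideal_list:
  assumes J: "inv_ideal I V n J"
  shows "set \<psi>s \<subseteq> J \<Longrightarrow> \<chi> \<in> Fm \<Longrightarrow>
    (\<And>e. e \<in> assignments V \<Longrightarrow> sat V e \<chi> \<Longrightarrow> \<exists>\<psi>\<in>set \<psi>s. sat V e \<psi>) \<Longrightarrow> \<chi> \<in> J"
proof (induction \<psi>s arbitrary: \<chi>)
  case Nil
  then show ?case using idealD(2)[OF J, of \<chi>] by auto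
next
  case (Cons \<psi> \<psi>s)
  have \<psi>: "\<psi> \<in> J" "set \<psi>s \<subseteq> J" using Cons.prems by auto
  have "\<psi> \<in> Fm" by (rule idealD(1)[OF J \<psi>(1)])
  then have "FAnd \<chi> (FNot \<psi>) \<in> J" using Cons.prems \<psi>(2) by (intro Cons.IH) auto
  then show ?case using Cons.prems(2) by (rule idealD(3)[OF J \<psi>(1)]) simp
qed

lemma elem_params: "elem I V V C h \<Longrightarrow> params \<psi> \<subseteq> C \<Longrightarrow> elem I V V (params \<psi>) h"
  by (rule elem_mono) auto

lemma map_inverse: "inj_on h C \<Longrightarrow> params \<psi> \<subseteq> C \<Longrightarrow> map_fm id (inv_into C h) (map_fm id h \<psi>) = \<psi>"
  unfolding map_fm_comp by (rule map_fm_ident) auto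

lemma Fm_params: "\<psi> \<in> Fm \<Longrightarrow> params \<psi> \<subseteq> Dom V"
  by (simp add: formulas_def)

lemma Fm_map: "\<psi> \<in> Fm \<Longrightarrow> elem I V V (params \<psi>) h \<Longrightarrow> map_fm id h \<psi> \<in> Fm"
  by (auto simp: formulas_def elem_def)

lemma ideal_map_iff:
  assumes J: "inv_ideal I V n J" and \<psi>: "\<psi> \<in> Fm" and h: "elem I V V (params \<psi>) h"
  shows "map_fm id h \<psi> \<in> J \<longleftrightarrow> \<psi> \<in> J"
proof
  assume "map_fm id h \<psi> \<in> J"
  moreover have "elem I V V (params (map_fm id h \<psi>)) (inv_into (params \<psi>) h)"
    using elem_inv[OF h V V Fm_params[OF \<psi>]] by simp
  ultimately have "map_fm id (inv_into (params \<psi>) h) (map_fm id h \<psi>) \<in> J" by (rule idealD(4)[OF J])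
  then show "\<psi> \<in> J" using map_inverse[OF elem_inj[OF h V V] subset_refl] by simp
qed (use idealD(4)[OF J _ h] in blast)

lemma extend_elem:
  assumes h: "elem I V V C0 h" and C: "countable C" "C \<subseteq> Dom V" "C0 \<subseteq> C"
  obtains h' where "elem I V V C h'" "\<And>c. c \<in> C0 \<Longrightarrow> h' c = h c"
  using countable_extend_elem[OF sat I V V C h] by blast

text \<open>To test the image of \<open>\<alpha>\<close> against \<open>\<beta>\<close>, the inverse
  of \<open>h\<close> is extended to the parameters of \<open>\<beta>\<close> by saturation; the
  test is made at \<open>\<alpha>\<close>, and its outcome is carried back by the invariance of
  J.\<close>

lemma atom_map:
  assumes J: "inv_ideal I V n J" and \<alpha>: "atom I V n J \<alpha>" and h: "elem I V V (params \<alpha>) h"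
  shows "atom I V n J (map_fm id h \<alpha>)"
proof -
  have \<alpha>F: "\<alpha> \<in> Fm" "\<alpha> \<notin> J" using \<alpha> by (auto simp: atom_def)
  let ?\<alpha> = "map_fm id h \<alpha>"
  have \<alpha>'F: "?\<alpha> \<in> Fm" by (rule Fm_map[OF \<alpha>F(1) h])
  have "FAnd ?\<alpha> \<beta> \<in> J \<or> FAnd ?\<alpha> (FNot \<beta>) \<in> J" if \<beta>: "\<beta> \<in> Fm" for \<beta>
  proof -
    let ?g0 = "inv_into (params \<alpha>) h" and ?C = "h ` params \<alpha> \<union> params \<beta>"
    have g0: "elem I V V (h ` params \<alpha>) ?g0" by (rule elem_inv[OF h V V Fm_params[OF \<alpha>F(1)]])
    have C: "countable ?C" "?C \<subseteq> Dom V" "h ` params \<alpha> \<subseteq> ?C"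
      using Fm_params[OF \<beta>] Fm_params[OF \<alpha>'F] by (auto simp: countable_finite)
    obtain g where g: "elem I V V ?C g" "\<And>c. c \<in> h ` params \<alpha> \<Longrightarrow> g c = ?g0 c"
      using extend_elem[OF g0 C] by blast
    have g\<alpha>: "map_fm id g ?\<alpha> = \<alpha>"
    proof -
      have "map_fm id g ?\<alpha> = map_fm id ?g0 ?\<alpha>" by (rule map_fm_cong_params) (simp add: g(2))
      then show ?thesis using map_inverse[OF elem_inj[OF h V V] subset_refl] by simp
    qed
    have "map_fm id g \<beta> \<in> Fm" by (rule Fm_map[OF \<beta> elem_params[OF g(1)]]) simp
    then have "map_fm id g (FAnd ?\<alpha> \<beta>) \<in> J \<or> map_fm id g (FAnd ?\<alpha> (FNot \<beta>)) \<in> J"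
      using \<alpha> unfolding fm.map g\<alpha> atom_def by blast
    moreover have "map_fm id g (FAnd ?\<alpha> \<beta>) \<in> J \<longleftrightarrow> FAnd ?\<alpha> \<beta> \<in> J"
      using \<alpha>'F \<beta> by (intro ideal_map_iff[OF J] elem_params[OF g(1)]) auto
    moreover have "map_fm id g (FAnd ?\<alpha> (FNot \<beta>)) \<in> J \<longleftrightarrow> FAnd ?\<alpha> (FNot \<beta>) \<in> J"
      using \<alpha>'F \<beta> by (intro ideal_map_iff[OF J] elem_params[OF g(1)]) auto
    ultimately show ?thesis by blast
  qed
  then show ?thesis using \<alpha>'F \<alpha>F ideal_map_iff[OF J \<alpha>F(1) h] by (auto simp: atom_def)
qed

lemma inv_ideal_atoms:
  assumes J: "inv_ideal I V n J"
  shows "inv_ideal I V n (atom_ideal I V n J)"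
  unfolding inv_ideal_def
proof (intro conjI ballI allI impI)
  show "atom_ideal I V n J \<subseteq> Fm" by (auto simp: atom_ideal_def)
  fix \<psi> assume "\<psi> \<in> Fm" "\<forall>e\<in>assignments V. \<not> sat V e \<psi>"
  then show "\<psi> \<in> atom_ideal I V n J"
    using idealD(2)[OF J, of "FAnd \<psi> (FNot (FDisj []))"]
    by (auto simp: atom_ideal_def intro!: exI[of _ "[]"])
next
  fix \<psi> \<psi>' \<chi> assume "\<psi> \<in> atom_ideal I V n J" "\<psi>' \<in> atom_ideal I V n J" and \<chi>: "\<chi> \<in> Fm"
    and imp: "\<forall>e\<in>assignments V. sat V e \<chi> \<longrightarrow> sat V e \<psi> \<or> sat V e \<psi>'"
  then obtain \<alpha>s \<alpha>s' where \<alpha>: "\<forall>\<alpha>\<in>set \<alpha>s. atom I V n J \<alpha>" "FAnd \<psi> (FNot (FDisj \<alpha>s)) \<in> J"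
    "\<forall>\<alpha>\<in>set \<alpha>s'. atom I V n J \<alpha>" "FAnd \<psi>' (FNot (FDisj \<alpha>s')) \<in> J" by (auto simp: atom_ideal_def)
  have "FAnd \<chi> (FNot (FDisj (\<alpha>s @ \<alpha>s'))) \<in> J"
  proof (rule idealD(3)[OF J \<alpha>(2,4)])
    show "FAnd \<chi> (FNot (FDisj (\<alpha>s @ \<alpha>s'))) \<in> Fm" using \<chi> \<alpha>(1,3) by (auto simp: atom_def)
  qed (use imp in auto)
  then show "\<chi> \<in> atom_ideal I V n J" using \<chi> \<alpha>(1,3)
    by (auto simp: atom_ideal_def intro!: exI[of _ "\<alpha>s @ \<alpha>s'"])
next
  fix \<psi> h assume "\<psi> \<in> atom_ideal I V n J" and h: "elem I V V (params \<psi>) h"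
  then obtain \<alpha>s where \<psi>: "\<psi> \<in> Fm" and \<alpha>: "\<forall>\<alpha>\<in>set \<alpha>s. atom I V n J \<alpha>" "FAnd \<psi> (FNot (FDisj \<alpha>s)) \<in> J"
    by (auto simp: atom_ideal_def)
  \<comment> \<open>\<open>h\<close> is elementary on the parameters of \<open>\<psi>\<close> only;
    it is extended to those of the atoms, so that the covering of \<open>\<psi>\<close> by atoms can
    be moved as a whole.\<close>
  let ?C = "params \<psi> \<union> (\<Union>\<alpha>\<in>set \<alpha>s. params \<alpha>)"
  have C: "countable ?C" "?C \<subseteq> Dom V" "params \<psi> \<subseteq> ?C"
    using \<psi> \<alpha>(1) by (auto simp: atom_def formulas_def countable_finite)
  obtain g where g: "elem I V V ?C g" "\<And>c. c \<in> params \<psi> \<Longrightarrow> g c = h c" using extend_elem[OF h C] by blast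
  have "map_fm id g \<psi> = map_fm id h \<psi>" by (rule map_fm_cong_params) (rule g(2))
  moreover have "map_fm id g (FAnd \<psi> (FNot (FDisj \<alpha>s))) \<in> J"
    by (rule idealD(4)[OF J \<alpha>(2) elem_params[OF g(1)]]) auto
  moreover have "atom I V n J \<alpha>'" if "\<alpha>' \<in> set (map (map_fm id g) \<alpha>s)" for \<alpha>'
    using that \<alpha>(1) by (auto intro!: atom_map[OF J] elem_params[OF g(1)])
  ultimately show "map_fm id h \<psi> \<in> atom_ideal I V n J"
    using Fm_map[OF \<psi> h] by (auto simp: atom_ideal_def intro!: exI[of _ "map (map_fm id g) \<alpha>s"])
qed

text \<open>Without atoms every formula outside J splits into two formulas outside J, and iterating
  this builds a binary tree.\<close>

lemma atom_exists:
  assumes J: "inv_ideal I V n J" and \<phi>: "\<phi> \<in> Fm" "\<phi> \<notin> J" and tree: "\<And>t. \<not> binary_tree I V n t"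
  shows "\<exists>\<alpha>. atom I V n J \<alpha>"
proof (rule ccontr)
  assume no: "\<not> ?thesis"
  have "\<forall>\<psi>\<in>Fm - J. \<exists>\<beta>. \<beta> \<in> Fm \<and> FAnd \<psi> \<beta> \<notin> J \<and> FAnd \<psi> (FNot \<beta>) \<notin> J"
    using no by (auto simp: atom_def)
  from bchoice[OF this] obtain sp where
    sp: "\<forall>\<psi>\<in>Fm - J. sp \<psi> \<in> Fm \<and> FAnd \<psi> (sp \<psi>) \<notin> J \<and> FAnd \<psi> (FNot (sp \<psi>)) \<notin> J" by (rule exE)
  define t where "t = rec_list \<phi> (\<lambda>b s \<psi>. FAnd \<psi> (if b then sp \<psi> else FNot (sp \<psi>)))"
  have t: "t [] = \<phi>" "t (b # s) = FAnd (t s) (if b then sp (t s) else FNot (sp (t s)))" for b s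
    by (simp_all add: t_def)
  have tF: "t s \<in> Fm - J" for s
  proof (induction s)
    case (Cons b s)
    then show ?case using sp by (auto simp: t)
  qed (use \<phi> t in simp)
  \<comment> \<open>The recursion puts the latest choice at the head of the list, the tree puts it
    at the end.\<close>
  have "binary_tree I V n (\<lambda>s. t (rev s))"
    unfolding binary_tree_def
  proof (intro allI conjI)
    fix s
    show "t (rev s) \<in> Fm" using tF by blast
    show "\<exists>e\<in>assignments V. sat V e (t (rev s))" using tF[of "rev s"] idealD(2)[OF J, of "t (rev s)"] by blast
    show "\<not> (\<exists>e\<in>assignments V. sat V e (t (rev (s @ [False]))) \<and> sat V e (t (rev (s @ [True]))))"
      by (auto simp: t)
    fix b show "\<forall>e\<in>assignments V. sat V e (t (rev (s @ [b]))) \<longrightarrow> sat V e (t (rev s))" by (auto simp: t)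
  qed
  then show False using tree by blast
qed

text \<open>If J is maximal among the invariant ideals disjoint from p, then its atoms generate a
  strictly larger invariant ideal, which must meet p.\<close>

lemma finite_multiplicity:
  assumes p: "p \<subseteq> Fm" "p \<noteq> {}" "\<And>\<phi>. \<phi> \<in> p \<Longrightarrow> \<exists>e\<in>assignments V. sat V e \<phi>"
    and tree: "\<And>t. \<not> binary_tree I V n t"
  shows "\<exists>J \<phi> \<alpha>s. inv_ideal I V n J \<and> J \<inter> p = {} \<and> \<phi> \<in> p \<and> (\<forall>\<alpha>\<in>set \<alpha>s. atom I V n J \<alpha>) \<and>
    FAnd \<phi> (FNot (FDisj \<alpha>s)) \<in> J"
proof -
  define S where "S = {J. inv_ideal I V n J \<and> J \<inter> p = {}}"
  have "\<exists>J\<in>S. \<forall>J'\<in>S. J \<subseteq> J' \<longrightarrow> J' = J"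
  proof (rule subset_Zorn_nonempty)
    let ?J0 = "{\<psi> \<in> Fm. \<forall>e\<in>assignments V. \<not> sat V e \<psi>}"
    have "map_fm id h \<psi> \<in> ?J0" if \<psi>: "\<psi> \<in> ?J0" and h: "elem I V V (params \<psi>) h" for \<psi> h
      using elem_ex[OF h V V, of \<psi>] \<psi> Fm_map[OF _ h] by (auto simp: formulas_def fms_def)
    then have "inv_ideal I V n ?J0" unfolding inv_ideal_def by blast
    moreover have "?J0 \<inter> p = {}" using p(3) by auto
    ultimately show "S \<noteq> {}" by (auto simp: S_def)
    fix C assume C: "C \<noteq> {}" "subset.chain S C"
    then have CS: "\<And>J. J \<in> C \<Longrightarrow> inv_ideal I V n J \<and> J \<inter> p = {}" by (auto simp: subset.chain_def S_def)
    have "inv_ideal I V n (\<Union>C)"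
      unfolding inv_ideal_def
    proof (intro conjI ballI allI impI)
      show "\<Union>C \<subseteq> Fm" using CS idealD(1) by blast
      obtain J0 where J0: "J0 \<in> C" using C(1) by auto
      fix \<psi> assume "\<psi> \<in> Fm" "\<forall>e\<in>assignments V. \<not> sat V e \<psi>"
      then have "\<psi> \<in> J0" using idealD(2)[of J0 \<psi>] CS[OF J0] by blast
      then show "\<psi> \<in> \<Union>C" using J0 by auto
    next
      fix \<psi> \<psi>' \<chi> assume "\<psi> \<in> \<Union>C" "\<psi>' \<in> \<Union>C" and \<chi>: "\<chi> \<in> Fm"
        "\<forall>e\<in>assignments V. sat V e \<chi> \<longrightarrow> sat V e \<psi> \<or> sat V e \<psi>'"
      then obtain J1 J2 where J12: "J1 \<in> C" "\<psi> \<in> J1" "J2 \<in> C" "\<psi>' \<in> J2" by auto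
      then have "J1 \<subseteq> J2 \<or> J2 \<subseteq> J1" using C(2) by (auto simp: subset_chain_def)
      then obtain J where J: "J \<in> C" "\<psi> \<in> J" "\<psi>' \<in> J" using J12 by blast
      then have "\<chi> \<in> J" using idealD(3)[of J \<psi> \<psi>' \<chi>] CS[OF J(1)] \<chi> by blast
      then show "\<chi> \<in> \<Union>C" using J(1) by auto
    next
      fix \<psi> h assume "\<psi> \<in> \<Union>C" and h: "elem I V V (params \<psi>) h"
      then obtain J where J: "J \<in> C" "\<psi> \<in> J" by auto
      then have "map_fm id h \<psi> \<in> J" using idealD(4)[of J \<psi> h] CS[OF J(1)] h by blast
      then show "map_fm id h \<psi> \<in> \<Union>C" using J(1) by auto
    qed
    moreover have "\<Union>C \<inter> p = {}" using CS by blast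
    ultimately show "\<Union>C \<in> S" by (simp add: S_def)
  qed
  then obtain J where J: "inv_ideal I V n J" "J \<inter> p = {}"
    and max: "\<And>J'. inv_ideal I V n J' \<Longrightarrow> J' \<inter> p = {} \<Longrightarrow> J \<subseteq> J' \<Longrightarrow> J' = J"
    by (auto simp: S_def)
  obtain \<phi> where "\<phi> \<in> p" using p(2) by auto
  then have "\<phi> \<in> Fm" "\<phi> \<notin> J" using p(1) J(2) by auto
  then obtain \<alpha> where \<alpha>: "atom I V n J \<alpha>" using atom_exists[OF J(1) _ _ tree] by blast
  then have \<alpha>': "\<alpha> \<in> Fm" "\<alpha> \<notin> J" by (auto simp: atom_def)
  let ?J = "atom_ideal I V n J"
  have "J \<subseteq> ?J"
  proof
    fix \<psi> assume \<psi>: "\<psi> \<in> J"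
    then have "\<psi> \<in> Fm" by (rule idealD(1)[OF J(1)])
    moreover have "FAnd \<psi> (FNot (FDisj [])) \<in> J"
      by (rule idealD(3)[OF J(1) \<psi> \<psi>]) (use \<open>\<psi> \<in> Fm\<close> in auto)
    ultimately show "\<psi> \<in> ?J" by (auto simp: atom_ideal_def intro!: exI[of _ "[]"])
  qed
  moreover have "FAnd \<alpha> (FNot (FDisj [\<alpha>])) \<in> J"
    by (rule idealD(2)[OF J(1)]) (use \<alpha>'(1) in auto)
  then have "\<alpha> \<in> ?J" using \<alpha> \<alpha>'(1) by (auto simp: atom_ideal_def intro!: exI[of _ "[\<alpha>]"])
  ultimately have "?J \<inter> p \<noteq> {}" using max[OF inv_ideal_atoms[OF J(1)]] \<alpha>'(2) by blast
  then show ?thesis using J by (auto simp: atom_ideal_def)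
qed

text \<open>Otherwise, by invariance, every conjugate of \<open>\<psi>\<close> meets
  \<open>\<phi>\<close> outside J, hence meets one of the finitely many atoms outside J. Some atom
  serves infinitely many conjugates; k of these are inconsistent, so the parts of the atom outside
  each of them cover it. All these parts are in J, and the atom would be in J too.\<close>

lemma dividing_in_ideal:
  assumes J: "inv_ideal I V n J" and \<phi>: "\<phi> \<in> Fm" and \<alpha>: "\<forall>\<alpha>\<in>set \<alpha>s. atom I V n J \<alpha>"
    and mult: "FAnd \<phi> (FNot (FDisj \<alpha>s)) \<in> J" and \<psi>: "\<psi> \<in> Fm"
    and h: "\<And>j :: nat. elem I V V (params \<phi> \<union> params \<psi>) (h j)" "\<And>j c. c \<in> params \<phi> \<Longrightarrow> h j c = c"
    and incons: "\<And>K. finite K \<Longrightarrow> card K = k \<Longrightarrow> \<not> (\<exists>e\<in>assignments V. \<forall>j\<in>K. sat V e (map_fm id (h j) \<psi>))"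
  shows "FAnd \<phi> \<psi> \<in> J"
proof (rule ccontr)
  assume not: "FAnd \<phi> \<psi> \<notin> J"
  let ?\<psi> = "\<lambda>j. map_fm id (h j) \<psi>"
  have \<psi>F: "?\<psi> j \<in> Fm" for j by (rule Fm_map[OF \<psi> elem_params[OF h(1)]]) simp
  have \<phi>\<psi>: "FAnd \<phi> (?\<psi> j) \<notin> J" for j
  proof -
    have "map_fm id (h j) \<phi> = \<phi>" by (rule map_fm_ident) (rule h(2))
    then have "map_fm id (h j) (FAnd \<phi> \<psi>) = FAnd \<phi> (?\<psi> j)" by simp
    moreover have "map_fm id (h j) (FAnd \<phi> \<psi>) \<in> J \<longleftrightarrow> FAnd \<phi> \<psi> \<in> J"
      using \<phi> \<psi> by (intro ideal_map_iff[OF J] elem_params[OF h(1)]) auto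
    ultimately show ?thesis using not by simp
  qed
  have "\<exists>\<alpha>\<in>set \<alpha>s. FAnd \<alpha> (?\<psi> j) \<notin> J" for j
  proof (rule ccontr)
    assume "\<not> ?thesis"
    then have "set (FAnd \<phi> (FNot (FDisj \<alpha>s)) # map (\<lambda>\<alpha>. FAnd \<alpha> (?\<psi> j)) \<alpha>s) \<subseteq> J" using mult by auto
    then have "FAnd \<phi> (?\<psi> j) \<in> J"
      by (rule ideal_list[OF J]) (use \<phi> \<psi>F in auto)
    then show False using \<phi>\<psi> by blast
  qed
  then have "\<exists>i<length \<alpha>s. FAnd (\<alpha>s ! i) (?\<psi> j) \<notin> J" for j by (metis in_set_conv_nth)
  then have "\<forall>j. \<exists>i. i < length \<alpha>s \<and> FAnd (\<alpha>s ! i) (?\<psi> j) \<notin> J" by blast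
  from choice[OF this] obtain c where c: "\<forall>j. c j < length \<alpha>s \<and> FAnd (\<alpha>s ! c j) (?\<psi> j) \<notin> J" by (rule exE)
  have "finite (range c)" by (rule finite_subset[of _ "{..<length \<alpha>s}"]) (use c in auto)
  then obtain j0 where inf: "infinite {j. c j = c j0}"
    using pigeonhole_infinite[of "UNIV :: nat set" c] by auto
  obtain K where K: "finite K" "card K = k" "K \<subseteq> {j. c j = c j0}"
    using infinite_arbitrarily_large[OF inf] by blast
  let ?\<alpha> = "\<alpha>s ! c j0"
  have at: "atom I V n J ?\<alpha>" using c \<alpha> by simp
  have "FAnd ?\<alpha> (FNot (?\<psi> j)) \<in> J" if "j \<in> K" for j
  proof -
    have "c j = c j0" using K(3) that by blast
    then have "FAnd ?\<alpha> (?\<psi> j) \<notin> J" using c[THEN spec, of j] by simp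
    then show ?thesis using at \<psi>F[of j] unfolding atom_def by blast
  qed
  moreover obtain ks where ks: "set ks = K" using finite_list[OF K(1)] by auto
  ultimately have sub: "set (map (\<lambda>j. FAnd ?\<alpha> (FNot (?\<psi> j))) ks) \<subseteq> J" by auto
  have "?\<alpha> \<in> J"
  proof (rule ideal_list[OF J sub])
    show "?\<alpha> \<in> Fm" using at by (simp add: atom_def)
    fix e assume "e \<in> assignments V" "sat V e ?\<alpha>"
    then show "\<exists>\<psi>'\<in>set (map (\<lambda>j. FAnd ?\<alpha> (FNot (?\<psi> j))) ks). sat V e \<psi>'"
      using incons[OF K(1,2)] ks by auto
  qed
  then show False using at by (simp add: atom_def)
qed

end

subsection \<open>Forking\<close>

text \<open>The inconsistency that defines forking involves a finite part P of the type; having P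
  explicitly makes it possible to keep track of its parameters and predicates.\<close>

lemma forksE:
  fixes M :: "('i, 'a) struct"
  assumes "forks I M B n p"
  shows "\<exists>(N :: ('i, 'a) struct) f \<Phi> P. is_struct I N \<and> elem I M N (Dom M) f \<and> finite \<Phi> \<and> \<Phi> \<subseteq> formulas I (Dom N) n \<and>
    (\<forall>\<psi>\<in>\<Phi>. Defs.divides I N (f ` B) \<psi>) \<and> finite P \<and> P \<subseteq> p \<and>
    (\<forall>e\<in>assignments N. (\<forall>\<phi>\<in>P. sat N e (map_fm id f \<phi>)) \<longrightarrow> (\<exists>\<psi>\<in>\<Phi>. sat N e \<psi>))"
proof -
  obtain N :: "('i, 'a) struct" and f \<Phi> where *: "is_struct I N" "elem I M N (Dom M) f" "finite \<Phi>" "\<Phi> \<subseteq> formulas I (Dom N) n"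
    "\<forall>\<psi>\<in>\<Phi>. Defs.divides I N (f ` B) \<psi>" "\<not> fin_sat N (map_fm id f ` p \<union> FNot ` \<Phi>)"
    using assms unfolding forks_def elementary_on_elem by blast
  then obtain q where q: "finite q" "q \<subseteq> map_fm id f ` p \<union> FNot ` \<Phi>"
    "\<not> (\<exists>e\<in>assignments N. \<forall>\<phi>\<in>q. sat N e \<phi>)" unfolding fin_sat_def by blast
  have "finite (q \<inter> map_fm id f ` p)" "q \<inter> map_fm id f ` p \<subseteq> map_fm id f ` p" using q(1) by auto
  then obtain P where P: "finite P" "P \<subseteq> p" "q \<inter> map_fm id f ` p = map_fm id f ` P"
    using finite_subset_image[of "q \<inter> map_fm id f ` p" "map_fm id f" p] by blast
  have "\<exists>\<psi>\<in>\<Phi>. sat N e \<psi>" if e: "e \<in> assignments N" "\<forall>\<phi>\<in>P. sat N e (map_fm id f \<phi>)" for e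
  proof (rule ccontr)
    assume no: "\<not> ?thesis"
    have "sat N e \<phi>" if "\<phi> \<in> q" for \<phi>
    proof (cases "\<phi> \<in> map_fm id f ` p")
      case True
      then have "\<phi> \<in> map_fm id f ` P" using P(3) that by blast
      then show ?thesis using e(2) by auto
    next
      case False
      then have "\<phi> \<in> FNot ` \<Phi>" using q(2) that by blast
      then show ?thesis using no by auto
    qed
    then show False using q(3) e(1) by blast
  qed
  then show ?thesis using * P by blast
qed

text \<open>In a countable sublanguage, a formula dividing over \<open>B\<close> in some elementary extension of \<open>M\<close> can be
  moved into the saturated model, together with witnesses of its dividing.\<close>

lemma divides_saturated:
  fixes N :: "('i, 'a) struct" and V :: "('i, 'b) struct"
  assumes I0: "countable I0" "I0 \<subseteq> I" and V: "is_struct I0 V" "saturated I0 V" and N: "is_struct I N"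
    and div: "Defs.divides I N B \<psi>" and \<psi>: "\<psi> \<in> fms I0 (Dom N)" and B: "countable B" "B \<subseteq> Dom N"
    and g: "elem I0 N V (B \<union> params \<psi>) g"
  shows "\<exists>h k. (\<forall>j :: nat. elem I0 V V (g ` (B \<union> params \<psi>)) (h j)) \<and> (\<forall>j. \<forall>b\<in>B. h j (g b) = g b) \<and>
    (\<forall>K. finite K \<and> card K = k \<longrightarrow>
      \<not> (\<exists>e\<in>assignments V. \<forall>j\<in>K. sat V e (map_fm id (h j) (map_fm id g \<psi>))))"
proof -
  obtain N' f' and hh :: "nat \<Rightarrow> 'a \<Rightarrow> 'a" and k where N': "is_struct I N'" "elem I N N' (Dom N) f'"
    and hh: "\<And>j. elem I N N' (B \<union> params \<psi>) (hh j)" "\<And>j b. b \<in> B \<Longrightarrow> hh j b = f' b"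
    and inc: "\<And>K. finite K \<and> card K = k \<Longrightarrow> \<not> (\<exists>e\<in>assignments N'. \<forall>j\<in>K. sat N' e (map_fm id (hh j) \<psi>))"
    using div unfolding Defs.divides_def elementary_on_elem by metis
  let ?D = "B \<union> params \<psi>"
  have D: "countable ?D" "?D \<subseteq> Dom N" using B \<psi> by (auto simp: fms_def countable_finite)
  have N0: "is_struct I0 N" "is_struct I0 N'" using is_struct_mono[OF N I0(2)] is_struct_mono[OF N'(1) I0(2)] by auto
  have f'0: "elem I0 N N' B f'" by (rule elem_mono[OF N'(2) B(2) I0(2)])
  have hh0: "elem I0 N N' ?D (hh j)" for j by (rule elem_mono[OF hh(1) subset_refl I0(2)])
  let ?inv = "inv_into B f'"
  have inj_f': "inj_on f' B" by (rule elem_inj[OF f'0 N0])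
  have "elem I0 N' V (f' ` B) (\<lambda>x. g (?inv x))"
  proof (rule elem_comp[where f = ?inv and g = g])
    show "elem I0 N' N (f' ` B) ?inv" by (rule elem_inv[OF f'0 N0 B(2)])
    show "elem I0 N V B g" by (rule elem_mono[OF g]) auto
    show "?inv ` f' ` B \<subseteq> B" using inj_f' by auto
  qed
  note hcomp = this
  \<comment> \<open>A single map \<open>g'\<close> moves all conjugates into V, agreeing with
    \<open>g\<close> on what comes from B. The new conjugations \<open>h j\<close> lead from V back
    to N, then by \<open>hh j\<close> to the further extension, and by \<open>g'\<close> into
    V.\<close>
  let ?C = "f' ` B \<union> (\<Union>j. hh j ` ?D)"
  have hhD: "hh j ` ?D \<subseteq> Dom N'" for j using hh0[of j] by (simp add: elem_def)
  have "f' ` B \<subseteq> Dom N'" using f'0 by (simp add: elem_def)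
  then have C: "countable ?C" "?C \<subseteq> Dom N'" "f' ` B \<subseteq> ?C"
    subgoal using B(1) D(1) by simp
    subgoal by (intro Un_least UN_least hhD \<open>f' ` B \<subseteq> Dom N'\<close>)
    subgoal by (rule Un_upper1)
    done
  obtain g' where g'0: "elem I0 N' V ?C g' \<and> (\<forall>c\<in>f' ` B. g' c = g (?inv c))"
    by (rule exE[OF countable_extend_elem[OF V(2) I0(1) V(1) N0(2) C hcomp]])
  note g' = conjunct1[OF g'0] bspec[OF conjunct2[OF g'0]]
  have inj_g: "inj_on g ?D" by (rule elem_inj[OF g N0(1) V(1)])
  define h where "h j x = g' (hh j (inv_into ?D g x))" for j x
  have "elem I0 V V (g ` ?D) (h j)" for j
    unfolding h_def
  proof (rule elem_comp[where f = "\<lambda>x. hh j (inv_into ?D g x)" and g = g'])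
    show "elem I0 V N' (g ` ?D) (\<lambda>x. hh j (inv_into ?D g x))"
      by (rule elem_comp[OF elem_inv[OF g N0(1) V(1) D(2)] hh0]) (use inj_g in auto)
    show "elem I0 N' V ?C g'" by (rule g'(1))
    show "(\<lambda>x. hh j (inv_into ?D g x)) ` g ` ?D \<subseteq> ?C"
    proof (intro image_subsetI)
      fix y assume "y \<in> g ` ?D"
      then have "inv_into ?D g y \<in> ?D" by (rule inv_into_into)
      then have "hh j (inv_into ?D g y) \<in> hh j ` ?D" by (rule imageI)
      then show "hh j (inv_into ?D g y) \<in> ?C" by blast
    qed
  qed
  moreover have "h j (g b) = g b" if "b \<in> B" for j b
  proof -
    have "inv_into ?D g (g b) = b" using inj_g that by (intro inv_into_f_f) auto
    then have "h j (g b) = g' (f' b)" using hh(2)[OF that] by (simp add: h_def)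
    also have "\<dots> = g b" using g'(2)[of "f' b"] inv_into_f_f[OF inj_f' that] that by auto
    finally show ?thesis .
  qed
  moreover have "\<not> (\<exists>e\<in>assignments V. \<forall>j\<in>K. sat V e (map_fm id (h j) (map_fm id g \<psi>)))"
    if K: "finite K \<and> card K = k" for K
  proof -
    obtain ks where ks: "set ks = K" using K finite_list by blast
    have eq: "map_fm id (h j) (map_fm id g \<psi>) = map_fm id g' (map_fm id (hh j) \<psi>)" for j
      unfolding map_fm_comp h_def using inj_g by (intro map_fm_cong_params) (simp add: inv_into_f_f)
    let ?\<chi> = "FConj (map (\<lambda>j. map_fm id (hh j) \<psi>) ks)"
    have "map_fm id (hh j) \<psi> \<in> fms I0 ?C" for j
    proof -
      have "hh j ` params \<psi> \<subseteq> hh j ` ?D" by (rule image_mono) (rule Un_upper2)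
      also have "\<dots> \<subseteq> ?C" by (rule le_supI2) (rule UN_upper, rule UNIV_I)
      finally show ?thesis using \<psi> by (simp add: fms_def fm.set_map)
    qed
    then have "?\<chi> \<in> fms I0 ?C" by auto
    moreover have "\<not> (\<exists>e\<in>assignments N'. sat N' e ?\<chi>)" using inc[OF K] ks by simp
    ultimately have "\<not> (\<exists>e\<in>assignments V. sat V e (map_fm id g' ?\<chi>))"
      using elem_ex[OF g'(1) N0(2) V(1)] by blast
    then show ?thesis unfolding eq using ks by simp
  qed
  ultimately show ?thesis by blast
qed

text \<open>If p forks over every finite subset of A, each instance is witnessed by finitely many
  formulas. The increasing finite sets \<open>Bs m\<close> absorb the parameters of the witnesses
  for the preceding set, and only the countably many predicates occurring in the witnesses are kept.
  A formula of finite multiplicity in the restricted type has its parameters in some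
  \<open>Bs m\<close>; forking over this set then forces a formula of the type into an ideal
  disjoint from it.\<close>

theorem nonforking_finite_base:
  fixes M :: "('i, 'a) struct"
  assumes M: "M \<in> models I (ACF_chain I r)" and wo: "well_order_on I r" and A: "A \<subseteq> Dom M"
    and p: "p \<in> complete_types I M A n"
  shows "\<exists>B. finite B \<and> B \<subseteq> A \<and> \<not> forks I M B n p"
proof (rule ccontr)
  assume no: "\<not> ?thesis"
  have Ms: "is_struct I M" by (rule models_is_struct[OF M])
  have p': "p \<subseteq> formulas I A n" "fin_sat M p" "\<And>\<phi>. \<phi> \<in> formulas I A n \<Longrightarrow> \<phi> \<in> p \<or> FNot \<phi> \<in> p"
    using p by (auto simp: complete_types_def)
  define Q where "Q B = (\<lambda>(N :: ('i, 'a) struct, f, \<Phi>, P). is_struct I N \<and> elem I M N (Dom M) f \<and> finite \<Phi> \<and>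
    \<Phi> \<subseteq> formulas I (Dom N) n \<and>
    (\<forall>\<psi>\<in>\<Phi>. Defs.divides I N (f ` B) \<psi>) \<and> finite P \<and> P \<subseteq> p \<and>
    (\<forall>e\<in>assignments N. (\<forall>\<phi>\<in>P. sat N e (map_fm id f \<phi>)) \<longrightarrow> (\<exists>\<psi>\<in>\<Phi>. sat N e \<psi>)))" for B
  have "\<forall>B\<in>{B. finite B \<and> B \<subseteq> A}. \<exists>x. Q B x"
  proof
    fix B assume "B \<in> {B. finite B \<and> B \<subseteq> A}"
    then have "forks I M B n p" using no by blast
    from forksE[OF this] show "\<exists>x. Q B x" unfolding Q_def by auto
  qed
  from bchoice[OF this] obtain X' where X': "\<forall>B\<in>{B. finite B \<and> B \<subseteq> A}. Q B (X' B)" by (rule exE)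
  define NN where "NN B = fst (X' B)" for B
  define ff where "ff B = fst (snd (X' B))" for B
  define PH where "PH B = fst (snd (snd (X' B)))" for B
  define PP where "PP B = snd (snd (snd (X' B)))" for B
  have Q: "is_struct I (NN B)" "elem I M (NN B) (Dom M) (ff B)" "finite (PH B)" "PH B \<subseteq> formulas I (Dom (NN B)) n"
    "\<And>\<psi>. \<psi> \<in> PH B \<Longrightarrow> Defs.divides I (NN B) (ff B ` B) \<psi>" "finite (PP B)" "PP B \<subseteq> p"
    "\<And>e. e \<in> assignments (NN B) \<Longrightarrow> (\<And>\<phi>. \<phi> \<in> PP B \<Longrightarrow> sat (NN B) e (map_fm id (ff B) \<phi>)) \<Longrightarrow>
       \<exists>\<psi>\<in>PH B. sat (NN B) e \<psi>"
    if "finite B" "B \<subseteq> A" for B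
    using bspec[OF X', of B] that unfolding Q_def NN_def ff_def PH_def PP_def case_prod_beta by blast+
  define Bs where "Bs = rec_nat {} (\<lambda>_ B. B \<union> (\<Union>\<phi>\<in>PP B. params \<phi>))"
  have Bs: "Bs 0 = {}" "Bs (Suc m) = Bs m \<union> (\<Union>\<phi>\<in>PP (Bs m). params \<phi>)" for m by (simp_all add: Bs_def)
  have BsA: "finite (Bs m) \<and> Bs m \<subseteq> A" for m
  proof (induction m)
    case (Suc m)
    then have "finite (PP (Bs m))" "PP (Bs m) \<subseteq> p" using Q(6,7)[of "Bs m"] by auto
    then show ?case using Suc p'(1) by (auto simp: Bs formulas_def)
  qed (simp add: Bs)
  have mono: "Bs m \<subseteq> Bs m'" if "m \<le> m'" for m m'
    using lift_Suc_mono_le[of Bs m m'] that Bs(2) by blast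
  define I0 where "I0 = (\<Union>m. (\<Union>\<phi>\<in>PP (Bs m). preds \<phi>) \<union> (\<Union>\<psi>\<in>PH (Bs m). preds \<psi>))"
  define A0 where "A0 = (\<Union>m. Bs m)"
  have PPc: "finite (PP (Bs m))" "PP (Bs m) \<subseteq> p" "finite (PH (Bs m))" "PH (Bs m) \<subseteq> formulas I (Dom (NN (Bs m))) n" for m
    using Q(3,4,6,7)[of "Bs m"] BsA[of m] by auto
  have I0: "countable I0" "I0 \<subseteq> I"
  proof -
    show "countable I0" unfolding I0_def using PPc by (intro countable_UN) (auto intro!: countable_finite)
    show "I0 \<subseteq> I" unfolding I0_def using PPc(2,4) p'(1) by (fastforce simp: formulas_def)
  qed
  have A0: "countable A0" "A0 \<subseteq> A" using BsA countable_UN[of UNIV Bs] countable_finite by (auto simp: A0_def)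
  obtain U :: "nat filter" where U: "ultrafilter U" "U \<le> sequentially" using nonprincipal_ultrafilter by auto
  let ?V = "ultrapower U M" and ?d = "diag U M"
  have Ms0: "is_struct I0 M" by (rule is_struct_mono[OF Ms I0(2)])
  have Vs: "is_struct I0 ?V" by (rule is_struct_ultrapower[OF U(1) Ms0])
  have Vsat: "saturated I0 ?V" by (rule saturated_ultrapower[OF U Ms0])
  have tree: "\<not> binary_tree I0 ?V n t" for t
  proof
    assume "binary_tree I0 ?V n t"
    then have "binary_tree I ?V n t" using I0(2) unfolding binary_tree_def formulas_def by blast
    then show False using no_binary_tree[OF ultrapower_models[OF U(1) M] wo] by blast
  qed
  define p0 where "p0 = p \<inter> formulas I0 A0 n"
  have in_p0: "\<theta> \<in> p0" if \<theta>: "\<theta> \<in> formulas I0 A0 n" and S: "finite S" "S \<subseteq> p"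
    and imp: "\<And>e. e \<in> assignments M \<Longrightarrow> (\<And>\<phi>. \<phi> \<in> S \<Longrightarrow> sat M e \<phi>) \<Longrightarrow> sat M e \<theta>" for \<theta> S
  proof -
    have "\<theta> \<in> formulas I A n" using \<theta> I0(2) A0(2) by (auto intro: formulas_mono)
    moreover have "FNot \<theta> \<notin> p"
    proof
      assume "FNot \<theta> \<in> p"
      then have "\<exists>e\<in>assignments M. \<forall>\<phi>\<in>insert (FNot \<theta>) S. sat M e \<phi>"
        using p'(2) S unfolding fin_sat_def by (meson finite_insert insert_subset)
      then show False using imp by auto
    qed
    ultimately show ?thesis using p'(3) \<theta> by (auto simp: p0_def)
  qed
  have dA: "?d ` A0 \<subseteq> Dom ?V" using A0(2) A diag_Dom[OF U(1) Ms] by auto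
  let ?p = "map_fm id ?d ` p0"
  have "?p \<subseteq> formulas I0 (Dom ?V) n" using dA by (auto simp: p0_def intro: map_fm_formulas)
  moreover have "FEq TZero TZero \<in> p0" by (rule in_p0[of _ "{}"]) auto
  then have "?p \<noteq> {}" by auto
  moreover have "\<exists>e\<in>assignments ?V. sat ?V e \<phi>'" if mem: "\<phi>' \<in> ?p" for \<phi>'
  proof -
    obtain \<phi> where \<phi>: "\<phi> \<in> p0" "\<phi>' = map_fm id ?d \<phi>" using mem by (rule imageE)
    then have "finite {\<phi>} \<and> {\<phi>} \<subseteq> p" by (simp add: p0_def)
    then have "\<exists>e\<in>assignments M. sat M e \<phi>" using p'(2) unfolding fin_sat_def by blast
    moreover have "\<phi> \<in> fms I0 (Dom M)" using \<phi>(1) A0(2) A by (auto simp: p0_def formulas_def fms_def)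
    ultimately show ?thesis
      using elem_ex[OF diag_elem[OF U(1) Ms0] Ms0 Vs] \<phi>(2) by blast
  qed
  ultimately obtain J \<phi>' \<alpha>s where J: "inv_ideal I0 ?V n J" "J \<inter> ?p = {}" "\<phi>' \<in> ?p"
    and \<alpha>: "\<forall>\<alpha>\<in>set \<alpha>s. atom I0 ?V n J \<alpha>" "FAnd \<phi>' (FNot (FDisj \<alpha>s)) \<in> J"
    using finite_multiplicity[OF I0(1) Vs Vsat _ _ _ tree, of ?p] by blast
  obtain \<phi> where \<phi>: "\<phi> \<in> p0" "\<phi>' = map_fm id ?d \<phi>" using J(3) by (rule imageE)
  have "\<exists>m. F \<subseteq> Bs m" if "finite F" "F \<subseteq> A0" for F
    using that
  proof (induction F rule: finite_induct)
    case (insert x F)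
    then obtain m m' where "F \<subseteq> Bs m" "x \<in> Bs m'" by (auto simp: A0_def)
    then have "insert x F \<subseteq> Bs (max m m')" using mono[of m "max m m'"] mono[of m' "max m m'"] by auto
    then show ?case by blast
  qed simp
  from this[of "params \<phi>"] obtain m where m: "params \<phi> \<subseteq> Bs m"
    using \<phi>(1) by (auto simp: p0_def formulas_def)
  let ?B = "Bs m" and ?B' = "Bs (Suc m)"
  let ?N = "NN ?B" and ?f = "ff ?B"
  note Qm = Q[of ?B, OF conjunct1[OF BsA] conjunct2[OF BsA]]
  have BD: "?B' \<subseteq> Dom M" "?B \<subseteq> ?B'" using BsA[of "Suc m"] A mono[of m "Suc m"] by auto
  have N0: "is_struct I0 ?N" by (rule is_struct_mono[OF Qm(1) I0(2)])
  have f0: "elem I0 M ?N ?B' ?f" by (rule elem_mono[OF Qm(2) BD(1) I0(2)])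
  have inj_f: "inj_on ?f ?B'" by (rule elem_inj[OF f0 Ms0 N0])
  let ?inv = "inv_into ?B' ?f"
  have "elem I0 ?N ?V (?f ` ?B') (\<lambda>x. ?d (?inv x))"
    by (rule elem_comp[OF elem_inv[OF f0 Ms0 N0 BD(1)] elem_mono[OF diag_elem[OF U(1) Ms0] BD(1) subset_refl]])
      (use inj_f in auto)
  note finv = this
  \<comment> \<open>The extension N and the ultrapower V have only M in common. Going back from N to
    M on the image of \<open>?B'\<close> and then along the diagonal is elementary; its extension to
    the parameters of the dividing formulas brings these into V.\<close>
  let ?C = "?f ` ?B' \<union> (\<Union>\<psi>\<in>PH ?B. params \<psi>)"
  have C: "countable ?C" "?C \<subseteq> Dom ?N" "?f ` ?B' \<subseteq> ?C"
  proof -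
    show "countable ?C" using BsA[of "Suc m"] PPc(3)[of m] by (auto intro!: countable_finite)
    show "?C \<subseteq> Dom ?N" using f0 PPc(4)[of m] by (auto simp: elem_def formulas_def)
  qed auto
  obtain g where g0: "elem I0 ?N ?V ?C g \<and> (\<forall>c\<in>?f ` ?B'. g c = ?d (?inv c))"
    by (rule exE[OF countable_extend_elem[OF Vsat I0(1) Vs N0 C finv]])
  note g = conjunct1[OF g0] bspec[OF conjunct2[OF g0]]
  have gf: "g (?f b) = ?d b" if "b \<in> ?B'" for b using g(2)[of "?f b"] inv_into_f_f[OF inj_f that] that by auto
  have \<psi>J: "FAnd \<phi>' (map_fm id g \<psi>) \<in> J" if \<psi>: "\<psi> \<in> PH ?B" for \<psi>
  proof -
    have \<psi>0: "\<psi> \<in> fms I0 (Dom ?N)" "fvars \<psi> \<subseteq> {..<n}"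
      using \<psi> PPc(4)[of m] by (auto simp: I0_def formulas_def fms_def)
    have gD: "elem I0 ?N ?V (?f ` ?B \<union> params \<psi>) g"
      using \<psi> BD(2) by (intro elem_mono[OF g(1)]) auto
    have fB: "countable (?f ` ?B)" using BsA[of m] by (auto intro: countable_finite)
    have fB2: "?f ` ?B \<subseteq> Dom ?N" using BD(2) C(2) by (meson image_mono le_sup_iff order_trans)
    obtain h k where h0: "(\<forall>j :: nat. elem I0 ?V ?V (g ` (?f ` ?B \<union> params \<psi>)) (h j)) \<and>
      (\<forall>j. \<forall>b\<in>?f ` ?B. h j (g b) = g b) \<and> (\<forall>K. finite K \<and> card K = k \<longrightarrow>
        \<not> (\<exists>e\<in>assignments ?V. \<forall>j\<in>K. sat ?V e (map_fm id (h j) (map_fm id g \<psi>))))"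
      using divides_saturated[OF I0 Vs Vsat Qm(1) Qm(5)[OF \<psi>] \<psi>0(1) fB fB2 gD] by (elim exE)
    note h = spec[OF conjunct1[OF h0]] bspec[OF spec[OF conjunct1[OF conjunct2[OF h0]]]]
      mp[OF spec[OF conjunct2[OF conjunct2[OF h0]]]]
    have par: "params \<phi>' \<subseteq> g ` ?f ` ?B"
    proof
      fix c assume "c \<in> params \<phi>'"
      then obtain b where "b \<in> ?B" "c = ?d b" using \<phi>(2) m by auto
      then show "c \<in> g ` ?f ` ?B" using gf[of b] BD(2) by (metis imageI subsetD)
    qed
    show ?thesis
    proof (rule dividing_in_ideal[OF I0(1) Vs Vsat J(1) _ \<alpha>])
      show "\<phi>' \<in> formulas I0 (Dom ?V) n" using J(3) \<open>?p \<subseteq> formulas I0 (Dom ?V) n\<close> by blast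
      show "map_fm id g \<psi> \<in> formulas I0 (Dom ?V) n"
        using \<psi>0 gD by (auto simp: formulas_def fms_def elem_def)
      show "elem I0 ?V ?V (params \<phi>' \<union> params (map_fm id g \<psi>)) (h j)" for j
        using par by (intro elem_mono[OF h(1)]) auto
      show "h j c = c" if "c \<in> params \<phi>'" for j c using par that h(2) by auto
      show "\<not> (\<exists>e\<in>assignments ?V. \<forall>j\<in>K. sat ?V e (map_fm id (h j) (map_fm id g \<psi>)))"
        if "finite K" "card K = k" for K by (rule h(3)) (use that in simp)
    qed
  qed
  obtain Ps where Ps: "set Ps = PP ?B" using finite_list[OF PPc(1)] by blast
  obtain Hs where Hs: "set Hs = PH ?B" using finite_list[OF PPc(3)] by blast
  have PsF: "\<theta> \<in> formulas I0 A0 n" "params \<theta> \<subseteq> ?B'" if "\<theta> \<in> PP ?B" for \<theta>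
  proof -
    show "params \<theta> \<subseteq> ?B'" using that by (auto simp: Bs(2))
    then have "params \<theta> \<subseteq> A0" unfolding A0_def by blast
    moreover have "preds \<theta> \<subseteq> I0" using that by (auto simp: I0_def)
    moreover have "\<theta> \<in> formulas I A n" using that PPc(2)[of m] p'(1) by blast
    ultimately show "\<theta> \<in> formulas I0 A0 n" by (simp add: formulas_def)
  qed
  \<comment> \<open>In V this implies \<open>\<phi>'\<close> together with one of the dividing
    formulas, so it lies in J by \<open>\<psi>J\<close>, although it belongs to the type.\<close>
  let ?\<theta> = "FConj (\<phi> # Ps)"
  have "?\<theta> \<in> p0"
  proof (rule in_p0)
    show "?\<theta> \<in> formulas I0 A0 n" using \<phi>(1) PsF Ps by (auto simp: p0_def)
    show "finite (insert \<phi> (PP ?B))" "insert \<phi> (PP ?B) \<subseteq> p" using PPc \<phi>(1) by (auto simp: p0_def)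
  qed (use Ps in auto)
  then have \<theta>p: "map_fm id ?d ?\<theta> \<in> ?p" by blast
  let ?\<chi> = "FNot (FAnd (FConj (map (map_fm id ?f) Ps)) (FNot (FDisj Hs)))"
  have "?\<chi> \<in> fms I0 ?C"
  proof -
    have "map_fm id ?f \<theta> \<in> fms I0 ?C" if "\<theta> \<in> PP ?B" for \<theta>
      using PsF[OF that] by (auto simp: formulas_def fms_def)
    moreover have "\<psi> \<in> fms I0 ?C" if "\<psi> \<in> PH ?B" for \<psi> using that by (auto simp: I0_def fms_def)
    ultimately show ?thesis using Ps Hs by (auto simp: FDisj_def)
  qed
  moreover have "\<forall>e\<in>assignments ?N. sat ?N e ?\<chi>"
  proof
    fix e assume e: "e \<in> assignments ?N"
    have "\<exists>\<psi>\<in>PH ?B. sat ?N e \<psi>" if *: "\<forall>\<theta>\<in>PP ?B. sat ?N e (map_fm id ?f \<theta>)"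
      by (rule Qm(8)[OF e]) (rule bspec[OF *])
    then show "sat ?N e ?\<chi>" by (auto simp: Ps Hs)
  qed
  ultimately have \<chi>V: "\<forall>e\<in>assignments ?V. sat ?V e (map_fm id g ?\<chi>)" using elem_all[OF g(1) N0 Vs] by blast
  have gPs: "map_fm id g (map_fm id ?f \<theta>) = map_fm id ?d \<theta>" if "\<theta> \<in> PP ?B" for \<theta>
    unfolding map_fm_comp using PsF(2)[OF that] gf by (intro map_fm_cong_params) auto
  have "map_fm id ?d ?\<theta> \<in> J"
  proof (rule ideal_list[OF I0(1) Vs Vsat J(1)])
    show "set (map (\<lambda>\<psi>. FAnd \<phi>' (map_fm id g \<psi>)) Hs) \<subseteq> J" using \<psi>J Hs by auto
    show "map_fm id ?d ?\<theta> \<in> formulas I0 (Dom ?V) n" using \<theta>p \<open>?p \<subseteq> formulas I0 (Dom ?V) n\<close> by blast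
    fix e assume e: "e \<in> assignments ?V" "sat ?V e (map_fm id ?d ?\<theta>)"
    then have 1: "sat ?V e \<phi>'" "\<And>\<theta>. \<theta> \<in> PP ?B \<Longrightarrow> sat ?V e (map_fm id ?d \<theta>)" using Ps \<phi>(2) by auto
    have "sat ?V e (map_fm id g ?\<chi>)" using \<chi>V e(1) by blast
    then have "\<exists>\<psi>\<in>PH ?B. sat ?V e (map_fm id g \<psi>)" using 1(2) gPs Ps Hs by auto
    then show "\<exists>\<psi>\<in>set (map (\<lambda>\<psi>. FAnd \<phi>' (map_fm id g \<psi>)) Hs). sat ?V e \<psi>" using 1(1) Hs by auto
  qed
  then show False using \<theta>p J(2) by blast
qed

subsection \<open>The downward Loewenheim-Skolem theorem\<close>

text \<open>Codes in \<open>'a\<close> itself, from a pairing function p and an injection k of the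
  natural numbers. The first component of every pair is the number of the constructor;
  \<open>k 0\<close> pads constructors without arguments.\<close>

primrec ctm :: "('a \<times> 'a \<Rightarrow> 'a) \<Rightarrow> (nat \<Rightarrow> 'a) \<Rightarrow> 'a tm \<Rightarrow> 'a" where
  "ctm p k (Var v) = p (k 0, k v)"
| "ctm p k (Cst a) = p (k 1, a)"
| "ctm p k TZero = p (k 2, k 0)"
| "ctm p k TOne = p (k 3, k 0)"
| "ctm p k (TAdd s t) = p (k 4, p (ctm p k s, ctm p k t))"
| "ctm p k (TMinus t) = p (k 5, ctm p k t)"
| "ctm p k (TMul s t) = p (k 6, p (ctm p k s, ctm p k t))"

primrec cfm :: "('a \<times> 'a \<Rightarrow> 'a) \<Rightarrow> (nat \<Rightarrow> 'a) \<Rightarrow> ('a, 'a) fm \<Rightarrow> 'a" where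
  "cfm p k (FEq s t) = p (k 0, p (ctm p k s, ctm p k t))"
| "cfm p k (FPred i t) = p (k 1, p (i, ctm p k t))"
| "cfm p k (FNot \<phi>) = p (k 2, cfm p k \<phi>)"
| "cfm p k (FAnd \<phi> \<psi>) = p (k 3, p (cfm p k \<phi>, cfm p k \<psi>))"
| "cfm p k (FEx v \<phi>) = p (k 4, p (k v, cfm p k \<phi>))"

primrec clist :: "('a \<times> 'a \<Rightarrow> 'a) \<Rightarrow> (nat \<Rightarrow> 'a) \<Rightarrow> 'a list \<Rightarrow> 'a" where
  "clist p k [] = p (k 0, k 0)"
| "clist p k (x # xs) = p (k 1, p (x, clist p k xs))"

text \<open>Names for the elements of a Skolem hull: \<open>SWit \<phi> v ss\<close> names a witness of \<open>\<exists>v. \<phi>\<close>, where the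
  parameters of \<open>\<phi>\<close> and the values \<open>ss\<close> of its free variables are again given by names. The predicates
  are indexed by elements of \<open>'a\<close>, so that the names can be coded in \<open>'a\<close>.\<close>

datatype 'a sk = SBase nat | SWit "('a, 'a sk) fm" nat "'a sk list"

primrec csk :: "('a \<times> 'a \<Rightarrow> 'a) \<Rightarrow> (nat \<Rightarrow> 'a) \<Rightarrow> 'a sk \<Rightarrow> 'a" where
  "csk p k (SBase n) = p (k 0, k n)"
| "csk p k (SWit \<phi> v ss) = p (k 1, p (cfm p k (map_fm id (csk p k) \<phi>), p (k v, clist p k (map (csk p k) ss))))"

context
  fixes p :: "'a \<times> 'a \<Rightarrow> 'a" and k :: "nat \<Rightarrow> 'a"
  assumes p: "inj p" and k: "inj k"
begin

lemma p_eq [simp]: "p x = p y \<longleftrightarrow> x = y"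
  using p by (rule inj_eq)

lemma k_eq [simp]: "k x = k y \<longleftrightarrow> x = y"
  using k by (rule inj_eq)

lemma ctm_inj: "ctm p k s = ctm p k t \<Longrightarrow> s = t"
proof (induction s arbitrary: t)
  case (Var v) then show ?case by (cases t) auto
next
  case (Cst a) then show ?case by (cases t) auto
next
  case TZero then show ?case by (cases t) auto
next
  case TOne then show ?case by (cases t) auto
next
  case (TAdd s1 s2) then show ?case by (cases t) auto
next
  case (TMinus s) then show ?case by (cases t) auto
next
  case (TMul s1 s2) then show ?case by (cases t) auto
qed

lemma cfm_inj: "cfm p k \<phi> = cfm p k \<psi> \<Longrightarrow> \<phi> = \<psi>"
proof (induction \<phi> arbitrary: \<psi>)
  case (FEq s t) then show ?case by (cases \<psi>) (auto dest: ctm_inj)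
next
  case (FPred i t) then show ?case by (cases \<psi>) (auto dest: ctm_inj)
next
  case (FNot \<phi>) then show ?case by (cases \<psi>) auto
next
  case (FAnd \<phi>1 \<phi>2) then show ?case by (cases \<psi>) auto
next
  case (FEx v \<phi>) then show ?case by (cases \<psi>) auto
qed

lemma clist_inj: "clist p k xs = clist p k ys \<Longrightarrow> xs = ys"
proof (induction xs arbitrary: ys)
  case Nil then show ?case by (cases ys) auto
next
  case (Cons x xs) then show ?case by (cases ys) auto
qed

lemma csk_inj: "csk p k s = csk p k t \<Longrightarrow> s = t"
proof (induction s arbitrary: t)
  case (SBase n)
  then show ?case by (cases t) auto
next
  case (SWit \<phi> v ss)
  show ?case
  proof (cases t)
    case (SBase n)
    then show ?thesis using SWit.prems by simp
  next
    case t: (SWit \<psi> w ts)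
    have 1: "map_fm id (csk p k) \<phi> = map_fm id (csk p k) \<psi>"
      using SWit.prems t by (auto dest: cfm_inj)
    have 2: "map (csk p k) ss = map (csk p k) ts" "v = w"
      using SWit.prems t by (auto dest: clist_inj)
    have "\<phi> = \<psi>" using fm.inj_map_strong[OF _ _ 1] SWit.IH(1) by (metis id_apply)
    moreover have "ss = ts" using list.inj_map_strong[OF _ 2(1)] SWit.IH(2) by metis
    ultimately show ?thesis using t 2 by simp
  qed
qed

end

text \<open>The list \<open>ss\<close> gives the values of the variables 0, 1, ... up to its length,
  and zero is used beyond it. \<open>j\<close> decodes the indices of the predicates. A name that
  asks for a witness where none exists denotes zero.\<close>

primrec evsk :: "('i, 'b) struct \<Rightarrow> ('a \<Rightarrow> 'i) \<Rightarrow> (nat \<Rightarrow> 'b) \<Rightarrow> 'a sk \<Rightarrow> 'b" where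
  "evsk N j x (SBase n) = x n"
| "evsk N j x (SWit \<phi> v ss) =
     (let vs = map (evsk N j x) ss; \<psi> = map_fm j id (map_fm id (evsk N j x) \<phi>);
          e = (\<lambda>w. if w < length vs then vs ! w else zero_of N)
      in if \<exists>a\<in>Dom N. sat N (e(v := a)) \<psi> then SOME a. a \<in> Dom N \<and> sat N (e(v := a)) \<psi> else zero_of N)"

text \<open>The Tarski-Vaught test, for a structure that differs from N in the domain only.\<close>

lemma sat_subset:
  assumes N: "is_struct I N" and N': "N' = N\<lparr>Dom := H\<rparr>" and H: "H \<subseteq> Dom N"
    and wit: "\<And>\<phi> v e. \<phi> \<in> fms I H \<Longrightarrow> range e \<subseteq> H \<Longrightarrow> \<exists>a\<in>Dom N. sat N (e(v := a)) \<phi> \<Longrightarrow> \<exists>a\<in>H. sat N (e(v := a)) \<phi>"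
  shows "\<phi> \<in> fms I H \<Longrightarrow> range e \<subseteq> H \<Longrightarrow> sat N' e \<phi> \<longleftrightarrow> sat N e \<phi>"
proof (induction \<phi> arbitrary: e)
  have val: "val N' e t = val N e t" for e t by (induction t) (simp_all add: N')
  {
    case (FEq s t) show ?case by (simp add: val)
  next
    case (FPred i t) show ?case by (simp add: val) (simp add: N')
  next
    case (FNot \<phi>) then show ?case by simp
  next
    case (FAnd \<phi> \<psi>) then show ?case by simp
  next
    case (FEx v \<phi>)
    have \<phi>: "\<phi> \<in> fms I H" using FEx.prems(1) by simp
    have IH: "sat N' (e(v := a)) \<phi> \<longleftrightarrow> sat N (e(v := a)) \<phi>" if "a \<in> H" for a
      by (rule FEx.IH[OF \<phi>]) (use FEx.prems(2) that in auto)
    have "sat N' e (FEx v \<phi>) \<longleftrightarrow> (\<exists>a\<in>H. sat N (e(v := a)) \<phi>)" using IH by (simp add: N')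
    also have "\<dots> \<longleftrightarrow> (\<exists>a\<in>Dom N. sat N (e(v := a)) \<phi>)" using wit[OF \<phi> FEx.prems(2)] H by blast
    finally show ?case by simp
  }
qed

lemma inj_pairing:
  assumes "infinite (UNIV :: 'a set)"
  shows "\<exists>p :: 'a \<times> 'a \<Rightarrow> 'a. inj p"
proof -
  have "ordLeq3 (card_of ((UNIV :: 'a set) \<times> (UNIV :: 'a set))) (card_of (UNIV :: 'a set))"
    using card_of_Times_same_infinite[OF assms] by (rule ordIso_imp_ordLeq)
  then show ?thesis unfolding card_of_ordLeq[symmetric] by auto
qed

text \<open>The hull H consists of the values of all names, which closes it under witnesses.
  Choosing a name for each element and coding it in \<open>'a\<close> is an injection of H into
  \<open>'a\<close>, along which the structure is copied.\<close>

lemma downward_lowenheim_skolem: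
  fixes N :: "('i, 'b) struct"
  assumes N: "is_struct I N" and inf: "infinite (UNIV :: 'a set)" and I: "I \<lesssim> (UNIV :: 'a set)"
    and Z: "countable Z" "Z \<subseteq> Dom N"
  shows "\<exists>(N' :: ('i, 'a) struct) H \<kappa>. is_struct I N' \<and> Z \<subseteq> H \<and> H \<subseteq> Dom N \<and> Dom N' = \<kappa> ` H \<and> elem I N N' H \<kappa>"
proof -
  obtain p :: "'a \<times> 'a \<Rightarrow> 'a" where p: "inj p" using inj_pairing[OF inf] by auto
  obtain k :: "nat \<Rightarrow> 'a" where k: "inj k" using infinite_countable_subset[OF inf] by auto
  obtain ix :: "'i \<Rightarrow> 'a" where ix: "inj_on ix I" using I by (auto simp: lepoll_def)
  define j where "j = inv_into I ix"
  have j: "j (ix i) = i" if "i \<in> I" for i using ix that by (simp add: j_def)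
  \<comment> \<open>Inserting zero makes the enumerated set nonempty even if Z is empty.\<close>
  define x where "x = from_nat_into (insert (zero_of N) Z)"
  have x: "range x = insert (zero_of N) Z"
    unfolding x_def by (rule range_from_nat_into) (use Z(1) in auto)
  have zD: "zero_of N \<in> Dom N" by (rule zero_in_Dom[OF N])
  define ev where "ev = (evsk N j x :: 'a sk \<Rightarrow> 'b)"
  have evD: "ev s \<in> Dom N" for s
  proof (cases s)
    case (SBase n)
    then have "ev s \<in> range x" by (simp add: ev_def)
    then show ?thesis using x Z(2) zD by auto
  next
    case (SWit \<phi> v ss)
    have *: "(if \<exists>a\<in>D. P a then SOME a. a \<in> D \<and> P a else z) \<in> D" if "z \<in> D" for D and P :: "'b \<Rightarrow> bool" and z
    proof (cases "\<exists>a\<in>D. P a")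
      case True
      then have "\<exists>a. a \<in> D \<and> P a" by blast
      from someI_ex[OF this] show ?thesis using True by simp
    qed (use that in simp)
    show ?thesis unfolding SWit ev_def evsk.simps Let_def by (rule *[OF zD])
  qed
  define H where "H = range ev"
  have HD: "H \<subseteq> Dom N" using evD by (auto simp: H_def)
  have ZH: "insert (zero_of N) Z \<subseteq> H"
  proof -
    have "x n \<in> H" for n unfolding H_def ev_def by (rule image_eqI[of _ _ "SBase n"]) simp_all
    then have "range x \<subseteq> H" by blast
    then show ?thesis unfolding x .
  qed
  have wit: "\<exists>a\<in>H. sat N (e(v := a)) \<phi>"
    if \<phi>: "\<phi> \<in> fms I H" and e: "range e \<subseteq> H" and ex: "\<exists>a\<in>Dom N. sat N (e(v := a)) \<phi>" for \<phi> v e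
  proof -
    let ?g = "inv_into UNIV ev"
    have g: "ev (?g h) = h" if "h \<in> H" for h using that unfolding H_def by (rule f_inv_into_f)
    \<comment> \<open>The list of values must reach beyond every free variable of
      \<open>\<phi>\<close>; the inserted 0 keeps the maximum defined for a sentence.\<close>
    let ?\<phi> = "map_fm ix ?g \<phi>" and ?n = "Suc (Max (insert 0 (fvars \<phi>)))"
    let ?ss = "map (\<lambda>w. ?g (e w)) [0..<?n]"
    have "map_fm j id (map_fm id ev ?\<phi>) = map_fm id id \<phi>"
      unfolding fm.map_comp using \<phi> g j by (intro fm.map_cong) (auto simp: fms_def)
    then have 1: "map_fm j id (map_fm id ev ?\<phi>) = \<phi>" by (simp add: fm.map_id0)
    define e' where "e' = (\<lambda>w. if w < length (map ev ?ss) then map ev ?ss ! w else zero_of N)"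
    have e': "e' w = e w" if "w \<in> fvars \<phi>" for w
    proof -
      have "w < ?n" using that by (simp add: le_imp_less_Suc)
      then show ?thesis using g e by (simp add: e'_def del: upt_Suc) blast
    qed
    have eq: "sat N (e'(v := a)) \<phi> \<longleftrightarrow> sat N (e(v := a)) \<phi>" for a
      by (rule sat_cong) (use e' in auto)
    have "ev (SWit ?\<phi> v ?ss) = (if \<exists>a\<in>Dom N. sat N (e'(v := a)) \<phi> then SOME a. a \<in> Dom N \<and> sat N (e'(v := a)) \<phi> else zero_of N)"
      unfolding ev_def evsk.simps Let_def unfolding ev_def[symmetric] 1 e'_def[symmetric] ..
    also have "\<dots> = (SOME a. a \<in> Dom N \<and> sat N (e(v := a)) \<phi>)" using ex unfolding eq by simp
    finally have ev: "ev (SWit ?\<phi> v ?ss) = (SOME a. a \<in> Dom N \<and> sat N (e(v := a)) \<phi>)" .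
    have "\<exists>a. a \<in> Dom N \<and> sat N (e(v := a)) \<phi>" using ex by blast
    from someI_ex[OF this] have "sat N (e(v := ev (SWit ?\<phi> v ?ss))) \<phi>" unfolding ev by (rule conjunct2)
    then show ?thesis unfolding H_def by blast
  qed
  have valH: "val N (\<lambda>_. zero_of N) t \<in> H" if t: "tparams t \<subseteq> H" "tvars t = {}" for t
  proof -
    let ?v = "val N (\<lambda>_. zero_of N) t"
    have "?v \<in> Dom N" using t HD zD by (intro val_in_Dom[OF N]) auto
    moreover have v: "val N ((\<lambda>_. zero_of N)(0 := a)) t = ?v" for a by (rule val_cong) (simp add: t(2))
    \<comment> \<open>The value of t is the only witness of x = t, so closure under witnesses
      includes closure under the operations.\<close>
    ultimately have "\<exists>a\<in>H. sat N ((\<lambda>_. zero_of N)(0 := a)) (FEq (Var 0) t)"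
      using t ZH by (intro wit) (auto simp: v)
    then show ?thesis by (auto simp: v)
  qed
  \<comment> \<open>\<open>K\<close> cuts the predicates down to H, as \<open>is_struct\<close>
    demands; \<open>K0\<close> keeps those of N, as the Tarski-Vaught test demands. They agree on
    formulas over H because values of terms stay in H.\<close>
  define K where "K = N\<lparr>Dom := H, pred_of := \<lambda>i. pred_of N i \<inter> H\<rparr>"
  define K0 where "K0 = N\<lparr>Dom := H\<rparr>"
  have clo: "zero_of N \<in> H" "one_of N \<in> H"
    "\<And>a b. a \<in> H \<Longrightarrow> b \<in> H \<Longrightarrow> add_of N a b \<in> H" "\<And>a. a \<in> H \<Longrightarrow> minus_of N a \<in> H"
    "\<And>a b. a \<in> H \<Longrightarrow> b \<in> H \<Longrightarrow> mul_of N a b \<in> H"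
    using valH[of TZero] valH[of TOne] valH[of "TAdd (Cst _) (Cst _)"] valH[of "TMinus (Cst _)"]
      valH[of "TMul (Cst _) (Cst _)"] by simp_all
  have Ks: "is_struct I K" using clo by (auto simp: is_struct_def K_def)
  define \<kappa> where "\<kappa> h = csk p k (inv_into UNIV ev h)" for h
  have inj: "inj_on \<kappa> H"
  proof (rule inj_onI)
    fix a b assume ab: "a \<in> H" "b \<in> H" "\<kappa> a = \<kappa> b"
    then have "inv_into UNIV ev a = inv_into UNIV ev b" unfolding \<kappa>_def by (intro csk_inj[OF p k])
    then show "a = b" using ab f_inv_into_f[of _ ev UNIV] unfolding H_def by metis
  qed
  let ?\<kappa>' = "inv_into H \<kappa>"
  have \<kappa>': "?\<kappa>' (\<kappa> a) = a" if "a \<in> H" for a using inj that by simp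
  define N' where "N' = \<lparr>Dom = \<kappa> ` H, zero_of = \<kappa> (zero_of N), one_of = \<kappa> (one_of N),
    add_of = \<lambda>a b. \<kappa> (add_of N (?\<kappa>' a) (?\<kappa>' b)), minus_of = \<lambda>a. \<kappa> (minus_of N (?\<kappa>' a)),
    mul_of = \<lambda>a b. \<kappa> (mul_of N (?\<kappa>' a) (?\<kappa>' b)), pred_of = \<lambda>i. \<kappa> ` (pred_of N i \<inter> H)\<rparr>"
  have iso: "struct_iso I K N' \<kappa>"
    unfolding struct_iso_def N'_def K_def using inj \<kappa>' clo
    by (auto simp: bij_betw_def inj_on_eq_iff inj_on_image_mem_iff)
  have N's: "is_struct I N'" unfolding is_struct_def N'_def using clo by (auto simp: \<kappa>')
  have satK: "sat K e \<phi> \<longleftrightarrow> sat N e \<phi>" if \<phi>: "\<phi> \<in> fms I H" and e: "range e \<subseteq> H" for \<phi> e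
  proof -
    have "sat K e \<phi> \<longleftrightarrow> sat K0 e \<phi>"
      using \<phi> e
    proof (induction \<phi> arbitrary: e)
      have val: "val K e t = val K0 e t" for e t by (induction t) (simp_all add: K_def K0_def)
      {
        case (FEq s t)
        show ?case by (simp add: val)
      next
        case (FPred i t)
        have "val K e t \<in> H" using FPred.prems val_in_Dom[OF Ks, of t e] by (force simp: K_def)
        then show ?case by (simp add: val) (simp add: K_def K0_def)
      next
        case (FEx v \<phi>)
        have "sat K (e(v := a)) \<phi> \<longleftrightarrow> sat K0 (e(v := a)) \<phi>" if "a \<in> H" for a
          by (rule FEx.IH) (use FEx.prems that in auto)
        then show ?case by (simp add: K_def K0_def)
      }
    qed (simp_all add: K_def K0_def)
    also have "\<dots> \<longleftrightarrow> sat N e \<phi>" by (rule sat_subset[OF N K0_def HD wit \<phi> e])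
    finally show ?thesis .
  qed
  have "holds N \<phi> \<longleftrightarrow> holds N' (map_fm id \<kappa> \<phi>)" if \<phi>: "\<phi> \<in> formulas I H 0" for \<phi>
  proof -
    have fv: "fvars \<phi> = {}" "\<phi> \<in> fms I H" using \<phi> by (auto simp: formulas_fms)
    let ?e = "\<lambda>_. zero_of N"
    have e: "?e \<in> assignments K" "range ?e \<subseteq> H" using clo(1) by (auto simp: assignments_def K_def)
    have \<phi>K: "\<phi> \<in> fms I (Dom K)" using fv(2) by (simp add: K_def)
    have "holds N \<phi> \<longleftrightarrow> sat N ?e \<phi>" by (rule holds_sentence[OF N fv(1)])
    also have "\<dots> \<longleftrightarrow> sat K ?e \<phi>" by (rule satK[OF fv(2) e(2), symmetric])
    also have "\<dots> \<longleftrightarrow> sat N' (\<lambda>v. \<kappa> (?e v)) (map_fm id \<kappa> \<phi>)" by (rule sat_iso[OF Ks iso e(1) \<phi>K, symmetric])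
    also have "\<dots> \<longleftrightarrow> holds N' (map_fm id \<kappa> \<phi>)" by (rule holds_sentence[OF N's, symmetric]) (simp add: fv)
    finally show ?thesis .
  qed
  then have "elem I N N' H \<kappa>" by (simp add: elem_def N'_def)
  moreover have "Dom N' = \<kappa> ` H" by (simp add: N'_def)
  ultimately show ?thesis using N's ZH HD by blast
qed

subsection \<open>Descending chains\<close>

text \<open>For i' below i take a basis element b in P_i outside P_i' and its multiples q * b with
  nonzero q in P_i'. As q is algebraic over the other basis elements, b can be exchanged for q * b,
  which gives an automorphism fixing the rest of the basis. It preserves each P_j: if b is in P_j,
  then i' is below j, so q is in P_j as well.\<close>

lemma scalings:
  fixes M :: "('i, 'a) struct"
  assumes chain: "acf_chain J r M" and wo: "well_order_on J r"
  shows "\<exists>c :: 'i \<Rightarrow> 'i \<Rightarrow> nat \<Rightarrow> 'a. \<forall>i\<in>J. \<forall>i'\<in>J. (i', i) \<in> r \<and> i' \<noteq> i \<longrightarrow> (\<forall>l. c i i' l \<in> pred_of M i \<and>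
    c i i' l \<notin> pred_of M i' \<and>
    (\<forall>l'. l \<noteq> l' \<longrightarrow> add_of M (c i i' l) (minus_of M (c i i' l')) \<notin> pred_of M i') \<and>
    (\<exists>\<tau>. struct_iso J M M \<tau> \<and> \<tau> (c i i' 0) = c i i' l \<and>
      (\<forall>m\<in>J. \<forall>m'\<in>J. (m', m) \<in> r \<and> m' \<noteq> m \<and> (i, m') \<in> r \<longrightarrow> \<tau> (c m m' 0) = c m m' 0)))"
proof -
  let ?R = "ring_of M"
  interpret acf ?R M using chain by (simp add: acf_chain_def)
  let ?P = "pred_of M"
  note Pc = pred_carrier[OF chain wo] and Pm = pred_mono[OF chain wo] and aP = acl_pred[OF chain wo]
  have Psub: "subfield (?P i) ?R" if "i \<in> J" for i using chain that by (simp add: acf_chain_def)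
  note Pr = subringE[OF subfieldE(1)[OF Psub]]
  obtain B where B: "indep {} B" "acl B = carrier ?R" "\<And>i. i \<in> J \<Longrightarrow> acl (B \<inter> ?P i) = ?P i"
    using adapted_basis_exists[OF chain wo] by blast
  have BR: "B \<subseteq> carrier ?R" using B(1) by (simp add: indep_def)
  have "\<forall>x\<in>{(i, i'). i \<in> J \<and> i' \<in> J \<and> (i', i) \<in> r \<and> i' \<noteq> i}. \<exists>b. b \<in> B \<and> b \<in> ?P (fst x) \<and> b \<notin> ?P (snd x)"
  proof (clarsimp, rule ccontr)
    fix i i' assume i: "i \<in> J" "i' \<in> J" "(i', i) \<in> r" "i' \<noteq> i" "\<nexists>b. b \<in> B \<and> b \<in> ?P i \<and> b \<notin> ?P i'"
    then have "B \<inter> ?P i \<subseteq> ?P i'" by blast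
    then have "acl (B \<inter> ?P i) \<subseteq> acl (?P i')" by (rule acl_mono) (rule Pc[OF i(2)])
    then have "?P i \<subseteq> ?P i'" using B(3)[OF i(1)] aP[OF i(2)] by simp
    moreover have "?P i' \<subset> ?P i" using chain i unfolding acf_chain_def by blast
    ultimately show False by blast
  qed
  from bchoice[OF this] obtain b' where
    b': "\<forall>x\<in>{(i, i'). i \<in> J \<and> i' \<in> J \<and> (i', i) \<in> r \<and> i' \<noteq> i}. b' x \<in> B \<and> b' x \<in> ?P (fst x) \<and> b' x \<notin> ?P (snd x)"
    by (rule exE)
  define b where "b i i' = b' (i, i')" for i i'
  have b: "b i i' \<in> B" "b i i' \<in> ?P i" "b i i' \<notin> ?P i'" if "i \<in> J" "i' \<in> J" "(i', i) \<in> r" "i' \<noteq> i" for i i'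
    using bspec[OF b', of "(i, i')"] that by (auto simp: b_def)
  have "\<forall>i\<in>J. \<exists>q :: nat \<Rightarrow> 'a. inj q \<and> range q \<subseteq> ?P i - {\<zero>\<^bsub>?R\<^esub>} \<and> q 0 = \<one>\<^bsub>?R\<^esub>"
  proof
    fix i assume i: "i \<in> J"
    have "infinite (?P i)" by (rule infinite_root_closed[OF Psub[OF i]]) (use chain i in \<open>simp add: acf_chain_def\<close>)
    then have "infinite (?P i - {\<zero>\<^bsub>?R\<^esub>, \<one>\<^bsub>?R\<^esub>})" by simp
    from infinite_countable_subset[OF this] obtain q :: "nat \<Rightarrow> 'a" where
      q: "inj q" "range q \<subseteq> ?P i - {\<zero>\<^bsub>?R\<^esub>, \<one>\<^bsub>?R\<^esub>}" by blast
    \<comment> \<open>The value 1 at 0 makes \<open>c i i' 0\<close> the basis element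
      itself.\<close>
    let ?q = "\<lambda>n. case n of 0 \<Rightarrow> \<one>\<^bsub>?R\<^esub> | Suc m \<Rightarrow> q m"
    have ne: "q m \<noteq> \<one>\<^bsub>?R\<^esub>" "q m \<in> ?P i - {\<zero>\<^bsub>?R\<^esub>}" for m using q(2) by blast+
    have "inj ?q"
    proof (rule injI)
      fix m n assume "?q m = ?q n"
      then show "m = n" using ne(1)[of "m - 1"] ne(1)[of "n - 1"] q(1)
        by (cases m; cases n) (simp_all add: inj_eq)
    qed
    moreover have "?q n \<in> ?P i - {\<zero>\<^bsub>?R\<^esub>}" for n using ne(2) Pr(3)[OF i] by (cases n) simp_all
    ultimately show "\<exists>q :: nat \<Rightarrow> 'a. inj q \<and> range q \<subseteq> ?P i - {\<zero>\<^bsub>?R\<^esub>} \<and> q 0 = \<one>\<^bsub>?R\<^esub>"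
      by (intro exI[of _ ?q]) auto
  qed
  from bchoice[OF this] obtain q :: "'i \<Rightarrow> nat \<Rightarrow> 'a" where
    q': "\<forall>i\<in>J. inj (q i) \<and> range (q i) \<subseteq> ?P i - {\<zero>\<^bsub>?R\<^esub>} \<and> q i 0 = \<one>\<^bsub>?R\<^esub>" by (rule exE)
  have q: "inj (q i)" "q i l \<in> ?P i" "q i l \<noteq> \<zero>\<^bsub>?R\<^esub>" "q i 0 = \<one>\<^bsub>?R\<^esub>" if "i \<in> J" for i and l :: nat
    using bspec[OF q' that] by auto
  define c where "c i i' l = q i' l \<otimes>\<^bsub>?R\<^esub> b i i'" for i i' and l :: nat
  have cancel: "x \<in> K" if K: "subfield K ?R" and a: "a \<in> K" "a \<noteq> \<zero>\<^bsub>?R\<^esub>" and x: "x \<in> carrier ?R" and ax: "a \<otimes>\<^bsub>?R\<^esub> x \<in> K"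
    for K a x
  proof -
    note Kr = subringE[OF subfieldE(1)[OF K]]
    have aU: "a \<in> Units ?R" using a Kr(1) by (auto simp: field_Units)
    have "inv\<^bsub>?R\<^esub> a \<in> K" using subfield_m_inv(1)[OF K] a by simp
    then have "inv\<^bsub>?R\<^esub> a \<otimes>\<^bsub>?R\<^esub> (a \<otimes>\<^bsub>?R\<^esub> x) \<in> K" using Kr(6) ax by simp
    moreover have "inv\<^bsub>?R\<^esub> a \<otimes>\<^bsub>?R\<^esub> (a \<otimes>\<^bsub>?R\<^esub> x) = x"
      using aU x Units_closed[OF aU] by (simp add: m_assoc[symmetric])
    ultimately show ?thesis by simp
  qed
  show ?thesis
  proof (intro exI[of _ c] ballI impI allI)
    fix i i' and l :: nat assume i: "i \<in> J" "i' \<in> J" and ii: "(i', i) \<in> r \<and> i' \<noteq> i"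
    note bi = b[OF i conjunct1[OF ii] conjunct2[OF ii]]
    let ?b = "b i i'"
    have bR: "?b \<in> carrier ?R" using bi(1) BR by blast
    have qR: "q i' l \<in> carrier ?R" for l using q(2)[OF i(2)] Pc[OF i(2)] by blast
    have PP: "?P i' \<subseteq> ?P i" by (rule Pm[OF conjunct1[OF ii]])
    have c0: "c i i' 0 = ?b" using bR by (simp add: c_def q(4)[OF i(2)])
    have cR: "c i i' l \<in> carrier ?R" using bR qR by (simp add: c_def)
    have 1: "c i i' l \<in> ?P i"
      unfolding c_def by (rule Pr(6)[OF i(1)]) (use bi(2) q(2)[OF i(2)] PP in blast)+
    have 2: "c i i' l \<notin> ?P i'"
      using cancel[OF Psub[OF i(2)] q(2)[OF i(2)] q(3)[OF i(2)] bR, of l] bi(3) by (auto simp: c_def)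
    have 3: "add_of M (c i i' l) (minus_of M (c i i' l')) \<notin> ?P i'" if "l \<noteq> l'" for l'
    proof
      have eq: "add_of M (c i i' l) (minus_of M (c i i' l')) = (q i' l \<ominus>\<^bsub>?R\<^esub> q i' l') \<otimes>\<^bsub>?R\<^esub> ?b"
        using bR qR by (simp add: c_def minus_eq l_distr l_minus)
      \<comment> \<open>The difference of two scalars is nonzero in the field P_i', so it can be
        cancelled and b would lie in P_i'.\<close>
      have "q i' l \<ominus>\<^bsub>?R\<^esub> q i' l' \<in> ?P i'"
        unfolding minus_eq by (intro Pr(5,7)[OF i(2)] q(2)[OF i(2)])
      moreover have "q i' l \<ominus>\<^bsub>?R\<^esub> q i' l' \<noteq> \<zero>\<^bsub>?R\<^esub>" using that q(1)[OF i(2)] qR by (simp add: inj_eq)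
      moreover assume "add_of M (c i i' l) (minus_of M (c i i' l')) \<in> ?P i'"
      ultimately have "?b \<in> ?P i'" unfolding eq by (intro cancel[OF Psub[OF i(2)] _ _ bR]) 
      then show False using bi(3) by simp
    qed
    let ?B' = "B - {?b}" and ?qb = "c i i' l"
    let ?C = "acl ?B'"
    have B'R: "?B' \<subseteq> carrier ?R" using BR by auto
    have CR: "?C \<subseteq> carrier ?R" by (rule acl_carrier)
    have Cf: "subfield ?C ?R" by (rule subfield_acl[OF B'R])
    have ind: "indep ?C {?b}"
    proof -
      have "B - ?B' = {?b}" using bi(1) by auto
      then show ?thesis using indep_over_acl[OF B(1), of ?B'] by auto
    qed
    have qC: "q i' l \<in> ?C"
    proof -
      have "B \<inter> ?P i' \<subseteq> ?B'" using bi(3) by auto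
      then have "acl (B \<inter> ?P i') \<subseteq> ?C" by (rule acl_mono[OF _ B'R])
      then show ?thesis using B(3)[OF i(2)] q(2)[OF i(2)] by auto
    qed
    have bC: "?b \<notin> ?C" using B(1) bi(1) by (auto simp: indep_def)
    have "?qb \<notin> ?C" using cancel[OF Cf qC q(3)[OF i(2)] bR] bC by (auto simp: c_def)
    then have ind': "indep ?C ((\<lambda>_. ?qb) ` {?b})"
      using cR acl_idem[OF B'R] by (simp add: indep_def)
    let ?G = "(\<lambda>c. (c, c)) ` ?C \<union> (\<lambda>x. (x, ?qb)) ` {?b}"
    have pi: "pisom ?G" by (rule pisom_independent[OF CR ind _ ind']) simp
    have span: "acl S = carrier ?R" if "?C \<subseteq> S" "?b \<in> acl S" "S \<subseteq> carrier ?R" for S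
    proof -
      have "?B' \<subseteq> acl S" using acl_incl[OF B'R] that(1) acl_incl[OF that(3)] by blast
      then have "B \<subseteq> acl S" using that(2) by auto
      then have "acl B \<subseteq> acl S" by (rule acl_subset[OF _ that(3)])
      then show ?thesis using B(2) acl_carrier[of S] by auto
    qed
    have "acl (Domain ?G) = carrier ?R"
    proof (rule span)
      show DR: "Domain ?G \<subseteq> carrier ?R" using CR bR by auto
      have "?b \<in> Domain ?G" by auto
      then show "?b \<in> acl (Domain ?G)" using acl_incl[OF DR] by blast
    qed auto
    moreover have "acl (Range ?G) = carrier ?R"
    proof (rule span)
      show DR: "Range ?G \<subseteq> carrier ?R" using CR cR by auto
      have "?qb \<in> acl (Range ?G)" "q i' l \<in> acl (Range ?G)" using acl_incl[OF DR] qC by auto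
      then show "?b \<in> acl (Range ?G)"
        using cancel[OF subfield_acl[OF DR] _ q(3)[OF i(2)] bR] by (simp add: c_def)
    qed auto
    ultimately obtain \<tau> where \<tau>: "struct_iso {} M M \<tau>" "\<forall>a b. (a, b) \<in> ?G \<longrightarrow> \<tau> a = b"
      using automorphism_exists[OF pi] by blast
    have \<tau>b: "\<tau> ?b = ?qb" using \<tau>(2) by blast
    have \<tau>C: "\<tau> x = x" if "x \<in> ?C" for x using \<tau>(2) that by blast
    have \<tau>B: "\<tau> x = x" if "x \<in> B" "x \<noteq> ?b" for x using acl_incl[OF B'R] that by (intro \<tau>C) auto
    have "struct_iso J M M \<tau>"
    proof (rule automorphism_preds[OF \<tau>(1) BR B(3)])
      fix j assume j: "j \<in> J"
      show "acl (\<tau> ` (B \<inter> ?P j)) = ?P j"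
      proof (cases "?b \<in> ?P j")
        case False
        then have "\<tau> x = x" if "x \<in> B \<inter> ?P j" for x using that by (intro \<tau>B) auto
        then have "\<tau> ` (B \<inter> ?P j) = B \<inter> ?P j" by simp
        then show ?thesis using B(3)[OF j] by simp
      next
        case True
        have ij: "(i', j) \<in> r"
        proof (rule ccontr)
          assume n: "(i', j) \<notin> r"
          then have "(j, i') \<in> r"
            using well_order_onD(4,5)[OF wo] i(2) j by (cases "i' = j") (auto simp: total_on_def refl_on_def)
          then show False using Pm True bi(3) by blast
        qed
        have S: "\<tau> ` (B \<inter> ?P j) = insert ?qb (?B' \<inter> ?P j)" (is "_ = ?S")
        proof -
          have "B \<inter> ?P j = insert ?b (?B' \<inter> ?P j)" using True bi(1) by auto
          moreover have "\<tau> ` (?B' \<inter> ?P j) = ?B' \<inter> ?P j" using \<tau>B by auto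
          ultimately show ?thesis using \<tau>b by (metis image_insert)
        qed
        have qj: "q i' l \<in> ?P j" using Pm[OF ij] q(2)[OF i(2)] by blast
        have "?qb \<in> ?P j" unfolding c_def by (rule Pr(6)[OF j qj True])
        then have SP: "?S \<subseteq> ?P j" by auto
        then have SR: "?S \<subseteq> carrier ?R" using Pc[OF j] by blast
        have "acl ?S \<subseteq> acl (?P j)" by (rule acl_mono[OF SP Pc[OF j]])
        then have 1: "acl ?S \<subseteq> ?P j" using aP[OF j] by simp
        have "B \<inter> ?P i' \<subseteq> ?S" using bi(3) Pm[OF ij] by auto
        then have "acl (B \<inter> ?P i') \<subseteq> acl ?S" by (rule acl_mono[OF _ SR])
        then have qS: "q i' l \<in> acl ?S" using B(3)[OF i(2)] q(2)[OF i(2)] by auto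
        have "?qb \<in> acl ?S" using acl_incl[OF SR] by auto
        then have "?b \<in> acl ?S"
          using cancel[OF subfield_acl[OF SR] qS q(3)[OF i(2)] bR] by (simp add: c_def)
        then have "B \<inter> ?P j \<subseteq> acl ?S" using acl_incl[OF SR] by auto
        then have "acl (B \<inter> ?P j) \<subseteq> acl ?S" by (rule acl_subset[OF _ SR])
        then show ?thesis using 1 B(3)[OF j] unfolding S by auto
      qed
    qed
    \<comment> \<open>As m' is at least i, the moved element b lies in P_m', but
      \<open>b m m'\<close> does not; so these basis elements differ and the latter is
      fixed.\<close>
    moreover have "\<tau> (c m m' 0) = c m m' 0" if m: "m \<in> J" "m' \<in> J" "(m', m) \<in> r \<and> m' \<noteq> m \<and> (i, m') \<in> r" for m m'
    proof -
      have mb: "b m m' \<in> B" "b m m' \<notin> ?P m'" using b(1,3)[OF m(1,2)] m(3) by blast+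
      have "c m m' 0 = b m m'" using mb(1) BR by (auto simp: c_def q(4)[OF m(2)])
      moreover have "?b \<in> ?P m'" using Pm[of i m'] m(3) bi(2) by blast
      then have "b m m' \<noteq> ?b" using mb(2) by auto
      ultimately show ?thesis using \<tau>B[OF mb(1)] by simp
    qed
    ultimately show "c i i' l \<in> ?P i \<and> c i i' l \<notin> ?P i' \<and>
      (\<forall>l'. l \<noteq> l' \<longrightarrow> add_of M (c i i' l) (minus_of M (c i i' l')) \<notin> ?P i') \<and>
      (\<exists>\<tau>. struct_iso J M M \<tau> \<and> \<tau> (c i i' 0) = c i i' l \<and>
        (\<forall>m\<in>J. \<forall>m'\<in>J. (m', m) \<in> r \<and> m' \<noteq> m \<and> (i, m') \<in> r \<longrightarrow> \<tau> (c m m' 0) = c m m' 0))"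
      using 1 2 3 \<tau>b unfolding c0 by blast
  qed
qed

lemma elem_sat:
  assumes "elem I M N A f" "is_struct I M" "is_struct I N" "\<phi> \<in> formulas I A 0"
  shows "sat M e \<phi> \<longleftrightarrow> sat N e' (map_fm id f \<phi>)"
  using assms holds_sentence[OF assms(2) sentence_fvars[OF assms(4)], of e]
    holds_sentence[OF assms(3), of "map_fm id f \<phi>" e'] sentence_fvars[OF assms(4)]
  by (simp add: elem_def)

lemma elem_pred:
  assumes "elem I M N A f" "is_struct I M" "is_struct I N" "i \<in> I" "a \<in> A" "b \<in> A"
  shows "f a \<in> pred_of N i \<longleftrightarrow> a \<in> pred_of M i"
    and "add_of N (f a) (minus_of N (f b)) \<in> pred_of N i \<longleftrightarrow> add_of M a (minus_of M b) \<in> pred_of M i"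
  using elem_sat[OF assms(1-3), of "FPred i (Cst a)" undefined undefined]
    elem_sat[OF assms(1-3), of "FPred i (TAdd (Cst a) (TMinus (Cst b)))" undefined undefined] assms(4-6)
  by (auto simp: formulas_def)

lemma acf_chain_pred_mono:
  "acf_chain I r M \<Longrightarrow> i \<in> I \<Longrightarrow> j \<in> I \<Longrightarrow> (i, j) \<in> r \<Longrightarrow> pred_of M i \<subseteq> pred_of M j"
  unfolding acf_chain_def by (cases "i = j") blast+

text \<open>Column 0 supplies the summands of the infinite sum. Row k holds conjugates of
  \<open>c k 0\<close> over the preceding summands, in pairwise different cosets of the next field:
  exactly what makes the formula for such a coset divide.\<close>

definition descending_family ::
    "'i set \<Rightarrow> ('i, 'b) struct \<Rightarrow> (nat \<Rightarrow> 'i) \<Rightarrow> (nat \<Rightarrow> nat \<Rightarrow> 'b) \<Rightarrow> bool" where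
  "descending_family I V i c \<longleftrightarrow> (\<forall>k l. c k l \<in> pred_of V (i k) \<and> c k l \<notin> pred_of V (i (Suc k)) \<and>
     (\<forall>l'. l \<noteq> l' \<longrightarrow> add_of V (c k l) (minus_of V (c k l')) \<notin> pred_of V (i (Suc k))) \<and>
     (\<exists>h. elem I V V ((\<lambda>s. c s 0) ` {..k}) h \<and> (\<forall>s<k. h (c s 0) = c s 0) \<and> h (c k 0) = c k l))"

lemma descending_familyD:
  assumes "descending_family I V i c"
  shows "c k l \<in> pred_of V (i k)" "c k l \<notin> pred_of V (i (Suc k))"
    "l \<noteq> l' \<Longrightarrow> add_of V (c k l) (minus_of V (c k l')) \<notin> pred_of V (i (Suc k))"
    "\<exists>h. elem I V V ((\<lambda>s. c s 0) ` {..k}) h \<and> (\<forall>s<k. h (c s 0) = c s 0) \<and> h (c k 0) = c k l"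
  using assms unfolding descending_family_def by blast+

text \<open>Every finite part of the chain is well-ordered, so the scalings exist there; the ultraproduct along the
  finite subsets of \<open>I\<close> glues them.\<close>

lemma descending_ultrapower:
  fixes M :: "('i, 'a) struct" and i :: "nat \<Rightarrow> 'i" and U :: "'i set filter"
  assumes M: "M \<in> models I (ACF_chain I r)" and lin: "linear_order_on I r"
    and iI: "\<And>k. i k \<in> I" and desc: "\<And>k. (i (Suc k), i k) \<in> r - Id"
    and U: "ultrafilter U" "U \<le> finite_subsets_at_top I"
  shows "\<exists>c. descending_family I (ultrapower U M) i c"
proof -
  have chain: "acf_chain I r M" by (rule models_acf_chain[OF M])
  have Ms: "is_struct I M" by (rule models_is_struct[OF M])
  have ordr: "trans r" "refl_on I r"
    using lin by (auto simp: linear_order_on_def partial_order_on_def preorder_on_def)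
  have dec: "(i m, i n) \<in> r" if "n \<le> m" for m n
    using that
  proof (induction m rule: dec_induct)
    case base then show ?case using ordr(2) iI[of n] by (simp add: refl_on_def)
  next
    case (step m) then show ?case using transD[OF ordr(1), of "i (Suc m)" "i m"] desc[of m] by blast
  qed
  have nePM: "i (Suc k) \<noteq> i k" for k using desc[of k] by auto
  let ?V = "ultrapower U M"
  have Vs: "is_struct I ?V" by (rule is_struct_ultrapower[OF U(1) Ms])
  have Vchain: "acf_chain I r ?V" by (rule models_acf_chain[OF ultrapower_models[OF U(1) M]])
  define Sc where "Sc J C = (\<forall>i\<in>J. \<forall>i'\<in>J. (i', i) \<in> r \<inter> J \<times> J \<and> i' \<noteq> i \<longrightarrow> (\<forall>l. C i i' l \<in> pred_of M i \<and>
    C i i' l \<notin> pred_of M i' \<and>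
    (\<forall>l'. l \<noteq> l' \<longrightarrow> add_of M (C i i' l) (minus_of M (C i i' l')) \<notin> pred_of M i') \<and>
    (\<exists>\<tau>. struct_iso J M M \<tau> \<and> \<tau> (C i i' 0) = C i i' l \<and>
      (\<forall>m\<in>J. \<forall>m'\<in>J. (m', m) \<in> r \<inter> J \<times> J \<and> m' \<noteq> m \<and> (i, m') \<in> r \<inter> J \<times> J \<longrightarrow> \<tau> (C m m' 0) = C m m' 0))))"
    for J and C :: "'i \<Rightarrow> 'i \<Rightarrow> nat \<Rightarrow> 'a"
  have "\<forall>J\<in>{J. finite J \<and> J \<subseteq> I}. \<exists>C. Sc J C"
  proof
    fix J assume "J \<in> {J. finite J \<and> J \<subseteq> I}"
    then have J: "finite J" "J \<subseteq> I" by auto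
    show "\<exists>C. Sc J C" unfolding Sc_def
      by (rule scalings[OF acf_chain_subset[OF chain J(2)]
          finite_linear_order_well_order[OF linear_order_on_subset[OF lin J(2)] J(1)]])
  qed
  from bchoice[OF this] obtain C where C: "\<forall>J\<in>{J. finite J \<and> J \<subseteq> I}. Sc J (C J)" by (rule exE)
  define ok where "ok k J \<longleftrightarrow> finite J \<and> J \<subseteq> I \<and> i k \<in> J \<and> i (Suc k) \<in> J" for k J
  \<comment> \<open>Index sets J that miss one of the two indices get the value zero; U neglects
    them.\<close>
  define g where "g k l J = (if ok k J then C J (i k) (i (Suc k)) l else zero_of M)" for k l J
  have CJ: "C J (i k) (i (Suc k)) l \<in> pred_of M (i k) \<and> C J (i k) (i (Suc k)) l \<notin> pred_of M (i (Suc k)) \<and>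
    (\<forall>l'. l \<noteq> l' \<longrightarrow> add_of M (C J (i k) (i (Suc k)) l) (minus_of M (C J (i k) (i (Suc k)) l')) \<notin> pred_of M (i (Suc k))) \<and>
    (\<exists>\<tau>. struct_iso J M M \<tau> \<and> \<tau> (C J (i k) (i (Suc k)) 0) = C J (i k) (i (Suc k)) l \<and>
      (\<forall>m\<in>J. \<forall>m'\<in>J. (m', m) \<in> r \<inter> J \<times> J \<and> m' \<noteq> m \<and> (i k, m') \<in> r \<inter> J \<times> J \<longrightarrow> \<tau> (C J m m' 0) = C J m m' 0))"
    if ok: "ok k J" for k l J
  proof -
    have J: "J \<in> {J. finite J \<and> J \<subseteq> I}" "i k \<in> J" "i (Suc k) \<in> J" using ok by (auto simp: ok_def)
    have "(i (Suc k), i k) \<in> r \<inter> J \<times> J \<and> i (Suc k) \<noteq> i k" using desc[of k] J by auto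
    from spec[OF mp[OF bspec[OF bspec[OF bspec[OF C J(1), unfolded Sc_def] J(2)] J(3)] this], of l]
    show ?thesis .
  qed
  have gD: "g k l J \<in> Dom M" for k l J
  proof (cases "ok k J")
    case True
    then have "g k l J \<in> pred_of M (i k)" using conjunct1[OF CJ[OF True]] by (simp add: g_def)
    then show ?thesis using Ms iI[of k] by (auto simp: is_struct_def)
  qed (use zero_in_Dom[OF Ms] in \<open>simp add: g_def\<close>)
  have okU: "eventually (\<lambda>J. finite J \<and> F \<subseteq> J \<and> J \<subseteq> I) U" if F: "finite F" "F \<subseteq> I" for F
    using filter_leD[OF U(2), of "\<lambda>J. finite J \<and> F \<subseteq> J \<and> J \<subseteq> I"] F
    by (auto simp: eventually_finite_subsets_at_top)
  have ok_ev: "eventually (ok k) U" for k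
    using okU[of "{i k, i (Suc k)}"] iI by (auto simp: ok_def elim: eventually_mono)
  define c where "c k l = urep U (Dom M) (g k l)" for k l
  have cD: "c k l \<in> Dom ?V" for k l unfolding c_def by (rule urep_Dom[OF U(1) Ms gD])
  have c_ev: "eventually (\<lambda>J. ok k J \<and> c k l J = C J (i k) (i (Suc k)) l) U" for k l
    using urep_works(2)[of "g k l" "Dom M" U, OF gD] ok_ev[of k] by eventually_elim (simp add: c_def g_def)
  let ?e = "\<lambda>_. zero_of ?V"
  have e: "?e \<in> assignments ?V" by (rule assignmentsI) (rule zero_in_Dom[OF Vs])
  have satV: "sat ?V ?e \<phi> \<longleftrightarrow> eventually (\<lambda>J. sat M (\<lambda>v. zero_of ?V J) (map_fm id (\<lambda>a. a J) \<phi>)) U"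
    if "\<phi> \<in> fms I (Dom ?V)" for \<phi> by (rule los[OF U(1) Ms e that])
  have pV: "a \<in> pred_of ?V j \<longleftrightarrow> eventually (\<lambda>J. a J \<in> pred_of M j) U" if "j \<in> I" "a \<in> Dom ?V" for a j
    using satV[of "FPred j (Cst a)"] that by simp
  have dV: "add_of ?V a (minus_of ?V b) \<in> pred_of ?V j \<longleftrightarrow>
      eventually (\<lambda>J. add_of M (a J) (minus_of M (b J)) \<in> pred_of M j) U"
    if "j \<in> I" "a \<in> Dom ?V" "b \<in> Dom ?V" for a b j
    using satV[of "FPred j (TAdd (Cst a) (TMinus (Cst b)))"] that by simp
  have 1: "c k l \<in> pred_of ?V (i k)" for k l
    unfolding pV[OF iI cD] using c_ev[of k l]
  proof eventually_elim
    case (elim J)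
    then show ?case using conjunct1[OF CJ[of k J l]] by simp
  qed
  have 2: "c k l \<notin> pred_of ?V (i (Suc k))" for k l
  proof -
    have "eventually (\<lambda>J. \<not> c k l J \<in> pred_of M (i (Suc k))) U"
      using c_ev[of k l]
    proof eventually_elim
      case (elim J)
      then show ?case using conjunct1[OF conjunct2[OF CJ[of k J l]]] by simp
    qed
    then show ?thesis unfolding pV[OF iI cD] ultrafilter_not[OF U(1)] .
  qed
  have 3: "add_of ?V (c k l) (minus_of ?V (c k l')) \<notin> pred_of ?V (i (Suc k))" if "l \<noteq> l'" for k l l'
  proof -
    have "eventually (\<lambda>J. \<not> add_of M (c k l J) (minus_of M (c k l' J)) \<in> pred_of M (i (Suc k))) U"
      using c_ev[of k l] c_ev[of k l']
    proof eventually_elim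
      case (elim J)
      then show ?case
        using mp[OF spec[OF conjunct1[OF conjunct2[OF conjunct2[OF CJ[of k J l]]]]] that] by simp
    qed
    then show ?thesis unfolding dV[OF iI cD cD] ultrafilter_not[OF U(1)] .
  qed
  have 4: "\<exists>h. elem I ?V ?V ((\<lambda>s. c s 0) ` {..k}) h \<and> (\<forall>s<k. h (c s 0) = c s 0) \<and> h (c k 0) = c k l" for k l
  proof -
    \<comment> \<open>No automorphism of the ultrapower is constructed. For each sentence,
      \<open>h\<close> acts in almost every coordinate J like an automorphism of the reduct to J,
      and J contains the predicates of the sentence.\<close>
    define h where "h x = (if x = c k 0 then c k l else x)" for x
    have ne: "c s 0 \<noteq> c k 0" if "s < k" for s
    proof -
      have "pred_of ?V (i k) \<subseteq> pred_of ?V (i (Suc s))"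
        by (rule acf_chain_pred_mono[OF Vchain iI iI dec]) (use that in simp)
      then show ?thesis using 1[of k 0] 2[of s 0] by auto
    qed
    have "holds ?V \<phi> \<longleftrightarrow> holds ?V (map_fm id h \<phi>)" if \<phi>: "\<phi> \<in> formulas I ((\<lambda>s. c s 0) ` {..k}) 0" for \<phi>
    proof -
      have fv: "fvars \<phi> = {}" and par: "params \<phi> \<subseteq> (\<lambda>s. c s 0) ` {..k}" and pr: "preds \<phi> \<subseteq> I"
        using \<phi> by (auto simp: formulas_def)
      have \<phi>V: "\<phi> \<in> fms I (Dom ?V)" using par pr cD by (auto simp: fms_def)
      have h\<phi>V: "map_fm id h \<phi> \<in> fms I (Dom ?V)"
        using \<phi>V cD by (intro map_fm_fms[OF \<phi>V]) (auto simp: h_def)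
      let ?S = "\<lambda>J \<psi>. sat M (\<lambda>v. zero_of ?V J) \<psi>"
      have "eventually (\<lambda>J. \<forall>s\<in>{..k}. ok s J \<and> c s 0 J = C J (i s) (i (Suc s)) 0) U"
        by (intro eventually_ball_finite ballI c_ev) simp
      moreover have "eventually (\<lambda>J. finite J \<and> preds \<phi> \<subseteq> J \<and> J \<subseteq> I) U" by (rule okU) (simp_all add: pr)
      ultimately have "eventually (\<lambda>J. ?S J (map_fm id (\<lambda>a. a J) \<phi>) \<longleftrightarrow> ?S J (map_fm id (\<lambda>a. h a J) \<phi>)) U"
        using c_ev[of k l]
      proof eventually_elim
        case (elim J)
        have cJ: "c s 0 J = C J (i s) (i (Suc s)) 0" "ok s J" if "s \<le> k" for s
          using elim(1) that by auto
        have ckl: "c k l J = C J (i k) (i (Suc k)) l" using elim(3) by simp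
        have okk: "ok k J" by (rule cJ) simp
        obtain \<tau> where \<tau>: "struct_iso J M M \<tau> \<and> \<tau> (C J (i k) (i (Suc k)) 0) = C J (i k) (i (Suc k)) l \<and>
          (\<forall>m\<in>J. \<forall>m'\<in>J. (m', m) \<in> r \<inter> J \<times> J \<and> m' \<noteq> m \<and> (i k, m') \<in> r \<inter> J \<times> J \<longrightarrow> \<tau> (C J m m' 0) = C J m m' 0)"
          by (rule exE[OF conjunct2[OF conjunct2[OF conjunct2[OF CJ[OF okk, of l]]]]])
        have \<tau>1: "\<tau> (c k 0 J) = c k l J" using conjunct1[OF conjunct2[OF \<tau>]] cJ(1)[of k] ckl by simp
        have \<tau>2: "\<tau> (c s 0 J) = c s 0 J" if s: "s < k" for s
        proof -
          have "ok s J" using cJ(2) s by simp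
          then have J: "i s \<in> J" "i (Suc s) \<in> J" "i k \<in> J" using okk by (auto simp: ok_def)
          have "(i (Suc s), i s) \<in> r \<inter> J \<times> J \<and> i (Suc s) \<noteq> i s \<and> (i k, i (Suc s)) \<in> r \<inter> J \<times> J"
            using desc[of s] J dec[of "Suc s" k] s by auto
          from mp[OF bspec[OF bspec[OF conjunct2[OF conjunct2[OF \<tau>]] J(1)] J(2)] this]
          show ?thesis using cJ(1)[of s] s by simp
        qed
        have JI: "J \<subseteq> I" using elim(2) by simp
        let ?\<psi> = "map_fm id (\<lambda>a. a J) \<phi>"
        have DM: "a J \<in> Dom M" if "a \<in> Dom ?V" for a by (rule Dom_ultrapower[OF U(1) Ms that])
        have \<psi>: "?\<psi> \<in> fms J (Dom M)"
          using elim(2) \<phi>V DM by (auto simp: fms_def)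
        have "?S J ?\<psi> \<longleftrightarrow> sat M (\<lambda>v. \<tau> (zero_of ?V J)) (map_fm id \<tau> ?\<psi>)"
          by (rule sat_iso[OF is_struct_mono[OF Ms JI] conjunct1[OF \<tau>] _ \<psi>, symmetric])
            (intro assignmentsI DM zero_in_Dom[OF Vs])
        also have "\<dots> \<longleftrightarrow> ?S J (map_fm id \<tau> ?\<psi>)" by (rule sat_cong) (simp add: fv)
        also have "map_fm id \<tau> ?\<psi> = map_fm id (\<lambda>a. h a J) \<phi>"
          unfolding map_fm_comp
        proof (rule map_fm_cong_params)
          fix a assume "a \<in> params \<phi>"
          then obtain s where s: "s \<le> k" "a = c s 0" using par by auto
          show "\<tau> (a J) = h a J"
            using \<tau>1 \<tau>2[of s] ne[of s] s by (cases "s = k") (simp_all add: h_def)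
        qed
        finally show ?case .
      qed
      then have "eventually (\<lambda>J. ?S J (map_fm id (\<lambda>a. a J) \<phi>)) U \<longleftrightarrow> eventually (\<lambda>J. ?S J (map_fm id (\<lambda>a. h a J) \<phi>)) U"
        by (rule eventually_cong) simp
      then have "sat ?V ?e \<phi> \<longleftrightarrow> sat ?V ?e (map_fm id h \<phi>)"
        unfolding satV[OF \<phi>V] satV[OF h\<phi>V] map_fm_comp .
      then show ?thesis using holds_sentence[OF Vs, of \<phi> ?e] holds_sentence[OF Vs, of "map_fm id h \<phi>" ?e] fv by simp
    qed
    then have "elem I ?V ?V ((\<lambda>s. c s 0) ` {..k}) h" using cD by (auto simp: elem_def h_def)
    moreover have "\<forall>s<k. h (c s 0) = c s 0" using ne by (simp add: h_def)
    moreover have "h (c k 0) = c k l" by (simp add: h_def)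
    ultimately show ?thesis by blast
  qed
  show ?thesis unfolding descending_family_def using 1 2 3 4 by blast
qed

text \<open>The ultrapower consists of functions into \<open>'a\<close>, while \<open>models\<close>
  only admits structures over \<open>'a\<close>. An elementary hull of the family is therefore
  copied back, which keeps the sentences of T.\<close>

lemma descending_model:
  fixes T :: "('i, 'a) fm set" and i :: "nat \<Rightarrow> 'i"
  assumes T: "completion I (ACF_chain I r) T" and lin: "linear_order_on I r"
    and inf: "infinite (UNIV :: 'a set)" and I: "I \<lesssim> (UNIV :: 'a set)"
    and iI: "\<And>k. i k \<in> I" and desc: "\<And>k. (i (Suc k), i k) \<in> r - Id"
  shows "\<exists>N\<in>models I T. \<exists>c. descending_family I N i c"
proof -
  obtain M where MT: "M \<in> models I T" using T by (auto simp: completion_def complete_theory_def)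
  then have M: "M \<in> models I (ACF_chain I r)" using T by (auto simp: completion_def models_def)
  then have Ms: "is_struct I M" by (rule models_is_struct)
  obtain U :: "'i set filter" where U: "ultrafilter U" "U \<le> finite_subsets_at_top I"
    using ultrafilter_exists[of "finite_subsets_at_top I"] by auto
  let ?V = "ultrapower U M"
  have Vs: "is_struct I ?V" by (rule is_struct_ultrapower[OF U(1) Ms])
  obtain c where c: "descending_family I ?V i c"
    using descending_ultrapower[where i = i, OF M lin iI desc U] by blast
  note c' = descending_familyD[OF c]
  \<comment> \<open>The hull has to contain the conjugates as well, so that the maps taking
    \<open>c k 0\<close> to them can be copied.\<close>
  let ?Z = "range (\<lambda>(k, l). c k l)"
  have "c k l \<in> Dom ?V" for k l using c'(1)[of k l] Vs iI[of k] by (auto simp: is_struct_def)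
  then have "?Z \<subseteq> Dom ?V" by auto
  moreover have "countable ?Z" by simp
  ultimately obtain N :: "('i, 'a) struct" and H \<kappa> where N: "is_struct I N" "?Z \<subseteq> H" "H \<subseteq> Dom ?V" "elem I ?V N H \<kappa>"
    using downward_lowenheim_skolem[OF Vs inf I, of ?Z] by blast
  have cH: "c k l \<in> H" for k l using N(2) by auto
  have inj: "inj_on \<kappa> H" by (rule elem_inj[OF N(4) Vs N(1)])
  have "elem I M N {} (\<lambda>x. \<kappa> (diag U M x))"
    by (rule elem_comp[OF elem_mono[OF diag_elem[OF U(1) Ms]] N(4)]) auto
  then have "holds N \<phi>" if "\<phi> \<in> T" for \<phi>
  proof -
    have \<phi>: "\<phi> \<in> sentences I" using T that by (auto simp: completion_def complete_theory_def)
    then have "map_fm id (\<lambda>x. \<kappa> (diag U M x)) \<phi> = \<phi>" by (intro map_fm_ident) (auto simp: formulas_def)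
    then show ?thesis
      using \<open>elem I M N {} (\<lambda>x. \<kappa> (diag U M x))\<close> \<phi> MT that by (auto simp: elem_def models_def)
  qed
  then have NT: "N \<in> models I T" using N(1) by (simp add: models_def)
  define d where "d k l = \<kappa> (c k l)" for k l
  have 4: "\<exists>h. elem I N N ((\<lambda>s. d s 0) ` {..k}) h \<and> (\<forall>s<k. h (d s 0) = d s 0) \<and> h (d k 0) = d k l" for k l
  proof -
    let ?A = "(\<lambda>s. c s 0) ` {..k}"
    obtain h where h: "elem I ?V ?V ?A h \<and> (\<forall>s<k. h (c s 0) = c s 0) \<and> h (c k 0) = c k l"
      by (rule exE[OF c'(4)])
    have AH: "?A \<subseteq> H" using cH by auto
    have hs: "h (c s 0) \<in> H" if "s \<le> k" for s
      using that h cH by (cases "s = k") auto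
    have dA: "(\<lambda>s. d s 0) ` {..k} = \<kappa> ` ?A" by (auto simp: d_def)
    have injA: "inj_on \<kappa> ?A" using inj AH by (rule inj_on_subset)
    have \<kappa>A: "elem I ?V N ?A \<kappa>" by (rule elem_mono[OF N(4) AH subset_refl])
    let ?h = "\<lambda>x. \<kappa> (h (inv_into ?A \<kappa> x))"
    have "elem I N ?V (\<kappa> ` ?A) (\<lambda>x. h (inv_into ?A \<kappa> x))"
      by (rule elem_comp[OF elem_inv[OF \<kappa>A Vs N(1)] conjunct1[OF h]]) (use AH N(3) injA in auto)
    then have "elem I N N (\<kappa> ` ?A) ?h"
    proof (rule elem_comp[OF _ N(4)])
      show "(\<lambda>x. h (inv_into ?A \<kappa> x)) ` \<kappa> ` ?A \<subseteq> H"
        using hs injA by (auto simp: inv_into_f_f)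
    qed
    moreover have "?h (d s 0) = \<kappa> (h (c s 0))" if "s \<le> k" for s
      using inv_into_f_f[OF injA, of "c s 0"] that by (simp add: d_def)
    ultimately show ?thesis using h unfolding dA
      by (intro exI[of _ ?h]) (simp add: d_def)
  qed
  note ep = elem_pred[OF N(4) Vs N(1) iI cH cH]
  have "descending_family I N i d"
    unfolding descending_family_def
  proof (intro allI conjI impI 4)
    show "d k l \<in> pred_of N (i k)" for k l using c'(1) unfolding d_def ep(1) .
    show "d k l \<notin> pred_of N (i (Suc k))" for k l using c'(2) unfolding d_def ep(1) .
    show "add_of N (d k l) (minus_of N (d k l')) \<notin> pred_of N (i (Suc k))" if "l \<noteq> l'" for k l l'
      using c'(3)[OF that] unfolding d_def ep(2) .
  qed
  then show ?thesis using NT by blast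
qed

primrec partial_sum :: "(nat \<Rightarrow> 'a) \<Rightarrow> nat \<Rightarrow> 'a tm" where
  "partial_sum c 0 = TZero"
| "partial_sum c (Suc k) = TAdd (partial_sum c k) (Cst (c k))"

lemma tparams_partial_sum [simp]: "tparams (partial_sum c k) = c ` {..<k}"
  by (induction k) (auto simp: lessThan_Suc)

lemma tvars_partial_sum [simp]: "tvars (partial_sum c k) = {}"
  by (induction k) auto

lemma map_partial_sum: "(\<And>s. s < k \<Longrightarrow> f (c s) = c s) \<Longrightarrow> map_tm f (partial_sum c k) = partial_sum c k"
  by (induction k) auto

theorem not_superstable:
  fixes T :: "('i, 'a) fm set" and i :: "nat \<Rightarrow> 'i"
  assumes T: "completion I (ACF_chain I r) T" and lin: "linear_order_on I r"
    and inf: "infinite (UNIV :: 'a set)" and I: "I \<lesssim> (UNIV :: 'a set)"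
    and iI: "\<And>k. i k \<in> I" and desc: "\<And>k. (i (Suc k), i k) \<in> r - Id"
  shows "\<not> superstable I T"
proof
  assume ss: "superstable I T"
  obtain N c where NT: "N \<in> models I T" and c: "descending_family I N i c"
    using descending_model[where i = i, OF assms] by blast
  note c' = descending_familyD[OF c]
  have Nm: "N \<in> models I (ACF_chain I r)" using NT T by (auto simp: completion_def models_def)
  then have Ns: "is_struct I N" by (rule models_is_struct)
  have chain: "acf_chain I r N" by (rule models_acf_chain[OF Nm])
  let ?R = "ring_of N"
  interpret acf ?R N using chain by (simp add: acf_chain_def)
  let ?P = "\<lambda>k. pred_of N (i k)"
  have Pr: "subring (?P k) ?R" for k using chain iI[of k] by (auto simp: acf_chain_def intro: subfieldE(1))
  have Pdec: "?P m \<subseteq> ?P n" if "n \<le> m" for m n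
    using that
  proof (induction m rule: dec_induct)
    case (step m)
    have "?P (Suc m) \<subseteq> ?P m" using desc[of m] by (intro acf_chain_pred_mono[OF chain iI iI]) auto
    then show ?case using step by blast
  qed simp
  let ?c = "\<lambda>s. c s 0"
  have cR: "c k l \<in> carrier ?R" for k l using c'(1)[of k l] subringE(1)[OF Pr] by blast
  define a where "a k = cval (partial_sum ?c k)" for k
  have aR: "a k \<in> carrier ?R" for k
    unfolding a_def by (rule val_closed) (use cR in auto)
  have a_Suc: "a (Suc k) = a k \<oplus>\<^bsub>?R\<^esub> c k 0" for k by (simp add: a_def)
  have a_eq: "val N e (partial_sum ?c k) = a k" for e k
    unfolding a_def by (rule val_cong) simp
  \<comment> \<open>The coset of the partial sum \<open>a (Suc k)\<close> modulo the field of index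
    \<open>i (Suc k)\<close>. All later summands lie in this field, so all later partial sums belong
    to the coset.\<close>
  define \<phi> where "\<phi> k = FPred (i (Suc k)) (TAdd (Var 0) (TMinus (partial_sum ?c (Suc k))))" for k
  let ?A = "range ?c"
  have AD: "?A \<subseteq> Dom N" using cR by auto
  have \<phi>A: "\<phi> k \<in> formulas I (?c ` {..k}) 1" for k
    using iI by (auto simp: \<phi>_def formulas_def)
  obtain U :: "nat filter" where U: "ultrafilter U" "U \<le> sequentially" using nonprincipal_ultrafilter by auto
  \<comment> \<open>An element that is the infinite sum need not exist in N; its type is the limit
    along U of the types of the partial sums.\<close>
  define p where "p = {\<psi> \<in> formulas I ?A 1. eventually (\<lambda>k. sat N (\<lambda>_. a k) \<psi>) U}"
  have ea: "(\<lambda>_. a k) \<in> assignments N" for k by (rule assignmentsI) (simp add: aR)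
  have "p \<in> complete_types I N ?A 1"
    unfolding complete_types_def
  proof (intro CollectI conjI ballI)
    show "p \<subseteq> formulas I ?A 1" by (auto simp: p_def)
    show "fin_sat N p"
      unfolding fin_sat_def
    proof (intro allI impI)
      fix q assume q: "finite q \<and> q \<subseteq> p"
      have "eventually (\<lambda>k. \<forall>\<psi>\<in>q. sat N (\<lambda>_. a k) \<psi>) U"
        using q by (intro eventually_ball_finite) (auto simp: p_def)
      then obtain k where "\<forall>\<psi>\<in>q. sat N (\<lambda>_. a k) \<psi>" using ultrafilter_ex[OF U(1)] by blast
      then show "\<exists>e\<in>assignments N. \<forall>\<psi>\<in>q. sat N e \<psi>" using ea by blast
    qed
    show "\<psi> \<in> p \<or> FNot \<psi> \<in> p" if "\<psi> \<in> formulas I ?A 1" for \<psi>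
      using that ultrafilter_not[OF U(1), of "\<lambda>k. sat N (\<lambda>_. a k) \<psi>"] by (auto simp: p_def formulas_def)
  qed
  then obtain B where B: "finite B" "B \<subseteq> ?A" "\<not> forks I N B 1 p"
    using ss NT AD unfolding superstable_def by blast
  have "\<exists>k. B \<subseteq> ?c ` {..<k}"
    using B(1,2)
  proof (induction B rule: finite_induct)
    case (insert x F)
    then obtain k s where "F \<subseteq> ?c ` {..<k}" "x = ?c s" by auto
    then have "insert x F \<subseteq> ?c ` {..<max k (Suc s)}" by auto
    then show ?case by blast
  qed simp
  \<comment> \<open>B uses only the first k summands, so the conjugations of \<open>c k 0\<close>
    over these fix B, and the coset formula of index k divides over B.\<close>
  then obtain k where k: "B \<subseteq> ?c ` {..<k}" by blast
  have \<phi>p: "\<phi> k \<in> p"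
  proof -
    have diff: "a (Suc k + m) \<ominus>\<^bsub>?R\<^esub> a (Suc k) \<in> ?P (Suc k)" for m
    proof (induction m)
      case 0
      then show ?case using aR subringE(2)[OF Pr] by (simp add: minus_eq r_neg)
    next
      case (Suc m)
      have "c (Suc k + m) 0 \<in> ?P (Suc k)" using c'(1)[of "Suc k + m" 0] Pdec[of "Suc k" "Suc k + m"] by auto
      then have "(a (Suc k + m) \<ominus>\<^bsub>?R\<^esub> a (Suc k)) \<oplus>\<^bsub>?R\<^esub> c (Suc k + m) 0 \<in> ?P (Suc k)"
        using Suc.IH subringE(7)[OF Pr] by blast
      moreover have "(a (Suc k + m) \<ominus>\<^bsub>?R\<^esub> a (Suc k)) \<oplus>\<^bsub>?R\<^esub> c (Suc k + m) 0 = a (Suc k + Suc m) \<ominus>\<^bsub>?R\<^esub> a (Suc k)"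
        using aR[of "Suc k + m"] aR[of "Suc k"] cR[of "Suc k + m" 0] a_Suc[of "Suc k + m"]
        by (simp add: minus_eq a_ac)
      ultimately show ?case by simp
    qed
    have "sat N (\<lambda>_. a m) (\<phi> k)" if le: "Suc k \<le> m" for m
    proof -
      obtain m' where m': "m = Suc k + m'" by (rule exE[OF le_Suc_ex[OF le]])
      have "a m \<oplus>\<^bsub>?R\<^esub> \<ominus>\<^bsub>?R\<^esub> a (Suc k) \<in> ?P (Suc k)" using diff[of m'] unfolding m' minus_eq .
      then show ?thesis unfolding \<phi>_def by (simp only: sat.simps val.simps(1,5,6) a_eq[of "\<lambda>_. a m" "Suc k"] add_R minus_R[OF aR])
    qed
    then have "eventually (\<lambda>m. sat N (\<lambda>_. a m) (\<phi> k)) sequentially"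
      by (intro eventually_sequentiallyI) auto
    then have "eventually (\<lambda>m. sat N (\<lambda>_. a m) (\<phi> k)) U" by (rule filter_leD[OF U(2)])
    moreover have "\<phi> k \<in> formulas I ?A 1" by (rule formulas_mono[OF \<phi>A]) auto
    ultimately show ?thesis by (simp add: p_def)
  qed
  have emb: "elem I N N (Dom N) id"
    by (simp add: elem_def fm.map_id)
  have "Defs.divides I N B (\<phi> k)"
  proof -
    have "\<forall>l. \<exists>h. elem I N N (?c ` {..k}) h \<and> (\<forall>s<k. h (?c s) = ?c s) \<and> h (?c k) = c k l"
      using c'(4)[of k] by blast
    from choice[OF this] obtain h where
      h': "\<forall>l. elem I N N (?c ` {..k}) (h l) \<and> (\<forall>s<k. h l (?c s) = ?c s) \<and> h l (?c k) = c k l" by (rule exE)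
    note h1 = conjunct1[OF spec[OF h']] conjunct2[OF spec[OF h']]
    have h: "elem I N N (?c ` {..k}) (h l)" "s < k \<Longrightarrow> h l (?c s) = ?c s" "h l (?c k) = c k l" for l s
      by (rule h1(1), rule mp[OF spec[OF conjunct1[OF h1(2)]]], assumption, rule conjunct2[OF h1(2)])
    have par: "B \<union> params (\<phi> k) \<subseteq> ?c ` {..k}" using k \<phi>A[of k] by (auto simp: formulas_def)
    have val_l: "val N e (map_tm (h l) (partial_sum ?c (Suc k))) = a k \<oplus>\<^bsub>?R\<^esub> c k l" for e l
      using map_partial_sum[of k "h l" ?c] h(2,3) by (simp add: a_eq)
    \<comment> \<open>Two conjugates already conflict: subtracting the two conditions puts the
      difference of \<open>c k l\<close> and \<open>c k l'\<close> into the next field.\<close>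
    have inc: "\<not> (\<exists>e\<in>assignments N. \<forall>j\<in>K. sat N e (map_fm id (h j) (\<phi> k)))" if K: "finite K \<and> card K = 2" for K
    proof
      assume "\<exists>e\<in>assignments N. \<forall>j\<in>K. sat N e (map_fm id (h j) (\<phi> k))"
      then obtain e where e: "e \<in> assignments N" "\<And>j. j \<in> K \<Longrightarrow> sat N e (map_fm id (h j) (\<phi> k))" by blast
      obtain l l' where l: "K = {l, l'}" "l \<noteq> l'"
        using card_2_iff[of K, THEN iffD1, OF conjunct2[OF K]] by (elim exE conjE)
      have e0: "e 0 \<in> carrier ?R" using assignmentsD[OF e(1), of 0] by simp
      have s: "e 0 \<ominus>\<^bsub>?R\<^esub> (a k \<oplus>\<^bsub>?R\<^esub> c k j) \<in> ?P (Suc k)" if "j \<in> K" for j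
        using e(2)[OF that] aR cR unfolding \<phi>_def fm.map tm.map sat.simps val.simps
          val_l by (simp add: minus_eq)
      have "(e 0 \<ominus>\<^bsub>?R\<^esub> (a k \<oplus>\<^bsub>?R\<^esub> c k l')) \<ominus>\<^bsub>?R\<^esub> (e 0 \<ominus>\<^bsub>?R\<^esub> (a k \<oplus>\<^bsub>?R\<^esub> c k l)) \<in> ?P (Suc k)"
        unfolding minus_eq[of "e 0 \<ominus>\<^bsub>?R\<^esub> (a k \<oplus>\<^bsub>?R\<^esub> c k l')"]
        by (intro subringE(5,7)[OF Pr] s) (simp_all add: l(1))
      moreover have "(e 0 \<ominus>\<^bsub>?R\<^esub> (a k \<oplus>\<^bsub>?R\<^esub> c k l')) \<ominus>\<^bsub>?R\<^esub> (e 0 \<ominus>\<^bsub>?R\<^esub> (a k \<oplus>\<^bsub>?R\<^esub> c k l)) = c k l \<ominus>\<^bsub>?R\<^esub> c k l'"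
        using e0 aR[of k] cR[of k l] cR[of k l'] by algebra
      ultimately have "add_of N (c k l) (minus_of N (c k l')) \<in> ?P (Suc k)" using cR by (simp add: minus_eq)
      then show False using c'(3)[OF l(2)] by blast
    qed
    have id_B: "h j b = id b" if "b \<in> B" for j b
    proof -
      obtain s where "s < k" "b = ?c s" using k \<open>b \<in> B\<close> by auto
      then show ?thesis using h(2)[of s j] by simp
    qed
    show ?thesis
      unfolding Defs.divides_def elementary_on_elem
      by (rule exI[of _ N], rule exI[of _ id], rule exI[of _ h], rule exI[of _ 2])
        (intro conjI allI ballI impI Ns emb elem_mono[OF h(1) par subset_refl] id_B, assumption, rule inc, assumption)
  qed
  moreover have "\<phi> k \<in> formulas I (Dom N) 1" by (rule formulas_mono[OF \<phi>A]) (use AD in auto)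
  moreover have "\<not> fin_sat N (map_fm id id ` p \<union> FNot ` {\<phi> k})"
  proof
    assume "fin_sat N (map_fm id id ` p \<union> FNot ` {\<phi> k})"
    moreover have "{\<phi> k, FNot (\<phi> k)} \<subseteq> map_fm id id ` p \<union> FNot ` {\<phi> k}" using \<phi>p by (auto simp: fm.map_id)
    ultimately have "\<exists>e\<in>assignments N. \<forall>\<psi>\<in>{\<phi> k, FNot (\<phi> k)}. sat N e \<psi>"
      unfolding fin_sat_def by (meson finite.emptyI finite.insertI)
    then show False by auto
  qed
  ultimately have "forks I N B 1 p"
    unfolding forks_def elementary_on_elem using Ns emb
    by (intro exI[of _ N] exI[of _ id] exI[of _ "{\<phi> k}"]) (simp add: image_id)
  then show False using B(3) by blast
qed

theorem proposition6p4:
  fixes I :: "'i set" and r :: "'i rel"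
  assumes "linear_order_on I r"
    and "infinite (UNIV :: 'a set)" and "I \<lesssim> (UNIV :: 'a set)"
  shows "(finite I \<or> (countable I \<and> well_order_on I r) \<longrightarrow>
            (\<forall>T :: ('i, 'a) fm set. completion I (ACF_chain I r) T \<longrightarrow> omega_stable I T)) \<and>
         (uncountable I \<and> well_order_on I r \<longrightarrow>
            (\<forall>T :: ('i, 'a) fm set. completion I (ACF_chain I r) T \<longrightarrow>
               totally_transcendental I T \<and> superstable I T \<and> \<not> omega_stable I T)) \<and>
         (\<not> well_order_on I r \<longrightarrow>
            (\<forall>T :: ('i, 'a) fm set. completion I (ACF_chain I r) T \<longrightarrow> \<not> superstable I T))"
proof -
  have mod: "M \<in> models I (ACF_chain I r)" if "completion I (ACF_chain I r) T" "M \<in> models I T"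
    for T and M :: "('i, 'a) struct" using that by (auto simp: completion_def models_def)
  have 1: "omega_stable I T"
    if "finite I \<or> (countable I \<and> well_order_on I r)" and T: "completion I (ACF_chain I r) T" for T :: "('i, 'a) fm set"
  proof -
    have "well_order_on I r" "countable I"
      using that(1) finite_linear_order_well_order[OF assms(1)] by (auto intro: countable_finite)
    then show ?thesis unfolding omega_stable_def using countable_complete_types mod[OF T] by blast
  qed
  have 2: "totally_transcendental I T \<and> superstable I T \<and> \<not> omega_stable I T"
    if I: "uncountable I" "well_order_on I r" and T: "completion I (ACF_chain I r) T" for T :: "('i, 'a) fm set"
  proof (intro conjI)
    have "\<not> binary_tree I M n \<phi>" if "M \<in> models I T" for M n \<phi>
      by (rule no_binary_tree[OF mod[OF T that] I(2)])
    then show "totally_transcendental I T" unfolding totally_transcendental_def by blast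
    have "\<not> order_property M n \<phi>" if "M \<in> models I T" "\<phi> \<in> formulas I {} (n + m)" for M n m \<phi>
      by (rule no_order_property[OF mod[OF T that(1)] I(2) that(2)])
    then have "stable I T" unfolding stable_def by blast
    then show "superstable I T"
      unfolding superstable_def
    proof (intro conjI ballI allI impI)
      show "\<exists>B. finite B \<and> B \<subseteq> A \<and> \<not> forks I M B n p"
        if "M \<in> models I T" "p \<in> complete_types I M A n" "A \<subseteq> Dom M" for M A n p
        by (rule nonforking_finite_base[OF mod[OF T that(1)] I(2) that(3,2)])
    qed
    show "\<not> omega_stable I T" by (rule not_omega_stable[OF T I(2,1)])
  qed
  have 3: "\<not> superstable I T"
    if "\<not> well_order_on I r" and T: "completion I (ACF_chain I r) T" for T :: "('i, 'a) fm set"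
  proof -
    have "\<not> wf (r - Id)" using that(1) assms(1) by (simp add: well_order_on_def)
    then obtain i where i: "\<And>k :: nat. (i (Suc k), i k) \<in> r - Id" unfolding wf_iff_no_infinite_down_chain by blast
    have "r \<subseteq> I \<times> I" using assms(1) by (auto simp: linear_order_on_def partial_order_on_def preorder_on_def)
    then have "i k \<in> I" for k using i[of k] by blast
    then show ?thesis by (rule not_superstable[where i = i, OF T assms]) (rule i)
  qed
  show ?thesis
    by ((rule conjI[OF _ conjI]; intro allI impI), (rule 1; assumption),
      (rule 2; (erule conjunct1 | erule conjunct2 | assumption)), (rule 3; assumption))
qed

end
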